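(* Let $a\in\mathbb{C}$ with $a\ne0$. If $d\ge5$, then $$\mathrm{Lie}_0(\mathcal{Z}_c)=\mathfrak{sl}_2(\mathbb{C})\oplus S_d$$ (direct sum of vector spaces of a Lie subalgebra isomorphic to $\mathfrak{sl}_2(\mathbb{C})$ and of $S_d$), where $S_d$ is a commutative ideal of the Lie algebra $\mathrm{Lie}_0(\mathcal{Z}_c)$ of dimension $d+1$ on which $\mathfrak{sl}_2(\mathbb{C})$ acts irreducibly (i.e. $S_d\simeq\mathrm{Sym}^d(\mathbb{C}^2)$ as an $\mathfrak{sl}_2(\mathbb{C})$-module).
   Context: Let $\zeta\in\mathbb{C}$ be a primitive $d$-th root of unity, $V=\mathbb{C}^2$ with canonical basis $(x,y)$, and $(X,Y)$ the dual basis of $V^*$. For $i\in\mathbb{Z}/d\mathbb{Z}$ let $s_i=\begin{pmatrix}0&\zeta^i\\ \zeta^{-i}&0\end{pmatrix}\in \mathrm{GL}_2(\mathbb{C})$ and $W=\langle s_0,s_1\rangle$, the dihedral group of order $2d$, whose reflections are the $s_i$. It acts by $s_i(x)=\zeta^{-i}y$, $s_i(y)=\zeta^i x$, $s_i(X)=\zeta^iY$, $s_i(Y)=\zeta^{-i}X$. For $\hbar$ an indeterminate, let $H_{\hbar,c}$ be the $\mathbb{C}[\hbar]$-algebra quotient of $\mathbb{C}[\hbar]\otimes(T(V\oplus V^* )\rtimes W)$ by the relations $[x,y]=[X,Y]=0$, $[x,X]=[y,Y]=\hbar-a\sum_i s_i$, $[x,Y]=a\sum_i\zeta^{-i}s_i$,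 $[y,X]=a\sum_i\zeta^i s_i$ (sums over $i\in\mathbb{Z}/d\mathbb{Z}$), and let $H_c=H_{\hbar,c}/\hbar H_{\hbar,c}$. $Z_c$ is the center of $H_c$, with Poisson bracket $\{z,z'\}=\big(\hbar^{-1}[\hat z,\hat z']\big)\bmod \hbar$ for any lifts $\hat z,\hat z'\in H_{\hbar,c}$ of $z,z'\in Z_c$. $\mathcal{Z}_c$ (Calogero-Moser space) is the affine variety with $\mathbb{C}[\mathcal{Z}_c]=Z_c$. Multiplication gives a vector space isomorphism $\mathbb{C}[x,y]\otimes\mathbb{C}[X,Y]\otimes\mathbb{C}W\simeq H_c$; identify $\mathbb{C}[x,y]\otimes\mathbb{C}[X,Y]$ with $\mathbb{C}[V\times V^*]$. Let $\mathrm{Trunc}_c:H_c\to\mathbb{C}[V\times V^*]$ be the linear map with $\mathrm{Trunc}_c(fw)=f$ if $w=1$ and $0$ if $w\in W\setminus\{1\}$. It is known that $\mathrm{Trunc}_c$ restricts to a linear isomorphism $Z_c\to\mathbb{C}[V\times V^*]^W$. Set $q=xy$, $Q=XY$ (central in $H_c$), and let $\boldsymbol{eu},\boldsymbol{a}_0,\dots,\boldsymbol{a}_d\in Z_c$ be the unique elements of $Z_c$ with $\mathrm{Trunc}_c(\boldsymbol{eu})=xX+yY$ and $\mathrm{Trunc}_c(\boldsymbol{a}_j)=x^{d-j}Y^j+y^{d-j}X^j$. The elements $q,Q,\boldsymbol{eu},\boldsymbol{a}_0,\dots,\boldsymbol{a}_d$ generate the algebra $Z_c$ and embed $\mathcal{Z}_c$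 as a closed subvariety of $\mathbb{C}^{d+4}$ containing the origin $0$. For $d\ge4$ and $a\ne0$, $0$ is the unique singular point of $\mathcal{Z}_c$ and is a cuspidal point: the maximal ideal $\mathfrak{m}_0=\langle q,Q,\boldsymbol{eu},\boldsymbol{a}_0,\dots,\boldsymbol{a}_d\rangle$ of $Z_c$ is a Poisson ideal. Hence the Poisson bracket induces a Lie algebra structure on $\mathfrak{m}_0/\mathfrak{m}_0^2$; this Lie algebra is denoted $\mathrm{Lie}_0(\mathcal{Z}_c)$. *)

theory Defs
  imports
    "Jordan_Normal_Form.VS_Connect"
    "HOL-Library.Poly_Mapping"
    "HOL-Algebra.Ideal_Product"
    "HOL-Algebra.QuotRing"
    "HOL-Algebra.Generated_Groups"
begin

section \<open>Lie algebras and their modules\<close>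

text \<open>As for \<open>module_vec\<close>, the fields \<open>mult\<close> and \<open>one\<close> that the record type of modules inherits
  from rings carry no meaning and are left \<open>undefined\<close> in the instances below.\<close>

record ('k, 'v) lie_alg = "('k, 'v) module" +
  bracket :: "'v \<Rightarrow> 'v \<Rightarrow> 'v"

locale lie_algebra = vectorspace K L
  for K :: "('k, 'm) ring_scheme" and L :: "('k, 'v, 'n) lie_alg_scheme" +
  assumes bracket_closed: "x \<in> carrier L \<Longrightarrow> y \<in> carrier L \<Longrightarrow> bracket L x y \<in> carrier L"
    and bracket_add_left: "x \<in> carrier L \<Longrightarrow> y \<in> carrier L \<Longrightarrow> z \<in> carrier L \<Longrightarrow>
      bracket L (x \<oplus>\<^bsub>L\<^esub> y) z = bracket L x z \<oplus>\<^bsub>L\<^esub> bracket L y z"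
    and bracket_add_right: "x \<in> carrier L \<Longrightarrow> y \<in> carrier L \<Longrightarrow> z \<in> carrier L \<Longrightarrow>
      bracket L x (y \<oplus>\<^bsub>L\<^esub> z) = bracket L x y \<oplus>\<^bsub>L\<^esub> bracket L x z"
    and bracket_smult_left: "c \<in> carrier K \<Longrightarrow> x \<in> carrier L \<Longrightarrow> y \<in> carrier L \<Longrightarrow>
      bracket L (c \<odot>\<^bsub>L\<^esub> x) y = c \<odot>\<^bsub>L\<^esub> bracket L x y"
    and bracket_smult_right: "c \<in> carrier K \<Longrightarrow> x \<in> carrier L \<Longrightarrow> y \<in> carrier L \<Longrightarrow>
      bracket L x (c \<odot>\<^bsub>L\<^esub> y) = c \<odot>\<^bsub>L\<^esub> bracket L x y"
    and bracket_alternating: "x \<in> carrier L \<Longrightarrow> bracket L x x = \<zero>\<^bsub>L\<^esub>"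
    and jacobi: "x \<in> carrier L \<Longrightarrow> y \<in> carrier L \<Longrightarrow> z \<in> carrier L \<Longrightarrow>
      bracket L x (bracket L y z) \<oplus>\<^bsub>L\<^esub> bracket L y (bracket L z x) \<oplus>\<^bsub>L\<^esub> bracket L z (bracket L x y)
        = \<zero>\<^bsub>L\<^esub>"

definition lie_subalgebra where
  "lie_subalgebra K L U \<longleftrightarrow> subspace K U L \<and> (\<forall>x\<in>U. \<forall>y\<in>U. bracket L x y \<in> U)"

definition lie_ideal where
  "lie_ideal K L U \<longleftrightarrow> subspace K U L \<and> (\<forall>x\<in>carrier L. \<forall>y\<in>U. bracket L x y \<in> U)"

definition lie_commutative where
  "lie_commutative L \<longleftrightarrow> (\<forall>x\<in>carrier L. \<forall>y\<in>carrier L. bracket L x y = \<zero>\<^bsub>L\<^esub>)"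

definition internal_direct_sum where
  "internal_direct_sum K V U1 U2 \<longleftrightarrow> subspace K U1 V \<and> subspace K U2 V \<and>
     module.submodule_sum V U1 U2 = carrier V \<and> U1 \<inter> U2 = {\<zero>\<^bsub>V\<^esub>}"

definition lie_isos where
  "lie_isos K L M = {f \<in> LinearCombinations.module_hom K L M. bij_betw f (carrier L) (carrier M) \<and>
     (\<forall>x\<in>carrier L. \<forall>y\<in>carrier L. f (bracket L x y) = bracket M (f x) (f y))}"

locale lie_representation = L: lie_algebra K L + V: vectorspace K V
  for K :: "('k, 'm) ring_scheme" and L :: "('k, 'l, 'n) lie_alg_scheme"
    and V :: "('k, 'v, 'p) module_scheme" and \<rho> :: "'l \<Rightarrow> 'v \<Rightarrow> 'v" +
  assumes rep_hom: "x \<in> carrier L \<Longrightarrow> \<rho> x \<in> LinearCombinations.module_hom K V V"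
    and rep_add: "x \<in> carrier L \<Longrightarrow> y \<in> carrier L \<Longrightarrow> v \<in> carrier V \<Longrightarrow>
      \<rho> (x \<oplus>\<^bsub>L\<^esub> y) v = \<rho> x v \<oplus>\<^bsub>V\<^esub> \<rho> y v"
    and rep_smult: "c \<in> carrier K \<Longrightarrow> x \<in> carrier L \<Longrightarrow> v \<in> carrier V \<Longrightarrow>
      \<rho> (c \<odot>\<^bsub>L\<^esub> x) v = c \<odot>\<^bsub>V\<^esub> \<rho> x v"
    and rep_bracket: "x \<in> carrier L \<Longrightarrow> y \<in> carrier L \<Longrightarrow> v \<in> carrier V \<Longrightarrow>
      \<rho> (bracket L x y) v = \<rho> x (\<rho> y v) \<ominus>\<^bsub>V\<^esub> \<rho> y (\<rho> x v)"

definition lie_irreducible where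
  "lie_irreducible K L V \<rho> \<longleftrightarrow> lie_representation K L V \<rho> \<and> carrier V \<noteq> {\<zero>\<^bsub>V\<^esub>} \<and>
     (\<forall>U. subspace K U V \<and> (\<forall>x\<in>carrier L. \<forall>u\<in>U. \<rho> x u \<in> U) \<longrightarrow> U = {\<zero>\<^bsub>V\<^esub>} \<or> U = carrier V)"

definition lie_module_isos where
  "lie_module_isos K L V \<rho> V' \<rho>' = {f \<in> LinearCombinations.module_hom K V V'. bij_betw f (carrier V) (carrier V') \<and>
     (\<forall>x\<in>carrier L. \<forall>v\<in>carrier V. f (\<rho> x v) = \<rho>' x (f v))}"

definition sl2 :: "(complex, complex mat) lie_alg" where
  "sl2 = \<lparr>carrier = {A \<in> carrier_mat 2 2. A $$ (0,0) + A $$ (1,1) = 0},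
     mult = undefined, one = undefined, zero = 0\<^sub>m 2 2, add = (+), smult = (\<cdot>\<^sub>m),
     bracket = (\<lambda>A B. A * B - B * A)\<rparr>"

text \<open>\<open>Sym n\<close> of \<open>\<complex>\<^sup>2\<close> is realised as the homogeneous polynomials of degree \<open>n\<close> in the canonical
  basis \<open>u, v\<close> of \<open>\<complex>\<^sup>2\<close>; the coefficient of \<open>u^i v^j\<close> in \<open>p\<close> is \<open>coeff (coeff p j) i\<close>. A matrix acts
  by the derivation that extends its action \<open>u \<mapsto> A u\<close>, \<open>v \<mapsto> A v\<close> on \<open>\<complex>\<^sup>2\<close>.\<close>

definition sym_power :: "nat \<Rightarrow> (complex, complex poly poly) module" where
  "sym_power n = \<lparr>carrier = {p. \<forall>i j. coeff (coeff p j) i \<noteq> 0 \<longrightarrow> i + j = n},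
     mult = undefined, one = undefined, zero = 0, add = (+), smult = (\<lambda>c. Polynomial.smult [:c:])\<rparr>"

definition sym_action :: "complex mat \<Rightarrow> complex poly poly \<Rightarrow> complex poly poly" where
  "sym_action A p = (let u = [:[:0, 1:]:]; v = [:0, 1:]; s = (\<lambda>c. [:[:c:]:]) in
     (s (A $$ (0,0)) * u + s (A $$ (1,0)) * v) * map_poly pderiv p +
     (s (A $$ (0,1)) * u + s (A $$ (1,1)) * v) * pderiv p)"


section \<open>The dihedral group\<close>

definition primitive_root_of_unity :: "nat \<Rightarrow> complex \<Rightarrow> bool" where
  "primitive_root_of_unity d \<zeta> \<longleftrightarrow> 0 < d \<and> \<zeta> ^ d = 1 \<and> (\<forall>k. 0 < k \<and> k < d \<longrightarrow> \<zeta> ^ k \<noteq> 1)"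

definition GL2 :: "complex mat monoid" where
  "GL2 = units_of (ring_mat TYPE(complex) 2 ())"

definition reflection :: "complex \<Rightarrow> nat \<Rightarrow> complex mat" where
  "reflection \<zeta> i = mat_of_rows_list 2 [[0, \<zeta> ^ i], [inverse (\<zeta> ^ i), 0]]"

definition dihedral :: "complex \<Rightarrow> complex mat set" where
  "dihedral \<zeta> = generate GL2 {reflection \<zeta> 0, reflection \<zeta> 1}"


section \<open>The algebra \<open>\<complex>[\<hbar>] \<otimes> (T(V \<oplus> V\<^sup>*) \<rtimes> W)\<close>\<close>

text \<open>\<open>Gx, Gy\<close> stand for the basis of \<open>V\<close> and \<open>GX, GY\<close> for the dual basis.\<close>

datatype gen = Gx | Gy | GX | GY

datatype word = Word (letters: "gen list")

instantiation word :: monoid_add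
begin
definition "0 = Word []"
definition "u + v = Word (letters u @ letters v)"
instance by standard (simp_all add: zero_word_def plus_word_def)
end

text \<open>The tensor algebra of \<open>V \<oplus> V\<^sup>*\<close> over \<open>\<complex>[\<hbar>]\<close>: the monoid algebra of the free monoid of words,
  with coefficients in \<open>\<complex>[\<hbar>]\<close>, so that \<open>\<hbar>\<close> is the polynomial \<open>[:0, 1:]\<close>.\<close>

type_synonym tensor = "word \<Rightarrow>\<^sub>0 complex poly"

definition scalar :: "complex poly \<Rightarrow> tensor" where
  "scalar p = Poly_Mapping.single 0 p"

definition letter :: "gen \<Rightarrow> tensor" where
  "letter g = Poly_Mapping.single (Word [g]) 1"

text \<open>\<open>W\<close> acts on \<open>V\<close> by its matrices and on \<open>V\<^sup>*\<close> by the contragredient action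
  \<open>(w \<phi>)(v) = \<phi> (w\<^sup>-\<^sup>1 v)\<close>.\<close>

definition act_gen :: "complex mat \<Rightarrow> gen \<Rightarrow> tensor" where
  "act_gen w g = (let v = inv\<^bsub>GL2\<^esub> w; s = (\<lambda>c. scalar [:c:]) in
     case g of
       Gx \<Rightarrow> s (w $$ (0,0)) * letter Gx + s (w $$ (1,0)) * letter Gy
     | Gy \<Rightarrow> s (w $$ (0,1)) * letter Gx + s (w $$ (1,1)) * letter Gy
     | GX \<Rightarrow> s (v $$ (0,0)) * letter GX + s (v $$ (0,1)) * letter GY
     | GY \<Rightarrow> s (v $$ (1,0)) * letter GX + s (v $$ (1,1)) * letter GY)"

definition act :: "complex mat \<Rightarrow> tensor \<Rightarrow> tensor" where
  "act w t = (\<Sum>m\<in>Poly_Mapping.keys t.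
     scalar (Poly_Mapping.lookup t m) * prod_list (map (act_gen w) (letters m)))"

text \<open>The element \<open>\<Sum>\<^sub>w F(w) w\<close> of the semidirect product is represented by the function \<open>F\<close>, and
  \<open>(t u) (t' v) = t u(t') u v\<close>.\<close>

definition smash :: "complex \<Rightarrow> (complex mat \<Rightarrow> tensor) ring" where
  "smash \<zeta> = \<lparr>carrier = {F. \<forall>w. w \<notin> dihedral \<zeta> \<longrightarrow> F w = 0},
     mult = (\<lambda>F G w. \<Sum>(u, v) \<in> {(u, v) \<in> dihedral \<zeta> \<times> dihedral \<zeta>. u \<otimes>\<^bsub>GL2\<^esub> v = w}.
               F u * act u (G v)),
     one = (\<lambda>w. if w = \<one>\<^bsub>GL2\<^esub> then 1 else 0),
     zero = (\<lambda>w. 0),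
     add = (\<lambda>F G w. F w + G w)\<rparr>"

definition tens :: "tensor \<Rightarrow> complex mat \<Rightarrow> tensor" where
  "tens t = (\<lambda>w. if w = \<one>\<^bsub>GL2\<^esub> then t else 0)"

abbreviation lett :: "gen \<Rightarrow> complex mat \<Rightarrow> tensor" where
  "lett g \<equiv> tens (letter g)"

definition hbar :: "complex mat \<Rightarrow> tensor" where
  "hbar = tens (scalar [:0, 1:])"

definition refl_sum :: "nat \<Rightarrow> complex \<Rightarrow> (nat \<Rightarrow> complex) \<Rightarrow> complex mat \<Rightarrow> tensor" \<comment> \<open>\<open>\<Sum>\<^sub>i c\<^sub>i s\<^sub>i\<close>\<close>
  where "refl_sum d \<zeta> c = (\<lambda>w. \<Sum>i<d. if w = reflection \<zeta> i then scalar [:c i:] else 0)"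


section \<open>The Cherednik algebras\<close>

definition commutator where
  "commutator R x y = (x \<otimes>\<^bsub>R\<^esub> y) \<ominus>\<^bsub>R\<^esub> (y \<otimes>\<^bsub>R\<^esub> x)"

definition cherednik_relations :: "nat \<Rightarrow> complex \<Rightarrow> complex \<Rightarrow> (complex mat \<Rightarrow> tensor) set" where
  "cherednik_relations d \<zeta> a = (let A = smash \<zeta>; br = commutator A in
     {br (lett Gx) (lett Gy),
      br (lett GX) (lett GY),
      br (lett Gx) (lett GX) \<ominus>\<^bsub>A\<^esub> (hbar \<ominus>\<^bsub>A\<^esub> refl_sum d \<zeta> (\<lambda>i. a)),
      br (lett Gy) (lett GY) \<ominus>\<^bsub>A\<^esub> (hbar \<ominus>\<^bsub>A\<^esub> refl_sum d \<zeta> (\<lambda>i. a)),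
      br (lett Gx) (lett GY) \<ominus>\<^bsub>A\<^esub> refl_sum d \<zeta> (\<lambda>i. a * inverse (\<zeta> ^ i)),
      br (lett Gy) (lett GX) \<ominus>\<^bsub>A\<^esub> refl_sum d \<zeta> (\<lambda>i. a * \<zeta> ^ i)})"

definition cherednik_ideal :: "nat \<Rightarrow> complex \<Rightarrow> complex \<Rightarrow> (complex mat \<Rightarrow> tensor) set" where
  "cherednik_ideal d \<zeta> a = genideal (smash \<zeta>) (cherednik_relations d \<zeta> a)"

type_synonym hh = "(complex mat \<Rightarrow> tensor) set"
type_synonym hc = "hh set"

definition H_hbar :: "nat \<Rightarrow> complex \<Rightarrow> complex \<Rightarrow> hh ring" where
  "H_hbar d \<zeta> a = smash \<zeta> Quot cherednik_ideal d \<zeta> a"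

definition to_H_hbar :: "nat \<Rightarrow> complex \<Rightarrow> complex \<Rightarrow> (complex mat \<Rightarrow> tensor) \<Rightarrow> hh" where
  "to_H_hbar d \<zeta> a F = cherednik_ideal d \<zeta> a +>\<^bsub>smash \<zeta>\<^esub> F"

definition hbar_ideal :: "nat \<Rightarrow> complex \<Rightarrow> complex \<Rightarrow> hh set" where
  "hbar_ideal d \<zeta> a = genideal (H_hbar d \<zeta> a) {to_H_hbar d \<zeta> a hbar}"

definition H_c :: "nat \<Rightarrow> complex \<Rightarrow> complex \<Rightarrow> hc ring" where
  "H_c d \<zeta> a = H_hbar d \<zeta> a Quot hbar_ideal d \<zeta> a"

definition mod_hbar :: "nat \<Rightarrow> complex \<Rightarrow> complex \<Rightarrow> hh \<Rightarrow> hc" where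
  "mod_hbar d \<zeta> a h = hbar_ideal d \<zeta> a +>\<^bsub>H_hbar d \<zeta> a\<^esub> h"

definition to_H_c :: "nat \<Rightarrow> complex \<Rightarrow> complex \<Rightarrow> (complex mat \<Rightarrow> tensor) \<Rightarrow> hc" where
  "to_H_c d \<zeta> a F = mod_hbar d \<zeta> a (to_H_hbar d \<zeta> a F)"

definition Z_c :: "nat \<Rightarrow> complex \<Rightarrow> complex \<Rightarrow> hc ring" where
  "Z_c d \<zeta> a = (let H = H_c d \<zeta> a in
     H\<lparr>carrier := {z \<in> carrier H. \<forall>h\<in>carrier H. z \<otimes>\<^bsub>H\<^esub> h = h \<otimes>\<^bsub>H\<^esub> z}\<rparr>)"

text \<open>The definite description expresses both that the commutator of lifts is uniquely divisible by
  \<open>\<hbar>\<close> and that the outcome modulo \<open>\<hbar>\<close> does not depend on the lifts.\<close>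

definition poisson :: "nat \<Rightarrow> complex \<Rightarrow> complex \<Rightarrow> hc \<Rightarrow> hc \<Rightarrow> hc" where
  "poisson d \<zeta> a z z' = (let H = H_hbar d \<zeta> a in
     THE p. \<exists>l\<in>carrier H. \<exists>l'\<in>carrier H. \<exists>h\<in>carrier H.
       mod_hbar d \<zeta> a l = z \<and> mod_hbar d \<zeta> a l' = z' \<and>
       to_H_hbar d \<zeta> a hbar \<otimes>\<^bsub>H\<^esub> h = commutator H l l' \<and> p = mod_hbar d \<zeta> a h)"


section \<open>Truncation and the generators of the center\<close>

text \<open>\<open>\<complex>[V \<times> V\<^sup>*] = \<complex>[x,y] \<otimes> \<complex>[X,Y]\<close> as polynomials in the four commuting variables \<open>gen\<close>.\<close>

type_synonym polyVV = "(gen \<Rightarrow>\<^sub>0 nat) \<Rightarrow>\<^sub>0 complex"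

definition var :: "gen \<Rightarrow> polyVV" where
  "var g = Poly_Mapping.single (Poly_Mapping.single g 1) 1"

text \<open>The multiplication map: \<open>x^i y^j \<otimes> X^k Y^l\<close> goes to the product in this order.\<close>

definition ordered_word :: "(gen \<Rightarrow>\<^sub>0 nat) \<Rightarrow> word" where
  "ordered_word m = Word (concat (map (\<lambda>g. replicate (Poly_Mapping.lookup m g) g) [Gx, Gy, GX, GY]))"

definition ordered_tensor :: "polyVV \<Rightarrow> tensor" where
  "ordered_tensor f = (\<Sum>m\<in>Poly_Mapping.keys f.
     Poly_Mapping.single (ordered_word m) [:Poly_Mapping.lookup f m:])"

definition VVW :: "complex \<Rightarrow> (complex mat \<Rightarrow> polyVV) set" \<comment> \<open>\<open>\<complex>[x,y] \<otimes> \<complex>[X,Y] \<otimes> \<complex>W\<close>\<close>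
  where "VVW \<zeta> = {F. \<forall>w. w \<notin> dihedral \<zeta> \<longrightarrow> F w = 0}"

definition mult_map :: "nat \<Rightarrow> complex \<Rightarrow> complex \<Rightarrow> (complex mat \<Rightarrow> polyVV) \<Rightarrow> hc" where
  "mult_map d \<zeta> a F = to_H_c d \<zeta> a (\<lambda>w. ordered_tensor (F w))"

definition Trunc :: "nat \<Rightarrow> complex \<Rightarrow> complex \<Rightarrow> hc \<Rightarrow> polyVV" where
  "Trunc d \<zeta> a z = inv_into (VVW \<zeta>) (mult_map d \<zeta> a) z \<one>\<^bsub>GL2\<^esub>"

definition q_elt :: "nat \<Rightarrow> complex \<Rightarrow> complex \<Rightarrow> hc" where
  "q_elt d \<zeta> a = to_H_c d \<zeta> a (tens (letter Gx * letter Gy))"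

definition Q_elt :: "nat \<Rightarrow> complex \<Rightarrow> complex \<Rightarrow> hc" where
  "Q_elt d \<zeta> a = to_H_c d \<zeta> a (tens (letter GX * letter GY))"

definition eu_elt :: "nat \<Rightarrow> complex \<Rightarrow> complex \<Rightarrow> hc" where
  "eu_elt d \<zeta> a = (THE z. z \<in> carrier (Z_c d \<zeta> a) \<and>
     Trunc d \<zeta> a z = var Gx * var GX + var Gy * var GY)"

definition a_elt :: "nat \<Rightarrow> complex \<Rightarrow> complex \<Rightarrow> nat \<Rightarrow> hc" where
  "a_elt d \<zeta> a j = (THE z. z \<in> carrier (Z_c d \<zeta> a) \<and>
     Trunc d \<zeta> a z = var Gx ^ (d - j) * var GY ^ j + var Gy ^ (d - j) * var GX ^ j)"


section \<open>The Lie algebra at the origin\<close>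

definition m0 :: "nat \<Rightarrow> complex \<Rightarrow> complex \<Rightarrow> hc set" where
  "m0 d \<zeta> a = genideal (Z_c d \<zeta> a)
     ({q_elt d \<zeta> a, Q_elt d \<zeta> a, eu_elt d \<zeta> a} \<union> a_elt d \<zeta> a ` {0..d})"

definition m0_sq :: "nat \<Rightarrow> complex \<Rightarrow> complex \<Rightarrow> hc set" where
  "m0_sq d \<zeta> a = ideal_prod (Z_c d \<zeta> a) (m0 d \<zeta> a) (m0 d \<zeta> a)"

text \<open>The quotient \<open>m\<^sub>0 / m\<^sub>0\<^sup>2\<close>. As in \<open>rcoset_mult\<close>, an operation on cosets is the union of the cosets
  of the results over all representatives; it is a single coset precisely when the operation is well
  defined on the quotient.\<close>

definition Lie0 :: "nat \<Rightarrow> complex \<Rightarrow> complex \<Rightarrow> (complex, hc set) lie_alg" where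
  "Lie0 d \<zeta> a = (let Z = Z_c d \<zeta> a; I = m0_sq d \<zeta> a in
     \<lparr>carrier = (\<lambda>z. I +>\<^bsub>Z\<^esub> z) ` m0 d \<zeta> a,
      mult = undefined, one = undefined, zero = I, add = set_add Z,
      smult = (\<lambda>c A. \<Union>z\<in>A. I +>\<^bsub>Z\<^esub> (to_H_c d \<zeta> a (tens (scalar [:c:])) \<otimes>\<^bsub>Z\<^esub> z)),
      bracket = (\<lambda>A B. \<Union>z\<in>A. \<Union>z'\<in>B. I +>\<^bsub>Z\<^esub> poisson d \<zeta> a z z')\<rparr>)"

end

theory Submission
  imports Defs
begin

text \<open>Write H for the Cherednik algebra over C[hbar]. The proof replaces H by an algebra of
  operators, where division by hbar can be carried out, and then lets an sl_2-triple and one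
  standard module do the work.

  Realization. A module over C[X,Y] and W induces an H-module with basis x^i y^j n, on which X and Y
  act as Dunkl operators. In the module induced from the regular representation, ordered monomials
  times group elements send a cyclic vector to distinct basis vectors (\<open>ob_e0\<close>), and
  they span H (\<open>Sp_all\<close>). This is the PBW theorem: H is isomorphic to a torsion-free
  algebra \<open>HH\<close> of operators (\<open>normal_form\<close>, \<open>hb_cancel\<close>).
  Elements of the centre of H_c lift to \<open>Zh\<close>, on which \<open>pb A B\<close> =
  [A,B]/hbar computes the Poisson bracket (\<open>poisson_eq\<close>). The ideals m_0 and m_0^2 have
  preimages \<open>M0\<close> and \<open>M2\<close> in \<open>Zh\<close>.

  Generators. Modulo hbar, q, Q and eu form an sl_2-triple. Repeated brackets with Q carry x^d + y^d
  through the elements \<open>AA j\<close>, binomial multiples of a_j, which shows that these are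
  central (\<open>AA_Zh\<close>) and span a module of highest weight d. Comparing leading terms of
  central elements with invariants of W (\<open>central_top\<close>, \<open>GG_sg\<close>) gives
  \<open>Zh\<close> = C + \<open>M0\<close> (\<open>Zh_CM\<close>), so that q, Q, eu and the
  \<open>AA j\<close> span m_0/m_0^2 (\<open>M0_span\<close>). An automorphism \<open>tau\<close>,
  built from a square root t of zeta with t^d = -1, fixes q, Q, eu and negates every
  \<open>AA j\<close>; it separates the two families.

  Independence. Modulo hbar a standard module has a quotient with basis x^m e+, y^m e-, filtered by
  m. \<open>M0\<close> moves e+ into degree at least d and \<open>M2\<close> into degree at least 2d
  (\<open>M2_Kn\<close>), whereas \<open>AA 0\<close> produces x^d e+. So \<open>AA 0\<close> is not
  in \<open>M2\<close>, the sl_2-action extends this to all combinations of the \<open>AA j\<close>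
  (\<open>LV_indep\<close>), and faithfulness of that action gives independence of q, Q, eu
  (\<open>L2_indep\<close>).

  Brackets of the a_j. Their constant terms form an invariant pairing on an irreducible sl_2-module,
  which vanishes once it vanishes in the middle weight: by antisymmetry for even d, by the action on
  e+ for odd d (\<open>ev_E\<close>). Hence m_0 is a Poisson ideal (\<open>pb_M0\<close>). Modulo
  m_0^2 such a bracket is even under \<open>tau\<close>, so it lies in the span of q, Q, eu. Weights
  leave {\<open>AA 0\<close>, \<open>AA d\<close>} = w eu; equivariance and the Jacobi identity
  yield (d - 4) w = 0 (\<open>E_0_d\<close>), and equivariance spreads w = 0 to all pairs
  (\<open>E_M2\<close>). What remains is sl_2 plus a commutative ideal, which becomes Sym^d after
  rescaling by signed binomial coefficients (\<open>psi_iso\<close>).\<close>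

section \<open>Operators on free modules over \<open>\<complex>[\<hbar>]\<close>\<close>

abbreviation (input) lk :: "('b \<Rightarrow>\<^sub>0 'r::zero) \<Rightarrow> 'b \<Rightarrow> 'r" where "lk \<equiv> Poly_Mapping.lookup"

abbreviation basis :: "'b \<Rightarrow> 'b \<Rightarrow>\<^sub>0 complex poly" where "basis b \<equiv> Poly_Mapping.single b 1"

definition pscale :: "complex poly \<Rightarrow> ('b \<Rightarrow>\<^sub>0 complex poly) \<Rightarrow> 'b \<Rightarrow>\<^sub>0 complex poly" where
  "pscale c p = Poly_Mapping.map ((*) c) p"

lemma lookup_pscale [simp]: "lk (pscale c p) b = c * lk p b"
  by (simp add: pscale_def Poly_Mapping.map.rep_eq when_def)

lemma pscale_simps [simp]:
  "pscale 0 p = 0" "pscale c 0 = 0" "pscale 1 p = p" "pscale c (pscale c' p) = pscale (c * c') p"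
  "pscale c (p + p') = pscale c p + pscale c p'" "pscale c (p - p') = pscale c p - pscale c p'"
  "pscale c (- p) = - pscale c p" "pscale c (Poly_Mapping.single b u) = Poly_Mapping.single b (c * u)"
  by (auto intro!: poly_mapping_eqI simp: lookup_add lookup_minus lookup_single when_def algebra_simps)

lemma pscale_add_left: "pscale (c + c') p = pscale c p + pscale c' p"
  by (auto intro!: poly_mapping_eqI simp: lookup_add algebra_simps)

lemma pscale_minus_left: "pscale (- c) p = - pscale c p"
  by (auto intro!: poly_mapping_eqI simp: lookup_add algebra_simps)

lemma pscale_sum: "pscale c (sum f A) = (\<Sum>x\<in>A. pscale c (f x))"
  by (induction A rule: infinite_finite_induct) auto

definition lin :: "('b \<Rightarrow> 'c \<Rightarrow>\<^sub>0 complex poly) \<Rightarrow> ('b \<Rightarrow>\<^sub>0 complex poly) \<Rightarrow> 'c \<Rightarrow>\<^sub>0 complex poly" where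
  "lin f p = (\<Sum>b\<in>Poly_Mapping.keys p. pscale (lk p b) (f b))"

lemma lin_superset:
  assumes "finite A" "Poly_Mapping.keys p \<subseteq> A"
  shows "lin f p = (\<Sum>b\<in>A. pscale (lk p b) (f b))"
  unfolding lin_def by (rule sum.mono_neutral_left) (use assms in \<open>auto simp: in_keys_iff\<close>)

lemma lin_0 [simp]: "lin f 0 = 0"
  by (simp add: lin_def)

lemma lin_single [simp]: "lin f (Poly_Mapping.single b c) = pscale c (f b)"
  by (cases "c = 0") (auto simp: lin_def)

lemma lin_add [simp]: "lin f (p + q) = lin f p + lin f q"
proof -
  let ?A = "Poly_Mapping.keys p \<union> Poly_Mapping.keys q"
  have "lin f (p + q) = (\<Sum>b\<in>?A. pscale (lk (p + q) b) (f b))"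
    by (rule lin_superset) (auto simp: Poly_Mapping.keys_add)
  also have "\<dots> = lin f p + lin f q"
    by (simp add: lin_superset[of ?A] lookup_add pscale_add_left sum.distrib)
  finally show ?thesis .
qed

lemma lin_pscale [simp]: "lin f (pscale c p) = pscale c (lin f p)"
proof -
  have "lin f (pscale c p) = (\<Sum>b\<in>Poly_Mapping.keys p. pscale (lk (pscale c p) b) (f b))"
    by (rule lin_superset) (auto simp: in_keys_iff)
  then show ?thesis by (simp add: lin_def pscale_sum)
qed

lemma lin_uminus [simp]: "lin f (- p) = - lin f p"
  using lin_pscale[of f "-1" p] by (simp add: pscale_minus_left)

lemma lin_diff [simp]: "lin f (p - q) = lin f p - lin f q"
  using lin_add[of f p "- q"] by simp

lemma lin_sum [simp]: "lin f (sum g A) = (\<Sum>x\<in>A. lin f (g x))"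
  by (induction A rule: infinite_finite_induct) auto

lemma lin_basis [simp]: "lin basis p = p"
  by (rule poly_mapping_eqI)
     (auto simp: lin_def lookup_sum lookup_single when_def in_keys_iff if_distrib cong: if_cong)

lemma lin_lin: "lin f (lin g p) = lin (\<lambda>b. lin f (g b)) p"
  by (simp add: lin_def[of g] lin_def[of "\<lambda>b. lin f (g b)"])

lemma lin_fun_add: "lin (\<lambda>b. f b + g b) p = lin f p + lin g p"
  by (simp add: lin_def sum.distrib)

lemma lin_fun_diff: "lin (\<lambda>b. f b - g b) p = lin f p - lin g p"
  by (simp add: lin_def sum_subtractf)

lemma lin_fun_uminus: "lin (\<lambda>b. - f b) p = - lin f p"
  by (simp add: lin_def sum_negf)

lemma lin_fun_pscale: "lin (\<lambda>b. pscale c (f b)) p = pscale c (lin f p)"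
  by (simp add: lin_def pscale_sum mult.commute)

lemma lin_fun_0 [simp]: "lin (\<lambda>b. 0) p = 0"
  by (simp add: lin_def)

lemma poly_mapping_sum_basis: "p = (\<Sum>b\<in>Poly_Mapping.keys p. pscale (lk p b) (basis b))"
  using lin_basis[of p] unfolding lin_def by (rule sym)

text \<open>An operator is given by the images of the basis vectors.\<close>

datatype 'b op = Op (col: "'b \<Rightarrow> 'b \<Rightarrow>\<^sub>0 complex poly")

definition app :: "'b op \<Rightarrow> ('b \<Rightarrow>\<^sub>0 complex poly) \<Rightarrow> 'b \<Rightarrow>\<^sub>0 complex poly" where
  "app A = lin (col A)"

lemma op_eqI: "(\<And>b. col A b = col B b) \<Longrightarrow> A = B"
  by (cases A; cases B) auto

instantiation op :: (type) ring_1
begin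
definition "0 = Op (\<lambda>b. 0)"
definition "1 = Op (\<lambda>b. basis b)"
definition "A + B = Op (\<lambda>b. col A b + col B b)"
definition "A - B = Op (\<lambda>b. col A b - col B b)"
definition "- A = Op (\<lambda>b. - col A b)"
definition "A * B = Op (\<lambda>b. app A (col B b))"
lemmas op_defs = zero_op_def one_op_def plus_op_def minus_op_def uminus_op_def times_op_def
instance
proof
  show "(0::'a op) \<noteq> 1"
    by (auto simp: op_defs fun_eq_iff poly_mapping_eq_iff lookup_single)
qed (auto intro!: op_eqI simp: op_defs app_def lin_lin lin_fun_add lin_fun_diff add_ac)
end

lemma app_simps [simp]:
  "app A 0 = 0" "app A (p + q) = app A p + app A q" "app A (p - q) = app A p - app A q"
  "app A (- p) = - app A p" "app A (pscale c p) = pscale c (app A p)"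
  "app A (sum f I) = (\<Sum>i\<in>I. app A (f i))"
  by (simp_all add: app_def)

lemma app_ops [simp]:
  "app 0 p = 0" "app 1 p = p" "app (A + B) p = app A p + app B p" "app (A - B) p = app A p - app B p"
  "app (- A) p = - app A p" "app (A * B) p = app A (app B p)"
  by (simp_all add: op_defs app_def lin_fun_add lin_fun_diff lin_fun_uminus lin_lin)

lemma app_op_sum [simp]: "app (sum f I) p = (\<Sum>i\<in>I. app (f i) p)"
  by (induction I rule: infinite_finite_induct) auto

lemma app_basis: "app A (basis b) = col A b"
  by (simp add: app_def)

lemma app_single: "app A (Poly_Mapping.single b c) = pscale c (col A b)"
  by (simp add: app_def)

lemma app_expand: "app A p = (\<Sum>b\<in>Poly_Mapping.keys p. pscale (lk p b) (app A (basis b)))"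
  by (simp add: app_basis) (simp add: app_def lin_def)

lemma op_ext: "(\<And>b. app A (basis b) = app B (basis b)) \<Longrightarrow> A = B"
  by (rule op_eqI) (simp add: app_basis)

text \<open>Multiplication by a scalar \<open>c\<close> of \<open>\<complex>[\<hbar>]\<close>, by a complex number, and by \<open>\<hbar>\<close>.\<close>

definition osc :: "complex poly \<Rightarrow> 'b op \<Rightarrow> 'b op" where
  "osc c A = Op (\<lambda>b. pscale c (col A b))"

definition cs :: "complex \<Rightarrow> 'b op \<Rightarrow> 'b op" where "cs z = osc [:z:]"

definition hb :: "'b op \<Rightarrow> 'b op" where "hb = osc [:0, 1:]"

lemma app_osc [simp]: "app (osc c A) p = pscale c (app A p)"
  by (simp add: osc_def app_def lin_fun_pscale)

lemma app_cs [simp]: "app (cs c A) p = pscale [:c:] (app A p)"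
  by (simp add: cs_def)

lemma app_hb [simp]: "app (hb A) p = pscale [:0,1:] (app A p)"
  by (simp add: hb_def)

lemma osc_simps:
  "osc c (osc c' A) = osc (c * c') A" "osc 1 A = A" "osc 0 A = 0" "osc c 0 = 0"
  "osc c (A + B) = osc c A + osc c B" "osc c (A - B) = osc c A - osc c B" "osc c (- A) = - osc c A"
  "osc c A * B = osc c (A * B)" "A * osc c B = osc c (A * B)"
  by (auto intro!: op_ext)

lemma osc_add_left: "osc (c + c') A = osc c A + osc c' A"
  by (auto intro!: op_ext simp: pscale_add_left)

lemma cs_simps [simp]:
  "cs z (cs w A) = cs (z * w) A" "cs 1 A = A" "cs 0 A = 0" "cs z 0 = 0"
  "cs z (A + B) = cs z A + cs z B" "cs z (A - B) = cs z A - cs z B" "cs z (- A) = - cs z A"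
  "cs z A * B = cs z (A * B)" "A * cs z B = cs z (A * B)" "hb (cs z A) = cs z (hb A)"
  by (simp_all add: cs_def hb_def osc_simps mult.commute pCons_one)

lemma hb_simps [simp]:
  "hb 0 = 0" "hb (A + B) = hb A + hb B" "hb (A - B) = hb A - hb B" "hb (- A) = - hb A"
  "hb A * B = hb (A * B)" "A * hb B = hb (A * B)"
  by (simp_all add: hb_def osc_simps)

lemma cs_sum: "cs z (sum f I) = (\<Sum>i\<in>I. cs z (f i))"
  by (induction I rule: infinite_finite_induct) auto

lemma hb_sum: "hb (sum f I) = (\<Sum>i\<in>I. hb (f i))"
  by (induction I rule: infinite_finite_induct) auto

lemma cs_add_left: "cs (z + w) A = cs z A + cs w A"
  using osc_add_left[of "[:z:]" "[:w:]" A] by (simp add: cs_def)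

lemma cs_uminus_left [simp]: "cs (- z) A = - cs z A"
  using cs_add_left[of z "-z" A] by (simp add: eq_neg_iff_add_eq_0 add.commute)

lemma cs_diff_left: "cs (z - w) A = cs z A - cs w A"
  using cs_add_left[of z "-w" A] by simp

lemma cs_of_nat: "cs (of_nat n) A = of_nat n * A"
  by (induction n) (simp_all add: cs_add_left algebra_simps)

text \<open>The coefficients lie in the domain C[hbar]. This torsion-freeness makes [A,B]/hbar
  single valued and lets identities be divided by hbar.\<close>

lemma hb_cancel: "hb A = hb B \<longleftrightarrow> A = B"
proof
  assume "hb A = hb B"
  show "A = B"
  proof (rule op_ext)
    fix b
    have "pscale [:0,1:] (app A (basis b)) = pscale [:0,1:] (app B (basis b))"
      using \<open>hb A = hb B\<close> by (metis app_hb)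
    then have "[:0,1:] * lk (app A (basis b)) c = [:0,1:] * lk (app B (basis b)) c" for c
      by (metis lookup_pscale)
    then show "app A (basis b) = app B (basis b)"
      by (intro poly_mapping_eqI) (metis mult_cancel_left pCons_eq_0_iff zero_neq_one)
  qed
qed simp

section \<open>Dunkl operators on induced modules\<close>

section \<open>Induced modules\<close>

locale cherednik =
  fixes d :: nat and \<zeta> a :: complex
  assumes prim: "primitive_root_of_unity d \<zeta>" and a0: "a \<noteq> 0" and d5: "d \<ge> 5"
begin

text \<open>Reflections are indexed by the roots of unity zeta^i, their upper right entries, instead
  of by residues i; no reduction modulo d is then needed.\<close>

definition U :: "complex set" where "U = {z. z ^ d = 1}"

lemma d_pos: "d > 0" and zeta_d: "\<zeta> ^ d = 1" and zeta_prim: "0 < k \<Longrightarrow> k < d \<Longrightarrow> \<zeta> ^ k \<noteq> 1"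
  using prim by (auto simp: primitive_root_of_unity_def)

lemma U_1 [simp]: "1 \<in> U" and U_mult: "z \<in> U \<Longrightarrow> w \<in> U \<Longrightarrow> z * w \<in> U"
  and U_divide: "z \<in> U \<Longrightarrow> w \<in> U \<Longrightarrow> z / w \<in> U" and U_power: "z \<in> U \<Longrightarrow> z ^ n \<in> U"
  and zeta_U [simp]: "\<zeta> \<in> U"
  using zeta_d by (auto simp: U_def power_mult_distrib power_divide) (metis power_commutes power_mult power_one mult.commute)

lemma U_nz: "z \<in> U \<Longrightarrow> z \<noteq> 0" and not_0_U [simp]: "0 \<notin> U"
  using d_pos by (auto simp: U_def zero_power)

lemma zeta_nz [simp]: "\<zeta> \<noteq> 0"
  using U_nz zeta_U by blast

lemma finite_U [simp]: "finite U"
  unfolding U_def using d_pos by (intro finite_roots_unity) auto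

lemma inj_zeta: "inj_on (\<lambda>i. \<zeta> ^ i) {..<d}"
proof -
  have "\<zeta> ^ i \<noteq> \<zeta> ^ j" if "i < j" "j < d" for i j
  proof
    assume "\<zeta> ^ i = \<zeta> ^ j"
    then have "\<zeta> ^ (j - i) = 1" using that by (simp add: power_diff)
    then show False using zeta_prim[of "j - i"] that by auto
  qed
  then show ?thesis
    by (auto simp: inj_on_def) (metis linorder_neqE_nat)
qed

lemma U_eq: "U = (\<lambda>i. \<zeta> ^ i) ` {..<d}"
proof (rule sym, rule card_seteq)
  show "card U \<le> card ((\<lambda>i. \<zeta> ^ i) ` {..<d})"
    using card_roots_unity[of d] d_pos by (simp add: card_image[OF inj_zeta] U_def)
qed (auto intro: U_power)

lemma sum_zeta: "(\<Sum>i<d. f (\<zeta> ^ i)) = (\<Sum>z\<in>U. f z)"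
  by (simp add: U_eq sum.reindex[OF inj_zeta])

lemma sum_U_mult: "w \<in> U \<Longrightarrow> (\<Sum>z\<in>U. f (w * z)) = (\<Sum>z\<in>U. f z)"
  by (rule sum.reindex_bij_witness[of _ "\<lambda>z. z / w" "\<lambda>z. w * z"]) (auto simp: U_divide U_mult U_nz)

lemma sum_U_div: "w \<in> U \<Longrightarrow> (\<Sum>z\<in>U. f (w / z)) = (\<Sum>z\<in>U. f z)"
  by (rule sum.reindex_bij_witness[of _ "\<lambda>z. w / z" "\<lambda>z. w / z"]) (auto simp: U_divide U_nz)

lemma sum_U_power:
  assumes "0 < k" "k < d"
  shows "(\<Sum>z\<in>U. z ^ k) = 0"
proof -
  have "(\<Sum>z\<in>U. z ^ k) = \<zeta> ^ k * (\<Sum>z\<in>U. z ^ k)"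
    using sum_U_mult[OF zeta_U, of "\<lambda>z. z ^ k"] by (simp add: power_mult_distrib sum_distrib_left)
  then have "(\<zeta> ^ k - 1) * (\<Sum>z\<in>U. z ^ k) = 0" by (simp add: algebra_simps)
  then show ?thesis using zeta_prim[OF assms] by simp
qed

end

text \<open>A module over \<open>\<complex>[X,Y] \<rtimes> W\<close> with basis \<open>'n\<close> (on which \<open>SN z\<close> is the action of the reflection
  with upper right entry \<open>z\<close>) induces a module over \<open>\<complex>[x,y] \<otimes> \<complex>[X,Y] \<rtimes> W\<close> in which \<open>x\<^sup>i y\<^sup>j n\<close> is
  the basis vector \<open>(i, j, n)\<close>. The action of \<open>X\<close> and \<open>Y\<close> is obtained by moving these operators
  through \<open>x\<^sup>i y\<^sup>j\<close> with the help of the Cherednik relations.\<close>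

locale induced = cherednik +
  fixes SN :: "complex \<Rightarrow> 'n op" and XN YN :: "'n op"
  assumes SN_mult: "z \<in> U \<Longrightarrow> w \<in> U \<Longrightarrow> SN z * SN w = SN (z / w) * SN 1"
    and SN_1: "SN 1 * SN 1 = 1"
    and SN_mult3: "z \<in> U \<Longrightarrow> w \<in> U \<Longrightarrow> SN z * SN 1 * SN w = SN (z * w)"
    and SN_X: "z \<in> U \<Longrightarrow> SN z * XN = cs z (YN * SN z)"
    and SN_Y: "z \<in> U \<Longrightarrow> SN z * YN = cs (1 / z) (XN * SN z)"
    and XN_YN: "XN * YN = YN * XN"
begin

definition emb :: "nat \<Rightarrow> nat \<Rightarrow> ('n \<Rightarrow>\<^sub>0 complex poly) \<Rightarrow> (nat \<times> nat \<times> 'n) \<Rightarrow>\<^sub>0 complex poly" where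
  "emb i j = lin (\<lambda>n. basis (i, j, n))"

lemma emb_simps [simp]: "emb i j (basis n) = basis (i, j, n)" "emb i j 0 = 0"
  "emb i j (p + q) = emb i j p + emb i j q" "emb i j (p - q) = emb i j p - emb i j q"
  "emb i j (pscale c p) = pscale c (emb i j p)"
  by (simp_all add: emb_def)

definition xo :: "(nat \<times> nat \<times> 'n) op" where "xo = Op (\<lambda>(i, j, n). basis (Suc i, j, n))"
definition yo :: "(nat \<times> nat \<times> 'n) op" where "yo = Op (\<lambda>(i, j, n). basis (i, Suc j, n))"

text \<open>A reflection exchanges x and y up to the factors 1/z and z, so it sends x^i y^j n to
  z^(j-i) x^j y^i (s n).\<close>

definition So :: "complex \<Rightarrow> (nat \<times> nat \<times> 'n) op" where
  "So z = Op (\<lambda>(i, j, n). pscale [:z ^ j / z ^ i:] (emb j i (col (SN z) n)))"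

lemma xo_basis [simp]: "app xo (basis (i, j, n)) = basis (Suc i, j, n)"
  and yo_basis [simp]: "app yo (basis (i, j, n)) = basis (i, Suc j, n)"
  and So_basis: "app (So z) (basis (i, j, n)) = pscale [:z ^ j / z ^ i:] (emb j i (app (SN z) (basis n)))"
  by (simp_all add: app_basis xo_def yo_def So_def)

lemma app_emb:
  assumes "\<And>n. app A (basis (i, j, n)) = pscale c (emb k l (app B (basis n)))"
  shows "app A (emb i j p) = pscale c (emb k l (app B p))"
proof -
  have "col A (i, j, n) = pscale c (emb k l (app B (basis n)))" for n
    using assms by (simp add: app_basis)
  then have "app A (emb i j p) = lin (\<lambda>n. pscale c (emb k l (app B (basis n)))) p"
    by (simp add: emb_def lin_lin app_def)
  also have "\<dots> = pscale c (emb k l (app B p))"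
    by (simp add: lin_fun_pscale emb_def app_def lin_lin)
  finally show ?thesis .
qed

lemma So_emb: "app (So z) (emb i j p) = pscale [:z ^ j / z ^ i:] (emb j i (app (SN z) p))"
  by (rule app_emb) (rule So_basis)

lemma xo_yo: "xo * yo = yo * xo"
  by (rule op_ext) auto

lemma So_xo: "z \<in> U \<Longrightarrow> So z * xo = cs (1 / z) (yo * So z)"
  and So_yo: "z \<in> U \<Longrightarrow> So z * yo = cs z (xo * So z)"
proof -
  have 1: "app xo (emb i j p) = emb (Suc i) j p" for i j p
    using app_emb[of xo i j 1 "Suc i" j 1] by simp
  have 2: "app yo (emb i j p) = emb i (Suc j) p" for i j p
    using app_emb[of yo i j 1 i "Suc j" 1] by simp
  assume z: "z \<in> U"
  show "So z * xo = cs (1 / z) (yo * So z)" "So z * yo = cs z (xo * So z)"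
    using U_nz[OF z] by (auto intro!: op_ext simp: So_basis 1 2 field_simps)
qed

lemma So_mult: "z \<in> U \<Longrightarrow> w \<in> U \<Longrightarrow> So z * So w = So (z / w) * So 1"
  and So_1: "So 1 * So 1 = 1"
  and So_mult3: "z \<in> U \<Longrightarrow> w \<in> U \<Longrightarrow> So z * So 1 * So w = So (z * w)"
proof -
  have eq: "app (SN z) (app (SN w) p) = app (SN (z / w)) (app (SN 1) p)" if "z \<in> U" "w \<in> U" for z w p
    using SN_mult[OF that] by (metis app_ops(6))
  have eq1: "app (SN 1) (app (SN 1) p) = p" for p
    using SN_1 by (metis app_ops(2,6))
  have eq3: "app (SN z) (app (SN 1) (app (SN w) p)) = app (SN (z * w)) p" if "z \<in> U" "w \<in> U" for z w p
    using SN_mult3[OF that] by (metis app_ops(6))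
  show "So z * So w = So (z / w) * So 1" if "z \<in> U" "w \<in> U"
    using that U_nz[OF that(1)] U_nz[OF that(2)]
    by (auto intro!: op_ext simp: So_basis So_emb eq power_divide field_simps)
  show "So 1 * So 1 = 1"
    by (auto intro!: op_ext simp: So_basis So_emb eq1 pCons_one)
  show "So z * So 1 * So w = So (z * w)" if "z \<in> U" "w \<in> U"
    using that U_nz[OF that(1)] U_nz[OF that(2)]
    by (auto intro!: op_ext simp: So_basis So_emb eq3 power_mult_distrib field_simps)
qed

definition SS :: "(complex \<Rightarrow> complex) \<Rightarrow> (nat \<times> nat \<times> 'n) op" where
  "SS f = (\<Sum>z\<in>U. cs (f z) (So z))"

lemma SS_cong: "(\<And>z. z \<in> U \<Longrightarrow> f z = g z) \<Longrightarrow> SS f = SS g"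
  by (simp add: SS_def)

lemma SS_xo: "SS f * xo = yo * SS (\<lambda>z. f z / z)"
  and SS_yo: "SS f * yo = xo * SS (\<lambda>z. f z * z)"
  by (simp_all add: SS_def sum_distrib_left sum_distrib_right So_xo So_yo)

lemma SS_So: "w \<in> U \<Longrightarrow> SS f * So w = So w * SS (\<lambda>z. f (w * w / z))"
proof -
  assume w: "w \<in> U"
  have "SS f * So w = (\<Sum>z\<in>U. cs (f z) (So (z / w) * So 1))"
    by (auto simp: SS_def sum_distrib_right w So_mult intro!: sum.cong)
  also have "\<dots> = (\<Sum>z\<in>U. cs (f (w * w / z)) (So (w * w / z / w) * So 1))"
    by (rule sum_U_div[symmetric]) (simp add: U_mult w)
  also have "\<dots> = (\<Sum>z\<in>U. cs (f (w * w / z)) (So w * So z))"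
    by (rule sum.cong) (auto simp: So_mult w U_nz)
  finally show ?thesis by (simp add: SS_def sum_distrib_left)
qed

text \<open>The prescribed commutators: [x,X] = [y,Y] = \<open>Cx\<close>, [y,X] = \<open>Cy\<close>
  and [x,Y] = \<open>Dx\<close>.\<close>

definition Cx :: "(nat \<times> nat \<times> 'n) op" where "Cx = hb 1 - cs a (SS (\<lambda>z. 1))"
definition Cy :: "(nat \<times> nat \<times> 'n) op" where "Cy = cs a (SS (\<lambda>z. z))"
definition Dx :: "(nat \<times> nat \<times> 'n) op" where "Dx = cs a (SS (\<lambda>z. 1 / z))"

text \<open>The recursion is forced by the relations D x = x D - C and D y = y D - C' for the
  operator D to be defined: C and C' are its prescribed commutators, N its action on the inducing
  module. Powers of x are passed first, then powers of y.\<close>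

primrec dunkl0 where
  "dunkl0 C N 0 n = emb 0 0 (col N n)"
| "dunkl0 C N (Suc j) n = app yo (dunkl0 C N j n) - app C (basis (0, j, n))"

primrec dunkl1 where
  "dunkl1 C C' N 0 j n = dunkl0 C' N j n"
| "dunkl1 C C' N (Suc i) j n = app xo (dunkl1 C C' N i j n) - app C (basis (i, j, n))"

definition dunkl where "dunkl C C' N = Op (\<lambda>(i, j, n). dunkl1 C C' N i j n)"

lemma dunkl_basis: "app (dunkl C C' N) (basis (i, j, n)) = dunkl1 C C' N i j n"
  by (simp add: dunkl_def app_basis)

lemma dunkl_0: "app (dunkl C C' N) (basis (0, 0, n)) = emb 0 0 (app N (basis n))"
  by (simp add: dunkl_def app_basis)

lemma dunkl_xo: "dunkl C C' N * xo = xo * dunkl C C' N - C"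
  by (rule op_ext) (auto simp: dunkl_basis)

text \<open>Since x is passed before y, the relation with x holds by construction, but the one with
  y requires the two commutators to be compatible. The assumption is the Jacobi identity for x, y
  and the operator.\<close>

lemma dunkl_yo:
  assumes "xo * C' + C * yo = yo * C + C' * xo"
  shows "dunkl C C' N * yo = yo * dunkl C C' N - C'"
proof (rule op_ext)
  fix b :: "nat \<times> nat \<times> 'n"
  obtain i j n where b: "b = (i, j, n)" by (cases b) auto
  have eq: "app xo (app C' p) + app C (app yo p) = app yo (app C p) + app C' (app xo p)" for p
    using assms by (metis app_ops(3,6))
  have comm: "app xo (app yo p) = app yo (app xo p)" for p using xo_yo by (metis app_ops(6))
  have "app (dunkl C C' N) (app yo (basis (i, j, n))) =
      app yo (app (dunkl C C' N) (basis (i, j, n))) - app C' (basis (i, j, n))"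
  proof (induction i)
    case (Suc i)
    then have IH: "dunkl1 C C' N i (Suc j) n = app yo (dunkl1 C C' N i j n) - app C' (basis (i, j, n))"
      by (simp add: dunkl_basis)
    show ?case using eq[of "basis (i, j, n)"] by (simp add: dunkl_basis comm IH) (simp add: algebra_simps)
  qed (simp add: dunkl_basis)
  then show "app (dunkl C C' N * yo) (basis b) = app (yo * dunkl C C' N - C') (basis b)"
    by (simp add: b)
qed

definition Xo :: "(nat \<times> nat \<times> 'n) op" where "Xo = dunkl Cx Cy XN"
definition Yo :: "(nat \<times> nat \<times> 'n) op" where "Yo = dunkl Dx Cx YN"

lemma Xo_xo: "Xo * xo = xo * Xo - Cx" and Yo_xo: "Yo * xo = xo * Yo - Dx"
  by (simp_all add: Xo_def Yo_def dunkl_xo)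

lemma SS_mult: "SS (\<lambda>z. 1) * xo = yo * SS (\<lambda>z. 1 / z)" "SS (\<lambda>z. 1) * yo = xo * SS (\<lambda>z. z)"
  "SS (\<lambda>z. z) * xo = yo * SS (\<lambda>z. 1)" "SS (\<lambda>z. 1 / z) * yo = xo * SS (\<lambda>z. 1)"
  by (auto simp: SS_xo SS_yo U_nz intro!: SS_cong arg_cong2[of _ _ _ _ "(*)"])

lemma Xo_yo: "Xo * yo = yo * Xo - Cy" and Yo_yo: "Yo * yo = yo * Yo - Cx"
proof -
  show "Xo * yo = yo * Xo - Cy" unfolding Xo_def
    by (rule dunkl_yo) (simp add: Cx_def Cy_def algebra_simps SS_mult)
  show "Yo * yo = yo * Yo - Cx" unfolding Yo_def
    by (rule dunkl_yo) (simp add: Cx_def Dx_def algebra_simps SS_mult)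
qed

text \<open>All remaining relations follow by commuting both sides with \<open>x\<close> and \<open>y\<close>.\<close>

lemma op_eq_0I:
  fixes D :: "(nat \<times> nat \<times> 'n) op"
  assumes "D * xo = A * D" "D * yo = B * D" "\<And>n. app D (basis (0, 0, n)) = 0"
  shows "D = 0"
proof (rule op_ext)
  fix b :: "nat \<times> nat \<times> 'n"
  obtain i j n where b: "b = (i, j, n)" by (cases b) auto
  have x: "app D (app xo p) = app A (app D p)" for p using assms(1) by (metis app_ops(6))
  have y: "app D (app yo p) = app B (app D p)" for p using assms(2) by (metis app_ops(6))
  have 0: "app D (basis (0, j, n)) = 0" for j
    by (induction j) (use y[of "basis (0, _, n)"] assms(3) in simp_all)
  have "app D (basis (i, j, n)) = 0"
    by (induction i) (use x[of "basis (_, j, n)"] 0 in simp_all)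
  then show "app D (basis b) = app 0 (basis b)" by (simp add: b)
qed

lemma Xo_emb: "app Xo (emb 0 0 p) = emb 0 0 (app XN p)"
  and Yo_emb: "app Yo (emb 0 0 p) = emb 0 0 (app YN p)"
  using app_emb[of Xo 0 0 1 0 0 XN] app_emb[of Yo 0 0 1 0 0 YN]
  by (simp_all add: Xo_def Yo_def dunkl_0)

lemma Cx_So: "z \<in> U \<Longrightarrow> Cx * So z = So z * Cx"
  by (simp add: Cx_def algebra_simps SS_So)

lemma Dx_So: "z \<in> U \<Longrightarrow> cs (z * z) (Dx * So z) = So z * Cy"
proof -
  assume z: "z \<in> U"
  have *: "cs c (SS f) = SS (\<lambda>z. c * f z)" for c f by (simp add: SS_def cs_sum)
  show ?thesis using U_nz[OF z] z
    by (simp add: Dx_def Cy_def SS_So) (simp add: * field_simps flip: cs_simps(9))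
qed

lemma So_Xo: assumes z: "z \<in> U" shows "So z * Xo = cs z (Yo * So z)"
proof -
  let ?D = "So z * Xo - cs z (Yo * So z)"
  have "So z * Xo * xo = cs (1 / z) (yo * So z * Xo) - So z * Cx"
    by (simp add: mult.assoc Xo_xo right_diff_distrib) (simp add: So_xo[OF z] flip: mult.assoc)
  moreover have "cs z (Yo * So z) * xo = cs (1 / z) (yo * cs z (Yo * So z)) - So z * Cx"
  proof -
    have "cs z (Yo * So z) * xo = Yo * yo * So z"
      using U_nz[OF z] by (simp add: mult.assoc So_xo[OF z])
    also have "\<dots> = yo * Yo * So z - Cx * So z" by (simp add: Yo_yo algebra_simps)
    finally show ?thesis using U_nz[OF z] by (simp add: Cx_So z mult.assoc)
  qed
  ultimately have 1: "?D * xo = cs (1 / z) yo * ?D"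
    unfolding left_diff_distrib by (simp only: ) (simp add: algebra_simps)
  have "So z * Xo * yo = cs z (xo * So z * Xo) - So z * Cy"
    by (simp add: mult.assoc Xo_yo right_diff_distrib) (simp add: So_yo[OF z] flip: mult.assoc)
  moreover have "cs z (Yo * So z) * yo = cs z (xo * cs z (Yo * So z)) - So z * Cy"
  proof -
    have "cs z (Yo * So z) * yo = cs (z * z) (Yo * xo * So z)"
      by (simp add: mult.assoc So_yo[OF z])
    also have "\<dots> = cs (z * z) (xo * Yo * So z) - cs (z * z) (Dx * So z)"
      by (simp add: Yo_xo algebra_simps)
    finally show ?thesis by (simp add: Dx_So z mult.assoc)
  qed
  ultimately have 2: "?D * yo = cs z xo * ?D"
    unfolding left_diff_distrib by (simp only: ) (simp add: algebra_simps)
  have eq: "app (SN z) (app XN p) = pscale [:z:] (app YN (app (SN z) p))" for p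
    using SN_X[OF z] by (metis app_cs app_ops(6))
  have "?D = 0"
    by (rule op_eq_0I[OF 1 2]) (simp add: So_basis So_emb Xo_emb Yo_emb eq flip: emb_simps(1))
  then show ?thesis by simp
qed

lemma So_Yo: assumes z: "z \<in> U" shows "So z * Yo = cs (1 / z) (Xo * So z)"
proof -
  have zz: "So z * So z = 1" using So_mult[OF z z] So_1 U_nz[OF z] by simp
  have "So z * (So z * Xo) * So z = cs z (So z * Yo * (So z * So z))"
    by (simp add: So_Xo[OF z] mult.assoc)
  then have "Xo * So z = cs z (So z * Yo)" by (simp add: zz flip: mult.assoc)
  then show ?thesis using U_nz[OF z] by simp
qed

text \<open>The commutator of X and Y commutes with x and y, because the correction terms cancel
  after reflections are moved past X and Y; and it vanishes on the inducing module.\<close>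

lemma Xo_Yo: "Xo * Yo = Yo * Xo"
proof -
  let ?D = "Xo * Yo - Yo * Xo"
  have *: "cs c (SS f) = SS (\<lambda>z. c * f z)" for c f by (simp add: SS_def cs_sum)
  have "SS f * Xo = Yo * SS (\<lambda>z. f z * z)" "SS f * Yo = Xo * SS (\<lambda>z. f z / z)" for f
    by (simp_all add: SS_def sum_distrib_left sum_distrib_right So_Xo So_Yo)
  then have SSXY: "SS (\<lambda>z. 1) * Xo = Yo * SS (\<lambda>z. z)" "SS (\<lambda>z. 1) * Yo = Xo * SS (\<lambda>z. 1 / z)"
    "SS (\<lambda>z. 1 / z) * Xo = Yo * SS (\<lambda>z. 1)" "SS (\<lambda>z. z) * Yo = Xo * SS (\<lambda>z. 1)"
    by (auto simp: U_nz intro!: SS_cong arg_cong2[of _ _ _ _ "(*)"])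
  have 1: "?D * xo = xo * ?D"
  proof -
    have "Xo * Yo * xo = Xo * xo * Yo - Xo * Dx" by (simp add: mult.assoc Yo_xo right_diff_distrib)
    also have "\<dots> = xo * Xo * Yo - Cx * Yo - Xo * Dx" by (simp add: Xo_xo left_diff_distrib)
    finally have e1: "Xo * Yo * xo = xo * Xo * Yo - Cx * Yo - Xo * Dx" .
    have "Yo * Xo * xo = Yo * xo * Xo - Yo * Cx" by (simp add: mult.assoc Xo_xo right_diff_distrib)
    also have "\<dots> = xo * Yo * Xo - Dx * Xo - Yo * Cx" by (simp add: Yo_xo left_diff_distrib)
    finally have e2: "Yo * Xo * xo = xo * Yo * Xo - Dx * Xo - Yo * Cx" .
    have "Cx * Yo + Xo * Dx = Dx * Xo + Yo * Cx"
      by (simp add: Cx_def Dx_def algebra_simps SSXY)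
    then show ?thesis unfolding left_diff_distrib e1 e2 by (simp add: algebra_simps)
  qed
  have 2: "?D * yo = yo * ?D"
  proof -
    have "Xo * Yo * yo = Xo * yo * Yo - Xo * Cx" by (simp add: mult.assoc Yo_yo right_diff_distrib)
    also have "\<dots> = yo * Xo * Yo - Cy * Yo - Xo * Cx" by (simp add: Xo_yo left_diff_distrib)
    finally have e1: "Xo * Yo * yo = yo * Xo * Yo - Cy * Yo - Xo * Cx" .
    have "Yo * Xo * yo = Yo * yo * Xo - Yo * Cy" by (simp add: mult.assoc Xo_yo right_diff_distrib)
    also have "\<dots> = yo * Yo * Xo - Cx * Xo - Yo * Cy" by (simp add: Yo_yo left_diff_distrib)
    finally have e2: "Yo * Xo * yo = yo * Yo * Xo - Cx * Xo - Yo * Cy" .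
    have "Cy * Yo + Xo * Cx = Cx * Xo + Yo * Cy"
      by (simp add: Cx_def Cy_def algebra_simps SSXY)
    then show ?thesis unfolding left_diff_distrib e1 e2 by (simp add: algebra_simps)
  qed
  have eq: "app XN (app YN p) = app YN (app XN p)" for p
    using XN_YN by (metis app_ops(6))
  have "?D = 0"
    by (rule op_eq_0I[OF 1 2]) (simp add: Xo_emb Yo_emb eq flip: emb_simps(1))
  then show ?thesis by simp
qed

end

text \<open>Conjugation by T is to scale the letters by t or 1/t and to turn s_i into s_(i+1); since
  s_i involves zeta^i, t must be a square root of zeta. Only the operator \<open>TN\<close> on the
  inducing module has to be supplied, the extension \<open>To\<close> to the induced module is then
  explicit.\<close>

locale induced_twist = induced d \<zeta> a SN XN YN
  for d :: nat and \<zeta> a :: complex and SN :: "complex \<Rightarrow> 'n op" and XN YN :: "'n op" +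
  fixes t :: complex and TN :: "'n op"
  assumes t2: "t * t = \<zeta>"
    and TN_S: "z \<in> U \<Longrightarrow> TN * SN z = SN (\<zeta> * z) * TN"
    and TN_X: "TN * XN = cs (1 / t) (XN * TN)"
    and TN_Y: "TN * YN = cs t (YN * TN)"
begin

lemma t_nz [simp]: "t \<noteq> 0" using t2 by auto

definition To :: "(nat \<times> nat \<times> 'n) op" where
  "To = Op (\<lambda>(i, j, n). pscale [:t ^ i / t ^ j:] (emb i j (col TN n)))"

lemma To_basis: "app To (basis (i, j, n)) = pscale [:t ^ i / t ^ j:] (emb i j (app TN (basis n)))"
  by (simp add: app_basis To_def)

lemma To_emb: "app To (emb i j p) = pscale [:t ^ i / t ^ j:] (emb i j (app TN p))"
  by (rule app_emb) (rule To_basis)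

lemma To_xo: "To * xo = cs t (xo * To)" and To_yo: "To * yo = cs (1 / t) (yo * To)"
proof -
  have 1: "app xo (emb i j p) = emb (Suc i) j p" for i j p
    using app_emb[of xo i j 1 "Suc i" j 1] by simp
  have 2: "app yo (emb i j p) = emb i (Suc j) p" for i j p
    using app_emb[of yo i j 1 i "Suc j" 1] by simp
  show "To * xo = cs t (xo * To)" "To * yo = cs (1 / t) (yo * To)"
    by (auto intro!: op_ext simp: To_basis 1 2 field_simps)
qed

lemma To_So: assumes z: "z \<in> U" shows "To * So z = So (\<zeta> * z) * To"
proof -
  have eq: "app TN (app (SN z) p) = app (SN (\<zeta> * z)) (app TN p)" for p
    using TN_S[OF z] by (metis app_ops(6))
  show ?thesis using U_nz[OF z]
    by (auto intro!: op_ext simp: To_basis So_basis To_emb So_emb eq t2[symmetric] power_mult_distrib field_simps)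
qed

lemma To_SS: "To * SS f = SS (\<lambda>z. f (z / \<zeta>)) * To"
proof -
  have "To * SS f = (\<Sum>z\<in>U. cs (f (\<zeta> * z / \<zeta>)) (So (\<zeta> * z))) * To"
    by (simp add: SS_def sum_distrib_left sum_distrib_right To_So)
  also have "(\<Sum>z\<in>U. cs (f (\<zeta> * z / \<zeta>)) (So (\<zeta> * z))) = SS (\<lambda>z. f (z / \<zeta>))"
    unfolding SS_def by (rule sum_U_mult) simp
  finally show ?thesis .
qed

lemma To_Cx: "To * Cx = Cx * To"
  by (simp add: Cx_def algebra_simps To_SS)

lemma To_Cy: "To * Cy = cs (1 / \<zeta>) (Cy * To)" and To_Dx: "To * Dx = cs \<zeta> (Dx * To)"
proof -
  have *: "cs c (SS f) = SS (\<lambda>z. c * f z)" for c f by (simp add: SS_def cs_sum)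
  show "To * Cy = cs (1 / \<zeta>) (Cy * To)"
    by (simp add: Cy_def To_SS) (simp add: * field_simps flip: cs_simps(8))
  show "To * Dx = cs \<zeta> (Dx * To)"
    by (simp add: Dx_def To_SS) (simp add: * field_simps flip: cs_simps(8))
qed

lemma To_Xo: "To * Xo = cs (1 / t) (Xo * To)"
proof -
  let ?D = "To * Xo - cs (1 / t) (Xo * To)"
  have zt: "\<zeta> = t * t" by (simp add: t2)
  have "?D * xo = To * (Xo * xo) - Xo * xo * To"
    by (simp add: algebra_simps To_xo)
  also have "\<dots> = cs t xo * ?D"
    by (simp add: Xo_xo algebra_simps To_Cx) (simp add: To_xo flip: mult.assoc)
  finally have 1: "?D * xo = cs t xo * ?D" .
  have "?D * yo = To * (Xo * yo) - cs (1 / \<zeta>) (Xo * yo * To)"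
    by (simp add: algebra_simps To_yo zt)
  also have "\<dots> = cs (1 / t) yo * ?D"
    by (simp add: Xo_yo algebra_simps To_Cy) (simp add: To_yo zt flip: mult.assoc)
  finally have 2: "?D * yo = cs (1 / t) yo * ?D" .
  have eq: "app TN (app XN p) = pscale [:1 / t:] (app XN (app TN p))" for p
    using TN_X by (metis app_cs app_ops(6))
  have "?D = 0"
    by (rule op_eq_0I[OF 1 2]) (simp add: To_emb Xo_emb eq flip: emb_simps(1))
  then show ?thesis by simp
qed

lemma To_Yo: "To * Yo = cs t (Yo * To)"
proof -
  let ?D = "To * Yo - cs t (Yo * To)"
  have zt: "\<zeta> = t * t" by (simp add: t2)
  have "?D * xo = To * (Yo * xo) - cs \<zeta> (Yo * xo * To)"
    by (simp add: algebra_simps To_xo zt)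
  also have "\<dots> = cs t xo * ?D"
    by (simp add: Yo_xo algebra_simps To_Dx) (simp add: To_xo zt flip: mult.assoc)
  finally have 1: "?D * xo = cs t xo * ?D" .
  have "?D * yo = To * (Yo * yo) - Yo * yo * To"
    by (simp add: algebra_simps To_yo)
  also have "\<dots> = cs (1 / t) yo * ?D"
    by (simp add: Yo_yo algebra_simps To_Cx) (simp add: To_yo flip: mult.assoc)
  finally have 2: "?D * yo = cs (1 / t) yo * ?D" .
  have eq: "app TN (app YN p) = pscale [:t:] (app YN (app TN p))" for p
    using TN_Y by (metis app_cs app_ops(6))
  have "?D = 0"
    by (rule op_eq_0I[OF 1 2]) (simp add: To_emb Yo_emb eq flip: emb_simps(1))
  then show ?thesis by simp
qed

end

section \<open>Ring structure of the smash product and the matrices of the dihedral group\<close>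

section \<open>The smash product\<close>

lemma word_plus: "Word u + Word v = Word (u @ v)"
  by (simp add: plus_word_def)

lemma word_zero: "0 = Word []"
  by (simp add: zero_word_def)

lemma letters_simps [simp]: "letters (u + v) = letters u @ letters v" "letters 0 = []"
  by (simp_all add: plus_word_def zero_word_def)

lemma prod_list_letter: "prod_list (map letter l) = Poly_Mapping.single (Word l) 1"
  by (induction l) (simp_all add: letter_def mult_single word_plus flip: single_one word_zero)

lemma scalar_simps: "scalar (p + q) = scalar p + scalar q" "scalar (p * q) = scalar p * scalar q"
  "scalar 1 = 1" "scalar 0 = 0"
  by (simp_all add: scalar_def single_add mult_single)

lemma scalar_mult_single: "scalar c * Poly_Mapping.single m u = Poly_Mapping.single m (c * u)"
  by (simp add: scalar_def mult_single)

lemma tensor_sum: "t = (\<Sum>m\<in>Poly_Mapping.keys t. Poly_Mapping.single m (lk t m))" for t :: tensor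
  using poly_mapping_sum_basis[of t] by simp

lemma scalar_comm: "scalar c * t = t * scalar c"
  by (subst (1 2) tensor_sum[of t])
     (simp add: sum_distrib_left sum_distrib_right scalar_def mult_single mult.commute)

lemma tensor_induct [case_names add scalar letter mult]:
  assumes "\<And>t u. P t \<Longrightarrow> P u \<Longrightarrow> P (t + u)" "\<And>c. P (scalar c)" "\<And>g. P (letter g)"
    "\<And>t u. P t \<Longrightarrow> P u \<Longrightarrow> P (t * u)"
  shows "P t"
proof -
  have "P (prod_list (map letter l))" for l
    by (induction l) (use assms(2)[of 1] in \<open>auto simp: scalar_simps intro: assms\<close>)
  then have "P (scalar c * prod_list (map letter l))" for c l by (intro assms)
  then have 1: "P (Poly_Mapping.single m c)" for m c
    by (cases m) (metis mult.right_neutral prod_list_letter scalar_mult_single)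
  have "P (\<Sum>m\<in>A. Poly_Mapping.single m (lk t m))" for A
    by (induction A rule: infinite_finite_induct) (use assms(2)[of 0] in \<open>auto simp: scalar_simps intro: assms 1\<close>)
  then show ?thesis by (rule ssubst[of t _ P, OF tensor_sum])
qed

text \<open>Evaluation of tensors, with values in a ring that is a \<open>\<complex>[\<hbar>]\<close>-algebra by means of \<open>sc\<close>.\<close>

locale tensor_eval =
  fixes sc :: "complex poly \<Rightarrow> 'e::ring_1" and g :: "gen \<Rightarrow> 'e"
  assumes sc_add: "sc (p + q) = sc p + sc q" and sc_mult: "sc (p * q) = sc p * sc q" and sc_1: "sc 1 = 1"
    and sc_comm: "sc p * u = u * sc p"
begin

definition ev :: "tensor \<Rightarrow> 'e" where
  "ev t = (\<Sum>m\<in>Poly_Mapping.keys t. sc (lk t m) * prod_list (map g (letters m)))"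

lemma sc_0: "sc 0 = 0"
  using sc_add[of 0 0] by simp

lemma ev_superset:
  assumes "finite A" "Poly_Mapping.keys t \<subseteq> A"
  shows "ev t = (\<Sum>m\<in>A. sc (lk t m) * prod_list (map g (letters m)))"
  unfolding ev_def by (rule sum.mono_neutral_left) (use assms in \<open>auto simp: in_keys_iff sc_0\<close>)

lemma ev_add: "ev (t + u) = ev t + ev u"
proof -
  let ?A = "Poly_Mapping.keys t \<union> Poly_Mapping.keys u"
  have "ev (t + u) = (\<Sum>m\<in>?A. sc (lk (t + u) m) * prod_list (map g (letters m)))"
    by (rule ev_superset) (auto simp: Poly_Mapping.keys_add)
  also have "\<dots> = ev t + ev u"
    by (simp add: ev_superset[of ?A] lookup_add sc_add distrib_right sum.distrib)
  finally show ?thesis .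
qed

lemma ev_0: "ev 0 = 0"
  by (simp add: ev_def)

lemma ev_sum: "ev (sum f A) = (\<Sum>x\<in>A. ev (f x))"
  by (induction A rule: infinite_finite_induct) (auto simp: ev_0 ev_add)

lemma ev_single: "ev (Poly_Mapping.single m c) = sc c * prod_list (map g (letters m))"
  by (cases "c = 0") (auto simp: ev_def sc_0)

lemma ev_scalar: "ev (scalar c) = sc c" and ev_letter: "ev (letter l) = g l" and ev_1: "ev 1 = 1"
  by (simp_all add: scalar_def letter_def ev_single sc_1 flip: single_one)

lemma ev_mult: "ev (t * u) = ev t * ev u"
proof -
  have 1: "ev (Poly_Mapping.single m c * Poly_Mapping.single m' c') =
      ev (Poly_Mapping.single m c) * ev (Poly_Mapping.single m' c')" for m m' c c'
    unfolding mult_single ev_single sc_mult letters_simps map_append prod_list.append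
    by (metis mult.assoc sc_comm)
  show ?thesis
    by (subst (1 2) tensor_sum[of t], subst (1 2) tensor_sum[of u]) (simp add: sum_product ev_sum 1)
qed

end

interpretation tensor_act: tensor_eval scalar "act_gen w" for w
  by standard (rule scalar_simps scalar_comm)+

lemma act_eq: "act w = tensor_act.ev w"
  by (simp add: fun_eq_iff act_def tensor_act.ev_def)

lemmas act_simps = tensor_act.ev_add[folded act_eq] tensor_act.ev_0[folded act_eq]
  tensor_act.ev_sum[folded act_eq] tensor_act.ev_scalar[folded act_eq] tensor_act.ev_letter[folded act_eq]
  tensor_act.ev_mult[folded act_eq] tensor_act.ev_1[folded act_eq]

definition mat2 :: "complex \<Rightarrow> complex \<Rightarrow> complex \<Rightarrow> complex \<Rightarrow> complex mat" where
  "mat2 p q r s = mat_of_rows_list 2 [[p, q], [r, s]]"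

lemma mat2_simps [simp]: "mat2 p q r s \<in> carrier_mat 2 2" "dim_row (mat2 p q r s) = 2" "dim_col (mat2 p q r s) = 2"
  "mat2 p q r s $$ (0, 0) = p" "mat2 p q r s $$ (0, Suc 0) = q" "mat2 p q r s $$ (Suc 0, 0) = r"
  "mat2 p q r s $$ (Suc 0, Suc 0) = s"
  by (auto simp: mat2_def mat_of_rows_list_def)

lemma less_2: "i < (2::nat) \<longleftrightarrow> i = 0 \<or> i = Suc 0"
  by auto

lemma mat2_eqI: "A \<in> carrier_mat 2 2 \<Longrightarrow> B \<in> carrier_mat 2 2 \<Longrightarrow> A $$ (0, 0) = B $$ (0, 0) \<Longrightarrow>
    A $$ (0, Suc 0) = B $$ (0, Suc 0) \<Longrightarrow> A $$ (Suc 0, 0) = B $$ (Suc 0, 0) \<Longrightarrow>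
    A $$ (Suc 0, Suc 0) = B $$ (Suc 0, Suc 0) \<Longrightarrow> A = B"
  by (rule eq_matI) (auto simp: less_2)

lemma mat2_mult: "mat2 p q r s * mat2 p' q' r' s' =
    mat2 (p * p' + q * r') (p * q' + q * s') (r * p' + s * r') (r * q' + s * s')"
proof -
  have "{0..<2::nat} = {0, Suc 0}" by auto
  then show ?thesis by (intro mat2_eqI mult_carrier_mat[of _ 2 2]) (simp_all add: scalar_prod_def)
qed

lemma mat2_eq_iff: "mat2 p q r s = mat2 p' q' r' s' \<longleftrightarrow> p = p' \<and> q = q' \<and> r = r' \<and> s = s'"
  by (metis mat2_simps(4-7))

lemma one_mat2: "1\<^sub>m 2 = mat2 1 0 0 1"
  by (rule mat2_eqI) auto

definition Sm :: "complex \<Rightarrow> complex mat" where "Sm z = mat2 0 z (1 / z) 0"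
definition Rm :: "complex \<Rightarrow> complex mat" where "Rm z = mat2 z 0 0 (1 / z)"

lemma reflection_eq: "reflection \<zeta> i = Sm (\<zeta> ^ i)"
  by (simp add: reflection_def Sm_def mat2_def divide_inverse)

lemma SR_mult: "z \<noteq> 0 \<Longrightarrow> w \<noteq> 0 \<Longrightarrow> Sm z * Sm w = Rm (z / w)" "z \<noteq> 0 \<Longrightarrow> w \<noteq> 0 \<Longrightarrow> Sm z * Rm w = Sm (z / w)"
  "z \<noteq> 0 \<Longrightarrow> w \<noteq> 0 \<Longrightarrow> Rm z * Sm w = Sm (z * w)" "z \<noteq> 0 \<Longrightarrow> w \<noteq> 0 \<Longrightarrow> Rm z * Rm w = Rm (z * w)"
  by (simp_all add: Sm_def Rm_def mat2_mult)

lemma SR_eq_iff [simp]: "Sm z = Sm w \<longleftrightarrow> z = w" "Rm z = Rm w \<longleftrightarrow> z = w"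
  "z \<noteq> 0 \<Longrightarrow> Sm z \<noteq> Rm w" "z \<noteq> 0 \<Longrightarrow> Rm w \<noteq> Sm z"
  by (auto simp: Sm_def Rm_def mat2_eq_iff)

lemma group_GL2: "group GL2"
proof -
  interpret R: ring "ring_mat TYPE(complex) 2 ()" by (rule ring_mat)
  show ?thesis unfolding GL2_def by (rule R.units_group)
qed

lemma GL2_simps [simp]: "u \<otimes>\<^bsub>GL2\<^esub> v = u * v" "\<one>\<^bsub>GL2\<^esub> = Rm 1"
  by (auto simp: GL2_def units_of_def ring_mat_def Rm_def one_mat2)

lemma GL2_I: "A \<in> carrier_mat 2 2 \<Longrightarrow> B \<in> carrier_mat 2 2 \<Longrightarrow> A * B = Rm 1 \<Longrightarrow> B * A = Rm 1 \<Longrightarrow> A \<in> carrier GL2"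
  by (auto simp: GL2_def units_of_def Units_def ring_mat_simps Rm_def one_mat2)

lemma SR_GL2 [simp]: "z \<noteq> 0 \<Longrightarrow> Sm z \<in> carrier GL2" "z \<noteq> 0 \<Longrightarrow> Rm z \<in> carrier GL2"
proof -
  assume z: "z \<noteq> 0"
  show "Sm z \<in> carrier GL2"
    by (rule GL2_I[of _ "Sm z"]) (use z in \<open>auto simp: SR_mult\<close>, auto simp: Sm_def)
  show "Rm z \<in> carrier GL2"
    by (rule GL2_I[of _ "Rm (1 / z)"]) (use z in \<open>auto simp: SR_mult\<close>, auto simp: Rm_def)
qed

lemma SR_inv: "z \<noteq> 0 \<Longrightarrow> inv\<^bsub>GL2\<^esub> (Sm z) = Sm z" "z \<noteq> 0 \<Longrightarrow> inv\<^bsub>GL2\<^esub> (Rm z) = Rm (1 / z)"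
  by (rule group.inv_equality[OF group_GL2]; simp add: SR_mult)+

definition scal :: "complex \<Rightarrow> tensor" where "scal c = scalar [:c:]"

lemma scal_simps: "scal c * scal c' = scal (c * c')" "scal 1 = 1" "scal 0 = 0"
  "scal c + scal c' = scal (c + c')" "act w (scal c) = scal c"
  by (simp_all add: scal_def act_simps pCons_one flip: scalar_simps)
     (simp_all add: scalar_simps mult.commute pCons_one flip: scalar_simps)

lemma scal_assoc: "scal c * (scal c' * t) = scal (c * c') * t"
  by (simp add: scal_simps flip: mult.assoc)

lemma act_letter_S: assumes "z \<noteq> 0"
  shows "act (Sm z) (letter Gx) = scal (1 / z) * letter Gy" "act (Sm z) (letter Gy) = scal z * letter Gx"
    "act (Sm z) (letter GX) = scal z * letter GY" "act (Sm z) (letter GY) = scal (1 / z) * letter GX"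
  using assms by (simp_all add: act_simps act_gen_def Let_def SR_inv) (simp_all add: Sm_def scal_def scalar_simps)

lemma act_letter_R: assumes "z \<noteq> 0"
  shows "act (Rm z) (letter Gx) = scal z * letter Gx" "act (Rm z) (letter Gy) = scal (1 / z) * letter Gy"
    "act (Rm z) (letter GX) = scal (1 / z) * letter GX" "act (Rm z) (letter GY) = scal z * letter GY"
  using assms by (simp_all add: act_simps act_gen_def Let_def SR_inv) (simp_all add: Rm_def scal_def scalar_simps)

lemma act_Rm_1: "act (Rm 1) t = t"
proof (induction t rule: tensor_induct)
  case (letter g)
  then show ?case by (cases g) (simp_all add: act_letter_R scal_simps)
qed (simp_all add: act_simps)

context cherednik
begin

abbreviation D where "D \<equiv> dihedral \<zeta>"

lemma D_eq: "D = Sm ` U \<union> Rm ` U"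
proof
  let ?D = "Sm ` U \<union> Rm ` U"
  show "D \<subseteq> ?D"
  proof
    fix w assume "w \<in> D"
    then show "w \<in> ?D" unfolding dihedral_def reflection_eq
    proof (induction rule: generate.induct)
      case (inv h)
      then show ?case by (auto simp: SR_inv U_nz)
    next
      case (eng h1 h2)
      then show ?case by (auto simp: SR_mult U_nz U_mult U_divide intro: U_mult U_divide)
    qed auto
  qed
  interpret G: group GL2 by (rule group_GL2)
  have m: "u * v \<in> D" if "u \<in> D" "v \<in> D" for u v
    using generate.eng[OF that[unfolded dihedral_def]] by (simp add: dihedral_def)
  have S: "Sm 1 \<in> D" "Sm \<zeta> \<in> D"
    using generate.incl[of _ "{reflection \<zeta> 0, reflection \<zeta> 1}" GL2] by (auto simp: dihedral_def reflection_eq)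
  then have R: "Rm \<zeta> \<in> D" using m[OF S(2,1)] by (simp add: SR_mult)
  have "Rm (\<zeta> ^ i) \<in> D" for i
  proof (induction i)
    case 0
    then show ?case using m[OF S(1,1)] by (simp add: SR_mult)
  next
    case (Suc i)
    then show ?case using m[OF R Suc] by (simp add: SR_mult)
  qed
  then have RD: "Rm ` U \<subseteq> D" by (auto simp: U_eq)
  then have "Sm ` U \<subseteq> D" using m[OF _ S(1)] by (force simp: SR_mult U_nz)
  then show "?D \<subseteq> D" using RD by auto
qed

lemma D_mult: "u \<in> D \<Longrightarrow> v \<in> D \<Longrightarrow> u * v \<in> D"
  by (auto simp: D_eq SR_mult U_nz U_mult U_divide intro: U_mult U_divide)

lemma SR_D [simp]: "z \<in> U \<Longrightarrow> Sm z \<in> D" "z \<in> U \<Longrightarrow> Rm z \<in> D"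
  by (auto simp: D_eq)

lemma D_carrier: "u \<in> D \<Longrightarrow> u \<in> carrier_mat 2 2"
  by (auto simp: D_eq Sm_def Rm_def)

lemma finite_D [simp]: "finite D"
  by (simp add: D_eq)

lemma D_assoc: "u \<in> D \<Longrightarrow> v \<in> D \<Longrightarrow> w \<in> D \<Longrightarrow> u * v * w = u * (v * w)"
  using D_carrier assoc_mult_mat by blast

lemma D_one: "u \<in> D \<Longrightarrow> Rm 1 * u = u" "u \<in> D \<Longrightarrow> u * Rm 1 = u"
  by (auto simp: D_eq SR_mult U_nz)

lemma D_cases [consumes 1, case_names S R]:
  assumes "w \<in> D" obtains z where "z \<in> U" "z \<noteq> 0" "w = Sm z" | z where "z \<in> U" "z \<noteq> 0" "w = Rm z"
  using assms U_nz by (auto simp: D_eq)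

lemma act_mult: "u \<in> D \<Longrightarrow> v \<in> D \<Longrightarrow> act (u * v) t = act u (act v t)"
proof (induction t rule: tensor_induct)
  case (letter g)
  then show ?case
    by (cases g; elim D_cases)
       (simp_all add: act_letter_S act_letter_R SR_mult act_simps(6) scal_simps(5) scal_assoc mult.commute)
qed (simp_all add: act_simps)

definition cv :: "(complex mat \<Rightarrow> tensor) \<Rightarrow> (complex mat \<Rightarrow> tensor) \<Rightarrow> complex mat \<Rightarrow> tensor" where
  "cv F G w = (\<Sum>u\<in>D. \<Sum>v\<in>D. if u * v = w then F u * act u (G v) else 0)"

lemma smash_simps: "carrier (smash \<zeta>) = {F. \<forall>w. w \<notin> D \<longrightarrow> F w = 0}" "F \<otimes>\<^bsub>smash \<zeta>\<^esub> G = cv F G"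
  "\<one>\<^bsub>smash \<zeta>\<^esub> = (\<lambda>w. if w = Rm 1 then 1 else 0)" "\<zero>\<^bsub>smash \<zeta>\<^esub> = (\<lambda>w. 0)"
  "F \<oplus>\<^bsub>smash \<zeta>\<^esub> G = (\<lambda>w. F w + G w)"
proof -
  have eq: "{(u, v). (u, v) \<in> D \<times> D \<and> u * v = w} = {x \<in> D \<times> D. fst x * snd x = w}" for w :: "complex mat"
    by auto
  have "F \<otimes>\<^bsub>smash \<zeta>\<^esub> G = (\<lambda>w. \<Sum>(u, v)\<in>{(u, v). (u, v) \<in> D \<times> D \<and> u * v = w}. F u * act u (G v))"
    by (simp add: smash_def)
  also have "\<dots> = cv F G"
    unfolding eq cv_def sum.cartesian_product fun_eq_iff
    by (simp only: sum.inter_filter finite_cartesian_product finite_D case_prod_unfold simp_thms)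
  finally show "F \<otimes>\<^bsub>smash \<zeta>\<^esub> G = cv F G" .
qed (simp_all add: smash_def)

text \<open>Substitution c = b v in a sum over W, for \<open>h\<close> additive in its second
  argument. It carries both the associativity of \<open>cv\<close> and the multiplicativity of
  \<open>Psi\<close>.\<close>

lemma sum_conv:
  assumes "\<And>c x y. h c (x + y) = h c x + h c y" "\<And>c. h c 0 = (0::'e::ab_group_add)"
  shows "(\<Sum>c\<in>D. h c (\<Sum>b\<in>D. \<Sum>v\<in>D. if b * v = c then k b v else (0::'f::ab_group_add))) = (\<Sum>b\<in>D. \<Sum>v\<in>D. h (b * v) (k b v))"
proof -
  have s: "h c (sum f A) = (\<Sum>x\<in>A. h c (f x))" for c f and A :: "complex mat set"
    by (induction A rule: infinite_finite_induct) (auto simp: assms)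
  have "(\<Sum>c\<in>D. h c (\<Sum>b\<in>D. \<Sum>v\<in>D. if b * v = c then k b v else 0)) =
        (\<Sum>c\<in>D. \<Sum>b\<in>D. \<Sum>v\<in>D. if b * v = c then h c (k b v) else 0)"
    unfolding s by (intro sum.cong refl) (simp add: assms(2))
  also have "\<dots> = (\<Sum>b\<in>D. \<Sum>c\<in>D. \<Sum>v\<in>D. if b * v = c then h c (k b v) else 0)"
    by (rule sum.swap)
  also have "\<dots> = (\<Sum>b\<in>D. \<Sum>v\<in>D. \<Sum>c\<in>D. if b * v = c then h c (k b v) else 0)"
    by (rule sum.cong[OF refl], rule sum.swap)
  also have "\<dots> = (\<Sum>b\<in>D. \<Sum>v\<in>D. h (b * v) (k b v))"
    by (intro sum.cong refl) (simp add: D_mult)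
  finally show ?thesis .
qed

lemma cv_carrier: "cv F G \<in> carrier (smash \<zeta>)"
  unfolding smash_simps(1) mem_Collect_eq
proof (intro allI impI)
  fix w assume "w \<notin> D"
  then show "cv F G w = 0" unfolding cv_def by (intro sum.neutral ballI) (use D_mult in force)
qed

lemma cv_assoc: "cv (cv F G) H = cv F (cv G H)"
proof
  fix w
  have "cv (cv F G) H w = (\<Sum>u\<in>D. (cv F G u) * (\<Sum>v\<in>D. if u * v = w then act u (H v) else 0))"
    unfolding cv_def[of "cv F G"] sum_distrib_left by (intro sum.cong refl) simp
  also have "\<dots> = (\<Sum>p\<in>D. \<Sum>b\<in>D. (F p * act p (G b)) * (\<Sum>v\<in>D. if p * b * v = w then act (p * b) (H v) else 0))"
    unfolding cv_def[of F G]
    using sum_conv[of "\<lambda>u x. x * (\<Sum>v\<in>D. if u * v = w then act u (H v) else 0)" "\<lambda>p b. F p * act p (G b)"]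
    by (simp add: distrib_right)
  also have "\<dots> = (\<Sum>p\<in>D. \<Sum>b\<in>D. \<Sum>v\<in>D. if p * (b * v) = w then F p * act p (G b * act b (H v)) else 0)"
  proof (intro sum.cong refl)
    fix p b assume pb: "p \<in> D" "b \<in> D"
    show "(F p * act p (G b)) * (\<Sum>v\<in>D. if p * b * v = w then act (p * b) (H v) else 0) =
        (\<Sum>v\<in>D. if p * (b * v) = w then F p * act p (G b * act b (H v)) else 0)"
      unfolding sum_distrib_left
      by (intro sum.cong refl) (simp add: pb act_mult act_simps(6) D_assoc mult.assoc)
  qed
  also have "\<dots> = (\<Sum>p\<in>D. \<Sum>c\<in>D. if p * c = w then F p * act p (cv G H c) else 0)"
  proof (rule sum.cong[OF refl])
    fix p assume "p \<in> D"
    have "(\<Sum>c\<in>D. (\<lambda>c x. if p * c = w then F p * act p x else 0) c (cv G H c)) =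
        (\<Sum>b\<in>D. \<Sum>v\<in>D. (\<lambda>c x. if p * c = w then F p * act p x else 0) (b * v) (G b * act b (H v)))"
      unfolding cv_def[of G H]
      using sum_conv[of "\<lambda>c x. if p * c = w then F p * act p x else 0" "\<lambda>b v. G b * act b (H v)"]
      by (simp add: act_simps distrib_left)
    then show "(\<Sum>b\<in>D. \<Sum>v\<in>D. if p * (b * v) = w then F p * act p (G b * act b (H v)) else 0) =
        (\<Sum>c\<in>D. if p * c = w then F p * act p (cv G H c) else 0)" by simp
  qed
  finally show "cv (cv F G) H w = cv F (cv G H) w" by (simp add: cv_def[of F])
qed

definition del :: "complex mat \<Rightarrow> tensor \<Rightarrow> complex mat \<Rightarrow> tensor" where
  "del u t = (\<lambda>w. if w = u then t else 0)"

lemma cv_del: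
  assumes "u \<in> D" shows "cv (del u t) G w = (\<Sum>v\<in>D. if u * v = w then t * act u (G v) else 0)"
proof -
  have "cv (del u t) G w = (\<Sum>x\<in>D. if x = u then (\<Sum>v\<in>D. if x * v = w then t * act x (G v) else 0) else 0)"
    unfolding cv_def by (intro sum.cong refl) (auto simp: del_def intro!: sum.neutral sum.cong)
  then show ?thesis using assms by (simp add: del_def)
qed

lemma cv_del_del:
  assumes "u \<in> D" "v \<in> D" shows "cv (del u s) (del v t) = del (u * v) (s * act u t)"
proof
  fix w
  have "cv (del u s) (del v t) w = (\<Sum>x\<in>D. if x = v then (if u * x = w then s * act u t else 0) else 0)"
    unfolding cv_del[OF assms(1)] by (intro sum.cong refl) (auto simp: del_def act_simps)
  then show "cv (del u s) (del v t) w = del (u * v) (s * act u t) w"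
    using assms by (simp add: del_def)
qed

lemma cv_tens: "G \<in> carrier (smash \<zeta>) \<Longrightarrow> cv (del (Rm 1) t) G = (\<lambda>w. t * G w)"
proof
  fix w assume G: "G \<in> carrier (smash \<zeta>)"
  have "cv (del (Rm 1) t) G w = (\<Sum>v\<in>D. if v = w then t * G v else 0)"
    unfolding cv_del[OF SR_D(2)[OF U_1]] by (intro sum.cong refl) (simp add: D_one act_Rm_1)
  moreover have "w \<notin> D \<Longrightarrow> G w = 0" using G by (simp add: smash_simps(1))
  ultimately show "cv (del (Rm 1) t) G w = t * G w" by (cases "w \<in> D") simp_all
qed

lemma cv_one: "F \<in> carrier (smash \<zeta>) \<Longrightarrow> cv F (del (Rm 1) 1) = F"
proof
  fix w assume F: "F \<in> carrier (smash \<zeta>)"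
  have "cv F (del (Rm 1) 1) w = (\<Sum>u\<in>D. if u = w then F u else 0)"
    unfolding cv_def
  proof (intro sum.cong refl)
    fix u assume u: "u \<in> D"
    have "(\<Sum>v\<in>D. if u * v = w then F u * act u (del (Rm 1) 1 v) else 0) =
      (\<Sum>v\<in>D. if v = Rm 1 then (if u * v = w then F u else 0) else 0)"
      by (intro sum.cong refl) (auto simp: del_def act_simps)
    then show "(\<Sum>v\<in>D. if u * v = w then F u * act u (del (Rm 1) 1 v) else 0) = (if u = w then F u else 0)"
      by (simp add: D_one u)
  qed
  moreover have "w \<notin> D \<Longrightarrow> F w = 0" using F by (simp add: smash_simps(1))
  ultimately show "cv F (del (Rm 1) 1) w = F w" by (cases "w \<in> D") simp_all
qed

lemma cv_add_left: "cv (\<lambda>w. F w + F' w) G = (\<lambda>w. cv F G w + cv F' G w)"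
  unfolding cv_def fun_eq_iff sum.distrib[symmetric]
  by (intro allI sum.cong refl) (simp add: algebra_simps)

lemma cv_add_right: "cv G (\<lambda>w. F w + F' w) = (\<lambda>w. cv G F w + cv G F' w)"
  unfolding cv_def fun_eq_iff sum.distrib[symmetric]
  by (intro allI sum.cong refl) (simp add: algebra_simps act_simps)

lemma ring_smash: "ring (smash \<zeta>)"
proof (rule ringI)
  show "abelian_group (smash \<zeta>)"
  proof (rule abelian_groupI)
    fix F assume F: "F \<in> carrier (smash \<zeta>)"
    have "(\<lambda>w. - F w) \<in> carrier (smash \<zeta>)" using F by (simp add: smash_simps(1))
    moreover have "(\<lambda>w. - F w) \<oplus>\<^bsub>smash \<zeta>\<^esub> F = \<zero>\<^bsub>smash \<zeta>\<^esub>" by (simp add: smash_simps(4,5))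
    ultimately show "\<exists>G\<in>carrier (smash \<zeta>). G \<oplus>\<^bsub>smash \<zeta>\<^esub> F = \<zero>\<^bsub>smash \<zeta>\<^esub>" by blast
  qed (simp_all add: smash_simps(1,4,5) add_ac)
  have one: "\<one>\<^bsub>smash \<zeta>\<^esub> = del (Rm 1) 1" by (simp add: smash_simps del_def)
  show "monoid (smash \<zeta>)"
  proof (rule monoidI)
    show "\<one>\<^bsub>smash \<zeta>\<^esub> \<in> carrier (smash \<zeta>)" by (auto simp: smash_simps(1,3))
    show "F \<otimes>\<^bsub>smash \<zeta>\<^esub> G \<in> carrier (smash \<zeta>)" for F G
      using cv_carrier by (simp add: smash_simps(2))
    show "F \<otimes>\<^bsub>smash \<zeta>\<^esub> G \<otimes>\<^bsub>smash \<zeta>\<^esub> H = F \<otimes>\<^bsub>smash \<zeta>\<^esub> (G \<otimes>\<^bsub>smash \<zeta>\<^esub> H)" for F G H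
      by (simp add: smash_simps(2) cv_assoc)
    show "\<one>\<^bsub>smash \<zeta>\<^esub> \<otimes>\<^bsub>smash \<zeta>\<^esub> F = F" if "F \<in> carrier (smash \<zeta>)" for F
      using cv_tens[OF that, of 1] by (simp add: smash_simps(2) one)
    show "F \<otimes>\<^bsub>smash \<zeta>\<^esub> \<one>\<^bsub>smash \<zeta>\<^esub> = F" if "F \<in> carrier (smash \<zeta>)" for F
      using cv_one[OF that] by (simp add: smash_simps(2) one)
  qed
qed (simp_all add: smash_simps(2,5) cv_add_left cv_add_right)

sublocale smash: ring "smash \<zeta>" by (rule ring_smash)

lemma smash_minus: "F \<in> carrier (smash \<zeta>) \<Longrightarrow> G \<in> carrier (smash \<zeta>) \<Longrightarrow> F \<ominus>\<^bsub>smash \<zeta>\<^esub> G = (\<lambda>w. F w - G w)"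
proof -
  assume F: "F \<in> carrier (smash \<zeta>)" and G: "G \<in> carrier (smash \<zeta>)"
  have "\<ominus>\<^bsub>smash \<zeta>\<^esub> G = (\<lambda>w. - G w)"
    by (rule smash.minus_equality) (use G in \<open>auto simp: smash_simps\<close>)
  then show ?thesis by (simp add: a_minus_def smash_simps)
qed

end

section \<open>The action of the smash product on an induced module\<close>

context induced
begin

definition gm :: "gen \<Rightarrow> (nat \<times> nat \<times> 'n) op" where
  "gm g = (case g of Gx \<Rightarrow> xo | Gy \<Rightarrow> yo | GX \<Rightarrow> Xo | GY \<Rightarrow> Yo)"

lemma gm_simps [simp]: "gm Gx = xo" "gm Gy = yo" "gm GX = Xo" "gm GY = Yo"
  by (simp_all add: gm_def)

sublocale tev: tensor_eval "\<lambda>c. osc c 1" gm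
  by standard (simp_all add: osc_add_left osc_simps mult.commute)

abbreviation T where "T \<equiv> tev.ev"

lemma T_scalar_mult: "T (scalar c * t) = osc c (T t)"
  by (simp add: tev.ev_mult tev.ev_scalar osc_simps)

lemma T_scal_mult: "T (scal c * t) = cs c (T t)"
  by (simp add: scal_def T_scalar_mult cs_def)

text \<open>A rotation \<open>Rm z\<close> is the product of the reflections \<open>Sm z\<close> and
  \<open>Sm 1\<close>. The assumptions \<open>SN_mult\<close>, \<open>SN_1\<close> and
  \<open>SN_mult3\<close> of \<open>induced\<close> are the multiplication table of W in terms of
  reflections alone.\<close>

definition rep :: "complex mat \<Rightarrow> (nat \<times> nat \<times> 'n) op" where
  "rep w = (if w $$ (0, 0) = 0 then So (w $$ (0, 1)) else So (w $$ (0, 0)) * So 1)"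

lemma rep_S: "rep (Sm z) = So z" and rep_R: "z \<noteq> 0 \<Longrightarrow> rep (Rm z) = So z * So 1"
  by (simp_all add: rep_def Sm_def Rm_def)

lemma rep_one: "rep (Rm 1) = 1"
  by (simp add: rep_R So_1)

lemma rep_mult:
  assumes "u \<in> D" "v \<in> D" shows "rep (u * v) = rep u * rep v"
  using assms
proof (elim D_cases)
  fix z w assume *: "z \<in> U" "z \<noteq> 0" "u = Sm z" "w \<in> U" "w \<noteq> 0" "v = Sm w"
  then show ?thesis by (simp add: SR_mult rep_S rep_R So_mult[of z w])
next
  fix z w assume *: "z \<in> U" "z \<noteq> 0" "u = Sm z" "w \<in> U" "w \<noteq> 0" "v = Rm w"
  have "So z * (So w * So 1) = So (z / w) * (So 1 * So 1)"
    using So_mult[of z w] * by (metis mult.assoc)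
  then show ?thesis using * by (simp add: SR_mult rep_S rep_R So_1)
next
  fix z w assume *: "z \<in> U" "z \<noteq> 0" "u = Rm z" "w \<in> U" "w \<noteq> 0" "v = Sm w"
  then show ?thesis by (simp add: SR_mult rep_S rep_R So_mult3)
next
  fix z w assume *: "z \<in> U" "z \<noteq> 0" "u = Rm z" "w \<in> U" "w \<noteq> 0" "v = Rm w"
  have "So z * So 1 * (So w * So 1) = So (z * w) * So 1"
    using So_mult3[of z w] * by (metis mult.assoc)
  then show ?thesis using * by (simp add: SR_mult rep_S rep_R)
qed

lemma T_act_S: assumes z: "z \<in> U" shows "T (act (Sm z) t) * So z = So z * T t"
proof (induction t rule: tensor_induct)
  case (letter g)
  then show ?case using U_nz[OF z]
    by (cases g) (simp_all add: act_letter_S T_scal_mult tev.ev_letter So_xo[OF z] So_yo[OF z] So_Xo[OF z] So_Yo[OF z])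
next
  case (mult t u)
  then show ?case by (simp add: act_simps(6) tev.ev_mult mult.assoc) (simp flip: mult.assoc)
qed (simp_all add: act_simps tev.ev_add tev.ev_scalar algebra_simps osc_simps)

lemma T_act: assumes w: "w \<in> D" shows "T (act w t) * rep w = rep w * T t"
  using w
proof (cases rule: D_cases)
  case (S z)
  then show ?thesis using T_act_S by (simp add: rep_S)
next
  case (R z)
  have "act w t = act (Sm z) (act (Sm 1) t)"
    using R by (simp add: SR_mult flip: act_mult)
  then have "T (act w t) * rep w = T (act (Sm z) (act (Sm 1) t)) * So z * So 1"
    using R by (simp add: rep_R mult.assoc)
  also have "\<dots> = So z * (T (act (Sm 1) t) * So 1)"
    using R by (simp add: T_act_S mult.assoc)
  also have "\<dots> = rep w * T t"
    using R by (simp add: T_act_S[OF U_1] rep_R mult.assoc)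
  finally show ?thesis .
qed

definition Psi :: "(complex mat \<Rightarrow> tensor) \<Rightarrow> (nat \<times> nat \<times> 'n) op" where
  "Psi F = (\<Sum>w\<in>D. T (F w) * rep w)"

lemma Psi_add: "Psi (\<lambda>w. F w + G w) = Psi F + Psi G"
  by (simp add: Psi_def tev.ev_add algebra_simps sum.distrib)

lemma Psi_0: "Psi (\<lambda>w. 0) = 0"
  by (simp add: Psi_def tev.ev_0)

lemma Psi_sum: "Psi (\<lambda>w. \<Sum>i\<in>I. F i w) = (\<Sum>i\<in>I. Psi (F i))"
  by (induction I rule: infinite_finite_induct) (simp_all add: Psi_0 Psi_add)

lemma Psi_diff: "Psi (\<lambda>w. F w - G w) = Psi F - Psi G"
  using Psi_add[of "\<lambda>w. F w - G w" G] by simp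

lemma Psi_cv: "Psi (cv F G) = Psi F * Psi G"
proof -
  have "Psi (cv F G) = (\<Sum>u\<in>D. \<Sum>v\<in>D. T (F u * act u (G v)) * rep (u * v))"
    unfolding Psi_def cv_def
    using sum_conv[of "\<lambda>c x. T x * rep c" "\<lambda>u v. F u * act u (G v)"]
    by (simp add: tev.ev_add tev.ev_0 algebra_simps)
  also have "\<dots> = (\<Sum>u\<in>D. \<Sum>v\<in>D. T (F u) * rep u * (T (G v) * rep v))"
  proof (intro sum.cong refl)
    fix u v assume uv: "u \<in> D" "v \<in> D"
    have "T (F u * act u (G v)) * rep (u * v) = T (F u) * (T (act u (G v)) * rep u) * rep v"
      using uv by (simp add: tev.ev_mult rep_mult mult.assoc)
    then show "T (F u * act u (G v)) * rep (u * v) = T (F u) * rep u * (T (G v) * rep v)"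
      using uv by (simp add: T_act mult.assoc)
  qed
  finally show ?thesis by (simp add: Psi_def sum_product)
qed

lemma Psi_del: assumes "u \<in> D" shows "Psi (del u t) = T t * rep u"
proof -
  have "Psi (del u t) = (\<Sum>w\<in>D. if w = u then T t * rep u else 0)"
    unfolding Psi_def by (intro sum.cong refl) (auto simp: del_def tev.ev_0)
  then show ?thesis using assms by simp
qed

end

context cherednik
begin

lemma smash_a_inv: "F \<in> carrier (smash \<zeta>) \<Longrightarrow> \<ominus>\<^bsub>smash \<zeta>\<^esub> F = (\<lambda>w. - F w)"
  by (rule smash.minus_equality) (auto simp: smash_simps)

lemma tens_eq: "tens t = del (Rm 1) t"
  by (simp add: tens_def del_def)

lemma del_carrier [simp]: "u \<in> D \<Longrightarrow> del u t \<in> carrier (smash \<zeta>)"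
  by (auto simp: smash_simps(1) del_def)

lemma refl_sum_eq: "refl_sum d \<zeta> (\<lambda>i. f (\<zeta> ^ i)) = (\<lambda>w. \<Sum>z\<in>U. del (Sm z) (scal (f z)) w)"
proof
  fix w
  have "refl_sum d \<zeta> (\<lambda>i. f (\<zeta> ^ i)) w = (\<Sum>i<d. del (Sm (\<zeta> ^ i)) (scal (f (\<zeta> ^ i))) w)"
    by (simp add: refl_sum_def reflection_eq del_def scal_def)
  then show "refl_sum d \<zeta> (\<lambda>i. f (\<zeta> ^ i)) w = (\<Sum>z\<in>U. del (Sm z) (scal (f z)) w)"
    using sum_zeta[of "\<lambda>z. del (Sm z) (scal (f z)) w"] by simp
qed

lemma refl_sum_carrier: "(\<lambda>w. \<Sum>z\<in>U. del (Sm z) (scal (f z)) w) \<in> carrier (smash \<zeta>)"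
  by (auto simp: smash_simps(1) del_def intro!: sum.neutral)

definition RS :: "(complex \<Rightarrow> complex) \<Rightarrow> complex mat \<Rightarrow> tensor" where
  "RS f = (\<lambda>w. \<Sum>z\<in>U. del (Sm z) (scal (f z)) w)"

lemma RS_carrier [simp]: "RS f \<in> carrier (smash \<zeta>)"
  using refl_sum_carrier by (simp add: RS_def)

abbreviation lx where "lx g \<equiv> del (Rm 1) (letter g)"

abbreviation "hh1 \<equiv> del (Rm 1) (scalar [:0, 1:])"

lemma hh1_carrier [simp]: "del (Rm 1) t \<in> carrier (smash \<zeta>)"
  by simp

lemma relations_eq: "cherednik_relations d \<zeta> a =
   {\<lambda>w. cv (lx Gx) (lx Gy) w - cv (lx Gy) (lx Gx) w,
    \<lambda>w. cv (lx GX) (lx GY) w - cv (lx GY) (lx GX) w,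
    \<lambda>w. (cv (lx Gx) (lx GX) w - cv (lx GX) (lx Gx) w) - (hh1 w - RS (\<lambda>z. a) w),
    \<lambda>w. (cv (lx Gy) (lx GY) w - cv (lx GY) (lx Gy) w) - (hh1 w - RS (\<lambda>z. a) w),
    \<lambda>w. (cv (lx Gx) (lx GY) w - cv (lx GY) (lx Gx) w) - RS (\<lambda>z. a / z) w,
    \<lambda>w. (cv (lx Gy) (lx GX) w - cv (lx GX) (lx Gy) w) - RS (\<lambda>z. a * z) w}"
proof -
  have 1: "commutator (smash \<zeta>) F G = (\<lambda>w. cv F G w - cv G F w)" for F G
    unfolding commutator_def by (simp add: smash_simps(2) smash_minus cv_carrier)
  have 2: "(\<lambda>w. F w - G w) \<in> carrier (smash \<zeta>)" if "F \<in> carrier (smash \<zeta>)" "G \<in> carrier (smash \<zeta>)" for F G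
    using that by (auto simp: smash_simps(1))
  have 3: "refl_sum d \<zeta> (\<lambda>i. a) = RS (\<lambda>z. a)" "refl_sum d \<zeta> (\<lambda>i. a * inverse (\<zeta> ^ i)) = RS (\<lambda>z. a / z)"
    "refl_sum d \<zeta> (\<lambda>i. a * \<zeta> ^ i) = RS (\<lambda>z. a * z)"
    using refl_sum_eq[of "\<lambda>z. a"] refl_sum_eq[of "\<lambda>z. a / z"] refl_sum_eq[of "\<lambda>z. a * z"]
    by (simp_all add: RS_def divide_inverse)
  show ?thesis
    by (simp only: cherednik_relations_def Let_def 1 3 tens_eq hbar_def smash_minus 2 cv_carrier RS_carrier hh1_carrier)
qed

lemma relations_carrier: "cherednik_relations d \<zeta> a \<subseteq> carrier (smash \<zeta>)"
proof -
  have "\<And>w. w \<notin> D \<Longrightarrow> RS f w = 0" for f using RS_carrier[of f] by (simp add: smash_simps(1))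
  moreover have "\<And>w. w \<notin> D \<Longrightarrow> cv F G w = 0" for F G using cv_carrier[of F G] by (simp add: smash_simps(1))
  moreover have "\<And>w. w \<notin> D \<Longrightarrow> hh1 w = 0" using hh1_carrier by (simp add: smash_simps(1))
  ultimately show ?thesis by (simp add: relations_eq smash_simps(1))
qed

abbreviation II where "II \<equiv> cherednik_ideal d \<zeta> a"

lemma II_ideal: "ideal II (smash \<zeta>)"
  unfolding cherednik_ideal_def by (rule smash.genideal_ideal[OF relations_carrier])

lemma relations_II: "F \<in> cherednik_relations d \<zeta> a \<Longrightarrow> F \<in> II"
  unfolding cherednik_ideal_def using smash.genideal_self[OF relations_carrier] by blast

sublocale II: ideal II "smash \<zeta>" by (rule II_ideal)

lemma II_carrier: "F \<in> II \<Longrightarrow> F \<in> carrier (smash \<zeta>)" by (rule II.Icarr)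
lemma II_0: "(\<lambda>w. 0) \<in> II" using II.zero_closed by (simp add: smash_simps(4))
lemma II_add: "F \<in> II \<Longrightarrow> G \<in> II \<Longrightarrow> (\<lambda>w. F w + G w) \<in> II" using II.a_closed by (simp add: smash_simps(5))
lemma II_l: "F \<in> II \<Longrightarrow> G \<in> carrier (smash \<zeta>) \<Longrightarrow> cv G F \<in> II" using II.I_l_closed by (simp add: smash_simps(2))
lemma II_r: "F \<in> II \<Longrightarrow> G \<in> carrier (smash \<zeta>) \<Longrightarrow> cv F G \<in> II" using II.I_r_closed by (simp add: smash_simps(2))

lemma cv_uminus_left: "cv (\<lambda>w. - F w) G = (\<lambda>w. - cv F G w)"
  unfolding cv_def fun_eq_iff sum_negf[symmetric] by (intro allI sum.cong refl) simp

lemma act_uminus: "act u (- t) = - act u t"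
  using act_simps(1)[of u t "- t"] by (simp add: act_simps(2) eq_neg_iff_add_eq_0 add.commute)

lemma cv_uminus_right: "cv F (\<lambda>w. - G w) = (\<lambda>w. - cv F G w)"
  unfolding cv_def fun_eq_iff sum_negf[symmetric] by (intro allI sum.cong refl) (simp add: act_uminus)

lemma cv_diff_left: "cv (\<lambda>w. F w - G w) H = (\<lambda>w. cv F H w - cv G H w)"
  using cv_add_left[of F "\<lambda>w. - G w" H] by (simp add: cv_uminus_left)

lemma cv_diff_right: "cv H (\<lambda>w. F w - G w) = (\<lambda>w. cv H F w - cv H G w)"
  using cv_add_right[of H F "\<lambda>w. - G w"] by (simp add: cv_uminus_right)

lemma II_uminus: "F \<in> II \<Longrightarrow> (\<lambda>w. - F w) \<in> II"
proof -
  assume F: "F \<in> II"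
  have "cv (del (Rm 1) (-1)) F \<in> II" by (rule II_l[OF F]) simp
  then show ?thesis by (simp add: cv_tens II_carrier[OF F])
qed

end

lemma (in induced) Psi_RS: "Psi (RS f) = SS f"
  unfolding RS_def Psi_sum SS_def
proof (intro sum.cong refl)
  fix z assume "z \<in> U"
  then show "Psi (del (Sm z) (scal (f z))) = cs (f z) (So z)"
    using T_scal_mult[of "f z" 1] by (simp add: Psi_del rep_S tev.ev_1)
qed

text \<open>The kernel of \<open>Psi\<close> is a two-sided ideal and contains the six relations,
  hence the ideal generated by them: every induced module is a module over H.\<close>

lemma (in induced) Psi_II: "F \<in> II \<Longrightarrow> Psi F = 0"
proof -
  let ?K = "{F \<in> carrier (smash \<zeta>). Psi F = 0}"
  have h: "Psi hh1 = hb 1" "Psi (lx g) = gm g" for g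
    by (simp_all add: Psi_del tev.ev_scalar tev.ev_letter rep_one hb_def osc_simps)
  have "ideal ?K (smash \<zeta>)"
  proof (rule idealI[OF ring_smash])
    show "subgroup ?K (add_monoid (smash \<zeta>))"
    proof (rule group.subgroupI[OF smash.a_group])
      show "?K \<noteq> {}" using smash.zero_closed Psi_0 by (auto simp: smash_simps(4))
      fix F assume F: "F \<in> ?K"
      then show "inv\<^bsub>add_monoid (smash \<zeta>)\<^esub> F \<in> ?K" using Psi_diff[of "\<lambda>w. 0" F]
        unfolding a_inv_def[symmetric] by (simp add: smash_a_inv smash_simps(1) Psi_0)
    qed (auto simp: Psi_add smash_simps(5) smash_simps(1))
  qed (auto simp: smash_simps(2) Psi_cv cv_carrier)
  moreover have "cherednik_relations d \<zeta> a \<subseteq> ?K"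
  proof -
    have s: "SS (\<lambda>z. a) = cs a (SS (\<lambda>z. 1))" "SS (\<lambda>z. a / z) = cs a (SS (\<lambda>z. 1 / z))"
      "SS (\<lambda>z. a * z) = cs a (SS (\<lambda>z. z))"
      by (simp_all add: SS_def cs_sum)
    have "Psi F = 0" if "F \<in> cherednik_relations d \<zeta> a" for F
      using that unfolding relations_eq
      by (elim insertE emptyE; simp only: Psi_diff Psi_cv h Psi_RS gm_simps s;
          simp add: xo_yo Xo_Yo Xo_xo Xo_yo Yo_xo Yo_yo Cx_def Cy_def Dx_def algebra_simps)
    then show ?thesis using relations_carrier by auto
  qed
  ultimately have "II \<subseteq> ?K" unfolding cherednik_ideal_def by (rule smash.genideal_minimal)
  then show "F \<in> II \<Longrightarrow> Psi F = 0" by auto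
qed


text \<open>The module that exhibits the PBW basis: \<open>(i, j, k, l, False, v)\<close> stands for \<open>x\<^sup>i y\<^sup>j X\<^sup>k Y\<^sup>l\<close> times the
  rotation with upper left entry \<open>v\<close>, and \<open>True\<close> in place of \<open>False\<close> for the corresponding
  reflection.\<close>

type_synonym pbw = "nat \<times> nat \<times> bool \<times> complex"

definition SNp :: "complex \<Rightarrow> pbw op" where
  "SNp z = Op (\<lambda>(k, l, b, v). pscale [:z ^ k / z ^ l:] (basis (l, k, \<not> b, z / v)))"
definition XNp :: "pbw op" where "XNp = Op (\<lambda>(k, l, b, v). basis (Suc k, l, b, v))"
definition YNp :: "pbw op" where "YNp = Op (\<lambda>(k, l, b, v). basis (k, Suc l, b, v))"

lemma Np_single [simp]:
  "app (SNp z) (Poly_Mapping.single (k, l, b, v) c) = Poly_Mapping.single (l, k, \<not> b, z / v) ([:z ^ k / z ^ l:] * c)"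
  "app XNp (Poly_Mapping.single (k, l, b, v) c) = Poly_Mapping.single (Suc k, l, b, v) c"
  "app YNp (Poly_Mapping.single (k, l, b, v) c) = Poly_Mapping.single (k, Suc l, b, v) c"
  by (simp_all add: SNp_def XNp_def YNp_def app_single mult.commute)

sublocale cherednik \<subseteq> P: induced d \<zeta> a SNp XNp YNp
proof
  fix z w assume z: "z \<in> U" and w: "w \<in> U"
  show "SNp z * SNp w = SNp (z / w) * SNp 1"
    using U_nz[OF z] U_nz[OF w] by (auto intro!: op_ext simp: power_divide field_simps)
  show "SNp z * SNp 1 * SNp w = SNp (z * w)"
    using U_nz[OF z] U_nz[OF w] by (auto intro!: op_ext simp: power_mult_distrib field_simps)
next
  fix z assume z: "z \<in> U"
  show "SNp z * XNp = cs z (YNp * SNp z)" "SNp z * YNp = cs (1 / z) (XNp * SNp z)"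
    using U_nz[OF z] by (auto intro!: op_ext simp: algebra_simps)
qed (auto intro!: op_ext simp: pCons_one)

section \<open>Spanning by ordered monomials modulo the relations\<close>

context cherednik
begin

definition mon :: "nat \<Rightarrow> nat \<Rightarrow> nat \<Rightarrow> nat \<Rightarrow> tensor" where
  "mon i j k l = letter Gx ^ i * letter Gy ^ j * letter GX ^ k * letter GY ^ l"

text \<open>The combinations of ordered monomials modulo the ideal, without \<open>x\<close> and \<open>y\<close> unless \<open>m\<close> holds.\<close>

inductive_set Sp :: "bool \<Rightarrow> (complex mat \<Rightarrow> tensor) set" for m :: bool where
  base: "g \<in> D \<Longrightarrow> m \<or> i = 0 \<and> j = 0 \<Longrightarrow> del g (scalar c * mon i j k l) \<in> Sp m"
| zero: "(\<lambda>w. 0) \<in> Sp m"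
| add: "F \<in> Sp m \<Longrightarrow> G \<in> Sp m \<Longrightarrow> (\<lambda>w. F w + G w) \<in> Sp m"
| modI: "F \<in> Sp m \<Longrightarrow> G \<in> carrier (smash \<zeta>) \<Longrightarrow> (\<lambda>w. G w - F w) \<in> II \<Longrightarrow> G \<in> Sp m"

lemma Sp_carrier: "F \<in> Sp m \<Longrightarrow> F \<in> carrier (smash \<zeta>)"
  by (induction rule: Sp.induct) (auto simp: smash_simps(1) del_def)

lemma Sp_mono: "F \<in> Sp False \<Longrightarrow> F \<in> Sp True"
  by (induction rule: Sp.induct) (auto intro: Sp.intros)

lemma cv_0: "cv F (\<lambda>w. 0) = (\<lambda>w. 0)"
  by (simp add: cv_def act_simps fun_eq_iff)

lemma Sp_left:
  assumes F: "F \<in> Sp m" and u: "u \<in> carrier (smash \<zeta>)"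
    and b: "\<And>g c i j k l. g \<in> D \<Longrightarrow> m \<or> i = 0 \<and> j = 0 \<Longrightarrow> cv u (del g (scalar c * mon i j k l)) \<in> Sp m'"
  shows "cv u F \<in> Sp m'"
  using F
proof (induction rule: Sp.induct)
  case (modI F G)
  then show ?case using II_l[OF modI(3) u] by (intro Sp.modI[OF modI(4)] cv_carrier) (simp add: cv_diff_right)
qed (auto simp: b cv_0 cv_add_right intro: Sp.intros)

lemma Sp_swap:
  assumes "cv B e \<in> Sp m" "(\<lambda>w. A w - B w) \<in> II" "e \<in> carrier (smash \<zeta>)"
  shows "cv A e \<in> Sp m"
  by (rule Sp.modI[OF assms(1) cv_carrier]) (use II_r[OF assms(2,3)] in \<open>simp add: cv_diff_left\<close>)

lemma scalar_left_comm: "t * (scalar c * u) = scalar c * (t * u)"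
  by (metis mult.assoc scalar_comm)

lemma cv_1_del: "v \<in> D \<Longrightarrow> cv (del (Rm 1) s) (del v t) = del v (s * t)"
  by (simp add: cv_del_del D_one act_Rm_1)

lemma lx_base: assumes "g \<in> D"
  shows "cv (lx Gx) (del g (scalar c * mon i j k l)) = del g (scalar c * mon (Suc i) j k l)"
    "cv (lx Gy) (del g (scalar c * mon 0 j k l)) = del g (scalar c * mon 0 (Suc j) k l)"
    "cv (lx GX) (del g (scalar c * mon 0 0 k l)) = del g (scalar c * mon 0 0 (Suc k) l)"
    "cv (lx GY) (del g (scalar c * mon 0 0 0 l)) = del g (scalar c * mon 0 0 0 (Suc l))"
  using assms by (simp_all add: cv_1_del scalar_left_comm mon_def mult.assoc)

lemma Sp_scalar: "F \<in> Sp m \<Longrightarrow> cv (del (Rm 1) (scalar c)) F \<in> Sp m"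
  by (rule Sp_left) (auto simp: cv_1_del scalar_left_comm simp flip: mult.assoc scalar_simps(2) intro: Sp.base)

lemma Sp_x: "F \<in> Sp True \<Longrightarrow> cv (lx Gx) F \<in> Sp True"
  by (rule Sp_left) (auto simp: lx_base intro: Sp.base)

lemma Sp_y: "F \<in> Sp True \<Longrightarrow> cv (lx Gy) F \<in> Sp True"
proof (rule Sp_left)
  fix g c i j k l assume g: "g \<in> D"
  show "cv (lx Gy) (del g (scalar c * mon i j k l)) \<in> Sp True"
  proof (induction i)
    case (Suc i)
    let ?e = "del g (scalar c * mon i j k l)"
    have r: "(\<lambda>w. cv (lx Gy) (lx Gx) w - cv (lx Gx) (lx Gy) w) \<in> II"
      using II_uminus[OF relations_II[of "\<lambda>w. cv (lx Gx) (lx Gy) w - cv (lx Gy) (lx Gx) w"]] by (simp add: relations_eq)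
    have "cv (cv (lx Gx) (lx Gy)) ?e \<in> Sp True" using Sp_x[OF Suc] by (simp add: cv_assoc)
    then have "cv (cv (lx Gy) (lx Gx)) ?e \<in> Sp True" by (rule Sp_swap[OF _ r]) (simp add: g)
    then show ?case by (simp add: cv_assoc lx_base g)
  qed (auto simp: lx_base g intro: Sp.base)
qed auto

lemma Sp_X0: "F \<in> Sp False \<Longrightarrow> cv (lx GX) F \<in> Sp False"
  by (rule Sp_left) (auto simp: lx_base intro: Sp.base)

lemma Sp_Y0: "F \<in> Sp False \<Longrightarrow> cv (lx GY) F \<in> Sp False"
proof (rule Sp_left)
  fix g c and i j k l :: nat assume g: "g \<in> D" and ij: "False \<or> i = 0 \<and> j = 0"
  have "cv (lx GY) (del g (scalar c * mon 0 0 k l)) \<in> Sp False"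
  proof (induction k)
    case (Suc k)
    let ?e = "del g (scalar c * mon 0 0 k l)"
    have r: "(\<lambda>w. cv (lx GY) (lx GX) w - cv (lx GX) (lx GY) w) \<in> II"
      using II_uminus[OF relations_II[of "\<lambda>w. cv (lx GX) (lx GY) w - cv (lx GY) (lx GX) w"]] by (simp add: relations_eq)
    have "cv (cv (lx GX) (lx GY)) ?e \<in> Sp False" using Sp_X0[OF Suc] by (simp add: cv_assoc)
    then have "cv (cv (lx GY) (lx GX)) ?e \<in> Sp False" by (rule Sp_swap[OF _ r]) (simp add: g)
    then show ?case by (simp add: cv_assoc lx_base g)
  qed (auto simp: lx_base g intro: Sp.base)
  then show "cv (lx GY) (del g (scalar c * mon i j k l)) \<in> Sp False" using ij by simp
qed auto

abbreviation sm where "sm z \<equiv> del (Sm z) 1"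

lemma sm_lx: assumes z: "z \<in> U"
  shows "cv (sm z) (lx Gx) = cv (cv (del (Rm 1) (scal (1 / z))) (lx Gy)) (sm z)"
    "cv (sm z) (lx Gy) = cv (cv (del (Rm 1) (scal z)) (lx Gx)) (sm z)"
    "cv (sm z) (lx GX) = cv (cv (del (Rm 1) (scal z)) (lx GY)) (sm z)"
    "cv (sm z) (lx GY) = cv (cv (del (Rm 1) (scal (1 / z))) (lx GX)) (sm z)"
  using z U_nz[OF z] by (simp_all add: cv_del_del SR_mult act_letter_S act_Rm_1 act_simps(7))

lemma Sp_s0: assumes z: "z \<in> U" shows "F \<in> Sp False \<Longrightarrow> cv (sm z) F \<in> Sp False"
proof (rule Sp_left)
  fix g c and i j k l :: nat assume g: "g \<in> D" and ij: "False \<or> i = 0 \<and> j = 0"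
  have sc: "cv (del (Rm 1) (scal c')) F \<in> Sp False" if "F \<in> Sp False" for c' F
    using Sp_scalar[OF that] by (simp add: scal_def)
  have 0: "cv (sm z) (del g (scalar c * mon 0 0 0 l)) \<in> Sp False" for l
  proof (induction l)
    case 0
    have "cv (sm z) (del g (scalar c * mon 0 0 0 0)) = del (Sm z * g) (scalar c * mon 0 0 0 0)"
      by (simp add: cv_del_del z g mon_def act_simps)
    then show ?case using D_mult[OF SR_D(1)[OF z] g] by (auto intro: Sp.base)
  next
    case (Suc l)
    have "cv (cv (sm z) (lx GY)) (del g (scalar c * mon 0 0 0 l)) \<in> Sp False"
      unfolding sm_lx[OF z] cv_assoc by (intro sc Sp_X0 Suc)
    then show ?case by (simp add: cv_assoc lx_base g)
  qed
  have "cv (sm z) (del g (scalar c * mon 0 0 k l)) \<in> Sp False"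
  proof (induction k)
    case (Suc k)
    have "cv (cv (sm z) (lx GX)) (del g (scalar c * mon 0 0 k l)) \<in> Sp False"
      unfolding sm_lx[OF z] cv_assoc by (intro sc Sp_Y0 Suc)
    then show ?case by (simp add: cv_assoc lx_base g)
  qed (rule 0)
  then show "cv (sm z) (del g (scalar c * mon i j k l)) \<in> Sp False" using ij by simp
qed (use z in auto)

lemma Sp_base0: "g \<in> D \<Longrightarrow> del g (scalar c * mon 0 0 k l) \<in> Sp False"
  by (auto intro: Sp.base)

lemma Sp_s: assumes z: "z \<in> U" shows "F \<in> Sp True \<Longrightarrow> cv (sm z) F \<in> Sp True"
proof (rule Sp_left)
  fix g c and i j k l :: nat assume g: "g \<in> D"
  have sc: "cv (del (Rm 1) (scal c')) F \<in> Sp True" if "F \<in> Sp True" for c' F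
    using Sp_scalar[OF that] by (simp add: scal_def)
  have 0: "cv (sm z) (del g (scalar c * mon 0 j k l)) \<in> Sp True" for j
  proof (induction j)
    case 0
    show ?case by (rule Sp_mono[OF Sp_s0[OF z Sp_base0[OF g]]])
  next
    case (Suc j)
    have "cv (cv (sm z) (lx Gy)) (del g (scalar c * mon 0 j k l)) \<in> Sp True"
      unfolding sm_lx[OF z] cv_assoc by (intro sc Sp_x Suc)
    then show ?case by (simp add: cv_assoc lx_base g)
  qed
  show "cv (sm z) (del g (scalar c * mon i j k l)) \<in> Sp True"
  proof (induction i)
    case (Suc i)
    have "cv (cv (sm z) (lx Gx)) (del g (scalar c * mon i j k l)) \<in> Sp True"
      unfolding sm_lx[OF z] cv_assoc by (intro sc Sp_y Suc)
    then show ?case by (simp add: cv_assoc lx_base g)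
  qed (rule 0)
qed (use z in auto)

lemma Sp_sum: "(\<And>i. i \<in> I \<Longrightarrow> F i \<in> Sp m) \<Longrightarrow> (\<lambda>w. \<Sum>i\<in>I. F i w) \<in> Sp m"
  by (induction I rule: infinite_finite_induct) (auto intro: Sp.intros)

lemma cv_sum_left: "cv (\<lambda>w. \<Sum>i\<in>I. F i w) G = (\<lambda>w. \<Sum>i\<in>I. cv (F i) G w)"
proof -
  have "cv (\<lambda>w. 0) G = (\<lambda>w. 0)" by (simp add: cv_def fun_eq_iff)
  then show ?thesis by (induction I rule: infinite_finite_induct) (simp_all add: cv_add_left)
qed

lemma Sp_uminus: "F \<in> Sp m \<Longrightarrow> (\<lambda>w. - F w) \<in> Sp m"
proof -
  assume F: "F \<in> Sp m"
  have "scalar (-1) = -1" unfolding scalar_def by (simp add: single_uminus)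
  then show ?thesis using Sp_scalar[OF F, of "-1"] by (simp add: cv_tens Sp_carrier[OF F])
qed

lemma Sp_diff: "F \<in> Sp m \<Longrightarrow> G \<in> Sp m \<Longrightarrow> (\<lambda>w. F w - G w) \<in> Sp m"
  using Sp.add[of F m "\<lambda>w. - G w"] Sp_uminus[of G m] by simp

lemma Sp_RS: "F \<in> Sp True \<Longrightarrow> cv (RS f) F \<in> Sp True"
proof -
  assume F: "F \<in> Sp True"
  have "del (Sm z) (scal c) = cv (del (Rm 1) (scal c)) (sm z)" if "z \<in> U" for z c
    using that U_nz[OF that] by (simp add: cv_1_del)
  then have "cv (del (Sm z) (scal (f z))) F \<in> Sp True" if "z \<in> U" for z
    using that F by (simp add: cv_assoc Sp_s Sp_scalar scal_def)
  then show ?thesis unfolding RS_def cv_sum_left by (intro Sp_sum) auto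
qed

text \<open>Moving X or Y to the right of one letter x or y costs a commutator in hbar and
  reflections, under which the ordered combinations are already known to be stable. Once no x and y
  are left, the letter is sorted among X and Y inside \<open>Sp False\<close>.\<close>

lemma Sp_XY:
  assumes L: "L = lx GX \<or> L = lx GY" and F: "F \<in> Sp True"
  shows "cv L F \<in> Sp True"
  using F
proof (rule Sp_left)
  show "L \<in> carrier (smash \<zeta>)" using L by auto
  fix g c and i j k l :: nat assume g: "g \<in> D"
  have ex: "\<exists>C. (\<lambda>w. cv L l' w - (cv l' L w - C w)) \<in> II \<and> (\<forall>F \<in> Sp True. cv C F \<in> Sp True)"
    if l': "l' = lx Gx \<or> l' = lx Gy" for l'
  proof -
    have hRS: "\<forall>F\<in>Sp True. cv (\<lambda>w. hh1 w - RS f w) F \<in> Sp True" "\<forall>F\<in>Sp True. cv (RS f) F \<in> Sp True" for f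
      by (auto simp: cv_diff_left intro!: Sp_diff Sp_scalar Sp_RS)
    have u: "(\<lambda>w. (cv A B w - cv B A w) - C w) \<in> cherednik_relations d \<zeta> a \<Longrightarrow>
        (\<lambda>w. cv B A w - (cv A B w - C w)) \<in> II" for A B C
      using II_uminus[OF relations_II[of "\<lambda>w. (cv A B w - cv B A w) - C w"]] by (simp add: algebra_simps)
    show ?thesis using L l'
    proof (elim disjE)
      assume "L = lx GX" "l' = lx Gx"
      then show ?thesis using u[of "lx Gx" "lx GX" "\<lambda>w. hh1 w - RS (\<lambda>z. a) w"] hRS by (auto simp: relations_eq)
    next
      assume "L = lx GX" "l' = lx Gy"
      then show ?thesis using u[of "lx Gy" "lx GX" "RS (\<lambda>z. a * z)"] hRS by (auto simp: relations_eq)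
    next
      assume "L = lx GY" "l' = lx Gx"
      then show ?thesis using u[of "lx Gx" "lx GY" "RS (\<lambda>z. a / z)"] hRS by (auto simp: relations_eq)
    next
      assume "L = lx GY" "l' = lx Gy"
      then show ?thesis using u[of "lx Gy" "lx GY" "\<lambda>w. hh1 w - RS (\<lambda>z. a) w"] hRS by (auto simp: relations_eq)
    qed
  qed
  have step: "cv L (cv l' e) \<in> Sp True"
    if l': "l' = lx Gx \<or> l' = lx Gy" and e: "e \<in> Sp True" and IH: "cv L e \<in> Sp True" for l' e
  proof -
    obtain C where C: "(\<lambda>w. cv L l' w - (cv l' L w - C w)) \<in> II" "\<forall>F \<in> Sp True. cv C F \<in> Sp True"
      using ex[OF l'] by blast
    have "cv l' (cv L e) \<in> Sp True" using l' IH by (auto intro: Sp_x Sp_y)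
    then have "cv (\<lambda>w. cv l' L w - C w) e \<in> Sp True"
      using C(2) e by (auto simp: cv_diff_left cv_assoc intro: Sp_diff)
    then have "cv (cv L l') e \<in> Sp True" by (rule Sp_swap[OF _ C(1) Sp_carrier[OF e]])
    then show ?thesis by (simp add: cv_assoc)
  qed
  have 0: "cv L (del g (scalar c * mon 0 j k l)) \<in> Sp True" for j
  proof (induction j)
    case 0
    show ?case using L Sp_mono[OF Sp_X0[OF Sp_base0[OF g]]] Sp_mono[OF Sp_Y0[OF Sp_base0[OF g]]] by auto
  next
    case (Suc j)
    then show ?case using step[of "lx Gy" "del g (scalar c * mon 0 j k l)"] by (auto simp: lx_base g Sp.base)
  qed
  show "cv L (del g (scalar c * mon i j k l)) \<in> Sp True"
  proof (induction i)
    case (Suc i)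
    then show ?case using step[of "lx Gx" "del g (scalar c * mon i j k l)"] by (auto simp: lx_base g Sp.base)
  qed (rule 0)
qed

lemma Sp_tensor: "F \<in> Sp True \<Longrightarrow> cv (del (Rm 1) t) F \<in> Sp True"
proof (induction t arbitrary: F rule: tensor_induct)
  case (add t u)
  have "cv (del (Rm 1) (t + u)) F = (\<lambda>w. cv (del (Rm 1) t) F w + cv (del (Rm 1) u) F w)"
    using add.prems by (simp add: cv_tens Sp_carrier distrib_right)
  then show ?case using Sp.add[OF add.IH] add.prems by simp
next
  case (letter g)
  then show ?case by (cases g) (auto intro: Sp_x Sp_y Sp_XY)
next
  case (mult t u)
  have "cv (del (Rm 1) (t * u)) F = cv (del (Rm 1) t) (cv (del (Rm 1) u) F)"
    by (simp add: cv_1_del flip: cv_assoc)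
  then show ?case using mult by simp
qed (rule Sp_scalar)

lemma smash_expand: "F \<in> carrier (smash \<zeta>) \<Longrightarrow> F = (\<lambda>w. \<Sum>g\<in>D. del g (F g) w)"
  by (auto simp: del_def smash_simps(1) fun_eq_iff)

text \<open>The spanning half of PBW: ordered combinations contain the group elements and are stable
  under left multiplication by all tensors.\<close>

lemma Sp_all: assumes F: "F \<in> carrier (smash \<zeta>)" shows "F \<in> Sp True"
proof -
  have "del g t \<in> Sp True" if "g \<in> D" for g t
  proof -
    have "cv (del (Rm 1) t) (del g (scalar 1 * mon 0 0 0 0)) \<in> Sp True"
      using that by (intro Sp_tensor Sp.base) auto
    then show ?thesis using that by (simp add: cv_1_del mon_def scalar_simps)
  qed
  then have "(\<lambda>w. \<Sum>g\<in>D. del g (F g) w) \<in> Sp True" by (intro Sp_sum) auto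
  then show ?thesis using smash_expand[OF F] by simp
qed

end

section \<open>The PBW theorem and the faithful realization of H by operators\<close>

section \<open>The PBW theorem\<close>

context cherednik
begin

abbreviation "x \<equiv> P.xo"
abbreviation "y \<equiv> P.yo"
abbreviation "X \<equiv> P.Xo"
abbreviation "Y \<equiv> P.Yo"
abbreviation "S \<equiv> P.So"

definition e0 :: "(nat \<times> nat \<times> pbw) \<Rightarrow>\<^sub>0 complex poly" where "e0 = basis (0, 0, 0, 0, False, 1)"

definition gmat :: "bool \<Rightarrow> complex \<Rightarrow> complex mat" where "gmat b v = (if b then Sm v else Rm v)"

definition ob :: "nat \<times> nat \<times> pbw \<Rightarrow> (nat \<times> nat \<times> pbw) op" where
  "ob = (\<lambda>(i, j, k, l, b, v). x ^ i * y ^ j * X ^ k * Y ^ l * P.rep (gmat b v))"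

definition US :: "(nat \<times> nat \<times> pbw) set" where "US = {(i, j, k, l, b, v). v \<in> U}"

lemma gmat_D [simp]: "v \<in> U \<Longrightarrow> gmat b v \<in> D"
  by (simp add: gmat_def)

lemma XY_basis0: "app X (basis (0, 0, k, l, b, v)) = basis (0, 0, Suc k, l, b, v)"
  "app Y (basis (0, 0, k, l, b, v)) = basis (0, 0, k, Suc l, b, v)"
  using P.Xo_emb[of "basis (k, l, b, v)"] P.Yo_emb[of "basis (k, l, b, v)"] by simp_all

lemma rep_e0: "v \<in> U \<Longrightarrow> app (P.rep (gmat b v)) e0 = basis (0, 0, 0, 0, b, v)"
  using U_nz[of v] by (simp add: gmat_def P.rep_S P.rep_R e0_def P.So_basis pCons_one)

lemma app_power_basis:
  "app (x ^ n) (basis (i, j, m)) = basis (n + i, j, m)"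
  "app (y ^ n) (basis (i, j, m)) = basis (i, n + j, m)"
  "app (X ^ n) (basis (0, 0, k, l, g)) = basis (0, 0, n + k, l, g)"
  "app (Y ^ n) (basis (0, 0, k, l, g)) = basis (0, 0, k, n + l, g)"
  by (induction n; cases g; simp add: XY_basis0)+

text \<open>The independence half of PBW: on the cyclic vector the ordered monomials take distinct
  basis vectors as values.\<close>

lemma ob_e0: "b \<in> US \<Longrightarrow> app (ob b) e0 = basis b"
  by (auto simp: US_def ob_def rep_e0 app_power_basis)

definition tmon :: "nat \<times> nat \<times> pbw \<Rightarrow> complex poly \<Rightarrow> complex mat \<Rightarrow> tensor" where
  "tmon = (\<lambda>(i, j, k, l, b, v) c. del (gmat b v) (scalar c * mon i j k l))"

definition ordp :: "((nat \<times> nat \<times> pbw) \<Rightarrow>\<^sub>0 complex poly) \<Rightarrow> complex mat \<Rightarrow> tensor" where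
  "ordp p = (\<lambda>w. \<Sum>b\<in>Poly_Mapping.keys p. tmon b (lk p b) w)"

lemma tmon_0: "tmon b 0 = (\<lambda>w. 0)" and tmon_add: "tmon b (c + c') w = tmon b c w + tmon b c' w"
  by (cases b; simp add: tmon_def del_def scalar_simps fun_eq_iff algebra_simps)+

lemma ordp_superset:
  assumes "finite A" "Poly_Mapping.keys p \<subseteq> A"
  shows "ordp p w = (\<Sum>b\<in>A. tmon b (lk p b) w)"
  unfolding ordp_def by (rule sum.mono_neutral_left) (use assms in \<open>auto simp: in_keys_iff tmon_0\<close>)

lemma ordp_add: "ordp (p + q) = (\<lambda>w. ordp p w + ordp q w)"
proof
  fix w
  let ?A = "Poly_Mapping.keys p \<union> Poly_Mapping.keys q"
  have "ordp (p + q) w = (\<Sum>b\<in>?A. tmon b (lk (p + q) b) w)"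
    by (rule ordp_superset) (auto simp: Poly_Mapping.keys_add)
  then show "ordp (p + q) w = ordp p w + ordp q w"
    by (simp add: ordp_superset[of ?A] lookup_add tmon_add sum.distrib)
qed

lemma ordp_single: "ordp (Poly_Mapping.single b c) = tmon b c"
  by (cases "c = 0") (auto simp: ordp_def tmon_0 fun_eq_iff)

lemma ordp_0: "ordp 0 = (\<lambda>w. 0)"
  by (simp add: ordp_def)

lemma tmon_carrier: "b \<in> US \<Longrightarrow> tmon b c \<in> carrier (smash \<zeta>)"
  by (auto simp: US_def tmon_def)

lemma ordp_carrier: "Poly_Mapping.keys p \<subseteq> US \<Longrightarrow> ordp p \<in> carrier (smash \<zeta>)"
  using tmon_carrier unfolding ordp_def by (auto simp: smash_simps(1) intro!: sum.neutral)

lemma Sp_ordp: "F \<in> Sp True \<Longrightarrow> \<exists>p. Poly_Mapping.keys p \<subseteq> US \<and> (\<lambda>w. F w - ordp p w) \<in> II"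
proof (induction rule: Sp.induct)
  case (base g i j c k l)
  obtain b v where g: "v \<in> U" "g = gmat b v"
    using base(1) by (cases rule: D_cases) (metis gmat_def)+
  have "(\<lambda>w. del g (scalar c * mon i j k l) w - ordp (Poly_Mapping.single (i, j, k, l, b, v) c) w) = (\<lambda>w. 0)"
    by (simp add: ordp_single tmon_def g)
  moreover have "Poly_Mapping.keys (Poly_Mapping.single (i, j, k, l, b, v) c) \<subseteq> US"
    using g by (auto simp: US_def split: if_splits)
  ultimately show ?case using II_0
    by (intro exI[of _ "Poly_Mapping.single (i, j, k, l, b, v) c"] conjI) simp_all
next
  case zero
  then show ?case using II_0 by (intro exI[of _ 0]) (simp add: ordp_0)
next
  case (add F G)
  then obtain p q where p: "Poly_Mapping.keys p \<subseteq> US" "(\<lambda>w. F w - ordp p w) \<in> II"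
    and q: "Poly_Mapping.keys q \<subseteq> US" "(\<lambda>w. G w - ordp q w) \<in> II" by blast
  have "(\<lambda>w. F w + G w - ordp (p + q) w) = (\<lambda>w. (F w - ordp p w) + (G w - ordp q w))"
    by (simp add: ordp_add algebra_simps)
  then have "(\<lambda>w. F w + G w - ordp (p + q) w) \<in> II" using II_add[OF p(2) q(2)] by simp
  moreover have "Poly_Mapping.keys (p + q) \<subseteq> US" using p q Poly_Mapping.keys_add[of p q] by blast
  ultimately show ?case by blast
next
  case (modI F G)
  then obtain p where p: "Poly_Mapping.keys p \<subseteq> US" "(\<lambda>w. F w - ordp p w) \<in> II" by blast
  have "(\<lambda>w. G w - ordp p w) \<in> II" using II_add[OF modI(3) p(2)] by simp
  then show ?case using p by blast
qed

lemma T_power: "P.T (t ^ n) = P.T t ^ n"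
  by (induction n) (simp_all add: P.tev.ev_1 P.tev.ev_mult)

lemma Psi_tmon: "b \<in> US \<Longrightarrow> P.Psi (tmon b c) = osc c (ob b)"
  by (auto simp: US_def tmon_def ob_def P.Psi_del P.T_scalar_mult mon_def P.tev.ev_mult P.tev.ev_scalar T_power P.tev.ev_letter osc_simps)

lemma Psi_ordp: "Poly_Mapping.keys p \<subseteq> US \<Longrightarrow> P.Psi (ordp p) = (\<Sum>b\<in>Poly_Mapping.keys p. osc (lk p b) (ob b))"
  unfolding ordp_def P.Psi_sum by (intro sum.cong refl Psi_tmon) auto

lemma Psi_ordp_e0: assumes "Poly_Mapping.keys p \<subseteq> US" shows "app (P.Psi (ordp p)) e0 = p"
proof -
  have "app (P.Psi (ordp p)) e0 = (\<Sum>b\<in>Poly_Mapping.keys p. pscale (lk p b) (basis b))"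
    unfolding Psi_ordp[OF assms] app_op_sum by (intro sum.cong refl) (simp add: ob_e0 subsetD[OF assms])
  then show ?thesis by (simp only: poly_mapping_sum_basis[symmetric])
qed

lemma Psi_cong: "(\<lambda>w. F w - G w) \<in> II \<Longrightarrow> P.Psi F = P.Psi G"
  using P.Psi_II[of "\<lambda>w. F w - G w"] by (simp add: P.Psi_diff)

text \<open>By spanning, F is congruent to an ordered combination; applying it to the cyclic vector
  recovers the coefficients. Thus the normal form can be read off from the operator, and
  \<open>Psi\<close> is faithful modulo the ideal.\<close>

lemma normal_form:
  assumes F: "F \<in> carrier (smash \<zeta>)"
  shows "Poly_Mapping.keys (app (P.Psi F) e0) \<subseteq> US" "(\<lambda>w. F w - ordp (app (P.Psi F) e0) w) \<in> II"
proof -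
  obtain p where p: "Poly_Mapping.keys p \<subseteq> US" "(\<lambda>w. F w - ordp p w) \<in> II"
    using Sp_ordp[OF Sp_all[OF F]] by blast
  then have "app (P.Psi F) e0 = p" using Psi_cong[OF p(2)] Psi_ordp_e0 by simp
  then show "Poly_Mapping.keys (app (P.Psi F) e0) \<subseteq> US" "(\<lambda>w. F w - ordp (app (P.Psi F) e0) w) \<in> II"
    using p by auto
qed

lemma Psi_eq_0: "F \<in> carrier (smash \<zeta>) \<Longrightarrow> P.Psi F = 0 \<Longrightarrow> F \<in> II"
  using normal_form(2)[of F] by (simp add: ordp_0)

text \<open>The Cherednik algebra over \<open>\<complex>[\<hbar>]\<close> as an algebra of operators.\<close>

definition HH :: "(nat \<times> nat \<times> pbw) op set" where "HH = P.Psi ` carrier (smash \<zeta>)"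

lemma HH_keys: "A \<in> HH \<Longrightarrow> Poly_Mapping.keys (app A e0) \<subseteq> US"
  using normal_form by (auto simp: HH_def)

lemma HH_expand: "A \<in> HH \<Longrightarrow> A = (\<Sum>b\<in>Poly_Mapping.keys (app A e0). osc (lk (app A e0) b) (ob b))"
proof -
  assume "A \<in> HH"
  then obtain F where F: "F \<in> carrier (smash \<zeta>)" "A = P.Psi F" by (auto simp: HH_def)
  show ?thesis unfolding F(2)
    by (rule trans[OF Psi_cong[OF normal_form(2)[OF F(1)]] Psi_ordp[OF normal_form(1)[OF F(1)]]])
qed

lemma HH_Psi: "F \<in> carrier (smash \<zeta>) \<Longrightarrow> P.Psi F \<in> HH"
  by (simp add: HH_def)

lemma HH_add: "A \<in> HH \<Longrightarrow> B \<in> HH \<Longrightarrow> A + B \<in> HH"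
proof -
  assume "A \<in> HH" "B \<in> HH"
  then obtain F G where "F \<in> carrier (smash \<zeta>)" "A = P.Psi F" "G \<in> carrier (smash \<zeta>)" "B = P.Psi G"
    by (auto simp: HH_def)
  then show ?thesis using HH_Psi[OF smash.a_closed, of F G] by (simp add: smash_simps(5) P.Psi_add)
qed

lemma HH_mult: "A \<in> HH \<Longrightarrow> B \<in> HH \<Longrightarrow> A * B \<in> HH"
  using HH_Psi[OF cv_carrier] by (auto simp: HH_def P.Psi_cv[symmetric])

lemma HH_tens: "P.T t \<in> HH"
  using HH_Psi[of "del (Rm 1) t"] by (simp add: P.Psi_del P.rep_one)

lemma HH_osc1: "osc c 1 \<in> HH"
  using HH_tens[of "scalar c"] by (simp add: P.tev.ev_scalar)

lemma HH_osc: "A \<in> HH \<Longrightarrow> osc c A \<in> HH"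
  using HH_mult[OF HH_osc1[of c], of A] by (simp add: osc_simps)

lemma HH_cs: "A \<in> HH \<Longrightarrow> cs c A \<in> HH" and HH_hb: "A \<in> HH \<Longrightarrow> hb A \<in> HH"
  by (simp_all add: cs_def hb_def HH_osc)

lemma HH_1: "1 \<in> HH" and HH_0: "0 \<in> HH"
  using HH_osc1[of 1] HH_osc1[of 0] by (simp_all add: osc_simps)

lemma HH_uminus: "A \<in> HH \<Longrightarrow> - A \<in> HH"
  using HH_cs[of A "-1"] by simp

lemma HH_diff: "A \<in> HH \<Longrightarrow> B \<in> HH \<Longrightarrow> A - B \<in> HH"
  using HH_add[of A "- B"] HH_uminus[of B] by simp

lemma HH_sum: "(\<And>i. i \<in> I \<Longrightarrow> f i \<in> HH) \<Longrightarrow> sum f I \<in> HH"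
  by (induction I rule: infinite_finite_induct) (auto simp: HH_0 HH_add)

lemma HH_letters: "x \<in> HH" "y \<in> HH" "X \<in> HH" "Y \<in> HH"
  using HH_tens[of "letter Gx"] HH_tens[of "letter Gy"] HH_tens[of "letter GX"] HH_tens[of "letter GY"]
  by (simp_all add: P.tev.ev_letter)

lemma HH_S: "z \<in> U \<Longrightarrow> S z \<in> HH"
  using HH_Psi[of "del (Sm z) 1"] by (simp add: P.Psi_del P.tev.ev_1 P.rep_S)

lemma HH_power: "A \<in> HH \<Longrightarrow> A ^ n \<in> HH"
  by (induction n) (auto simp: HH_1 HH_mult)

lemma HH_rep: "g \<in> D \<Longrightarrow> P.rep g \<in> HH"
  using HH_Psi[of "del g 1"] by (simp add: P.Psi_del P.tev.ev_1)

lemma HH_ob: "b \<in> US \<Longrightarrow> ob b \<in> HH"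
  by (auto simp: ob_def US_def intro!: HH_mult HH_power HH_letters HH_rep)

lemma HH_induct [consumes 1, case_names add osc x y X Y S mult]:
  assumes A: "A \<in> HH"
    and add: "\<And>A B. A \<in> HH \<Longrightarrow> B \<in> HH \<Longrightarrow> Q A \<Longrightarrow> Q B \<Longrightarrow> Q (A + B)" and osc: "\<And>c. Q (osc c 1)"
    and gens: "Q x" "Q y" "Q X" "Q Y" and S: "\<And>z. z \<in> U \<Longrightarrow> Q (S z)"
    and mult: "\<And>A B. A \<in> HH \<Longrightarrow> B \<in> HH \<Longrightarrow> Q A \<Longrightarrow> Q B \<Longrightarrow> Q (A * B)"
  shows "Q A"
proof -
  have Q0: "Q 0" using osc[of 0] by (simp add: osc_simps)
  have T: "Q (P.T t)" for t
  proof (induction t rule: tensor_induct)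
    case (letter g)
    then show ?case using gens by (cases g) (simp_all add: P.tev.ev_letter)
  qed (auto simp: P.tev.ev_add P.tev.ev_mult P.tev.ev_scalar HH_tens intro: add mult osc)
  have R: "Q (P.rep g)" if "g \<in> D" for g
    using that by (cases rule: D_cases) (auto simp: P.rep_S P.rep_R intro!: mult S HH_S)
  obtain F where F: "F \<in> carrier (smash \<zeta>)" "A = P.Psi F" using A by (auto simp: HH_def)
  have w: "Q (P.T (F w) * P.rep w)" "P.T (F w) * P.rep w \<in> HH" if "w \<in> D" for w
    using that by (auto intro: mult HH_tens HH_rep T R HH_mult)
  have s: "sum f I \<in> HH \<and> Q (sum f I)" if "\<And>i. i \<in> I \<Longrightarrow> f i \<in> HH \<and> Q (f i)" for f and I :: "complex mat set"
    using that by (induction I rule: infinite_finite_induct) (auto simp: HH_0 HH_add Q0 intro: add)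
  show ?thesis unfolding F(2) P.Psi_def by (rule s[THEN conjunct2]) (simp add: w)
qed

text \<open>Divisibility by hbar inside \<open>HH\<close> is visible on the cyclic vector: PBW
  coefficients without constant term are divided by hbar one by one.\<close>

lemma hb_dvd:
  assumes A: "A \<in> HH" and 0: "\<And>b. coeff (lk (app A e0) b) 0 = 0"
  obtains B where "B \<in> HH" "A = hb B"
proof
  let ?p = "app A e0"
  let ?B = "\<Sum>b\<in>Poly_Mapping.keys ?p. osc (poly_shift 1 (lk ?p b)) (ob b)"
  have "[:0, 1:] * poly_shift 1 c = c" if "coeff c 0 = 0" for c :: "complex poly"
  proof (rule poly_eqI)
    fix n show "coeff ([:0, 1:] * poly_shift 1 c) n = coeff c n"
      using that by (cases n) (simp_all add: coeff_pCons coeff_poly_shift)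
  qed
  then have eq: "hb ?B = (\<Sum>b\<in>Poly_Mapping.keys ?p. osc (lk ?p b) (ob b))"
    unfolding hb_sum by (intro sum.cong refl) (simp add: hb_def osc_simps 0)
  show "A = hb ?B" by (rule trans[OF HH_expand[OF A] eq[symmetric]])
  show "?B \<in> HH" using HH_keys[OF A] by (intro HH_sum HH_osc HH_ob) auto
qed

end

section \<open>Identification of the quotient rings and of the Poisson bracket\<close>

section \<open>The algebras of the statement as quotients of the operator algebra\<close>

text \<open>A record-based ring presented as the image of a type-class ring of operators. It serves
  three times, for H over C[hbar], for H_c and for the centre, so that computations with cosets
  become computations with operators.\<close>

locale ring_image = ring R for R (structure) +
  fixes HS :: "'e::ring_1 set" and f :: "'e \<Rightarrow> 'a"
  assumes HS: "1 \<in> HS" "\<And>A B. A \<in> HS \<Longrightarrow> B \<in> HS \<Longrightarrow> A + B \<in> HS"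
      "\<And>A. A \<in> HS \<Longrightarrow> - A \<in> HS" "\<And>A B. A \<in> HS \<Longrightarrow> B \<in> HS \<Longrightarrow> A * B \<in> HS"
    and carrier_f: "carrier R = f ` HS"
    and f_add: "\<And>A B. A \<in> HS \<Longrightarrow> B \<in> HS \<Longrightarrow> f (A + B) = f A \<oplus> f B"
    and f_mult: "\<And>A B. A \<in> HS \<Longrightarrow> B \<in> HS \<Longrightarrow> f (A * B) = f A \<otimes> f B"
begin

lemma HS_0: "0 \<in> HS" using HS(2)[OF HS(1) HS(3)[OF HS(1)]] by simp
lemma f_closed: "A \<in> HS \<Longrightarrow> f A \<in> carrier R" by (simp add: carrier_f)

lemma f_0: "f 0 = \<zero>"
  using f_add[OF HS_0 HS_0] f_closed[OF HS_0] by (metis add.l_cancel_one' add_0)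

lemma f_uminus: "A \<in> HS \<Longrightarrow> f (- A) = \<ominus> f A"
  using f_add[OF HS(3), of A A] by (metis HS(3) f_0 f_closed minus_equality left_minus)

lemma f_diff: "A \<in> HS \<Longrightarrow> B \<in> HS \<Longrightarrow> f (A - B) = f A \<ominus> f B"
  using f_add[OF _ HS(3), of A B] by (simp add: f_uminus a_minus_def)

lemma ideal_image:
  assumes J: "J \<subseteq> HS" "0 \<in> J" "\<And>A B. A \<in> J \<Longrightarrow> B \<in> J \<Longrightarrow> A + B \<in> J"
    "\<And>A B. A \<in> J \<Longrightarrow> B \<in> HS \<Longrightarrow> B * A \<in> J" "\<And>A B. A \<in> J \<Longrightarrow> B \<in> HS \<Longrightarrow> A * B \<in> J"
  shows "ideal (f ` J) R"
proof (rule idealI[OF ring_axioms])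
  show "subgroup (f ` J) (add_monoid R)"
  proof (rule group.subgroupI[OF a_group])
    fix r assume "r \<in> f ` J"
    then obtain A where A: "A \<in> J" "r = f A" by auto
    have "- A \<in> J" using J(4)[OF A(1) HS(3)[OF HS(1)]] by simp
    moreover have "inv\<^bsub>add_monoid R\<^esub> r = f (- A)"
      unfolding a_inv_def[symmetric] using A J(1) f_uminus by auto
    ultimately show "inv\<^bsub>add_monoid R\<^esub> r \<in> f ` J" by auto
  next
    fix r s assume "r \<in> f ` J" "s \<in> f ` J"
    then obtain A B where "A \<in> J" "r = f A" "B \<in> J" "s = f B" by auto
    then have "r \<oplus> s = f (A + B)" "A + B \<in> J" using J f_add by (auto simp: subset_iff)
    then show "r \<otimes>\<^bsub>add_monoid R\<^esub> s \<in> f ` J" by auto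
  qed (use J f_closed in auto)
next
  fix r s assume "r \<in> f ` J" "s \<in> carrier R"
  then obtain A B where AB: "A \<in> J" "r = f A" "B \<in> HS" "s = f B" by (auto simp: carrier_f)
  have "s \<otimes> r = f (B * A)" "r \<otimes> s = f (A * B)" using AB J(1) f_mult by auto
  then show "s \<otimes> r \<in> f ` J" "r \<otimes> s \<in> f ` J" using AB J by auto
qed

end

context cherednik
begin

definition pre :: "(nat \<times> nat \<times> pbw) op \<Rightarrow> complex mat \<Rightarrow> tensor" where
  "pre A = (SOME F. F \<in> carrier (smash \<zeta>) \<and> P.Psi F = A)"

lemma pre: "A \<in> HH \<Longrightarrow> pre A \<in> carrier (smash \<zeta>)" "A \<in> HH \<Longrightarrow> P.Psi (pre A) = A"
proof -
  assume "A \<in> HH"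
  then have "\<exists>F. F \<in> carrier (smash \<zeta>) \<and> P.Psi F = A" by (auto simp: HH_def)
  then show "pre A \<in> carrier (smash \<zeta>)" "P.Psi (pre A) = A"
    unfolding pre_def by (metis (mono_tags, lifting) someI_ex)+
qed

abbreviation Hh where "Hh \<equiv> H_hbar d \<zeta> a"
abbreviation Hc where "Hc \<equiv> H_c d \<zeta> a"

text \<open>The inverse of the isomorphism from H onto \<open>HH\<close> induced by
  \<open>Psi\<close>; the preimage chosen by \<open>pre\<close> is determined modulo the
  ideal.\<close>

definition kh where "kh A = to_H_hbar d \<zeta> a (pre A)"

lemma II_minus_iff: "F \<in> carrier (smash \<zeta>) \<Longrightarrow> G \<in> carrier (smash \<zeta>) \<Longrightarrow>
    F \<ominus>\<^bsub>smash \<zeta>\<^esub> G \<in> II \<longleftrightarrow> P.Psi F = P.Psi G"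
  using Psi_cong[of F G] Psi_eq_0[of "\<lambda>w. F w - G w"]
  by (auto simp: smash_minus P.Psi_diff smash_simps(1))

lemma to_H_hbar_eq: "F \<in> carrier (smash \<zeta>) \<Longrightarrow> G \<in> carrier (smash \<zeta>) \<Longrightarrow>
    to_H_hbar d \<zeta> a F = to_H_hbar d \<zeta> a G \<longleftrightarrow> P.Psi F = P.Psi G"
  unfolding to_H_hbar_def using smash.quotient_eq_iff_same_a_r_cos[OF II_ideal] II_minus_iff by simp

lemma kh_Psi: "F \<in> carrier (smash \<zeta>) \<Longrightarrow> to_H_hbar d \<zeta> a F = kh (P.Psi F)"
  unfolding kh_def using to_H_hbar_eq[of F "pre (P.Psi F)"] pre[OF HH_Psi] by simp

lemma kh_inj: "A \<in> HH \<Longrightarrow> B \<in> HH \<Longrightarrow> kh A = kh B \<longleftrightarrow> A = B"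
  unfolding kh_def using to_H_hbar_eq[of "pre A" "pre B"] pre by simp

lemma to_H_hbar_hom: "to_H_hbar d \<zeta> a \<in> Ring.ring_hom (smash \<zeta>) Hh"
  using II.rcos_ring_hom by (simp add: H_hbar_def to_H_hbar_def[abs_def])

lemma ring_Hh: "ring Hh"
  unfolding H_hbar_def by (rule II.quotient_is_ring)

sublocale kh: ring_image Hh HH kh
proof (intro ring_image.intro ring_image_axioms.intro ring_Hh)
  have "carrier Hh = to_H_hbar d \<zeta> a ` carrier (smash \<zeta>)"
    by (auto simp: H_hbar_def FactRing_def A_RCOSETS_def' to_H_hbar_def)
  then show "carrier Hh = kh ` HH"
    by (auto simp: HH_def kh_Psi image_iff)
  fix A B assume AB: "A \<in> HH" "B \<in> HH"
  have "kh (A + B) = to_H_hbar d \<zeta> a (pre A \<oplus>\<^bsub>smash \<zeta>\<^esub> pre B)"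
    using kh_Psi[OF smash.a_closed[OF pre(1)[OF AB(1)] pre(1)[OF AB(2)]]]
    by (simp add: smash_simps(5) P.Psi_add pre AB)
  then show "kh (A + B) = kh A \<oplus>\<^bsub>Hh\<^esub> kh B"
    using Ring.ring_hom_add[OF to_H_hbar_hom, of "pre A" "pre B"] pre AB by (simp add: kh_def)
  have "kh (A * B) = to_H_hbar d \<zeta> a (pre A \<otimes>\<^bsub>smash \<zeta>\<^esub> pre B)"
    using kh_Psi[OF cv_carrier[of "pre A" "pre B"]]
    by (simp add: smash_simps(2) P.Psi_cv pre AB)
  then show "kh (A * B) = kh A \<otimes>\<^bsub>Hh\<^esub> kh B"
    using Ring.ring_hom_mult[OF to_H_hbar_hom, of "pre A" "pre B"] pre AB by (simp add: kh_def)
qed (auto simp: HH_1 HH_add HH_mult HH_uminus)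

lemma kh_hbar: "to_H_hbar d \<zeta> a hbar = kh (hb 1)"
  by (simp add: hbar_def tens_eq kh_Psi P.Psi_del P.tev.ev_scalar P.rep_one hb_def osc_simps)

lemma hbar_ideal_eq: "hbar_ideal d \<zeta> a = kh ` (hb ` HH)"
proof -
  have id: "ideal (kh ` (hb ` HH)) Hh"
  proof (rule kh.ideal_image)
    show "0 \<in> hb ` HH" using HH_0 by (intro image_eqI[of _ _ 0]) simp_all
    fix A B assume "A \<in> hb ` HH" "B \<in> hb ` HH"
    then show "A + B \<in> hb ` HH" by (auto simp: image_iff simp flip: hb_simps(2) intro: HH_add)
  next
    fix A B assume "A \<in> hb ` HH" "B \<in> HH"
    then show "B * A \<in> hb ` HH" "A * B \<in> hb ` HH" by (auto simp: image_iff intro: HH_mult)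
  qed (auto simp: HH_hb)
  show ?thesis unfolding hbar_ideal_def kh_hbar
  proof
    show "Idl\<^bsub>Hh\<^esub> {kh (hb 1)} \<subseteq> kh ` (hb ` HH)"
      by (rule kh.genideal_minimal[OF id]) (use HH_1 in auto)
    have c: "kh (hb 1) \<in> carrier Hh" by (simp add: kh.f_closed HH_hb HH_1)
    interpret I: ideal "Idl\<^bsub>Hh\<^esub> {kh (hb 1)}" Hh by (rule kh.genideal_ideal) (simp add: c)
    have "kh (hb A) \<in> Idl\<^bsub>Hh\<^esub> {kh (hb 1)}" if "A \<in> HH" for A
    proof -
      have "kh (hb A) = kh (hb 1) \<otimes>\<^bsub>Hh\<^esub> kh A" using kh.f_mult[of "hb 1" A] that by (simp add: HH_hb HH_1)
      then show ?thesis using I.I_r_closed kh.genideal_self'[OF c] kh.f_closed[OF that] by simp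
    qed
    then show "kh ` (hb ` HH) \<subseteq> Idl\<^bsub>Hh\<^esub> {kh (hb 1)}" by auto
  qed
qed

lemma hbar_ideal: "ideal (hbar_ideal d \<zeta> a) Hh"
  unfolding hbar_ideal_def kh_hbar by (rule kh.genideal_ideal) (simp add: kh.f_closed HH_hb HH_1)

definition kap where "kap A = mod_hbar d \<zeta> a (kh A)"

lemma mod_hbar_hom: "mod_hbar d \<zeta> a \<in> Ring.ring_hom Hh Hc"
  using ideal.rcos_ring_hom[OF hbar_ideal] by (simp add: H_c_def mod_hbar_def[abs_def])

lemma ring_Hc: "ring Hc"
  unfolding H_c_def by (rule ideal.quotient_is_ring[OF hbar_ideal])

sublocale kap: ring_image Hc HH kap
proof (intro ring_image.intro ring_image_axioms.intro ring_Hc)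
  have "carrier Hc = mod_hbar d \<zeta> a ` carrier Hh"
    by (auto simp: H_c_def FactRing_def A_RCOSETS_def' mod_hbar_def)
  then show "carrier Hc = kap ` HH"
    by (auto simp: kap_def kh.carrier_f)
qed (use Ring.ring_hom_add[OF mod_hbar_hom] Ring.ring_hom_mult[OF mod_hbar_hom] in
  \<open>auto simp: HH_1 HH_add HH_mult HH_uminus kap_def kh.f_add kh.f_mult kh.f_closed\<close>)

lemma kap_eq: "A \<in> HH \<Longrightarrow> B \<in> HH \<Longrightarrow> kap A = kap B \<longleftrightarrow> (\<exists>C\<in>HH. A - B = hb C)"
proof -
  assume AB: "A \<in> HH" "B \<in> HH"
  have "kap A = kap B \<longleftrightarrow> kh A \<ominus>\<^bsub>Hh\<^esub> kh B \<in> hbar_ideal d \<zeta> a"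
    unfolding kap_def mod_hbar_def
    using kh.quotient_eq_iff_same_a_r_cos[OF hbar_ideal] AB kh.f_closed by simp
  also have "\<dots> \<longleftrightarrow> kh (A - B) \<in> kh ` (hb ` HH)" using AB by (simp add: kh.f_diff hbar_ideal_eq)
  also have "\<dots> \<longleftrightarrow> (\<exists>C\<in>HH. A - B = hb C)"
    using AB by (auto simp: kh_inj HH_diff HH_hb)
  finally show ?thesis .
qed

lemma to_H_c_eq: "F \<in> carrier (smash \<zeta>) \<Longrightarrow> to_H_c d \<zeta> a F = kap (P.Psi F)"
  by (simp add: to_H_c_def kap_def kh_Psi)

lemma kap_scalar: "to_H_c d \<zeta> a (tens (scalar [:c:])) = kap (cs c 1)"
  by (simp add: to_H_c_eq tens_eq P.Psi_del P.tev.ev_scalar P.rep_one cs_def)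

lemma q_elt_eq: "q_elt d \<zeta> a = kap (x * y)" and Q_elt_eq: "Q_elt d \<zeta> a = kap (X * Y)"
  by (simp_all add: q_elt_def Q_elt_def to_H_c_eq tens_eq P.Psi_del P.tev.ev_mult P.tev.ev_letter P.rep_one)

text \<open>The operators that are central modulo \<open>\<hbar>\<close>, with the bracket \<open>[A,B] / \<hbar>\<close>.\<close>

definition Zh :: "(nat \<times> nat \<times> pbw) op set" where
  "Zh = {A \<in> HH. \<forall>B\<in>HH. \<exists>C\<in>HH. A * B - B * A = hb C}"

definition pb :: "(nat \<times> nat \<times> pbw) op \<Rightarrow> (nat \<times> nat \<times> pbw) op \<Rightarrow> (nat \<times> nat \<times> pbw) op" where
  "pb A B = (THE C. A * B - B * A = hb C)"

lemma pb_eqI: "A * B - B * A = hb C \<Longrightarrow> pb A B = C"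
  unfolding pb_def by (rule the_equality) (simp_all add: hb_cancel)

lemma Zh_HH: "A \<in> Zh \<Longrightarrow> A \<in> HH" by (simp add: Zh_def)

lemma pb: assumes "A \<in> Zh" "B \<in> HH" shows "pb A B \<in> HH" "A * B - B * A = hb (pb A B)"
proof -
  obtain C where C: "C \<in> HH" "A * B - B * A = hb C" using assms by (auto simp: Zh_def)
  then show "pb A B \<in> HH" "A * B - B * A = hb (pb A B)" using pb_eqI[OF C(2)] by simp_all
qed

lemma pb': assumes "A \<in> HH" "B \<in> Zh" shows "pb A B \<in> HH" "A * B - B * A = hb (pb A B)"
proof -
  have "A * B - B * A = hb (- pb B A)" using pb(2)[OF assms(2,1)] by simp (metis minus_diff_eq)
  then show "pb A B \<in> HH" "A * B - B * A = hb (pb A B)"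
    using pb_eqI[of A B "- pb B A"] pb(1)[OF assms(2,1)] HH_uminus by simp_all
qed

lemma Z_c_carrier: "carrier (Z_c d \<zeta> a) = kap ` Zh"
proof -
  have e: "kap A \<otimes>\<^bsub>Hc\<^esub> kap B = kap B \<otimes>\<^bsub>Hc\<^esub> kap A \<longleftrightarrow> (\<exists>C\<in>HH. A * B - B * A = hb C)" if "A \<in> HH" "B \<in> HH" for A B
    using kap_eq[of "A * B" "B * A"] that by (simp add: kap.f_mult HH_mult)
  have "{z \<in> kap ` HH. \<forall>h\<in>kap ` HH. z \<otimes>\<^bsub>Hc\<^esub> h = h \<otimes>\<^bsub>Hc\<^esub> z} =
      kap ` {A \<in> HH. \<forall>B\<in>HH. kap A \<otimes>\<^bsub>Hc\<^esub> kap B = kap B \<otimes>\<^bsub>Hc\<^esub> kap A}" by blast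
  also have "{A \<in> HH. \<forall>B\<in>HH. kap A \<otimes>\<^bsub>Hc\<^esub> kap B = kap B \<otimes>\<^bsub>Hc\<^esub> kap A} = Zh"
    unfolding Zh_def by (rule Collect_cong) (simp add: e cong: conj_cong)
  finally show ?thesis by (simp add: Z_c_def Let_def kap.carrier_f del: ball_simps)
qed

text \<open>Two lifts differ by hbar times an element of H. As A and B are central modulo hbar, a
  change of lifts alters the commutator by a multiple of hbar^2, so the quotient by hbar is
  unchanged modulo hbar.\<close>

lemma poisson_eq:
  assumes A: "A \<in> Zh" and B: "B \<in> Zh"
  shows "poisson d \<zeta> a (kap A) (kap B) = kap (pb A B)"
  unfolding poisson_def Let_def
proof (rule the_equality)
  have c: "commutator Hh (kh A) (kh B) = kh (A * B - B * A)" if "A \<in> HH" "B \<in> HH" for A B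
    using that by (simp add: commutator_def kh.f_mult kh.f_diff HH_mult)
  have m: "kh (hb 1) \<otimes>\<^bsub>Hh\<^esub> kh C = kh (hb C)" if "C \<in> HH" for C
    using kh.f_mult[of "hb 1" C] that by (simp add: HH_hb HH_1)
  have AB: "A \<in> HH" "B \<in> HH" using A B by (auto simp: Zh_def)
  show "\<exists>l\<in>carrier Hh. \<exists>l'\<in>carrier Hh. \<exists>h\<in>carrier Hh. mod_hbar d \<zeta> a l = kap A \<and> mod_hbar d \<zeta> a l' = kap B \<and>
      to_H_hbar d \<zeta> a hbar \<otimes>\<^bsub>Hh\<^esub> h = commutator Hh l l' \<and> kap (pb A B) = mod_hbar d \<zeta> a h"
    using AB pb[OF A AB(2)]
    by (intro bexI[of _ "kh A"] bexI[of _ "kh B"] bexI[of _ "kh (pb A B)"])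
       (auto simp: kap_def kh_hbar c m kh.f_closed)
  fix p assume "\<exists>l\<in>carrier Hh. \<exists>l'\<in>carrier Hh. \<exists>h\<in>carrier Hh. mod_hbar d \<zeta> a l = kap A \<and> mod_hbar d \<zeta> a l' = kap B \<and>
      to_H_hbar d \<zeta> a hbar \<otimes>\<^bsub>Hh\<^esub> h = commutator Hh l l' \<and> p = mod_hbar d \<zeta> a h"
  then obtain A' B' C where H: "A' \<in> HH" "B' \<in> HH" "C \<in> HH" and e: "kap A' = kap A" "kap B' = kap B"
    "kh (hb C) = kh (A' * B' - B' * A')" "p = kap C"
    by (auto simp: kh.carrier_f kap_def kh_hbar m c)
  obtain A1 where A1: "A1 \<in> HH" "A' = A + hb A1" using e(1) kap_eq[OF H(1) AB(1)] by (auto simp: algebra_simps)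
  obtain B1 where B1: "B1 \<in> HH" "B' = B + hb B1" using e(2) kap_eq[OF H(2) AB(2)] by (auto simp: algebra_simps)
  have 1: "A * B - B * A = hb (pb A B)" "A * B1 - B1 * A = hb (pb A B1)" "A1 * B - B * A1 = hb (pb A1 B)"
    using pb pb' A B A1 B1 AB by auto
  have "hb C = A' * B' - B' * A'" using e(3) H by (simp add: kh_inj HH_hb HH_diff HH_mult)
  also have "\<dots> = (A * B - B * A) + hb (A * B1 - B1 * A) + hb (A1 * B - B * A1) + hb (hb (A1 * B1 - B1 * A1))"
    by (simp add: A1 B1 algebra_simps)
  also have "\<dots> = hb (pb A B + hb (pb A B1 + pb A1 B + (A1 * B1 - B1 * A1)))"
    unfolding 1 by simp
  finally have "C - pb A B = hb (pb A B1 + pb A1 B + (A1 * B1 - B1 * A1))"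
    by (simp only: hb_cancel) simp
  moreover have "pb A B1 + pb A1 B + (A1 * B1 - B1 * A1) \<in> HH"
    using pb pb' A B A1 B1 AB by (auto intro!: HH_add HH_diff HH_mult)
  ultimately show "p = kap (pb A B)" unfolding e(4) kap_eq[OF H(3) pb(1)[OF A AB(2)]] by blast
qed

end

section \<open>A standard module and an automorphism that rotates the reflections\<close>

section \<open>The standard module \<open>\<Delta>\<close> and the twist\<close>

text \<open>\<open>\<Delta>\<close> is induced from the two-dimensional representation of \<open>W\<close> on \<open>V\<^sup>*\<close>, where \<open>X\<close> and \<open>Y\<close> act
  by zero; \<open>False\<close> and \<open>True\<close> are the basis vectors on which the rotations act like on \<open>1/x\<close> and
  \<open>1/y\<close>.\<close>

definition SNd :: "complex \<Rightarrow> bool op" where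
  "SNd z = Op (\<lambda>b. Poly_Mapping.single (\<not> b) [:if b then 1 / z else z:])"

lemma SNd_single [simp]: "app (SNd z) (Poly_Mapping.single b c) = Poly_Mapping.single (\<not> b) ([:if b then 1 / z else z:] * c)"
  by (simp add: SNd_def app_single mult.commute)

sublocale cherednik \<subseteq> Dl: induced d \<zeta> a SNd 0 0
proof
  fix z w assume z: "z \<in> U" and w: "w \<in> U"
  show "SNd z * SNd w = SNd (z / w) * SNd 1"
    using U_nz[OF z] U_nz[OF w] by (auto intro!: op_ext simp: field_simps)
  show "SNd z * SNd 1 * SNd w = SNd (z * w)"
    using U_nz[OF z] U_nz[OF w] by (auto intro!: op_ext simp: field_simps)
qed (auto intro!: op_ext simp: pCons_one)

definition TNp :: "complex \<Rightarrow> complex \<Rightarrow> pbw op" where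
  "TNp \<zeta> t = Op (\<lambda>(k, l, b, v). Poly_Mapping.single (k, l, b, if b then \<zeta> * v else v) [:t ^ l / t ^ k:])"

lemma TNp_single [simp]: "app (TNp \<zeta> t) (Poly_Mapping.single (k, l, b, v) c) =
    Poly_Mapping.single (k, l, b, if b then \<zeta> * v else v) ([:t ^ l / t ^ k:] * c)"
  by (simp add: TNp_def app_single mult.commute)

definition TNd :: "complex \<Rightarrow> bool op" where
  "TNd t = Op (\<lambda>b. Poly_Mapping.single b [:if b then t else 1 / t:])"

lemma TNd_single [simp]: "app (TNd t) (Poly_Mapping.single b c) = Poly_Mapping.single b ([:if b then t else 1 / t:] * c)"
  by (simp add: TNd_def app_single mult.commute)

lemma TNp_SNp: assumes "t * t = \<zeta>" "z \<noteq> 0" "t \<noteq> 0" shows "TNp \<zeta> t * SNp z = SNp (\<zeta> * z) * TNp \<zeta> t"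
  using assms(2,3) by (auto intro!: op_ext simp: assms(1)[symmetric] power_mult_distrib field_simps)

lemma TNd_SNd: assumes "t * t = \<zeta>" "z \<noteq> 0" "t \<noteq> 0" shows "TNd t * SNd z = SNd (\<zeta> * z) * TNd t"
  using assms(2,3) by (auto intro!: op_ext simp: assms(1)[symmetric] field_simps)

context cherednik
begin

definition tt :: complex where "tt = (SOME t. t * t = \<zeta> \<and> t ^ d = -1)"

text \<open>Any square root t of zeta has t^d = 1 or -1. If t^d = 1, then d is odd, as otherwise
  zeta^(d/2) = 1, and -t is the required root.\<close>

lemma tt: "tt * tt = \<zeta>" "tt ^ d = -1"
proof -
  define t where "t = csqrt \<zeta>"
  have t: "t * t = \<zeta>" unfolding t_def by (metis power2_csqrt power2_eq_square)
  have "t ^ d * t ^ d = 1" using zeta_d by (simp add: t flip: power_mult_distrib)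
  then have td: "t ^ d = 1 \<or> t ^ d = -1" by (simp add: square_eq_1_iff)
  have "\<exists>t. t * t = \<zeta> \<and> t ^ d = -1"
  proof (cases "t ^ d = -1")
    case False
    then have td: "t ^ d = 1" using td by blast
    have "odd d"
    proof
      assume "even d"
      then obtain k where k: "d = 2 * k" by blast
      then have "\<zeta> ^ k = 1" using td t by (simp add: power_mult power2_eq_square)
      then show False using zeta_prim[of k] k d5 by simp
    qed
    then show ?thesis using td t by (intro exI[of _ "- t"]) simp
  qed (use t in blast)
  then show "tt * tt = \<zeta>" "tt ^ d = -1" unfolding tt_def by (metis (mono_tags, lifting) someI_ex)+
qed

lemma tt_nz [simp]: "tt \<noteq> 0" using tt(1) by auto

text \<open>A power of t equals -1 only for odd multiples of d as exponents. All degree bounds for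
  elements negated by \<open>tau\<close> come from this.\<close>

lemma tt_power_eq: "tt ^ m = -1 \<Longrightarrow> \<exists>k. m = d * (2 * k + 1)"
proof -
  assume m: "tt ^ m = -1"
  have "\<zeta> ^ m = 1" using m tt(1) by (metis mult_minus1_right power_mult_distrib minus_minus)
  moreover have "\<zeta> ^ m = \<zeta> ^ (m mod d)"
    using zeta_d by (metis mult_div_mod_eq power_add power_mult power_one mult_1)
  ultimately have "m mod d = 0" using zeta_prim[of "m mod d"] d_pos by (metis mod_less_divisor neq0_conv)
  then obtain k where k: "m = d * k" by auto
  then have "(-1) ^ k = (-1 :: complex)" using m tt(2) by (simp add: power_mult)
  then have "odd k" by (cases "even k") auto
  then show ?thesis using k by (metis oddE)
qed

end

sublocale cherednik \<subseteq> Pt: induced_twist d \<zeta> a SNp XNp YNp tt "TNp \<zeta> tt"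
proof
  show "tt * tt = \<zeta>" by (rule tt)
  fix z assume z: "z \<in> U"
  show "TNp \<zeta> tt * SNp z = SNp (\<zeta> * z) * TNp \<zeta> tt"
    using TNp_SNp[OF tt(1) U_nz[OF z] tt_nz] .
qed (auto intro!: op_ext simp: mult.commute)

sublocale cherednik \<subseteq> Dt: induced_twist d \<zeta> a SNd 0 0 tt "TNd tt"
proof
  show "tt * tt = \<zeta>" by (rule tt)
  fix z assume z: "z \<in> U"
  show "TNd tt * SNd z = SNd (\<zeta> * z) * TNd tt"
    using TNd_SNd[OF tt(1) U_nz[OF z] tt_nz] .
qed (auto intro!: op_ext)

context cherednik
begin

text \<open>The action of H on the standard module, transported to \<open>HH\<close>. By
  \<open>rho_Psi\<close> every preimage gives the same operator, since a tensor killed by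
  \<open>Psi\<close> lies in the ideal and so acts by zero.\<close>

definition rho :: "(nat \<times> nat \<times> pbw) op \<Rightarrow> (nat \<times> nat \<times> bool) op" where
  "rho A = Dl.Psi (pre A)"

lemma rho_Psi: "F \<in> carrier (smash \<zeta>) \<Longrightarrow> rho (P.Psi F) = Dl.Psi F"
proof -
  assume F: "F \<in> carrier (smash \<zeta>)"
  let ?G = "pre (P.Psi F)"
  have "(\<lambda>w. ?G w - F w) \<in> II"
    using pre[OF HH_Psi[OF F]] F by (intro Psi_eq_0) (simp_all add: P.Psi_diff smash_simps(1))
  then have "Dl.Psi (\<lambda>w. ?G w - F w) = 0" by (rule Dl.Psi_II)
  then show ?thesis by (simp add: rho_def Dl.Psi_diff)
qed

lemma rho_add: "A \<in> HH \<Longrightarrow> B \<in> HH \<Longrightarrow> rho (A + B) = rho A + rho B"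
proof -
  assume AB: "A \<in> HH" "B \<in> HH"
  then have "A + B = P.Psi (\<lambda>w. pre A w + pre B w)" by (simp add: P.Psi_add pre)
  moreover have "(\<lambda>w. pre A w + pre B w) \<in> carrier (smash \<zeta>)"
    using smash.a_closed[OF pre(1)[OF AB(1)] pre(1)[OF AB(2)]] by (simp add: smash_simps(5))
  ultimately show ?thesis by (simp add: rho_Psi Dl.Psi_add) (simp add: rho_def)
qed

lemma rho_mult: "A \<in> HH \<Longrightarrow> B \<in> HH \<Longrightarrow> rho (A * B) = rho A * rho B"
proof -
  assume AB: "A \<in> HH" "B \<in> HH"
  then have "A * B = P.Psi (cv (pre A) (pre B))" by (simp add: P.Psi_cv pre)
  then show ?thesis by (simp add: rho_Psi cv_carrier Dl.Psi_cv) (simp add: rho_def)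
qed

lemma rho_osc1: "rho (osc c 1) = osc c 1"
  using rho_Psi[of "del (Rm 1) (scalar c)"] by (simp add: P.Psi_del Dl.Psi_del P.tev.ev_scalar Dl.tev.ev_scalar P.rep_one Dl.rep_one)

lemma rho_osc: "A \<in> HH \<Longrightarrow> rho (osc c A) = osc c (rho A)"
  using rho_mult[OF HH_osc1[of c], of A] by (simp add: rho_osc1 osc_simps)

lemma rho_cs: "A \<in> HH \<Longrightarrow> rho (cs c A) = cs c (rho A)" and rho_hb: "A \<in> HH \<Longrightarrow> rho (hb A) = hb (rho A)"
  by (simp_all add: cs_def hb_def rho_osc)

lemma rho_uminus: "A \<in> HH \<Longrightarrow> rho (- A) = - rho A"
  using rho_cs[of A "-1"] by simp

lemma rho_diff: "A \<in> HH \<Longrightarrow> B \<in> HH \<Longrightarrow> rho (A - B) = rho A - rho B"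
  using rho_add[of A "- B"] HH_uminus[of B] by (simp add: rho_uminus)

lemma rho_1: "rho 1 = 1" and rho_0: "rho 0 = 0"
  using rho_osc1[of 1] rho_osc1[of 0] by (simp_all add: osc_simps)

lemma rho_letters: "rho x = Dl.xo" "rho y = Dl.yo" "rho X = Dl.Xo" "rho Y = Dl.Yo"
  using rho_Psi[of "lx Gx"] rho_Psi[of "lx Gy"] rho_Psi[of "lx GX"] rho_Psi[of "lx GY"]
  by (simp_all add: P.Psi_del Dl.Psi_del P.tev.ev_letter Dl.tev.ev_letter P.rep_one Dl.rep_one)

lemma rho_S: "z \<in> U \<Longrightarrow> rho (S z) = Dl.So z"
  using rho_Psi[of "sm z"] by (simp add: P.Psi_del Dl.Psi_del P.rep_S Dl.rep_S P.tev.ev_1 Dl.tev.ev_1)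

lemma rho_power: "A \<in> HH \<Longrightarrow> rho (A ^ n) = rho A ^ n"
  by (induction n) (simp_all add: rho_1 rho_mult HH_power)

lemma rho_sum: "(\<And>i. i \<in> I \<Longrightarrow> f i \<in> HH) \<Longrightarrow> rho (sum f I) = (\<Sum>i\<in>I. rho (f i))"
  by (induction I rule: infinite_finite_induct) (simp_all add: rho_0 rho_add HH_sum)

text \<open>The automorphism with \<open>x \<mapsto> t x\<close>, \<open>y \<mapsto> y/t\<close>, \<open>X \<mapsto> X/t\<close>, \<open>Y \<mapsto> t Y\<close>, \<open>s\<^sub>i \<mapsto> s\<^bsub>i+1\<^esub>\<close>, which exists
  because all parameters of the Cherednik algebra are equal.\<close>

definition tau :: "(nat \<times> nat \<times> pbw) op \<Rightarrow> (nat \<times> nat \<times> pbw) op" where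
  "tau A = (THE B. Pt.To * A = B * Pt.To)"

lemma To_single: "app Pt.To (Poly_Mapping.single (i, j, k, l, b, v) c) =
    Poly_Mapping.single (i, j, k, l, b, if b then \<zeta> * v else v) ([:tt ^ i / tt ^ j * (tt ^ l / tt ^ k):] * c)"
proof -
  have "app Pt.To (Poly_Mapping.single (i, j, k, l, b, v) c) = pscale c (app Pt.To (basis (i, j, k, l, b, v)))"
    by (simp add: app_single app_basis)
  also have "app Pt.To (basis (i, j, k, l, b, v)) =
     pscale [:tt ^ i / tt ^ j:] (P.emb i j (pscale [:tt ^ l / tt ^ k:] (basis (k, l, b, if b then \<zeta> * v else v))))"
    by (subst Pt.To_basis) simp
  finally show ?thesis by (simp add: mult_ac P.emb_def)
qed

lemma To_right_cancel: "B * Pt.To = C * Pt.To \<Longrightarrow> B = C"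
proof (rule op_ext)
  fix b :: "nat \<times> nat \<times> pbw"
  assume eq: "B * Pt.To = C * Pt.To"
  obtain i j k l g v where b: "b = (i, j, k, l, g, v)" by (cases b) auto
  have "basis b = app Pt.To (Poly_Mapping.single (i, j, k, l, g, if g then v / \<zeta> else v) [:tt ^ j / tt ^ i * (tt ^ k / tt ^ l):])"
    by (simp add: To_single b pCons_one)
  then show "app B (basis b) = app C (basis b)"
    using arg_cong[OF eq, of "\<lambda>A. app A (Poly_Mapping.single (i, j, k, l, g, if g then v / \<zeta> else v) [:tt ^ j / tt ^ i * (tt ^ k / tt ^ l):])"]
    by (simp only: app_ops)
qed

lemma tau_eqI: "Pt.To * A = B * Pt.To \<Longrightarrow> tau A = B"
  unfolding tau_def by (rule the_equality) (auto intro: To_right_cancel)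

text \<open>It suffices to treat generators. Both modules are handled in one induction because the
  same B has to describe the conjugation on the PBW module and on the standard module; this makes
  \<open>tau\<close> compatible with \<open>rho\<close>.\<close>

lemma tau_ex: "A \<in> HH \<Longrightarrow> \<exists>B\<in>HH. Pt.To * A = B * Pt.To \<and> Dt.To * rho A = rho B * Dt.To"
proof (induction rule: HH_induct)
  case (add A B)
  then obtain A' B' where "A' \<in> HH" "Pt.To * A = A' * Pt.To" "Dt.To * rho A = rho A' * Dt.To"
    "B' \<in> HH" "Pt.To * B = B' * Pt.To" "Dt.To * rho B = rho B' * Dt.To" by blast
  then show ?case using add by (intro bexI[of _ "A' + B'"]) (simp_all add: HH_add rho_add algebra_simps)
next
  case (mult A B)
  then obtain A' B' where *: "A' \<in> HH" "Pt.To * A = A' * Pt.To" "Dt.To * rho A = rho A' * Dt.To"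
    "B' \<in> HH" "Pt.To * B = B' * Pt.To" "Dt.To * rho B = rho B' * Dt.To" by blast
  have "Pt.To * (A * B) = A' * B' * Pt.To"
    by (simp only: mult.assoc[symmetric] *(2)) (simp only: mult.assoc *(5))
  moreover have "Dt.To * (rho A * rho B) = rho A' * rho B' * Dt.To"
    by (simp only: mult.assoc[symmetric] *(3)) (simp only: mult.assoc *(6))
  ultimately
  show ?case using mult * by (intro bexI[of _ "A' * B'"]) (simp_all add: HH_mult rho_mult)
next
  case (osc c)
  then show ?case by (intro bexI[of _ "osc c 1"]) (simp_all add: HH_osc1 rho_osc1 osc_simps)
next
  case x
  then show ?case by (intro bexI[of _ "cs tt x"])
    (simp_all add: HH_cs HH_letters rho_cs rho_letters Pt.To_xo Dt.To_xo)
next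
  case y
  then show ?case by (intro bexI[of _ "cs (1 / tt) y"])
    (simp_all add: HH_cs HH_letters rho_cs rho_letters Pt.To_yo Dt.To_yo)
next
  case X
  then show ?case by (intro bexI[of _ "cs (1 / tt) X"])
    (simp_all add: HH_cs HH_letters rho_cs rho_letters Pt.To_Xo Dt.To_Xo)
next
  case Y
  then show ?case by (intro bexI[of _ "cs tt Y"])
    (simp_all add: HH_cs HH_letters rho_cs rho_letters Pt.To_Yo Dt.To_Yo)
next
  case (S z)
  then show ?case by (intro bexI[of _ "S (\<zeta> * z)"])
    (simp_all add: HH_S rho_S U_mult Pt.To_So Dt.To_So)
qed

lemma tau: assumes "A \<in> HH" shows "tau A \<in> HH" "Pt.To * A = tau A * Pt.To" "Dt.To * rho A = rho (tau A) * Dt.To"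
proof -
  obtain B where "B \<in> HH" "Pt.To * A = B * Pt.To" "Dt.To * rho A = rho B * Dt.To" using tau_ex[OF assms] by blast
  then show "tau A \<in> HH" "Pt.To * A = tau A * Pt.To" "Dt.To * rho A = rho (tau A) * Dt.To"
    using tau_eqI by auto
qed

lemma tau_add: "A \<in> HH \<Longrightarrow> B \<in> HH \<Longrightarrow> tau (A + B) = tau A + tau B"
  by (rule tau_eqI) (simp add: distrib_left distrib_right tau)

lemma tau_mult: "A \<in> HH \<Longrightarrow> B \<in> HH \<Longrightarrow> tau (A * B) = tau A * tau B"
  by (rule tau_eqI) (simp only: mult.assoc[symmetric] tau(2)[of A], simp only: mult.assoc tau(2)[of B])

lemma tau_osc: "A \<in> HH \<Longrightarrow> tau (osc c A) = osc c (tau A)"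
  by (rule tau_eqI) (simp add: osc_simps tau)

lemma tau_cs: "A \<in> HH \<Longrightarrow> tau (cs c A) = cs c (tau A)" and tau_hb: "A \<in> HH \<Longrightarrow> tau (hb A) = hb (tau A)"
  by (simp_all add: cs_def hb_def tau_osc)

lemma tau_uminus: "A \<in> HH \<Longrightarrow> tau (- A) = - tau A"
  using tau_cs[of A "-1"] by simp

lemma tau_diff: "A \<in> HH \<Longrightarrow> B \<in> HH \<Longrightarrow> tau (A - B) = tau A - tau B"
  using tau_add[of A "- B"] by (simp add: HH_uminus tau_uminus)

lemma tau_gens: "tau x = cs tt x" "tau y = cs (1 / tt) y" "tau X = cs (1 / tt) X" "tau Y = cs tt Y"
  by (rule tau_eqI, simp add: Pt.To_xo Pt.To_yo Pt.To_Xo Pt.To_Yo)+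

lemma tau_surj: "A \<in> HH \<Longrightarrow> \<exists>B\<in>HH. tau B = A"
proof (induction rule: HH_induct)
  case (add A B)
  then obtain A' B' where "A' \<in> HH" "tau A' = A" "B' \<in> HH" "tau B' = B" by blast
  then show ?case by (intro bexI[of _ "A' + B'"]) (simp_all add: HH_add tau_add)
next
  case (mult A B)
  then obtain A' B' where "A' \<in> HH" "tau A' = A" "B' \<in> HH" "tau B' = B" by blast
  then show ?case by (intro bexI[of _ "A' * B'"]) (simp_all add: HH_mult tau_mult)
next
  case (osc c)
  have "tau 1 = 1" by (rule tau_eqI) simp
  then show ?case by (intro bexI[of _ "osc c 1"]) (simp_all add: tau_osc HH_1 HH_osc1)
next
  case (S z)
  have "tau (S (z / \<zeta>)) = S z" using S by (intro tau_eqI) (simp add: Pt.To_So U_divide)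
  then show ?case using S by (intro bexI[of _ "S (z / \<zeta>)"]) (simp_all add: HH_S U_divide)
next
  case x then show ?case by (intro bexI[of _ "cs (1 / tt) x"]) (simp_all add: tau_cs tau_gens HH_letters HH_cs)
next
  case y then show ?case by (intro bexI[of _ "cs tt y"]) (simp_all add: tau_cs tau_gens HH_letters HH_cs)
next
  case X then show ?case by (intro bexI[of _ "cs tt X"]) (simp_all add: tau_cs tau_gens HH_letters HH_cs)
next
  case Y then show ?case by (intro bexI[of _ "cs (1 / tt) Y"]) (simp_all add: tau_cs tau_gens HH_letters HH_cs)
qed

lemma tau_Zh: assumes A: "A \<in> Zh" shows "tau A \<in> Zh"
  unfolding Zh_def mem_Collect_eq
proof (intro conjI ballI)
  show "tau A \<in> HH" by (rule tau[OF Zh_HH[OF A]])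
  fix B assume "B \<in> HH"
  then obtain B' where B': "B' \<in> HH" "tau B' = B" using tau_surj by blast
  have "tau A * B - B * tau A = tau (A * B' - B' * A)"
    using A B' by (simp add: tau_diff tau_mult HH_mult Zh_HH)
  also have "\<dots> = hb (tau (pb A B'))" using pb[OF A B'(1)] by (simp add: tau_hb)
  finally show "\<exists>C\<in>HH. tau A * B - B * tau A = hb C" by (rule bexI) (rule tau(1)[OF pb(1)[OF A B'(1)]])
qed

section \<open>Poisson algebra structure on the lifts of the centre\<close>

section \<open>The bracket on operators that are central modulo \<open>\<hbar>\<close>\<close>

lemma pb_add_left: "A \<in> Zh \<Longrightarrow> B \<in> Zh \<Longrightarrow> C \<in> HH \<Longrightarrow> pb (A + B) C = pb A C + pb B C"
  using pb(2)[of A C] pb(2)[of B C] by (intro pb_eqI) (simp add: algebra_simps)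

lemma pb_add_right: "A \<in> Zh \<Longrightarrow> B \<in> HH \<Longrightarrow> C \<in> HH \<Longrightarrow> pb A (B + C) = pb A B + pb A C"
  using pb(2)[of A B] pb(2)[of A C] by (intro pb_eqI) (simp add: algebra_simps)

lemma pb_cs_left: "A \<in> Zh \<Longrightarrow> C \<in> HH \<Longrightarrow> pb (cs c A) C = cs c (pb A C)"
  using pb(2)[of A C, symmetric] by (intro pb_eqI) simp

lemma pb_cs_right: "A \<in> Zh \<Longrightarrow> C \<in> HH \<Longrightarrow> pb A (cs c C) = cs c (pb A C)"
  using pb(2)[of A C, symmetric] by (intro pb_eqI) simp

lemma pb_hb_right: "pb A (hb B) = A * B - B * A"
  by (rule pb_eqI) simp

lemma pb_mult_right: "A \<in> Zh \<Longrightarrow> B \<in> HH \<Longrightarrow> C \<in> HH \<Longrightarrow> pb A (B * C) = pb A B * C + B * pb A C"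
proof (rule pb_eqI)
  assume *: "A \<in> Zh" "B \<in> HH" "C \<in> HH"
  have "A * (B * C) - B * C * A = (A * B - B * A) * C + B * (A * C - C * A)" by (simp add: algebra_simps)
  also have "\<dots> = hb (pb A B) * C + B * hb (pb A C)" using pb(2) * by simp
  finally show "A * (B * C) - B * C * A = hb (pb A B * C + B * pb A C)" by simp
qed

lemma pb_anti: "A \<in> Zh \<Longrightarrow> B \<in> HH \<Longrightarrow> pb B A = - pb A B"
  using pb(2)[of A B, symmetric] by (intro pb_eqI) simp

lemma pb_self: "pb A A = 0"
  by (rule pb_eqI) simp

lemma pb_1: "pb A 1 = 0" and pb_1_left: "pb 1 A = 0"
  by (rule pb_eqI, simp)+

text \<open>The Jacobi identity for commutators, divided by hbar twice.\<close>

lemma pb_jacobi: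
  assumes A: "A \<in> Zh" and B: "B \<in> Zh" and C: "C \<in> HH"
  shows "pb A (pb B C) = pb (pb A B) C + pb B (pb A C)"
proof -
  have BH: "B \<in> HH" using B Zh_HH by blast
  have h: "hb (pb A B) = A * B - B * A" "hb (pb B C) = B * C - C * B" "hb (pb A C) = A * C - C * A"
    using pb(2) A B C BH by auto
  have 1: "hb (pb A (pb B C)) = A * pb B C - pb B C * A" using pb(2)[OF A pb(1)[OF B C]] by simp
  have 2: "hb (pb B (pb A C)) = B * pb A C - pb A C * B" using pb(2)[OF B pb(1)[OF A C]] by simp
  have "hb (hb (pb A (pb B C) - pb B (pb A C))) =
      A * hb (pb B C) - hb (pb B C) * A - (B * hb (pb A C) - hb (pb A C) * B)"
    unfolding hb_simps 1 2 by simp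
  also have "\<dots> = (A * B - B * A) * C - C * (A * B - B * A)" unfolding h by (simp add: algebra_simps)
  also have "\<dots> = hb (pb A B * C - C * pb A B)" unfolding h(1)[symmetric] by simp
  finally have "pb A B * C - C * pb A B = hb (pb A (pb B C) - pb B (pb A C))" by (simp only: hb_cancel)
  then have "pb (pb A B) C = pb A (pb B C) - pb B (pb A C)" by (rule pb_eqI)
  then show ?thesis by simp
qed

lemma Zh_I: "A \<in> HH \<Longrightarrow> (\<And>B. B \<in> HH \<Longrightarrow> \<exists>C\<in>HH. A * B - B * A = hb C) \<Longrightarrow> A \<in> Zh"
  by (simp add: Zh_def)

lemma Zh_add: "A \<in> Zh \<Longrightarrow> B \<in> Zh \<Longrightarrow> A + B \<in> Zh"
proof (rule Zh_I)
  fix C assume *: "A \<in> Zh" "B \<in> Zh" "C \<in> HH"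
  then have "(A + B) * C - C * (A + B) = hb (pb A C + pb B C)"
    using pb(2)[of A C] pb(2)[of B C] by (simp add: algebra_simps)
  then show "\<exists>E\<in>HH. (A + B) * C - C * (A + B) = hb E"
    by (rule bexI) (use * in \<open>auto intro!: HH_add pb(1)\<close>)
qed (simp add: HH_add Zh_HH)

lemma Zh_mult: "A \<in> Zh \<Longrightarrow> B \<in> Zh \<Longrightarrow> A * B \<in> Zh"
proof (rule Zh_I)
  fix C assume *: "A \<in> Zh" "B \<in> Zh" "C \<in> HH"
  then have "A * B * C - C * (A * B) = hb (pb A C) * B + A * hb (pb B C)"
    using pb(2)[of A C, symmetric] pb(2)[of B C, symmetric] by (simp only:) (simp add: algebra_simps)
  then have "A * B * C - C * (A * B) = hb (pb A C * B + A * pb B C)" by simp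
  then show "\<exists>E\<in>HH. A * B * C - C * (A * B) = hb E"
    by (rule bexI) (use * Zh_HH in \<open>auto intro!: HH_add HH_mult pb(1)\<close>)
qed (simp add: HH_mult Zh_HH)

lemma Zh_hb: "A \<in> HH \<Longrightarrow> hb A \<in> Zh"
proof (rule Zh_I)
  fix C assume *: "A \<in> HH" "C \<in> HH"
  have "hb A * C - C * hb A = hb (A * C - C * A)" by simp
  then show "\<exists>E\<in>HH. hb A * C - C * hb A = hb E"
    by (rule bexI) (use * in \<open>auto intro!: HH_diff HH_mult\<close>)
qed (simp add: HH_hb)

lemma Zh_osc1: "osc c 1 \<in> Zh"
  by (rule Zh_I[OF HH_osc1]) (use HH_0 in \<open>auto simp: osc_simps intro!: bexI[of _ 0]\<close>)

lemma Zh_cs: "A \<in> Zh \<Longrightarrow> cs c A \<in> Zh"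
  using Zh_mult[OF Zh_osc1[of "[:c:]"], of A] by (simp add: cs_def osc_simps)

lemma Zh_1: "1 \<in> Zh" and Zh_0: "0 \<in> Zh"
  using Zh_osc1[of 1] Zh_osc1[of 0] by (simp_all add: osc_simps)

lemma Zh_uminus: "A \<in> Zh \<Longrightarrow> - A \<in> Zh" using Zh_cs[of A "-1"] by simp

lemma Zh_diff: "A \<in> Zh \<Longrightarrow> B \<in> Zh \<Longrightarrow> A - B \<in> Zh" using Zh_add[of A "- B"] Zh_uminus[of B] by simp

lemma Zh_sum: "(\<And>i. i \<in> I \<Longrightarrow> f i \<in> Zh) \<Longrightarrow> sum f I \<in> Zh"
  by (induction I rule: infinite_finite_induct) (auto simp: Zh_0 Zh_add)

text \<open>By the Jacobi identity the commutator of \<open>pb A B\<close> with C is hbar times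
  {A,{B,C}} - {B,{A,C}}, so \<open>pb A B\<close> is again central modulo hbar.\<close>

lemma Zh_pb: "A \<in> Zh \<Longrightarrow> B \<in> Zh \<Longrightarrow> pb A B \<in> Zh"
proof (rule Zh_I)
  fix C assume *: "A \<in> Zh" "B \<in> Zh" "C \<in> HH"
  have "hb (pb A B * C - C * pb A B) = hb (hb (pb A (pb B C) - pb B (pb A C)))"
  proof -
    have h: "hb (pb A B) = A * B - B * A" "hb (pb B C) = B * C - C * B" "hb (pb A C) = A * C - C * A"
      using pb(2) * Zh_HH by auto
    have 1: "hb (pb A (pb B C)) = A * pb B C - pb B C * A" "hb (pb B (pb A C)) = B * pb A C - pb A C * B"
      using pb(2) pb(1) * by auto
    have "hb (hb (pb A (pb B C) - pb B (pb A C))) =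
        A * hb (pb B C) - hb (pb B C) * A - (B * hb (pb A C) - hb (pb A C) * B)"
      unfolding hb_simps 1 by simp
    also have "\<dots> = hb (pb A B) * C - C * hb (pb A B)" unfolding h by (simp add: algebra_simps)
    finally show ?thesis by simp
  qed
  then have "pb A B * C - C * pb A B = hb (pb A (pb B C) - pb B (pb A C))" by (simp only: hb_cancel)
  moreover have "pb A (pb B C) - pb B (pb A C) \<in> HH" using * pb(1) by (intro HH_diff) auto
  ultimately show "\<exists>E\<in>HH. pb A B * C - C * pb A B = hb E" by (rule bexI)
qed (use pb(1) Zh_HH in auto)

lemma Zh_gensI:
  assumes A: "A \<in> HH" and g: "\<And>B. B \<in> {x, y, X, Y} \<union> S ` U \<Longrightarrow> \<exists>C\<in>HH. A * B - B * A = hb C"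
  shows "A \<in> Zh"
proof (rule Zh_I[OF A])
  fix B assume "B \<in> HH"
  then show "\<exists>C\<in>HH. A * B - B * A = hb C"
  proof (induction rule: HH_induct)
    case (add B B')
    then obtain C C' where C: "C \<in> HH" "A * B - B * A = hb C" "C' \<in> HH" "A * B' - B' * A = hb C'" by blast
    have "A * (B + B') - (B + B') * A = hb (C + C')" unfolding hb_simps C(2,4)[symmetric] by (simp add: algebra_simps)
    then show ?case by (rule bexI) (intro HH_add C)
  next
    case (mult B B')
    then obtain C C' where C: "C \<in> HH" "A * B - B * A = hb C" "C' \<in> HH" "A * B' - B' * A = hb C'" by blast
    have "A * (B * B') - (B * B') * A = (A * B - B * A) * B' + B * (A * B' - B' * A)" by (simp add: algebra_simps)
    also have "\<dots> = hb (C * B' + B * C')" unfolding C by simp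
    finally show ?case by (rule bexI) (intro HH_add HH_mult C mult)
  next
    case (osc c)
    then show ?case using HH_0 by (intro bexI[of _ 0]) (simp_all add: osc_simps)
  qed (use g in auto)
qed

end

section \<open>The sl_2-triple and the module generated by x^d + y^d\<close>

section \<open>The \<open>sl\<^sub>2\<close>-triple and the elements \<open>a\<^sub>j\<close>\<close>

text \<open>The sum of all words with \<open>n\<close> letters, of which \<open>j\<close> are \<open>v\<close> and the others \<open>u\<close>.\<close>

fun wd :: "'e::ring_1 \<Rightarrow> 'e \<Rightarrow> nat \<Rightarrow> nat \<Rightarrow> 'e" where
  "wd u v 0 0 = 1"
| "wd u v 0 (Suc j) = 0"
| "wd u v (Suc n) 0 = u * wd u v n 0"
| "wd u v (Suc n) (Suc j) = u * wd u v n (Suc j) + v * wd u v n j"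

lemma wd_0: "wd u v n 0 = u ^ n"
  by (induction n) auto

lemma wd_gt: "j > n \<Longrightarrow> wd u v n j = 0"
  by (induction u v n j rule: wd.induct) auto

definition cm :: "'e::ring_1 \<Rightarrow> 'e \<Rightarrow> 'e" where "cm A B = A * B - B * A"

lemma cm_simps: "cm G (A * B) = cm G A * B + A * cm G B" "cm G (A + B) = cm G A + cm G B" "cm G 0 = 0" "cm G 1 = 0"
  by (simp_all add: cm_def algebra_simps)

lemma cm_power: "cm G u = 0 \<Longrightarrow> cm G (u ^ n) = 0"
  by (induction n) (simp_all add: cm_simps)

lemma cs_two: "cs 2 A = A + A"
  using cs_add_left[of 1 1 A] by simp

text \<open>\<open>wd u v n j\<close> is the coefficient of s^j in the noncommutative power (u + s
  v)^n. The derivation ad G sends u + s v to -hbar v, so it acts on the powers as -hbar d/ds. The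
  two lemmas that follow are the analogues for the opposite and the diagonal element of
  sl_2.\<close>

lemma wd_lower:
  fixes G u v :: "'b op"
  assumes "cm G u = - hb v" "cm G v = 0"
  shows "cm G (wd u v n j) = - hb (cs (of_nat j + 1) (wd u v n (Suc j)))"
proof (induction n arbitrary: j)
  case 0
  then show ?case by (cases j) (auto simp: cm_simps)
next
  case (Suc n)
  show ?case
    by (cases j) (simp_all add: cm_simps assms Suc.IH cs_add_left cs_two algebra_simps)
qed

lemma wd_raise:
  fixes G u v :: "'b op"
  assumes "cm G u = 0" "cm G v = hb u"
  shows "cm G (wd u v n (Suc j)) = hb (cs (of_nat n - of_nat j) (wd u v n j))"
proof (induction n arbitrary: j)
  case 0
  then show ?case by (cases j) (auto simp: cm_simps)
next
  case (Suc n)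
  show ?case
  proof (cases j)
    case 0
    then show ?thesis using cm_power[OF assms(1), of n]
      by (simp add: cm_simps assms Suc.IH cs_add_left wd_0)
  next
    case (Suc i)
    then show ?thesis
      by (simp add: cm_simps assms Suc.IH cs_add_left cs_diff_left cs_two algebra_simps)
  qed
qed

lemma wd_weight:
  fixes G u v :: "'b op"
  assumes "cm G u = - hb u" "cm G v = hb v"
  shows "cm G (wd u v n j) = - hb (cs (of_nat n - 2 * of_nat j) (wd u v n j))"
proof (induction n arbitrary: j)
  case 0
  then show ?case by (cases j) (auto simp: cm_simps)
next
  case (Suc n)
  show ?case
    by (cases j) (simp_all add: cm_simps assms Suc.IH cs_add_left cs_diff_left cs_two algebra_simps)
qed

context cherednik
begin

definition "s1 = P.SS (\<lambda>z. 1)"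
definition "sz = P.SS (\<lambda>z. z)"
definition "si = P.SS (\<lambda>z. 1 / z)"

lemma s_letters: "s1 * x = y * si" "s1 * y = x * sz" "sz * x = y * s1" "si * y = x * s1"
  "s1 * X = Y * sz" "s1 * Y = X * si" "si * X = Y * s1" "sz * Y = X * s1"
proof -
  show "s1 * x = y * si" "s1 * y = x * sz" "sz * x = y * s1" "si * y = x * s1"
    unfolding s1_def sz_def si_def by (rule P.SS_mult)+
  have "P.SS f * X = Y * P.SS (\<lambda>z. f z * z)" "P.SS f * Y = X * P.SS (\<lambda>z. f z / z)" for f
    by (simp_all add: P.SS_def sum_distrib_left sum_distrib_right P.So_Xo P.So_Yo)
  then show "s1 * X = Y * sz" "s1 * Y = X * si" "si * X = Y * s1" "sz * Y = X * s1"
    unfolding s1_def sz_def si_def by (auto simp: U_nz intro!: P.SS_cong arg_cong2[of _ _ _ _ "(*)"])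
qed

lemma letters_comm: "y * x = x * y" "Y * X = X * Y" "X * x = x * X - hb 1 + cs a s1" "X * y = y * X - cs a sz"
  "Y * x = x * Y - cs a si" "Y * y = y * Y - hb 1 + cs a s1"
  by (simp_all add: P.xo_yo P.Xo_Yo P.Xo_xo P.Xo_yo P.Yo_xo P.Yo_yo P.Cx_def P.Cy_def P.Dx_def s1_def sz_def si_def)

lemma assoc_rule: "A * B = C \<Longrightarrow> A * (B * E) = C * (E :: 'e::ring_1)"
  by (simp flip: mult.assoc)

text \<open>Normal ordering: X and Y are moved to the right of x and y, and sums of reflections to
  the right of all letters.\<close>

lemmas nf = letters_comm s_letters letters_comm[THEN assoc_rule] s_letters[THEN assoc_rule] algebra_simps

definition "qq = x * y"
definition "QQ = X * Y"
text \<open>The sum of reflections cancels the reflection terms in the commutators of x X + y Y with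
  the letters, so that ad eu becomes hbar times the grading with x, y in degree -1 and X, Y in
  degree 1.\<close>

definition "eu = x * X + y * Y + cs a s1"

lemma s1_HH: "s1 \<in> HH" "sz \<in> HH" "si \<in> HH"
  unfolding s1_def sz_def si_def P.SS_def by (intro HH_sum HH_cs HH_S; assumption)+

lemma sl2_HH: "qq \<in> HH" "QQ \<in> HH" "eu \<in> HH"
  by (auto simp: qq_def QQ_def eu_def intro!: HH_add HH_mult HH_letters HH_cs s1_HH)

lemma qq_comm: "cm qq x = 0" "cm qq y = 0" "cm qq X = hb y" "cm qq Y = hb x"
  by (simp_all add: cm_def qq_def nf)

lemma QQ_comm: "cm QQ x = - hb Y" "cm QQ y = - hb X" "cm QQ X = 0" "cm QQ Y = 0"
  by (simp_all add: cm_def QQ_def nf)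

lemma eu_comm: "cm eu x = - hb x" "cm eu y = - hb y" "cm eu X = hb X" "cm eu Y = hb Y"
  by (simp_all add: cm_def eu_def nf)

lemma qQ_comm: "qq * QQ - QQ * qq = hb (eu - hb 1)"
  by (simp add: qq_def QQ_def eu_def nf)

lemma S_letters: assumes z: "z \<in> U" shows "S z * x = cs (1 / z) (y * S z)" "S z * y = cs z (x * S z)"
  "S z * X = cs z (Y * S z)" "S z * Y = cs (1 / z) (X * S z)" "S z * s1 = s1 * S z"
  using P.So_xo[OF z] P.So_yo[OF z] P.So_Xo[OF z] P.So_Yo[OF z] P.SS_So[OF z, of "\<lambda>z. 1"] by (simp_all add: s1_def)

lemma sl2_S: assumes z: "z \<in> U" shows "S z * qq = qq * S z" "S z * QQ = QQ * S z" "S z * eu = eu * S z"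
  using U_nz[OF z]
  by (simp_all add: qq_def QQ_def eu_def S_letters[OF z] S_letters[OF z, THEN assoc_rule] letters_comm(1,2)
      letters_comm(1,2)[THEN assoc_rule] mult.assoc distrib_left distrib_right add.commute)

lemma sl2_Zh: "qq \<in> Zh" "QQ \<in> Zh" "eu \<in> Zh"
proof -
  have z: "\<exists>C\<in>HH. (0::(nat \<times> nat \<times> pbw) op) = hb C" using HH_0 by (intro bexI[of _ 0]) simp_all
  have h: "C \<in> HH \<Longrightarrow> \<exists>C'\<in>HH. hb C = hb C'" "C \<in> HH \<Longrightarrow> \<exists>C'\<in>HH. - hb C = hb C'" for C
    by blast (intro bexI[of _ "- C"], simp_all add: HH_uminus)
  show "qq \<in> Zh" by (rule Zh_gensI[OF sl2_HH(1)]) (use z h HH_letters in \<open>auto simp: qq_comm[unfolded cm_def] sl2_S\<close>)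
  show "QQ \<in> Zh" by (rule Zh_gensI[OF sl2_HH(2)]) (use z h HH_letters in \<open>auto simp: QQ_comm[unfolded cm_def] sl2_S\<close>)
  show "eu \<in> Zh" by (rule Zh_gensI[OF sl2_HH(3)]) (use z h HH_letters in \<open>auto simp: eu_comm[unfolded cm_def] sl2_S\<close>)
qed

lemma pb_sl2: "pb qq QQ = eu - hb 1" "pb eu qq = cs (-2) qq" "pb eu QQ = cs 2 QQ"
proof -
  show "pb qq QQ = eu - hb 1" by (rule pb_eqI) (rule qQ_comm)
  have "cm eu qq = - hb (qq + qq)" by (simp add: cm_simps eu_comm qq_def)
  then show "pb eu qq = cs (-2) qq" by (intro pb_eqI) (simp add: cs_two flip: cm_def)
  have "cm eu QQ = hb (QQ + QQ)" by (simp add: cm_simps eu_comm QQ_def)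
  then show "pb eu QQ = cs 2 QQ" by (intro pb_eqI) (simp add: cs_two flip: cm_def)
qed

text \<open>Sums of all words are used instead of the ordered monomials x^(d-j) Y^j + y^(d-j) X^j:
  they agree in leading term up to the binomial coefficient, but only the former are permuted up to
  scalars by brackets with q and Q.\<close>

definition AA :: "nat \<Rightarrow> (nat \<times> nat \<times> pbw) op" where "AA j = wd x Y d j + wd y X d j"

lemma wd_HH: "A \<in> HH \<Longrightarrow> B \<in> HH \<Longrightarrow> wd A B n j \<in> HH"
  by (induction A B n j rule: wd.induct) (auto simp: HH_1 HH_0 HH_add HH_mult)

lemma AA_HH: "AA j \<in> HH"
  by (auto simp: AA_def intro!: HH_add wd_HH HH_letters)

lemma QQ_AA: "cm QQ (AA j) = hb (cs (- (of_nat j + 1)) (AA (Suc j)))"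
  using wd_lower[OF QQ_comm(1,4), of d j] wd_lower[OF QQ_comm(2,3), of d j]
  by (simp add: AA_def cm_simps cs_add_left cs_diff_left)

lemma qq_AA: "cm qq (AA (Suc j)) = hb (cs (of_nat d - of_nat j) (AA j))"
  using wd_raise[OF qq_comm(1,4), of d j] wd_raise[OF qq_comm(2,3), of d j]
  by (simp add: AA_def cm_simps)

lemma qq_AA_0: "cm qq (AA 0) = 0"
  by (simp add: AA_def wd_0 cm_simps cm_power qq_comm)

lemma eu_AA: "cm eu (AA j) = hb (cs (2 * of_nat j - of_nat d) (AA j))"
  using wd_weight[OF eu_comm(1,4), of d j] wd_weight[OF eu_comm(2,3), of d j]
  by (simp add: AA_def cm_simps cs_diff_left)

lemma power_comm_sum:
  fixes X x C :: "'e::ring_1"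
  assumes "X * x = x * X - C"
  shows "X * x ^ n = x ^ n * X - (\<Sum>p<n. x ^ p * (C * x ^ (n - 1 - p)))"
proof (induction n)
  case (Suc n)
  have "X * x ^ Suc n = x * (X * x ^ n) - C * x ^ n" by (simp add: assms algebra_simps flip: mult.assoc)
  also have "\<dots> = x ^ Suc n * X - (\<Sum>p<n. x ^ Suc p * (C * x ^ (n - 1 - p))) - C * x ^ n"
    by (simp add: Suc right_diff_distrib sum_distrib_left mult.assoc)
  also have "\<dots> = x ^ Suc n * X - (\<Sum>p<Suc n. x ^ p * (C * x ^ (Suc n - 1 - p)))"
    by (subst sum.lessThan_Suc_shift) simp
  finally show ?case .
qed simp

lemma SS_power: "P.SS f * x ^ m = y ^ m * P.SS (\<lambda>z. f z / z ^ m)" "P.SS f * y ^ m = x ^ m * P.SS (\<lambda>z. f z * z ^ m)"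
proof -
  show "P.SS f * x ^ m = y ^ m * P.SS (\<lambda>z. f z / z ^ m)"
  proof (induction m arbitrary: f)
    case (Suc m)
    have "P.SS f * x ^ Suc m = y * (P.SS (\<lambda>z. f z / z) * x ^ m)" by (simp add: P.SS_xo flip: mult.assoc)
    then show ?case by (simp add: Suc mult.assoc)
  qed simp
  show "P.SS f * y ^ m = x ^ m * P.SS (\<lambda>z. f z * z ^ m)"
  proof (induction m arbitrary: f)
    case (Suc m)
    have "P.SS f * y ^ Suc m = x * (P.SS (\<lambda>z. f z * z) * y ^ m)" by (simp add: P.SS_yo flip: mult.assoc)
    then show ?case by (simp add: Suc mult.assoc)
  qed simp
qed

text \<open>Commuting X with x^d and with y^d produces the same combination of x^p y^(d-1-p) times
  reflections, with opposite signs, because z^d = 1. Only hbar d x^(d-1) survives; similarly for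
  Y.\<close>

lemma A0_comm: "AA 0 * X - X * AA 0 = hb (of_nat d * x ^ (d - 1))" "AA 0 * Y - Y * AA 0 = hb (of_nat d * y ^ (d - 1))"
proof -
  have pw: "z ^ (d - 1 - p) * z ^ Suc p = 1" if "z \<in> U" "p < d" for z p
  proof -
    have "d - 1 - p + Suc p = d" using that by simp
    then show ?thesis using that(1) by (simp only: power_add[symmetric] U_def mem_Collect_eq)
  qed
  have xy: "x ^ p * y ^ m = y ^ m * x ^ p" for p m
    by (rule power_commuting_commutes[OF power_commuting_commutes[OF P.xo_yo, symmetric], symmetric])
  have Cx: "P.Cx * u = hb u - cs a (s1 * u)" for u by (simp add: P.Cx_def s1_def algebra_simps)
  have X1: "X * x ^ d = x ^ d * X - hb (of_nat d * x ^ (d - 1)) + cs a (\<Sum>p<d. x ^ p * (y ^ (d - 1 - p) * P.SS (\<lambda>z. z ^ Suc p)))"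
  proof -
    have "(\<Sum>p<d. x ^ p * (P.Cx * x ^ (d - 1 - p))) =
      (\<Sum>p<d. hb (x ^ (d - 1)) - cs a (x ^ p * (y ^ (d - 1 - p) * P.SS (\<lambda>z. z ^ Suc p))))"
    proof (intro sum.cong refl)
      fix p assume p: "p \<in> {..<d}"
      \<comment> \<open>The relation z^d = 1 turns the exponent -(d-1-p) into p+1, the form in which
        the reflections occur in the computation for y^d.\<close>
      have "P.SS (\<lambda>z. 1 / z ^ (d - 1 - p)) = P.SS (\<lambda>z. z ^ Suc p)"
        using pw p U_nz by (intro P.SS_cong) (simp add: field_simps)
      moreover have "x ^ p * x ^ (d - 1 - p) = x ^ (d - 1)" using p by (simp flip: power_add)
      ultimately show "x ^ p * (P.Cx * x ^ (d - 1 - p)) = hb (x ^ (d - 1)) - cs a (x ^ p * (y ^ (d - 1 - p) * P.SS (\<lambda>z. z ^ Suc p)))"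
        by (simp add: Cx s1_def SS_power right_diff_distrib)
    qed
    then show ?thesis
      unfolding power_comm_sum[OF P.Xo_xo] by (simp add: sum_subtractf cs_sum)
  qed
  have X2: "X * y ^ d = y ^ d * X - cs a (\<Sum>p<d. x ^ p * (y ^ (d - 1 - p) * P.SS (\<lambda>z. z ^ Suc p)))"
  proof -
    have "(\<Sum>p<d. y ^ p * (P.Cy * y ^ (d - 1 - p))) =
      (\<Sum>p<d. cs a (x ^ (d - 1 - p) * (y ^ p * P.SS (\<lambda>z. z ^ Suc (d - 1 - p)))))"
    proof (intro sum.cong refl)
      fix p assume p: "p \<in> {..<d}"
      show "y ^ p * (P.Cy * y ^ (d - 1 - p)) = cs a (x ^ (d - 1 - p) * (y ^ p * P.SS (\<lambda>z. z ^ Suc (d - 1 - p))))"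
        by (simp add: P.Cy_def SS_power flip: mult.assoc) (simp add: xy)
    qed
    also have "\<dots> = (\<Sum>p<d. cs a (x ^ p * (y ^ (d - 1 - p) * P.SS (\<lambda>z. z ^ Suc p))))"
      by (subst sum.nat_diff_reindex[symmetric]) (auto intro!: sum.cong)
    finally show ?thesis unfolding power_comm_sum[OF P.Xo_yo] by (simp add: cs_sum)
  qed
  show "AA 0 * X - X * AA 0 = hb (of_nat d * x ^ (d - 1))"
    by (simp add: AA_def wd_0 distrib_left distrib_right X1 X2)
  have Y2: "Y * y ^ d = y ^ d * Y - hb (of_nat d * y ^ (d - 1)) + cs a (\<Sum>p<d. x ^ p * (y ^ (d - 1 - p) * P.SS (\<lambda>z. z ^ p)))"
  proof -
    have "(\<Sum>p<d. y ^ p * (P.Cx * y ^ (d - 1 - p))) =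
      (\<Sum>p<d. hb (y ^ (d - 1)) - cs a (x ^ (d - 1 - p) * (y ^ p * P.SS (\<lambda>z. z ^ (d - 1 - p)))))"
    proof (intro sum.cong refl)
      fix p assume p: "p \<in> {..<d}"
      have "y ^ p * y ^ (d - 1 - p) = y ^ (d - 1)" using p by (simp flip: power_add)
      then show "y ^ p * (P.Cx * y ^ (d - 1 - p)) = hb (y ^ (d - 1)) - cs a (x ^ (d - 1 - p) * (y ^ p * P.SS (\<lambda>z. z ^ (d - 1 - p))))"
        by (simp add: Cx s1_def SS_power right_diff_distrib flip: mult.assoc) (simp add: xy)
    qed
    moreover have "(\<Sum>p<d. cs a (x ^ (d - 1 - p) * (y ^ p * P.SS (\<lambda>z. z ^ (d - 1 - p))))) =
       (\<Sum>p<d. cs a (x ^ p * (y ^ (d - 1 - p) * P.SS (\<lambda>z. z ^ p))))"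
      by (subst sum.nat_diff_reindex[symmetric]) (auto intro!: sum.cong)
    ultimately show ?thesis
      unfolding power_comm_sum[OF P.Yo_yo] by (simp add: sum_subtractf cs_sum)
  qed
  have Y1: "Y * x ^ d = x ^ d * Y - cs a (\<Sum>p<d. x ^ p * (y ^ (d - 1 - p) * P.SS (\<lambda>z. z ^ p)))"
  proof -
    have "(\<Sum>p<d. x ^ p * (P.Dx * x ^ (d - 1 - p))) =
      (\<Sum>p<d. cs a (x ^ p * (y ^ (d - 1 - p) * P.SS (\<lambda>z. z ^ p))))"
    proof (intro sum.cong refl)
      fix p assume p: "p \<in> {..<d}"
      have "P.SS (\<lambda>z. 1 / z / z ^ (d - 1 - p)) = P.SS (\<lambda>z. z ^ p)"
        using pw p U_nz by (intro P.SS_cong) (simp add: field_simps)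
      then show "x ^ p * (P.Dx * x ^ (d - 1 - p)) = cs a (x ^ p * (y ^ (d - 1 - p) * P.SS (\<lambda>z. z ^ p)))"
        by (simp add: P.Dx_def SS_power)
    qed
    then show ?thesis unfolding power_comm_sum[OF P.Yo_xo] by (simp add: cs_sum)
  qed
  show "AA 0 * Y - Y * AA 0 = hb (of_nat d * y ^ (d - 1))"
    by (simp add: AA_def wd_0 distrib_left distrib_right Y1 Y2)
qed

lemma S_power: assumes z: "z \<in> U" shows "S z * x ^ n = cs (1 / z ^ n) (y ^ n * S z)" "S z * y ^ n = cs (z ^ n) (x ^ n * S z)"
proof -
  show "S z * x ^ n = cs (1 / z ^ n) (y ^ n * S z)"
  proof (induction n)
    case (Suc n)
    have "S z * x ^ Suc n = cs (1 / z) (y * (S z * x ^ n))" by (simp add: S_letters[OF z] flip: mult.assoc)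
    then show ?case by (simp add: Suc mult.assoc)
  qed simp
  show "S z * y ^ n = cs (z ^ n) (x ^ n * S z)"
  proof (induction n)
    case (Suc n)
    have "S z * y ^ Suc n = cs z (x * (S z * y ^ n))" by (simp add: S_letters[OF z] flip: mult.assoc)
    then show ?case by (simp add: Suc mult.assoc)
  qed simp
qed

lemma AA_0_Zh: "AA 0 \<in> Zh"
proof (rule Zh_gensI[OF AA_HH])
  have z: "\<exists>C\<in>HH. (0::(nat \<times> nat \<times> pbw) op) = hb C" using HH_0 by (intro bexI[of _ 0]) simp_all
  have n: "of_nat d * A \<in> HH" if "A \<in> HH" for A using HH_cs[OF that, of "of_nat d"] by (simp add: cs_of_nat)
  have xy: "x * y ^ m = y ^ m * x" "y * x ^ m = x ^ m * y" for m
    by (rule power_commuting_commutes[OF P.xo_yo[symmetric], symmetric],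
        rule power_commuting_commutes[OF P.xo_yo, symmetric])
  fix B assume "B \<in> {x, y, X, Y} \<union> S ` U"
  then consider "B = x" | "B = y" | "B = X" | "B = Y" | v where "v \<in> U" "B = S v" by blast
  then show "\<exists>C\<in>HH. AA 0 * B - B * AA 0 = hb C"
  proof cases
    case 1
    have "AA 0 * x - x * AA 0 = 0" by (simp add: AA_def wd_0 distrib_left distrib_right xy power_commutes)
    then show ?thesis using z 1 by simp
  next
    case 2
    have "AA 0 * y - y * AA 0 = 0" by (simp add: AA_def wd_0 distrib_left distrib_right xy power_commutes)
    then show ?thesis using z 2 by simp
  next
    case 3
    then show ?thesis using A0_comm(1) n[OF HH_power[OF HH_letters(1), of "d - 1"]] by blast
  next
    case 4
    then show ?thesis using A0_comm(2) n[OF HH_power[OF HH_letters(2), of "d - 1"]] by blast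
  next
    case (5 v)
    then have "v ^ d = 1" by (simp add: U_def)
    then have "AA 0 * S v - S v * AA 0 = 0"
      using 5 by (simp add: AA_def wd_0 distrib_left distrib_right S_power)
    then show ?thesis using z 5 by simp
  qed
qed

lemma pb_AA: "pb QQ (AA j) = cs (- (of_nat j + 1)) (AA (Suc j))" "pb qq (AA (Suc j)) = cs (of_nat d - of_nat j) (AA j)"
  "pb qq (AA 0) = 0" "pb eu (AA j) = cs (2 * of_nat j - of_nat d) (AA j)"
  using QQ_AA qq_AA qq_AA_0 eu_AA unfolding cm_def by (auto intro!: pb_eqI simp del: cs_uminus_left)

lemma one_div_mult: "k \<noteq> 0 \<Longrightarrow> 1 / k * k = (1::complex)"
  by simp

text \<open>Centrality modulo hbar is inherited by brackets, so it spreads from \<open>AA 0\<close>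
  along the bracket with Q, whose coefficient -(j+1) is invertible.\<close>

lemma AA_Zh: "AA j \<in> Zh"
proof (induction j)
  case (Suc j)
  have "cs (1 / (- (of_nat j + 1))) (pb QQ (AA j)) \<in> Zh" by (intro Zh_cs Zh_pb sl2_Zh Suc)
  moreover have "of_nat j + 1 \<noteq> (0::complex)" by (metis of_nat_Suc of_nat_eq_0_iff nat.simps(3) add.commute)
  ultimately have "cs (1 / (- (of_nat j + 1)) * (- (of_nat j + 1))) (AA (Suc j)) \<in> Zh"
    unfolding pb_AA(1) cs_simps(1) by simp
  moreover have "1 / (- (of_nat j + 1)) * (- (of_nat j + 1)) = (1::complex)"
    by (intro one_div_mult) (simp only: neg_equal_0_iff_equal not_False_eq_True \<open>of_nat j + 1 \<noteq> (0::complex)\<close>)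
  ultimately show ?case by (simp only: cs_simps(2))
qed (rule AA_0_Zh)

lemma tau_wd: "A \<in> HH \<Longrightarrow> B \<in> HH \<Longrightarrow> tau A = cs c A \<Longrightarrow> tau B = cs c B \<Longrightarrow> tau (wd A B n j) = cs (c ^ n) (wd A B n j)"
proof (induction A B n j rule: wd.induct)
  case (1 u v)
  show ?case by simp (rule tau_eqI, simp)
next
  case (2 u v j)
  show ?case by simp (rule tau_eqI, simp)
qed (simp_all add: tau_add tau_mult HH_mult wd_HH mult.commute[of c])

text \<open>Each of the d letters of a word in x, Y contributes a factor t, and each letter of a
  word in y, X a factor 1/t; both d-th powers are -1.\<close>

lemma tau_AA: "tau (AA j) = - AA j"
proof -
  have "(1 / tt) ^ d = -1" using tt(2) by (simp add: power_divide)
  then show ?thesis unfolding AA_def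
    by (simp add: tau_add wd_HH HH_letters tau_wd[where c = tt] tau_wd[where c = "1 / tt"] tau_gens tt(2))
qed

lemma tau_sl2: "tau qq = qq" "tau QQ = QQ" "tau eu = eu"
proof -
  have "tau s1 = s1" unfolding s1_def
    by (rule tau_eqI) (simp add: Pt.To_SS)
  then show "tau qq = qq" "tau QQ = QQ" "tau eu = eu"
    by (simp_all add: qq_def QQ_def eu_def tau_add tau_mult tau_cs tau_gens HH_letters HH_mult HH_add HH_cs s1_HH)
qed

end

section \<open>Orders and principal symbols of operators\<close>

section \<open>The degree filtration\<close>

fun pdeg :: "nat \<times> nat \<times> pbw \<Rightarrow> nat" where "pdeg (i, j, k, l, b, v) = i + j + k + l"

text \<open>Vectors of degree less than \<open>N\<close> modulo \<open>\<hbar>\<close>.\<close>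

definition Fl :: "nat \<Rightarrow> ((nat \<times> nat \<times> pbw) \<Rightarrow>\<^sub>0 complex poly) set" where
  "Fl N = {p. \<forall>b. coeff (lk p b) 0 \<noteq> 0 \<longrightarrow> pdeg b < N}"

lemma coeff_0_mult: "coeff (p * q) 0 = coeff p 0 * coeff (q :: complex poly) 0"
  by (simp add: coeff_mult)

lemma Fl_simps: "0 \<in> Fl N" "p \<in> Fl N \<Longrightarrow> q \<in> Fl N \<Longrightarrow> p + q \<in> Fl N" "p \<in> Fl N \<Longrightarrow> q \<in> Fl N \<Longrightarrow> p - q \<in> Fl N"
  "p \<in> Fl N \<Longrightarrow> pscale c p \<in> Fl N"
  and Fl_coeff0: "coeff c 0 = 0 \<Longrightarrow> pscale c q \<in> Fl N"
  unfolding Fl_def mem_Collect_eq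
  by (auto simp: lookup_add lookup_minus coeff_0_mult) (metis add_0, metis diff_0_right)

lemma Fl_mono: "p \<in> Fl N \<Longrightarrow> N \<le> M \<Longrightarrow> p \<in> Fl M"
  by (fastforce simp: Fl_def)

lemma Fl_sum: "(\<And>i. i \<in> I \<Longrightarrow> f i \<in> Fl N) \<Longrightarrow> sum f I \<in> Fl N"
  by (induction I rule: infinite_finite_induct) (auto intro: Fl_simps)

lemma Fl_single: "pdeg b < N \<Longrightarrow> Poly_Mapping.single b c \<in> Fl N"
  by (auto simp: Fl_def lookup_single when_def)

lemma Fl_lin:
  assumes "p \<in> Fl M" "\<And>b. pdeg b < M \<Longrightarrow> f b \<in> Fl N"
  shows "lin f p \<in> Fl N"
  unfolding lin_def
proof (rule Fl_sum)
  fix b show "pscale (lk p b) (f b) \<in> Fl N"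
  proof (cases "coeff (lk p b) 0 = 0")
    case False
    then have "pdeg b < M" using assms(1) unfolding Fl_def mem_Collect_eq by blast
    then show ?thesis by (intro Fl_simps(4) assms(2))
  qed (rule Fl_coeff0)
qed

lemma Fl_app: "p \<in> Fl M \<Longrightarrow> (\<And>b. pdeg b < M \<Longrightarrow> app A (basis b) \<in> Fl N) \<Longrightarrow> app A p \<in> Fl N"
  by (simp add: app_basis app_def Fl_lin)

lemma Fl0_app: "p \<in> Fl 0 \<Longrightarrow> app A p \<in> Fl N"
  by (rule Fl_app) auto

text \<open>A has order at most N with symbol f: both raise degrees by at most N modulo hbar, and
  they differ by an operator that raises degrees by less. Membership in \<open>Fl\<close> is a
  strict bound, whence the \<open>Suc\<close>.\<close>

definition sym :: "(nat \<times> nat \<times> pbw) op \<Rightarrow> nat \<Rightarrow> (nat \<times> nat \<times> pbw) op \<Rightarrow> bool" where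
  "sym A N f \<longleftrightarrow> (\<forall>M p. p \<in> Fl (Suc M) \<longrightarrow> app (A - f) p \<in> Fl (M + N)) \<and> (\<forall>M p. p \<in> Fl M \<longrightarrow> app f p \<in> Fl (M + N))"

lemma symI:
  assumes "\<And>b. app (A - f) (basis b) \<in> Fl (pdeg b + N)" "\<And>b. app f (basis b) \<in> Fl (Suc (pdeg b + N))"
  shows "sym A N f"
  unfolding sym_def
  by (intro conjI allI impI; erule Fl_app; rule Fl_mono[OF assms(1)] Fl_mono[OF assms(2)]; simp)

lemma sym_order: assumes "sym A N f" "p \<in> Fl M" shows "app A p \<in> Fl (M + N)"
proof (cases M)
  case 0
  then show ?thesis using assms Fl0_app by auto
next
  case (Suc m)
  have "app (A - f) p \<in> Fl (M + N)" using assms Fl_mono[of "app (A - f) p" "m + N" "M + N"] by (auto simp: sym_def Suc)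
  moreover have "app f p \<in> Fl (M + N)" using assms by (auto simp: sym_def)
  ultimately show ?thesis using Fl_simps(2)[of "app (A - f) p" "M + N" "app f p"] by simp
qed

lemma symD: "sym A N f \<Longrightarrow> p \<in> Fl (Suc M) \<Longrightarrow> app (A - f) p \<in> Fl (M + N)"
  "sym A N f \<Longrightarrow> p \<in> Fl M \<Longrightarrow> app f p \<in> Fl (M + N)"
  unfolding sym_def by blast+

lemma sym_mult: assumes A: "sym A N f" and B: "sym B N' f'" shows "sym (A * B) (N + N') (f * f')"
  unfolding sym_def
proof (intro conjI allI impI)
  fix M p assume p: "p \<in> Fl (Suc M)"
  have "app B p \<in> Fl (Suc (M + N'))" using sym_order[OF B p] by simp
  then have "app (A - f) (app B p) + app f (app (B - f') p) \<in> Fl (M + N' + N)"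
    by (rule Fl_simps(2)[OF symD(1)[OF A] symD(2)[OF A symD(1)[OF B p]]])
  moreover have "app (A * B - f * f') p = app (A - f) (app B p) + app f (app (B - f') p)" by simp
  ultimately show "app (A * B - f * f') p \<in> Fl (M + (N + N'))" by (simp only: ac_simps)
next
  fix M p assume p: "p \<in> Fl M"
  show "app (f * f') p \<in> Fl (M + (N + N'))" using symD(2)[OF A symD(2)[OF B p]] by (simp add: ac_simps)
qed

lemma sym_add: "sym A N f \<Longrightarrow> sym B N f' \<Longrightarrow> sym (A + B) N (f + f')"
proof -
  assume *: "sym A N f" "sym B N f'"
  have "app (A + B - (f + f')) p = app (A - f) p + app (B - f') p" for p by simp
  then show ?thesis using * unfolding sym_def by (auto intro!: Fl_simps(2) simp del: app_ops(4))
qed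

lemma sym_osc: "sym A N f \<Longrightarrow> sym (osc c A) N (osc c f)"
proof -
  assume *: "sym A N f"
  have "app (osc c A - osc c f) p = pscale c (app (A - f) p)" for p by simp
  then show ?thesis using * unfolding sym_def by (auto intro!: Fl_simps(4) simp del: app_ops(4))
qed

lemma sym_cs: "sym A N f \<Longrightarrow> sym (cs c A) N (cs c f)"
  by (simp add: cs_def sym_osc)

lemma sym_uminus: "sym A N f \<Longrightarrow> sym (- A) N (- f)"
  using sym_cs[of A N f "-1"] by simp

lemma sym_1: "sym 1 0 1"
  by (rule symI) (auto intro!: Fl_simps Fl_single)

lemma sym_0: "sym 0 N 0"
  by (rule symI) (auto intro!: Fl_simps)

text \<open>Multiplication by a monomial in the commutative polynomial ring.\<close>

definition mu :: "nat \<Rightarrow> nat \<Rightarrow> nat \<Rightarrow> nat \<Rightarrow> (nat \<times> nat \<times> pbw) op" where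
  "mu i j k l = Op (\<lambda>(i', j', k', l', g). basis (i + i', j + j', k + k', l + l', g))"

lemma mu_basis [simp]: "app (mu i j k l) (basis (i', j', k', l', g)) = basis (i + i', j + j', k + k', l + l', g)"
  by (simp add: mu_def app_basis)

lemma mu_mult: "mu i j k l * mu i' j' k' l' = mu (i + i') (j + j') (k + k') (l + l')"
  by (rule op_ext) (auto simp: ac_simps)

lemma mu_0: "mu 0 0 0 0 = 1"
  by (rule op_ext) auto

lemma mu_Fl: "app (mu i j k l) (basis b) \<in> Fl (Suc (pdeg b + (i + j + k + l)))"
  by (cases b) (auto intro!: Fl_single)

context cherednik
begin

lemma S_Fl: "app (S z) (basis b) \<in> Fl (Suc (pdeg b))"
proof -
  obtain i j k l g v where b: "b = (i, j, k, l, g, v)" by (cases b) auto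
  have "app (S z) (basis b) = Poly_Mapping.single (j, i, l, k, \<not> g, z / v) ([:z ^ j / z ^ i:] * [:z ^ k / z ^ l:])"
    unfolding b by (subst P.So_basis) (simp add: P.emb_def)
  then show ?thesis by (simp add: Fl_single b)
qed

lemma SS_Fl: "app (P.SS f) (basis b) \<in> Fl (Suc (pdeg b))"
  unfolding P.SS_def app_op_sum app_cs by (intro Fl_sum Fl_simps(4) S_Fl)

lemma C_Fl: "app P.Cx (basis b) \<in> Fl (Suc (pdeg b))" "app P.Cy (basis b) \<in> Fl (Suc (pdeg b))"
  "app P.Dx (basis b) \<in> Fl (Suc (pdeg b))"
  by (simp_all add: P.Cx_def P.Cy_def P.Dx_def) (auto intro!: Fl_simps SS_Fl Fl_single)

lemma x_Fl: "p \<in> Fl N \<Longrightarrow> app x p \<in> Fl (Suc N)" "p \<in> Fl N \<Longrightarrow> app y p \<in> Fl (Suc N)"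
  by (erule Fl_app; auto intro!: Fl_single)+

lemma x_eq_mu: "x = mu (Suc 0) 0 0 0" "y = mu 0 (Suc 0) 0 0"
  by (auto intro!: op_ext)

lemma sym_xy: "sym x 1 (mu 1 0 0 0)" "sym y 1 (mu 0 1 0 0)"
  by (rule symI; simp add: x_eq_mu Fl_simps; use mu_Fl[of "Suc 0" 0 0 0] mu_Fl[of 0 "Suc 0" 0 0] in simp)+

text \<open>A Dunkl operator has multiplication by X or Y as its symbol, because the commutators
  picked up on the way past x and y preserve degrees whereas multiplication by X or Y raises
  them.\<close>

lemma dunkl_sym:
  assumes C: "\<And>b. app C (basis b) \<in> Fl (Suc (pdeg b))" "\<And>b. app C' (basis b) \<in> Fl (Suc (pdeg b))"
    and N: "\<And>k l b v. app N (basis (k, l, b, v)) = basis (k + k0, l + l0, b, v)" and kl: "k0 + l0 = 1"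
  shows "sym (P.dunkl C C' N) 1 (mu 0 0 k0 l0)"
proof (rule symI)
  fix b :: "nat \<times> nat \<times> pbw"
  obtain i j k l g v where b: "b = (i, j, k, l, g, v)" by (cases b) auto
  show "app (mu 0 0 k0 l0) (basis b) \<in> Fl (Suc (pdeg b + 1))" using mu_Fl[of 0 0 k0 l0 b] kl by simp
  let ?n = "(k, l, g, v)"
  let ?d = "\<lambda>i j. P.dunkl1 C C' N i j ?n - basis (i, j, k + k0, l + l0, g, v)"
  have 0: "?d 0 j \<in> Fl (Suc (j + k + l))" for j
  proof (induction j)
    case 0
    have "P.dunkl1 C C' N 0 0 ?n = P.emb 0 0 (app N (basis ?n))" by (simp add: app_basis)
    then show ?case by (simp add: N Fl_simps)
  next
    case (Suc j)
    have "?d 0 (Suc j) = app y (?d 0 j) - app C' (basis (0, j, ?n))" by simp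
    then show ?case
      by (rule ssubst) (rule Fl_simps(3)[OF Fl_mono[OF x_Fl(2)[OF Suc]] Fl_mono[OF C(2)]]; simp)
  qed
  have "?d i j \<in> Fl (Suc (i + j + k + l))"
  proof (induction i)
    case (Suc i)
    have "?d (Suc i) j = app x (?d i j) - app C (basis (i, j, ?n))" by simp
    then show ?case
      by (rule ssubst) (rule Fl_simps(3)[OF Fl_mono[OF x_Fl(1)[OF Suc]] Fl_mono[OF C(1)]]; simp)
  qed (use 0 in simp)
  then show "app (P.dunkl C C' N - mu 0 0 k0 l0) (basis b) \<in> Fl (pdeg b + 1)"
    by (simp add: b P.dunkl_basis add.commute)
qed

lemma sym_XY: "sym X 1 (mu 0 0 1 0)" "sym Y 1 (mu 0 0 0 1)"
  unfolding P.Xo_def P.Yo_def by (rule dunkl_sym; simp add: C_Fl)+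

lemma sym_power: "sym A N f \<Longrightarrow> sym (A ^ n) (n * N) (f ^ n)"
  by (induction n) (auto simp: sym_1 intro: sym_mult)

lemma mu_power: "mu i j k l ^ n = mu (n * i) (n * j) (n * k) (n * l)"
  by (induction n) (simp_all add: mu_0 mu_mult)

lemma sym_ordered: "sym (x ^ i * y ^ j * X ^ k * Y ^ l) (i + j + k + l) (mu i j k l)"
proof -
  have "sym (x ^ i * y ^ j * X ^ k * Y ^ l) (i * 1 + j * 1 + k * 1 + l * 1)
     (mu 1 0 0 0 ^ i * mu 0 1 0 0 ^ j * mu 0 0 1 0 ^ k * mu 0 0 0 1 ^ l)"
    by (intro sym_mult sym_power sym_xy sym_XY)
  then show ?thesis by (simp add: mu_power mu_mult)
qed

text \<open>The orbit sum of a monomial under exchanging x with y and X with Y; a monomial fixed by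
  the exchange is counted twice.\<close>

definition sg :: "nat \<Rightarrow> nat \<Rightarrow> nat \<Rightarrow> nat \<Rightarrow> (nat \<times> nat \<times> pbw) op" where
  "sg i j k l = mu i j k l + mu j i l k"

lemma sg_swap: "sg i j k l = sg j i l k"
  by (simp add: sg_def add.commute)

lemma sym_sl2: "sym qq 2 (mu 1 1 0 0)" "sym QQ 2 (mu 0 0 1 1)" "sym eu 2 (sg 1 0 1 0)"
proof -
  show "sym qq 2 (mu 1 1 0 0)" "sym QQ 2 (mu 0 0 1 1)"
    using sym_mult[OF sym_xy] sym_mult[OF sym_XY] by (simp_all add: qq_def QQ_def mu_mult numeral_2_eq_2)
  have "sym (cs a s1) 2 0"
    by (rule symI) (auto intro!: Fl_simps Fl_mono[OF SS_Fl] simp: s1_def)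
  moreover have "sym (x * X) 2 (mu 1 0 1 0)" "sym (y * Y) 2 (mu 0 1 0 1)"
    using sym_mult[OF sym_xy(1) sym_XY(1)] sym_mult[OF sym_xy(2) sym_XY(2)] by (simp_all add: mu_mult numeral_2_eq_2)
  ultimately show "sym eu 2 (sg 1 0 1 0)"
    using sym_add[of "x * X + y * Y" 2 "sg 1 0 1 0" "cs a s1" 0] sym_add[of "x * X" 2 _ "y * Y"] by (simp add: eu_def sg_def)
qed

lemma sym_wd: "sym u 1 f \<Longrightarrow> sym v 1 f' \<Longrightarrow> sym (wd u v n j) n (wd f f' n j)"
proof (induction u v n j rule: wd.induct)
  case (1 u v)
  then show ?case using sym_1 by simp
next
  case (2 u v j)
  then show ?case using sym_0 by simp
next
  case (3 u v n)
  then show ?case using sym_mult[of u 1 f "wd u v n 0" n] by simp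
next
  case (4 u v n j)
  then show ?case using sym_mult[of u 1 f "wd u v n (Suc j)" n] sym_mult[of v 1 f' "wd u v n j" n]
    by (auto intro!: sym_add)
qed

lemma wd_mu: "wd (mu 1 0 0 0) (mu 0 0 0 1) n j = cs (of_nat (n choose j)) (mu (n - j) 0 0 j)"
  "wd (mu 0 1 0 0) (mu 0 0 1 0) n j = cs (of_nat (n choose j)) (mu 0 (n - j) j 0)"
proof -
  have "wd (mu 1 0 0 0) (mu 0 0 0 1) n j = cs (of_nat (n choose j)) (mu (n - j) 0 0 j) \<and>
    wd (mu 0 1 0 0) (mu 0 0 1 0) n j = cs (of_nat (n choose j)) (mu 0 (n - j) j 0)"
  proof (induction n arbitrary: j)
    case 0
    then show ?case by (cases j) (simp_all add: mu_0)
  next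
    case (Suc n)
    show ?case
    proof (cases j)
      case 0
      then show ?thesis using Suc[of 0] by (simp add: mu_mult)
    next
      case (Suc i)
      show ?thesis
      proof (cases "Suc i \<le> n")
        case True
        then have "Suc (n - Suc i) = n - i" by simp
        then show ?thesis using Suc.IH by (simp add: Suc mu_mult cs_add_left)
      next
        case False
        then show ?thesis using Suc.IH by (simp add: Suc mu_mult binomial_eq_0 cs_add_left)
      qed
    qed
  qed
  then show "wd (mu 1 0 0 0) (mu 0 0 0 1) n j = cs (of_nat (n choose j)) (mu (n - j) 0 0 j)"
    "wd (mu 0 1 0 0) (mu 0 0 1 0) n j = cs (of_nat (n choose j)) (mu 0 (n - j) j 0)" by auto
qed

lemma sym_AA: "sym (AA j) d (cs (of_nat (d choose j)) (sg (d - j) 0 0 j))"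
proof -
  have "sym (AA j) d (wd (mu 1 0 0 0) (mu 0 0 0 1) d j + wd (mu 0 1 0 0) (mu 0 0 1 0) d j)"
    unfolding AA_def by (intro sym_add sym_wd sym_xy sym_XY)
  then show ?thesis by (simp only: wd_mu sg_def cs_simps)
qed

section \<open>The preimage of m_0 and the invariants of W on the sum of V and its dual\<close>

section \<open>The ideal \<open>m\<^sub>0\<close> and its complement\<close>

text \<open>The preimages in \<open>Zh\<close> of \<open>m\<^sub>0\<close> and \<open>m\<^sub>0\<^sup>2\<close>.\<close>

inductive_set M0 :: "(nat \<times> nat \<times> pbw) op set" where
  q: "qq \<in> M0"
| Q: "QQ \<in> M0"
| e: "eu \<in> M0"
| A: "j \<le> d \<Longrightarrow> AA j \<in> M0"
| h: "B \<in> HH \<Longrightarrow> hb B \<in> M0"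
| add: "A \<in> M0 \<Longrightarrow> B \<in> M0 \<Longrightarrow> A + B \<in> M0"
| mult: "A \<in> M0 \<Longrightarrow> B \<in> Zh \<Longrightarrow> B * A \<in> M0"

lemma M0_Zh: "A \<in> M0 \<Longrightarrow> A \<in> Zh"
  by (induction rule: M0.induct) (auto intro: sl2_Zh AA_Zh Zh_hb Zh_add Zh_mult)

lemma M0_cs: "A \<in> M0 \<Longrightarrow> cs c A \<in> M0"
  using M0.mult[of A "cs c 1"] by (simp add: Zh_cs Zh_1)

lemma M0_uminus: "A \<in> M0 \<Longrightarrow> - A \<in> M0" using M0_cs[of A "-1"] by simp
lemma M0_diff: "A \<in> M0 \<Longrightarrow> B \<in> M0 \<Longrightarrow> A - B \<in> M0" using M0.add[of A "- B"] M0_uminus[of B] by simp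
lemma M0_0: "0 \<in> M0" using M0.h[OF HH_0] by simp
lemma M0_sum: "(\<And>i. i \<in> I \<Longrightarrow> f i \<in> M0) \<Longrightarrow> sum f I \<in> M0"
  by (induction I rule: infinite_finite_induct) (auto intro: M0_0 M0.add)

lemma M0_multr: "A \<in> M0 \<Longrightarrow> B \<in> Zh \<Longrightarrow> A * B \<in> M0"
proof -
  assume A: "A \<in> M0" "B \<in> Zh"
  have "A * B = B * A + hb (pb A B)" using pb(2)[OF M0_Zh[OF A(1)] Zh_HH[OF A(2)]] by (metis add.commute diff_add_cancel)
  then show ?thesis using M0.mult[OF A] M0.h[OF pb(1)[OF M0_Zh[OF A(1)] Zh_HH[OF A(2)]]] by (simp add: M0.add)
qed

definition CM :: "(nat \<times> nat \<times> pbw) op set" where "CM = {A. \<exists>c. A - cs c 1 \<in> M0}"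

lemma CM_simps: "A \<in> M0 \<Longrightarrow> A \<in> CM" "cs c 1 \<in> CM" "A \<in> CM \<Longrightarrow> B \<in> CM \<Longrightarrow> A + B \<in> CM" "A \<in> CM \<Longrightarrow> cs c A \<in> CM"
proof -
  show "A \<in> M0 \<Longrightarrow> A \<in> CM" unfolding CM_def by (auto intro!: exI[of _ 0])
  show "cs c 1 \<in> CM" unfolding CM_def using M0_0 by (auto intro!: exI[of _ c])
  assume A: "A \<in> CM"
  then obtain c1 where c1: "A - cs c1 1 \<in> M0" by (auto simp: CM_def)
  show "cs c A \<in> CM" unfolding CM_def using M0_cs[OF c1, of c] by (auto intro!: exI[of _ "c * c1"])
  assume "B \<in> CM"
  then obtain c2 where c2: "B - cs c2 1 \<in> M0" by (auto simp: CM_def)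
  have "A + B - cs (c1 + c2) 1 = (A - cs c1 1) + (B - cs c2 1)" by (simp add: cs_add_left)
  then have "A + B - cs (c1 + c2) 1 \<in> M0" using M0.add[OF c1 c2] by (simp only:)
  then show "A + B \<in> CM" unfolding CM_def mem_Collect_eq by (rule exI)
qed

text \<open>Working with leading terms of elements of C + \<open>M0\<close> reduces the generation
  of the centre to a statement on polynomial invariants; lower terms are removed later, in
  \<open>Fl_CM\<close>.\<close>

definition GG :: "nat \<Rightarrow> (nat \<times> nat \<times> pbw) op \<Rightarrow> bool" where
  "GG N f \<longleftrightarrow> (\<exists>A\<in>Zh \<inter> CM. sym A N f)"

lemma GG_I: "A \<in> Zh \<Longrightarrow> A \<in> CM \<Longrightarrow> sym A N f \<Longrightarrow> GG N f"
  unfolding GG_def by blast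

lemma GG_E: "GG N f \<Longrightarrow> (\<And>A. A \<in> Zh \<Longrightarrow> A \<in> CM \<Longrightarrow> sym A N f \<Longrightarrow> Q) \<Longrightarrow> Q"
  unfolding GG_def by blast

lemma GG_gen: "A \<in> M0 \<Longrightarrow> sym A N f \<Longrightarrow> GG N' f' \<Longrightarrow> GG (N + N') (f * f')"
  by (erule GG_E, rule GG_I[OF M0_Zh[OF M0_multr] CM_simps(1)[OF M0_multr] sym_mult])

lemma GG_add: "GG N f \<Longrightarrow> GG N f' \<Longrightarrow> GG N (f + f')"
  by (elim GG_E, rule GG_I[OF Zh_add CM_simps(3) sym_add])

lemma GG_cs: "GG N f \<Longrightarrow> GG N (cs c f)"
  by (elim GG_E, rule GG_I[OF Zh_cs CM_simps(4) sym_cs])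

lemma GG_diff: "GG N f \<Longrightarrow> GG N f' \<Longrightarrow> GG N (f - f')"
  using GG_add[of N f "- f'"] GG_cs[of N f' "-1"] by simp

lemma AA_M0_sym: assumes "j \<le> d" shows "cs (1 / of_nat (d choose j)) (AA j) \<in> M0" "sym (cs (1 / of_nat (d choose j)) (AA j)) d (sg (d - j) 0 0 j)"
proof -
  show "cs (1 / of_nat (d choose j)) (AA j) \<in> M0" by (intro M0_cs M0.A assms)
  have "of_nat (d choose j) \<noteq> (0::complex)" using assms by simp
  then show "sym (cs (1 / of_nat (d choose j)) (AA j)) d (sg (d - j) 0 0 j)"
    using sym_cs[OF sym_AA[of j], of "1 / of_nat (d choose j)"] by simp
qed

text \<open>The elements \<open>q, Q, eu, a\<^sub>j\<close> generate all invariants of the dihedral group on \<open>V \<times> V\<^sup>*\<close>.\<close>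

lemma mod_Suc_cancel: "Suc m mod d = Suc n mod d \<Longrightarrow> m mod d = n mod d"
proof -
  assume "Suc m mod d = Suc n mod d"
  then have "int (Suc m) mod int d = int (Suc n) mod int d" by (simp only: zmod_int[symmetric])
  then have "(int (Suc m) - 1) mod int d = (int (Suc n) - 1) mod int d" by (intro mod_diff_cong refl)
  then have "int m mod int d = int n mod int d" by simp
  then show "m mod d = n mod d" by (simp only: zmod_int[symmetric] of_nat_eq_iff)
qed

lemma GG_sg: "i + j + k + l = N \<Longrightarrow> (i + l) mod d = (j + k) mod d \<Longrightarrow> GG N (sg i j k l)"
proof (induction N arbitrary: i j k l rule: less_induct)
  case (less N)
  have q: "GG N (sg i j k l)" if "i + j + k + l = N" "(i + l) mod d = (j + k) mod d" "i > 0" "j > 0" for i j k l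
  proof -
    define i' j' where "i' = i - 1" and "j' = j - 1"
    then have ij: "i = Suc i'" "j = Suc j'" using that by auto
    have "(i' + l) mod d = (j' + k) mod d" by (rule mod_Suc_cancel, insert that(2)) (simp add: ij)
    then have "GG (N - 2) (sg i' j' k l)" using that by (intro less.IH) (auto simp: ij)
    then have "GG (2 + (N - 2)) (mu 1 1 0 0 * sg i' j' k l)" by (rule GG_gen[OF M0.q sym_sl2(1)])
    moreover have "2 + (N - 2) = N" using that by auto
    ultimately show ?thesis by (simp add: sg_def distrib_left mu_mult ij)
  qed
  have Q: "GG N (sg i j k l)" if "i + j + k + l = N" "(i + l) mod d = (j + k) mod d" "k > 0" "l > 0" for i j k l
  proof -
    define k' l' where "k' = k - 1" and "l' = l - 1"
    then have kl: "k = Suc k'" "l = Suc l'" using that by auto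
    have "(i + l') mod d = (j + k') mod d" by (rule mod_Suc_cancel, insert that(2)) (simp add: kl)
    then have "GG (N - 2) (sg i j k' l')" using that by (intro less.IH) (auto simp: kl)
    then have "GG (2 + (N - 2)) (mu 0 0 1 1 * sg i j k' l')" by (rule GG_gen[OF M0.Q sym_sl2(2)])
    moreover have "2 + (N - 2) = N" using that by auto
    ultimately show ?thesis by (simp add: sg_def distrib_left mu_mult kl)
  qed
  have E: "GG N (sg i 0 k 0)" if "i + k = N" "i mod d = k mod d" "i > 0" "k > 0" for i k
  proof -
    define i' k' where "i' = i - 1" and "k' = k - 1"
    then have ik: "i = Suc i'" "k = Suc k'" using that by auto
    show ?thesis
    proof (cases "i' = 0 \<and> k' = 0")
      case True
      then have "N = 2" using that ik by simp
      then show ?thesis using True ik GG_I[OF M0_Zh[OF M0.e] CM_simps(1)[OF M0.e] sym_sl2(3)] by simp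
    next
      case False
      have w: "i' mod d = k' mod d" by (rule mod_Suc_cancel, insert that(2)) (simp add: ik)
      then have "GG (N - 2) (sg i' 0 k' 0)" using that by (intro less.IH) (auto simp: ik)
      then have "GG (2 + (N - 2)) (sg 1 0 1 0 * sg i' 0 k' 0)" by (rule GG_gen[OF M0.e sym_sl2(3)])
      moreover have "2 + (N - 2) = N" using that ik by auto
      ultimately have 1: "GG N (sg 1 0 1 0 * sg i' 0 k' 0)" by simp
      have w': "(i' + 1) mod d = (1 + k') mod d" using w by (simp add: mod_Suc)
      \<comment> \<open>The cross term of the product is divisible by xy if i' > 0, and otherwise by
        XY because then k' > 0; both cases are settled above.\<close>
      have 2: "GG N (sg i' 1 k' 1)"
      proof (cases "i' > 0")
        case True
        then show ?thesis using that ik w' by (intro q) auto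
      next
        case False
        then show ?thesis using \<open>\<not> (i' = 0 \<and> k' = 0)\<close> that ik w' by (intro Q) auto
      qed
      have "sg i 0 k 0 = sg 1 0 1 0 * sg i' 0 k' 0 - sg i' 1 k' 1"
        by (simp add: sg_def ik distrib_left distrib_right mu_mult)
      then show ?thesis using GG_diff[OF 1 2] by simp
    qed
  qed
  have T: "GG N (sg i 0 0 l)" if t: "i + l = N" "N mod d = 0" "N > 0" for i l
  proof (cases "N = d")
    case True
    then have "l \<le> d" "d - l = i" using t by auto
    then show ?thesis using GG_I[OF M0_Zh[OF AA_M0_sym(1)] CM_simps(1)[OF AA_M0_sym(1)] AA_M0_sym(2), of l] True by simp
  next
    case False
    obtain c where c: "N = d * c" using t(2) by auto
    with False t(3) have "c \<ge> 2" by (cases c) auto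
    then have N: "N \<ge> 2 * d" using c by simp
    \<comment> \<open>Split off a factor of degree d with as many x as possible. The product of the
      two orbit sums is the desired one plus x^i1 y^i2 X^l2 Y^l1 and its mirror image. If i < d this
      cross term is divisible by XY; otherwise i1 = d and it is divisible by xy or of the form x^d
      X^l2.\<close>
    define i1 l1 where "i1 = min i d" and "l1 = d - i1"
    define i2 l2 where "i2 = i - i1" and "l2 = l - l1"
    have s: "i = i1 + i2" "l = l1 + l2" "i1 + l1 = d" "i2 + l2 = N - d"
      using t N d_pos by (auto simp: i1_def l1_def i2_def l2_def)
    have w: "(i2 + l2) mod d = 0" unfolding s(4) using N t(2) by (simp add: c)
    have "GG (N - d) (sg i2 0 0 l2)" using s N d_pos w by (intro less.IH) auto
    then have "GG (d + (N - d)) (sg (d - l1) 0 0 l1 * sg i2 0 0 l2)"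
      using s(3) by (intro GG_gen[OF AA_M0_sym]) auto
    moreover have "d + (N - d) = N" "d - l1 = i1" using N s by auto
    ultimately have 1: "GG N (sg i1 0 0 l1 * sg i2 0 0 l2)" by simp
    have 2: "GG N (sg i1 i2 l2 l1)"
    proof (cases "i < d")
      case True
      then have "i1 = i" by (simp add: i1_def)
      then have "i2 = 0" by (simp add: i2_def)
      have "l1 > 0" using True \<open>i1 = i\<close> s(3) by linarith
      moreover have "l2 > 0" using \<open>i2 = 0\<close> s(4) N d_pos by linarith
      moreover have "(i1 + l1) mod d = (i2 + l2) mod d" using s(3) w by simp
      moreover have "i1 + i2 + l2 + l1 = N" using s(3,4) N by linarith
      ultimately show ?thesis by (intro Q)
    next
      case False
      then have i1: "i1 = d" "l1 = 0" by (auto simp: i1_def l1_def)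
      show ?thesis
      proof (cases "i2 > 0")
        case True
        moreover have "(i1 + l1) mod d = (i2 + l2) mod d" using s(3) w by simp
        moreover have "i1 + i2 + l2 + l1 = N" using s(3,4) N by linarith
        ultimately show ?thesis using i1 d_pos by (intro q) simp_all
      next
        case False
        then have "i1 + l2 = N" "i1 mod d = l2 mod d" "l2 > 0" using s(4) N w i1 d_pos by simp_all
        then have "GG N (sg i1 0 l2 0)" using i1 d_pos by (intro E) simp_all
        then show ?thesis using False i1 by simp
      qed
    qed
    have "sg i 0 0 l = sg i1 0 0 l1 * sg i2 0 0 l2 - sg i1 i2 l2 l1"
      by (simp add: sg_def s(1,2) distrib_left distrib_right mu_mult add.commute)
    then show ?thesis using GG_diff[OF 1 2] by simp
  qed
  consider "N = 0" | "N > 0" "i > 0" "j > 0" | "N > 0" "k > 0" "l > 0" | "N > 0" "j = 0" "l = 0" | "N > 0" "j = 0" "k = 0"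
    | "N > 0" "i = 0" "k = 0" | "N > 0" "i = 0" "l = 0"
    by blast
  then show ?case
  proof cases
    case 1
    then have "sg i j k l = cs 2 1" using less.prems by (simp add: sg_def mu_0 cs_two)
    moreover have "GG N (cs 2 1)" using 1 GG_cs[OF GG_I[OF Zh_1 _ sym_1], of 2] CM_simps(2)[of 1] by simp
    ultimately show ?thesis by simp
  next
    case 2
    then show ?thesis using q less.prems by blast
  next
    case 3
    then show ?thesis using Q less.prems by blast
  next
    case 4
    consider "i = 0" | "k = 0" | "i > 0" "k > 0" by blast
    then show ?thesis
    proof cases
      case 1
      then show ?thesis using 4 less.prems T[of 0 k] by (subst sg_swap) auto
    next
      case 2
      then show ?thesis using 4 less.prems T[of i 0] by auto
    next
      case 3
      then show ?thesis using 4 less.prems E[of i k] by auto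
    qed
  next
    case 5
    then show ?thesis using less.prems T[of i l] by auto
  next
    case 6
    consider "j = 0" | "l = 0" | "j > 0" "l > 0" by blast
    then show ?thesis
    proof cases
      case 1
      then show ?thesis using 6 less.prems T[of 0 l] by auto
    next
      case 2
      then show ?thesis using 6 less.prems T[of j 0] by (subst sg_swap) auto
    next
      case 3
      then show ?thesis using 6 less.prems E[of j l] by (subst sg_swap) auto
    qed
  next
    case 7
    then show ?thesis using less.prems T[of j k] by (subst sg_swap) auto
  qed
qed

end

lemma lookup_lin_inj:
  assumes f: "\<And>b. f b = Poly_Mapping.single (g b) (c b)" and g: "inj g"
  shows "lk (lin f p) (g b) = lk p b * c b" "b' \<notin> range g \<Longrightarrow> lk (lin f p) b' = 0"
proof -
  have "lk (lin f p) (g b) = (\<Sum>x\<in>Poly_Mapping.keys p. if x = b then lk p x * c x else 0)"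
    unfolding lin_def lookup_sum by (intro sum.cong refl) (simp add: f lookup_single when_def inj_eq[OF g])
  also have "\<dots> = lk p b * c b"
    by (cases "b \<in> Poly_Mapping.keys p") (auto simp: in_keys_iff)
  finally show "lk (lin f p) (g b) = lk p b * c b" .
  show "b' \<notin> range g \<Longrightarrow> lk (lin f p) b' = 0"
    unfolding lin_def lookup_sum by (intro sum.neutral ballI) (auto simp: f lookup_single when_def)
qed

lemma app_eq_lin: assumes "\<And>b. col A b = f b" shows "app A p = lin f p"
proof -
  have "col A = f" using assms by (rule ext)
  then show ?thesis by (simp add: app_def)
qed

context cherednik
begin

section \<open>Leading terms of central elements; the centre is C + m_0\<close>

section \<open>The operators that are central modulo \<open>\<hbar>\<close>\<close>

definition c0 :: "(nat \<times> nat \<times> pbw) op \<Rightarrow> nat \<times> nat \<times> pbw \<Rightarrow> complex" where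
  "c0 A b = coeff (lk (app A e0) b) 0"

lemma c0_Fl: "app A e0 \<in> Fl N \<longleftrightarrow> (\<forall>b. c0 A b \<noteq> 0 \<longrightarrow> pdeg b < N)"
  by (simp only: c0_def Fl_def mem_Collect_eq)

lemma c0_US: "A \<in> HH \<Longrightarrow> c0 A b \<noteq> 0 \<Longrightarrow> b \<in> US"
  using HH_keys[of A] unfolding c0_def by (metis coeff_0 in_keys_iff subsetD)

lemma e0_Fl: "e0 \<in> Fl (Suc 0)"
  by (simp add: e0_def Fl_single)

definition shx :: "nat \<times> nat \<times> pbw \<Rightarrow> nat \<times> nat \<times> pbw" where
  "shx = (\<lambda>(i, j, k, l, g, v). if g then (i, Suc j, k, l, g, v) else (Suc i, j, k, l, g, v))"

text \<open>The leading term of right multiplication by x: a rotation moves past x with the factor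
  v, a reflection turns x into y/v.\<close>

definition rx :: "nat \<times> nat \<times> pbw \<Rightarrow> (nat \<times> nat \<times> pbw) \<Rightarrow>\<^sub>0 complex poly" where
  "rx = (\<lambda>(i, j, k, l, g, v). Poly_Mapping.single (shx (i, j, k, l, g, v)) [:if g then 1 / v else v:])"

lemma rep_x: assumes v: "v \<in> U" shows "P.rep (gmat True v) * x = cs (1 / v) (y * P.rep (gmat True v))"
    "P.rep (gmat False v) * x = cs v (x * P.rep (gmat False v))"
proof -
  show "P.rep (gmat True v) * x = cs (1 / v) (y * P.rep (gmat True v))"
    by (simp add: gmat_def P.rep_S S_letters[OF v])
  have "S v * S 1 * x = S v * (S 1 * x)" by (simp add: mult.assoc)
  also have "\<dots> = S v * y * S 1" by (simp add: S_letters[OF U_1] mult.assoc)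
  also have "\<dots> = cs v (x * (S v * S 1))" by (simp add: S_letters[OF v] mult.assoc)
  finally show "P.rep (gmat False v) * x = cs v (x * P.rep (gmat False v))"
    using U_nz[OF v] by (simp add: gmat_def P.rep_R)
qed

lemma ob_x: assumes "b \<in> US" shows "app (ob b) (app x e0) - rx b \<in> Fl (Suc (pdeg b))"
proof -
  obtain i j k l g v where b: "b = (i, j, k, l, g, v)" and v: "v \<in> U" using assms by (auto simp: US_def)
  let ?A = "x ^ i * y ^ j * X ^ k * Y ^ l" and ?c = "[:if g then 1 / v else v:]"
  define b1 :: "nat \<times> nat \<times> pbw" where "b1 = (if g then (0, 1, 0, 0, g, v) else (1, 0, 0, 0, g, v))"
  have "app (P.rep (gmat g v)) (app x e0) = app (P.rep (gmat g v) * x) e0" by simp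
  also have "\<dots> = pscale ?c (basis b1)"
    by (cases g) (simp_all add: rep_x[OF v] rep_e0[OF v] b1_def)
  finally have e1: "app (P.rep (gmat g v)) (app x e0) = pscale ?c (basis b1)" .
  have "app (ob b) (app x e0) = app ?A (app (P.rep (gmat g v)) (app x e0))" by (simp add: ob_def b)
  also have "\<dots> = pscale ?c (app ?A (basis b1))" unfolding e1 by (rule app_simps(5))
  finally have "app (ob b) (app x e0) = pscale ?c (app ?A (basis b1))" .
  moreover have "rx b = pscale ?c (app (mu i j k l) (basis b1))"
    by (simp add: rx_def shx_def b b1_def)
  ultimately have e: "app (ob b) (app x e0) - rx b = pscale ?c (app (?A - mu i j k l) (basis b1))" by simp
  have "basis b1 \<in> Fl (Suc 1)" by (auto simp: b1_def intro: Fl_single)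
  then have "app (?A - mu i j k l) (basis b1) \<in> Fl (Suc (pdeg b))"
    using symD(1)[OF sym_ordered[of i j k l], of "basis b1" 1] by (simp only: b pdeg.simps plus_1_eq_Suc)
  then show ?thesis unfolding e by (rule Fl_simps(4))
qed

lemma app_HH: assumes "A \<in> HH" shows "app A p = (\<Sum>b\<in>Poly_Mapping.keys (app A e0). pscale (lk (app A e0) b) (app (ob b) p))"
proof -
  have "app A p = app (\<Sum>b\<in>Poly_Mapping.keys (app A e0). osc (lk (app A e0) b) (ob b)) p"
    using HH_expand[OF assms] by (rule arg_cong)
  then show ?thesis by (simp only: app_op_sum app_osc)
qed

lemma right_x: assumes A: "A \<in> HH" "app A e0 \<in> Fl (Suc N)" shows "app A (app x e0) - lin rx (app A e0) \<in> Fl (Suc N)"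
proof -
  let ?p = "app A e0"
  have "app A (app x e0) - lin rx ?p = (\<Sum>b\<in>Poly_Mapping.keys ?p. pscale (lk ?p b) (app (ob b) (app x e0) - rx b))"
    unfolding app_HH[OF A(1), of "app x e0"] lin_def sum_subtractf[symmetric] by simp
  also have "\<dots> \<in> Fl (Suc N)"
  proof (rule Fl_sum)
    fix b assume b: "b \<in> Poly_Mapping.keys ?p"
    show "pscale (lk ?p b) (app (ob b) (app x e0) - rx b) \<in> Fl (Suc N)"
    proof (cases "coeff (lk ?p b) 0 = 0")
      case False
      then have "pdeg b < Suc N" using A(2) unfolding Fl_def mem_Collect_eq by blast
      then have "app (ob b) (app x e0) - rx b \<in> Fl (Suc N)"
        using HH_keys[OF A(1)] b by (intro Fl_mono[OF ob_x]) auto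
      then show ?thesis by (rule Fl_simps(4))
    qed (rule Fl_coeff0)
  qed
  finally show ?thesis .
qed

lemma shx_inj: "inj shx"
  by (auto simp: inj_def shx_def split: if_splits)

lemma hb_Fl0: "app (hb A) p \<in> Fl 0"
  by (simp add: Fl_coeff0)

text \<open>The leading part of z commutes with x in the smash product of the polynomial ring with
  W. On the component f of a rotation this reads x f = v x f, so v = 1 or f = 0. On a reflection it
  reads x f = (y/v) f, which forces f = 0 by induction on the exponent of x.\<close>

lemma central_top:
  assumes z: "z \<in> Zh" and N: "app z e0 \<in> Fl (Suc N)" and b: "pdeg (i, j, k, l, g, v) = N" and nz: "c0 z (i, j, k, l, g, v) \<noteq> 0"
  shows "\<not> g \<and> v = 1"
proof -
  let ?p = "app z e0"
  have zH: "z \<in> HH" by (rule Zh_HH[OF z])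
  have v: "v \<in> U" using c0_US[OF zH nz] by (simp add: US_def)
  have e: "app z (app x e0) - app x ?p = app (hb (pb z x)) e0"
    using arg_cong[OF pb(2)[OF z HH_letters(1)], of "\<lambda>A. app A e0"] by (simp only: app_ops)
  have "app z (app x e0) - app x ?p \<in> Fl 0" unfolding e by (rule hb_Fl0)
  then have "(app z (app x e0) - lin rx ?p) - (app z (app x e0) - app x ?p) \<in> Fl (Suc N)"
    using Fl_simps(3)[OF right_x[OF zH N] Fl_mono] by blast
  then have F: "app x ?p - lin rx ?p \<in> Fl (Suc N)" by simp
  have eq: "coeff (lk (app x ?p) b) 0 = coeff (lk (lin rx ?p) b) 0" if "pdeg b = Suc N" for b
  proof (rule ccontr)
    assume "\<not> ?thesis"
    then have "coeff (lk (app x ?p - lin rx ?p) b) 0 \<noteq> 0" by (simp add: lookup_minus)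
    then have "pdeg b < Suc N" using F unfolding Fl_def mem_Collect_eq by blast
    then show False using that by simp
  qed
  have xl: "app x ?p = lin (\<lambda>b. Poly_Mapping.single ((\<lambda>(i, m). (Suc i, m)) b) 1) ?p"
    by (rule app_eq_lin) (auto simp: P.xo_def)
  have inj: "inj (\<lambda>(i, m). (Suc i, m))" by (auto simp: inj_def)
  have X1: "lk (app x ?p) (Suc i, m) = lk ?p (i, m)" for i m
    using lookup_lin_inj(1)[of "\<lambda>b. Poly_Mapping.single ((\<lambda>(i, m). (Suc i, m)) b) 1" "\<lambda>(i, m). (Suc i, m)" "\<lambda>b. 1" ?p "(i, m)", OF refl inj]
    unfolding xl by simp
  have X0: "lk (app x ?p) (0, m) = 0" for m
  proof -
    have n: "(0, m) \<notin> range (\<lambda>(i, m). (Suc i, m))" by auto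
    show ?thesis unfolding xl
      by (rule lookup_lin_inj(2)[of "\<lambda>b. Poly_Mapping.single ((\<lambda>(i, m). (Suc i, m)) b) 1" "\<lambda>(i, m). (Suc i, m)" "\<lambda>b. 1", OF refl inj n])
  qed
  have rxf: "rx b = Poly_Mapping.single (shx b) [:case b of (i, j, k, l, g, v) \<Rightarrow> if g then 1 / v else v:]" for b
    by (cases b) (simp add: rx_def)
  have R: "lk (lin rx ?p) (shx (i, j, k, l, g, v)) = lk ?p (i, j, k, l, g, v) * [:if g then 1 / v else v:]" for i j k l g v
    using lookup_lin_inj(1)[of rx shx, OF rxf shx_inj, of ?p "(i, j, k, l, g, v)"] by simp
  show ?thesis
  proof (cases g)
    case False
    have "coeff (lk (app x ?p) (Suc i, j, k, l, g, v)) 0 = coeff (lk (lin rx ?p) (Suc i, j, k, l, g, v)) 0"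
      using b by (intro eq) simp
    then have "c0 z (i, j, k, l, g, v) = c0 z (i, j, k, l, g, v) * v"
      using R[of i j k l g v] False by (simp add: X1 shx_def c0_def coeff_0_mult)
    then show ?thesis using nz False by simp
  next
    case True
    have "c0 z (i, j, k, l, True, v) = 0" if "i + j + k + l = N" for i j
      using that
    proof (induction i arbitrary: j)
      case 0
      have "coeff (lk (app x ?p) (0, Suc j, k, l, True, v)) 0 = coeff (lk (lin rx ?p) (0, Suc j, k, l, True, v)) 0"
        using 0 by (intro eq) simp
      then show ?case using R[of 0 j k l True v] U_nz[OF v] by (simp add: X0 shx_def c0_def coeff_0_mult)
    next
      case (Suc i)
      have "coeff (lk (app x ?p) (Suc i, Suc j, k, l, True, v)) 0 = coeff (lk (lin rx ?p) (Suc i, Suc j, k, l, True, v)) 0"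
        using Suc.prems by (intro eq) simp
      then show ?case using R[of "Suc i" j k l True v] U_nz[OF v] Suc.IH[of "Suc j"] Suc.prems
        by (simp add: X1 shx_def c0_def coeff_0_mult)
    qed
    then show ?thesis using nz b True by simp
  qed
qed

text \<open>Commutation with a reflection compares coefficients in every degree at once, since
  reflections permute the PBW basis up to scalars. The identity component of z is thus invariant
  under W.\<close>

lemma central_invariant:
  assumes z: "z \<in> Zh" and v: "v \<in> U"
  shows "c0 z (j, i, l, k, False, 1) = v ^ (j + k) / v ^ (i + l) * c0 z (i, j, k, l, False, 1)"
proof -
  let ?p = "app z e0"
  have zH: "z \<in> HH" by (rule Zh_HH[OF z])
  have v0: "v \<noteq> 0" using U_nz[OF v] .
  have e: "app z (app (S v) e0) - app (S v) ?p = app (hb (pb z (S v))) e0"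
    using arg_cong[OF pb(2)[OF z HH_S[OF v]], of "\<lambda>A. app A e0"] by (simp only: app_ops)
  have "app z (app (S v) e0) - app (S v) ?p \<in> Fl 0" unfolding e by (rule hb_Fl0)
  then have eq: "coeff (lk (app z (app (S v) e0)) b) 0 = coeff (lk (app (S v) ?p) b) 0" for b
    by (simp add: Fl_def lookup_minus del: split_paired_All)
  define sh :: "nat \<times> nat \<times> pbw \<Rightarrow> nat \<times> nat \<times> pbw" where
    "sh = (\<lambda>(i, j, k, l, g, w). (i, j, k, l, \<not> g, if g then w / v else w * v))"
  define sh' :: "nat \<times> nat \<times> pbw \<Rightarrow> nat \<times> nat \<times> pbw" where
    "sh' = (\<lambda>(i, j, k, l, g, w). (j, i, l, k, \<not> g, v / w))"
  have inj: "inj sh" "inj sh'" using v0 by (auto simp: inj_def sh_def sh'_def split: if_splits)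
  have ob: "app (ob b) (app (S v) e0) = basis (sh b)" if bU: "b \<in> US" for b
  proof -
    obtain i j k l g w where b: "b = (i, j, k, l, g, w)" and w: "w \<in> U" using bU by (auto simp: US_def)
    have "P.rep (gmat g w) * S v = P.rep (gmat g w * Sm v)"
      by (simp add: P.rep_mult v w) (simp add: P.rep_S)
    also have "gmat g w * Sm v = gmat (\<not> g) (if g then w / v else w * v)"
      using v0 U_nz[OF w] by (simp add: gmat_def SR_mult)
    finally have "ob b * S v = ob (sh b)" by (simp add: ob_def b sh_def mult.assoc)
    then have "app (ob b) (app (S v) e0) = app (ob (sh b)) e0"
      by (simp only: app_ops(6)[symmetric])
    moreover have "sh b \<in> US" using v w by (auto simp: b sh_def US_def U_mult U_divide)
    ultimately show ?thesis by (simp add: ob_e0)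
  qed
  have "app z (app (S v) e0) = lin (\<lambda>b. basis (sh b)) ?p"
    unfolding app_HH[OF zH, of "app (S v) e0"] lin_def
    by (intro sum.cong refl) (use HH_keys[OF zH] ob in auto)
  then have 1: "lk (app z (app (S v) e0)) (sh b) = lk ?p b" for b
    using lookup_lin_inj(1)[of "\<lambda>b. basis (sh b)" sh "\<lambda>b. 1" ?p b, OF refl inj(1)] by simp
  have "app (S v) ?p = lin (\<lambda>b. Poly_Mapping.single (sh' b) (case b of (i, j, k, l, g, w) \<Rightarrow> [:v ^ j / v ^ i * (v ^ k / v ^ l):])) ?p"
    by (rule app_eq_lin) (auto simp: P.So_def sh'_def P.emb_def app_basis[symmetric] mult.commute)
  then have 2: "lk (app (S v) ?p) (sh' (i, j, k, l, g, w)) = lk ?p (i, j, k, l, g, w) * [:v ^ j / v ^ i * (v ^ k / v ^ l):]" for i j k l g w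
    using lookup_lin_inj(1)[of "\<lambda>b. Poly_Mapping.single (sh' b) (case b of (i, j, k, l, g, w) \<Rightarrow> [:v ^ j / v ^ i * (v ^ k / v ^ l):])" sh'
        "\<lambda>b. case b of (i, j, k, l, g, w) \<Rightarrow> [:v ^ j / v ^ i * (v ^ k / v ^ l):]" ?p "(i, j, k, l, g, w)", OF refl inj(2)] by simp
  have "sh (j, i, l, k, False, 1) = sh' (i, j, k, l, False, 1)" by (simp add: sh_def sh'_def)
  then show ?thesis using eq[of "sh (j, i, l, k, False, 1)"] 1[of "(j, i, l, k, False, 1)"] 2[of i j k l False 1]
    by (simp add: c0_def coeff_0_mult power_add)
qed

lemma central_sym: "z \<in> Zh \<Longrightarrow> c0 z (j, i, l, k, False, 1) = c0 z (i, j, k, l, False, 1)"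
  using central_invariant[OF _ U_1, of z j i l k] by simp

lemma central_weight: assumes "z \<in> Zh" "c0 z (i, j, k, l, False, 1) \<noteq> 0" shows "(i + l) mod d = (j + k) mod d"
proof -
  have "\<zeta> ^ (j + k) = \<zeta> ^ (i + l)"
    using central_invariant[OF assms(1) zeta_U, of j i l k] central_sym[OF assms(1), of j i l k] assms(2)
    by (simp add: field_simps)
  moreover have "\<zeta> ^ (m mod d) = \<zeta> ^ m" for m
  proof -
    have "\<zeta> ^ m = \<zeta> ^ (d * (m div d) + m mod d)" by simp
    then show ?thesis using zeta_d by (simp only: power_add power_mult power_one mult_1)
  qed
  ultimately have "\<zeta> ^ ((j + k) mod d) = \<zeta> ^ ((i + l) mod d)" by simp
  then show ?thesis using inj_zeta d_pos by (auto simp: inj_on_def)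
qed

lemma c0_simps: "c0 (A + B) b = c0 A b + c0 B b" "c0 (A - B) b = c0 A b - c0 B b" "c0 (cs c A) b = c * c0 A b"
  "c0 (hb A) b = 0" "c0 0 b = 0"
  by (simp_all add: c0_def lookup_add lookup_minus coeff_0_mult)

lemma c0_sum: "c0 (sum f I) b = (\<Sum>i\<in>I. c0 (f i) b)"
  by (induction I rule: infinite_finite_induct) (simp_all add: c0_simps)

lemma c0_sym: assumes "sym A N f" "pdeg b \<ge> N" shows "c0 A b = c0 f b"
proof -
  have "app (A - f) e0 \<in> Fl N" using symD(1)[OF assms(1) e0_Fl] by simp
  then have "c0 (A - f) b \<noteq> 0 \<longrightarrow> pdeg b < N" unfolding c0_Fl by blast
  then have "c0 (A - f) b = 0" using assms(2) by auto
  then show ?thesis by (simp add: c0_simps)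
qed

lemma c0_mu: "c0 (mu i j k l) b = (if b = (i, j, k, l, False, 1) then 1 else 0)"
  by (simp add: c0_def e0_def lookup_single when_def)

lemma CM_sum: "(\<And>i. i \<in> I \<Longrightarrow> g i \<in> CM) \<Longrightarrow> sum g I \<in> CM"
proof (induction I rule: infinite_finite_induct)
  case (insert i I)
  then show ?case by (simp add: CM_simps(3))
qed (use CM_simps(1)[OF M0_0] in simp_all)

text \<open>Induction on the degree: the leading part of z is a combination of the orbit sums of
  \<open>GG_sg\<close>, hence the leading part of an element of C + \<open>M0\<close>, which is
  subtracted.\<close>

lemma Fl_CM: "z \<in> Zh \<Longrightarrow> app z e0 \<in> Fl N \<Longrightarrow> z \<in> CM"
proof (induction N arbitrary: z)
  case 0
  then have "\<And>b. coeff (lk (app z e0) b) 0 = 0" unfolding Fl_def mem_Collect_eq by blast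
  then obtain B where "B \<in> HH" "z = hb B" using hb_dvd[OF Zh_HH[OF 0(1)]] by blast
  then show ?case by (auto intro: CM_simps M0.h)
next
  case (Suc N)
  define K where "K = {b \<in> Poly_Mapping.keys (app z e0). pdeg b = N \<and> c0 z b \<noteq> 0}"
  have fK: "finite K" by (simp add: K_def)
  have K: "b \<in> K \<longleftrightarrow> pdeg b = N \<and> c0 z b \<noteq> 0" for b
    by (auto simp: K_def c0_def in_keys_iff)
  define sw :: "nat \<times> nat \<times> pbw \<Rightarrow> nat \<times> nat \<times> pbw" where "sw = (\<lambda>(i, j, k, l, g). (j, i, l, k, g))"
  have Kf: "\<exists>i j k l. b = (i, j, k, l, False, 1)" if "b \<in> K" for b
  proof -
    obtain i j k l g v where b: "b = (i, j, k, l, g, v)" by (cases b) auto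
    show ?thesis using central_top[OF Suc.prems, of i j k l g v] that unfolding K b by auto
  qed
  have "\<exists>A\<in>Zh \<inter> CM. \<forall>b'. pdeg b' \<ge> N \<longrightarrow> c0 A b' = (if b' = b then 1 else 0) + (if b' = sw b then 1 else 0)" if bK: "b \<in> K" for b
  proof -
    obtain i j k l where b: "b = (i, j, k, l, False, 1)" using Kf[OF bK] by blast
    have nz: "c0 z (i, j, k, l, False, 1) \<noteq> 0" and N: "pdeg (i, j, k, l, False, 1) = N"
      using bK unfolding K b by blast+
    have "GG N (sg i j k l)"
      by (rule GG_sg) (use central_weight[OF Suc.prems(1) nz] N in auto)
    then obtain A where A: "A \<in> Zh" "A \<in> CM" "sym A N (sg i j k l)" by (rule GG_E)
    then show ?thesis using c0_sym[OF A(3)]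
      by (intro bexI[of _ A]) (auto simp: sg_def c0_simps c0_mu b sw_def)
  qed
  then have "\<forall>b\<in>K. \<exists>A. A \<in> Zh \<inter> CM \<and> (\<forall>b'. pdeg b' \<ge> N \<longrightarrow> c0 A b' = (if b' = b then 1 else 0) + (if b' = sw b then 1 else 0))"
    unfolding Bex_def by blast
  from bchoice[OF this] obtain f where f0: "\<forall>b\<in>K. f b \<in> Zh \<inter> CM \<and> (\<forall>b'. pdeg b' \<ge> N \<longrightarrow>
      c0 (f b) b' = (if b' = b then 1 else 0) + (if b' = sw b then 1 else 0))" by blast
  have f: "\<And>b. b \<in> K \<Longrightarrow> f b \<in> Zh \<inter> CM"
    "\<And>b b'. b \<in> K \<Longrightarrow> pdeg b' \<ge> N \<Longrightarrow> c0 (f b) b' = (if b' = b then 1 else 0) + (if b' = sw b then 1 else 0)"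
    using f0 by blast+
  \<comment> \<open>The sum runs over all monomials of the leading part, so each orbit sum is
    reached from b and from \<open>sw b\<close>, and a fixed monomial is doubled in
    \<open>sg\<close>; in either case 1/2 corrects the count.\<close>
  define z' where "z' = (\<Sum>b\<in>K. cs (c0 z b / 2) (f b))"
  have z': "z' \<in> Zh" "z' \<in> CM"
  proof -
    show "z' \<in> Zh" unfolding z'_def by (rule Zh_sum, rule Zh_cs) (use f(1) in blast)
    show "z' \<in> CM" unfolding z'_def by (rule CM_sum, rule CM_simps(4)) (use f(1) in blast)
  qed
  have sw2: "sw (sw b) = b" for b by (cases b) (simp add: sw_def)
  have swK: "sw b \<in> K \<and> c0 z (sw b) = c0 z b" if bK: "b \<in> K" for b
  proof -
    obtain i j k l where b: "b = (i, j, k, l, False, 1)" using Kf[OF bK] by blast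
    then show ?thesis using bK central_sym[OF Suc.prems(1), of j i l k] by (auto simp: K sw_def)
  qed
  have "app (z - z') e0 \<in> Fl N"
    unfolding c0_Fl
  proof (intro allI impI)
    fix b assume nz: "c0 (z - z') b \<noteq> 0"
    show "pdeg b < N"
    proof (rule ccontr)
      assume "\<not> pdeg b < N"
      then have bN: "pdeg b \<ge> N" by simp
      have "c0 z' b = (\<Sum>b'\<in>K. (if b' = b then c0 z b' / 2 else 0) + (if b' = sw b then c0 z b' / 2 else 0))"
        unfolding z'_def c0_sum c0_simps
        by (intro sum.cong refl) (use sw2 in \<open>auto simp: f(2) bN\<close>)
      also have "\<dots> = (if b \<in> K then c0 z b / 2 else 0) + (if sw b \<in> K then c0 z (sw b) / 2 else 0)"
        using fK by (simp add: sum.distrib)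
      also have "\<dots> = c0 z b"
      proof (cases "b \<in> K")
        case True
        then show ?thesis using swK[OF True] by simp
      next
        case False
        then have "sw b \<notin> K" using swK[of "sw b"] sw2 by auto
        moreover have "c0 z b = 0"
        proof (rule ccontr)
          assume "c0 z b \<noteq> 0"
          then have "pdeg b < Suc N" using Suc.prems(2) unfolding c0_Fl by blast
          then show False using \<open>c0 z b \<noteq> 0\<close> bN False K by auto
        qed
        ultimately show ?thesis using False by simp
      qed
      finally show False using nz by (simp add: c0_simps)
    qed
  qed
  then have "z - z' \<in> CM" using Suc.prems(1) z' by (intro Suc.IH Zh_diff)
  then show ?case using CM_simps(3)[of "z - z'" z'] z' by simp
qed

lemma Fl_ex: "\<exists>N. p \<in> Fl N"
proof -
  have "pdeg b < Suc (\<Sum>b\<in>Poly_Mapping.keys p. pdeg b)" if "coeff (lk p b) 0 \<noteq> 0" for b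
  proof -
    have "b \<in> Poly_Mapping.keys p" using that by (auto simp: in_keys_iff)
    then show ?thesis using member_le_sum[of b "Poly_Mapping.keys p" pdeg] by simp
  qed
  then show ?thesis unfolding Fl_def by blast
qed

lemma Zh_CM: "z \<in> Zh \<Longrightarrow> \<exists>c. z - cs c 1 \<in> M0"
  using Fl_CM Fl_ex[of "app z e0"] unfolding CM_def by blast

text \<open>Injectivity of the truncation on the centre: by \<open>central_top\<close> a vanishing
  identity component annihilates the leading part, degree after degree.\<close>

lemma Zh_eq_0:
  assumes z: "z \<in> Zh" and 0: "\<And>i j k l. c0 z (i, j, k, l, False, 1) = 0"
  shows "\<exists>C\<in>HH. z = hb C"
proof -
  have "app z e0 \<in> Fl N \<Longrightarrow> app z e0 \<in> Fl 0" for N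
  proof (induction N)
    case (Suc N)
    have "app z e0 \<in> Fl N" unfolding c0_Fl
    proof (intro allI impI)
      fix b assume nz: "c0 z b \<noteq> 0"
      obtain i j k l g v where b: "b = (i, j, k, l, g, v)" by (cases b) auto
      have "pdeg b < Suc N" using nz Suc.prems unfolding c0_Fl by blast
      moreover have "pdeg b \<noteq> N" using central_top[OF z Suc.prems, of i j k l g v] nz 0 unfolding b by auto
      ultimately show "pdeg b < N" by simp
    qed
    then show ?case by (rule Suc.IH)
  qed
  then have "app z e0 \<in> Fl 0" using Fl_ex by blast
  then have c: "\<And>b. coeff (lk (app z e0) b) 0 = 0" unfolding Fl_def mem_Collect_eq by blast
  obtain C where "C \<in> HH" "z = hb C" by (rule hb_dvd[OF Zh_HH[OF z] c])
  then show ?thesis by (rule bexI[rotated])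
qed

section \<open>The truncation map and the lifts of eu and a_j\<close>

section \<open>Truncation\<close>

definition idx :: "(gen \<Rightarrow>\<^sub>0 nat) \<Rightarrow> bool \<Rightarrow> complex \<Rightarrow> nat \<times> nat \<times> pbw" where
  "idx m g v = (lk m Gx, lk m Gy, lk m GX, lk m GY, g, v)"

lemma idx_inj: "idx m g v = idx m' g' v' \<longleftrightarrow> m = m' \<and> g = g' \<and> v = v'"
proof
  assume "idx m g v = idx m' g' v'"
  then have e: "lk m Gx = lk m' Gx" "lk m Gy = lk m' Gy" "lk m GX = lk m' GX" "lk m GY = lk m' GY" "g = g'" "v = v'"
    by (simp_all add: idx_def)
  have "lk m h = lk m' h" for h using e by (cases h) auto
  then show "m = m' \<and> g = g' \<and> v = v'" using e by (auto intro: poly_mapping_eqI)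
qed simp

definition mexp :: "nat \<times> nat \<times> pbw \<Rightarrow> gen \<Rightarrow>\<^sub>0 nat" where
  "mexp = (\<lambda>(i, j, k, l, g, v). Poly_Mapping.single Gx i + Poly_Mapping.single Gy j + Poly_Mapping.single GX k + Poly_Mapping.single GY l)"

lemma idx_mexp: "idx (mexp (i, j, k, l, g, v)) g' v' = (i, j, k, l, g', v')"
  by (simp add: idx_def mexp_def lookup_add lookup_single)

lemma idx_eq: "idx m g v = (i, j, k, l, g, v) \<longleftrightarrow> m = mexp (i, j, k, l, g', v')"
  using idx_inj[of m g v "mexp (i, j, k, l, g', v')" g v] by (simp add: idx_mexp)

lemma letter_power: "letter g ^ n = Poly_Mapping.single (Word (replicate n g)) 1"
  using prod_list_letter[of "replicate n g"] by (simp add: prod_list_replicate)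

lemma single_ordered_word: "Poly_Mapping.single (ordered_word m) [:c:] = scal c * mon (lk m Gx) (lk m Gy) (lk m GX) (lk m GY)"
  by (simp add: ordered_word_def mon_def letter_power mult_single word_plus scal_def scalar_mult_single)

lemma T_ordered_e0:
  assumes v: "v \<in> U"
  shows "app (P.T (ordered_tensor f) * P.rep (gmat g v)) e0 = (\<Sum>m\<in>Poly_Mapping.keys f. Poly_Mapping.single (idx m g v) [:lk f m:])"
proof -
  have "P.T (ordered_tensor f) * P.rep (gmat g v) =
     (\<Sum>m\<in>Poly_Mapping.keys f. cs (lk f m) (P.T (mon (lk m Gx) (lk m Gy) (lk m GX) (lk m GY)) * P.rep (gmat g v)))"
    unfolding ordered_tensor_def single_ordered_word P.tev.ev_sum by (simp add: P.T_scal_mult sum_distrib_right)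
  also have "app \<dots> e0 = (\<Sum>m\<in>Poly_Mapping.keys f. Poly_Mapping.single (idx m g v) [:lk f m:])"
    unfolding app_op_sum
  proof (intro sum.cong refl)
    fix m
    have us: "idx m g v \<in> US" using v by (simp add: US_def idx_def)
    have "P.T (mon (lk m Gx) (lk m Gy) (lk m GX) (lk m GY)) * P.rep (gmat g v) = ob (idx m g v)"
      by (simp add: mon_def idx_def ob_def P.tev.ev_mult T_power P.tev.ev_letter)
    then show "app (cs (lk f m) (P.T (mon (lk m Gx) (lk m Gy) (lk m GX) (lk m GY)) * P.rep (gmat g v))) e0 =
      Poly_Mapping.single (idx m g v) [:lk f m:]"
      by (simp add: ob_e0[OF us])
  qed
  finally show ?thesis .
qed

definition PF :: "(complex mat \<Rightarrow> polyVV) \<Rightarrow> (nat \<times> nat \<times> pbw) op" where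
  "PF F = P.Psi (\<lambda>w. ordered_tensor (F w))"

lemma PF: assumes F: "F \<in> VVW \<zeta>"
  shows "PF F \<in> HH" "mult_map d \<zeta> a F = kap (PF F)"
    "v \<in> U \<Longrightarrow> c0 (PF F) (idx m g v) = lk (F (gmat g v)) m"
proof -
  have c: "(\<lambda>w. ordered_tensor (F w)) \<in> carrier (smash \<zeta>)"
    using F by (simp add: VVW_def smash_simps(1) ordered_tensor_def)
  then show "PF F \<in> HH" "mult_map d \<zeta> a F = kap (PF F)"
    by (simp_all add: PF_def HH_Psi mult_map_def to_H_c_eq)
  assume v: "v \<in> U"
  have "lk (app (PF F) e0) (idx m g v) = (\<Sum>w\<in>D. if w = gmat g v then [:lk (F w) m:] else 0)"
    unfolding PF_def P.Psi_def app_op_sum lookup_sum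
  proof (intro sum.cong refl)
    fix w assume "w \<in> D"
    then obtain g' v' where w: "v' \<in> U" "w = gmat g' v'"
      by (cases rule: D_cases) (metis gmat_def)+
    have "lk (app (P.T (ordered_tensor (F w)) * P.rep w) e0) (idx m g v) =
      (\<Sum>m'\<in>Poly_Mapping.keys (F w). if m' = m then (if g' = g \<and> v' = v then [:lk (F w) m':] else 0) else 0)"
      unfolding w(2) T_ordered_e0[OF w(1)] lookup_sum
      by (intro sum.cong refl) (auto simp: lookup_single when_def idx_inj)
    also have "\<dots> = (if w = gmat g v then [:lk (F w) m:] else 0)"
      using U_nz[OF v] U_nz[OF w(1)] by (auto simp: gmat_def w(2) in_keys_iff)
    finally show "lk (app (P.T (ordered_tensor (F w)) * P.rep w) e0) (idx m g v) = (if w = gmat g v then [:lk (F w) m:] else 0)" .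
  qed
  then show "c0 (PF F) (idx m g v) = lk (F (gmat g v)) m"
    using v by (simp add: c0_def)
qed

lemma c0_kap: "A \<in> HH \<Longrightarrow> B \<in> HH \<Longrightarrow> kap A = kap B \<longleftrightarrow> (\<forall>b. c0 A b = c0 B b)"
proof -
  assume AB: "A \<in> HH" "B \<in> HH"
  have "(\<exists>C\<in>HH. A - B = hb C) \<longleftrightarrow> (\<forall>b. c0 (A - B) b = 0)"
  proof
    assume "\<exists>C\<in>HH. A - B = hb C"
    then obtain C where "A - B = hb C" by blast
    then show "\<forall>b. c0 (A - B) b = 0" by (simp add: c0_simps)
  next
    assume "\<forall>b. c0 (A - B) b = 0"
    then have "\<And>b. coeff (lk (app (A - B) e0) b) 0 = 0" by (simp only: c0_def)
    then show "\<exists>C\<in>HH. A - B = hb C" using hb_dvd[OF HH_diff[OF AB]] by blast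
  qed
  then show ?thesis using kap_eq[OF AB] by (simp add: c0_simps)
qed

lemma mult_map_surj: assumes A: "A \<in> HH" shows "\<exists>F\<in>VVW \<zeta>. mult_map d \<zeta> a F = kap A"
proof -
  define F where "F w = (\<Sum>b\<in>Poly_Mapping.keys (app A e0). if w = (case b of (i, j, k, l, g, v) \<Rightarrow> gmat g v)
      then Poly_Mapping.single (mexp b) (c0 A b) else 0)" for w
  have F: "F \<in> VVW \<zeta>"
    unfolding VVW_def mem_Collect_eq
  proof (intro allI impI)
    fix w assume "w \<notin> D"
    then show "F w = 0" unfolding F_def
      by (intro sum.neutral ballI) (use HH_keys[OF A] in \<open>force simp: US_def\<close>)
  qed
  have "c0 (PF F) b = c0 A b" for b
  proof (cases "b \<in> US")
    case False
    then have "c0 A b = 0" "c0 (PF F) b = 0" using c0_US[OF A, of b] c0_US[OF PF(1)[OF F], of b] by blast+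
    then show ?thesis by simp
  next
    case True
    then obtain i j k l g v where b: "b = (i, j, k, l, g, v)" and v: "v \<in> U" by (auto simp: US_def)
    let ?m = "mexp b"
    have bi: "b = idx ?m g v" by (simp add: b idx_mexp)
    have "c0 (PF F) b = lk (F (gmat g v)) ?m" using PF(3)[OF F v, of ?m g] bi by simp
    also have "\<dots> = (\<Sum>b'\<in>Poly_Mapping.keys (app A e0). if b' = b then c0 A b' else 0)"
      unfolding F_def lookup_sum
    proof (intro sum.cong refl)
      fix b' assume "b' \<in> Poly_Mapping.keys (app A e0)"
      then have "b' \<in> US" using HH_keys[OF A] by blast
      then obtain i' j' k' l' g' v' where b': "b' = (i', j', k', l', g', v')" and v': "v' \<in> U" by (auto simp: US_def)
      have "gmat g v = gmat g' v' \<longleftrightarrow> g = g' \<and> v = v'"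
        using U_nz[OF v] U_nz[OF v'] by (auto simp: gmat_def)
      moreover have "mexp b' = ?m \<longleftrightarrow> (i', j', k', l') = (i, j, k, l)"
        using idx_eq[of "mexp b'" g v i j k l g v] by (auto simp: b b' idx_mexp)
      ultimately show "lk (if gmat g v = (case b' of (i, j, k, l, g, v) \<Rightarrow> gmat g v)
          then Poly_Mapping.single (mexp b') (c0 A b') else 0) ?m = (if b' = b then c0 A b' else 0)"
        by (auto simp: b b' lookup_single when_def)
    qed
    also have "\<dots> = c0 A b" by (simp add: c0_def in_keys_iff)
    finally show ?thesis .
  qed
  then have "kap (PF F) = kap A" using c0_kap[OF PF(1)[OF F] A] by blast
  then show ?thesis using PF(2)[OF F] F by auto
qed

text \<open>The preimage selected in \<open>Trunc\<close> has the same PBW coefficients modulo hbar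
  as A, because these coefficients determine an element of H_c (\<open>c0_kap\<close>).\<close>

lemma Trunc_kap: assumes A: "A \<in> HH" shows "lk (Trunc d \<zeta> a (kap A)) m = c0 A (idx m False 1)"
proof -
  let ?F = "inv_into (VVW \<zeta>) (mult_map d \<zeta> a) (kap A)"
  have im: "kap A \<in> mult_map d \<zeta> a ` VVW \<zeta>" using mult_map_surj[OF A] by force
  have F: "?F \<in> VVW \<zeta>" by (rule inv_into_into[OF im])
  have "kap (PF ?F) = kap A" using f_inv_into_f[OF im] PF(2)[OF F] by simp
  then have "c0 (PF ?F) (idx m False 1) = c0 A (idx m False 1)" using c0_kap[OF PF(1)[OF F] A] by blast
  then show ?thesis using PF(3)[OF F U_1, of m False] by (simp add: Trunc_def gmat_def)
qed

lemma Trunc_unique: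
  assumes A: "A \<in> Zh" and T: "Trunc d \<zeta> a (kap A) = f"
  shows "(THE z. z \<in> carrier (Z_c d \<zeta> a) \<and> Trunc d \<zeta> a z = f) = kap A"
proof (rule the_equality)
  show "kap A \<in> carrier (Z_c d \<zeta> a) \<and> Trunc d \<zeta> a (kap A) = f" using A T by (simp add: Z_c_carrier)
  fix z assume z: "z \<in> carrier (Z_c d \<zeta> a) \<and> Trunc d \<zeta> a z = f"
  then obtain B where B: "B \<in> Zh" "z = kap B" by (auto simp: Z_c_carrier)
  have 0: "c0 (B - A) (i, j, k, l, False, 1) = 0" for i j k l
    using z B T Trunc_kap[OF Zh_HH[OF A], of "mexp (i, j, k, l, False, 1)"] Trunc_kap[OF Zh_HH[OF B(1)], of "mexp (i, j, k, l, False, 1)"]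
    by (simp add: c0_simps idx_mexp)
  obtain C where "C \<in> HH" "B - A = hb C" using Zh_eq_0[OF Zh_diff[OF B(1) A] 0] by blast
  then have "kap B = kap A" using kap_eq[OF Zh_HH[OF B(1)] Zh_HH[OF A]] by blast
  then show "z = kap A" using B(2) by simp
qed

lemma var_power: "var g ^ n = Poly_Mapping.single (Poly_Mapping.single g n) 1"
proof (induction n)
  case (Suc n)
  have "Poly_Mapping.single g 1 + Poly_Mapping.single g n = Poly_Mapping.single g (Suc n)"
    by (simp flip: single_add)
  then show ?case using Suc by (simp add: var_def mult_single)
qed simp

lemma c0_s1: "c0 s1 (i, j, k, l, False, 1) = 0"
proof -
  have "c0 (S z) (i, j, k, l, False, 1) = 0" for z
    by (simp add: c0_def e0_def P.So_basis P.emb_def lookup_single when_def)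
  then show ?thesis by (simp add: s1_def P.SS_def c0_sum c0_simps)
qed

lemma eu_elt_eq: "eu_elt d \<zeta> a = kap eu"
  unfolding eu_elt_def
proof (rule Trunc_unique[OF sl2_Zh(3)], rule poly_mapping_eqI)
  fix m
  obtain i j k l where m: "idx m False 1 = (i, j, k, l, False, 1)" using that unfolding idx_def by blast
  have "c0 eu (idx m False 1) = c0 (x * X + y * Y) (idx m False 1)" by (simp add: eu_def c0_simps c0_s1 m)
  also have "\<dots> = (if idx m False 1 = (1, 0, 1, 0, False, 1) then 1 else 0) + (if idx m False 1 = (0, 1, 0, 1, False, 1) then 1 else 0)"
    by (simp add: c0_def e0_def XY_basis0 lookup_add lookup_single when_def eq_commute)
  also have "\<dots> = lk (var Gx * var GX + var Gy * var GY) m"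
  proof -
    have "(idx m False 1 = (1, 0, 1, 0, False, 1)) = (m = Poly_Mapping.single Gx 1 + Poly_Mapping.single GX 1)"
      using idx_eq[of m False 1 1 0 1 0 False 1] by (simp add: mexp_def)
    moreover have "(idx m False 1 = (0, 1, 0, 1, False, 1)) = (m = Poly_Mapping.single Gy 1 + Poly_Mapping.single GY 1)"
      using idx_eq[of m False 1 0 1 0 1 False 1] by (simp add: mexp_def)
    ultimately show ?thesis by (simp add: var_def mult_single lookup_add lookup_single when_def)
  qed
  finally show "lk (Trunc d \<zeta> a (kap eu)) m = lk (var Gx * var GX + var Gy * var GY) m"
    using Trunc_kap[OF sl2_HH(3)] by simp
qed

text \<open>\<open>tau\<close> scales x^i y^j X^k Y^l by t^(i+l-j-k). For the eigenvalue -1 the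
  difference i+l-j-k must be an odd multiple of d up to sign, so the total degree is at least
  d.\<close>

lemma odd_c0: assumes A: "A \<in> HH" "tau A = - A" and nz: "c0 A (i, j, k, l, False, 1) \<noteq> 0"
  shows "d \<le> i + j + k + l"
proof -
  let ?p = "app A e0"
  define sh :: "nat \<times> nat \<times> pbw \<Rightarrow> nat \<times> nat \<times> pbw" where "sh = (\<lambda>(i, j, k, l, b, v). (i, j, k, l, b, if b then \<zeta> * v else v))"
  define co :: "nat \<times> nat \<times> pbw \<Rightarrow> complex poly" where "co = (\<lambda>(i, j, k, l, b, v). [:tt ^ i / tt ^ j * (tt ^ l / tt ^ k):])"
  have inj: "inj sh" by (auto simp: inj_def sh_def split: if_splits)
  have "app Pt.To ?p = lin (\<lambda>b. Poly_Mapping.single (sh b) (co b)) ?p"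
  proof (rule app_eq_lin)
    fix b :: "nat \<times> nat \<times> pbw"
    obtain i j k l g v where b: "b = (i, j, k, l, g, v)" by (cases b) auto
    show "col Pt.To b = Poly_Mapping.single (sh b) (co b)"
      using To_single[of i j k l g v 1] by (simp add: app_basis b sh_def co_def)
  qed
  then have 1: "lk (app Pt.To ?p) (sh b) = lk ?p b * co b" for b
    using lookup_lin_inj(1)[of "\<lambda>b. Poly_Mapping.single (sh b) (co b)" sh co ?p b, OF refl inj] by simp
  have "app Pt.To e0 = e0" using To_single[of 0 0 0 0 False 1 1] by (simp add: e0_def pCons_one)
  then have "app Pt.To ?p = - ?p"
    using arg_cong[OF tau(2)[OF A(1)], of "\<lambda>A. app A e0"] A(2) by simp
  then have "- lk ?p (i, j, k, l, False, 1) = lk ?p (i, j, k, l, False, 1) * [:tt ^ i / tt ^ j * (tt ^ l / tt ^ k):]"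
    using 1[of "(i, j, k, l, False, 1)"] by (simp add: sh_def co_def)
  from arg_cong[OF this, of "\<lambda>p. coeff p 0"]
  have e: "c0 A (i, j, k, l, False, 1) * w = - c0 A (i, j, k, l, False, 1)" if "w = tt ^ i / tt ^ j * (tt ^ l / tt ^ k)" for w
    using that by (simp add: c0_def coeff_0_mult)
  have w: "tt ^ i / tt ^ j * (tt ^ l / tt ^ k) = tt ^ (i + l) / tt ^ (j + k)" by (simp add: power_add)
  have "c0 A (i, j, k, l, False, 1) * (tt ^ (i + l) / tt ^ (j + k) + 1) = 0"
    unfolding distrib_left e[OF w[symmetric]] by simp
  then have "tt ^ (i + l) / tt ^ (j + k) = - 1" using nz by (simp add: eq_neg_iff_add_eq_0)
  then have "tt ^ (i + l) = - (tt ^ (j + k))" by (simp add: divide_eq_eq)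
  then have "tt ^ (max (i + l) (j + k) - min (i + l) (j + k)) = -1"
    by (cases "i + l \<le> j + k") (auto simp: power_diff max_def min_def field_simps)
  then obtain n where "max (i + l) (j + k) - min (i + l) (j + k) = d * (2 * n + 1)" using tt_power_eq by blast
  then have "d \<le> max (i + l) (j + k)" by (simp add: max_def min_def split: if_splits)
  then show ?thesis by simp
qed

definition an :: "nat \<Rightarrow> (nat \<times> nat \<times> pbw) op" where "an j = cs (1 / of_nat (d choose j)) (AA j)"

text \<open>The words in \<open>AA j\<close> are not ordered, and ordering them might leave terms of
  lower degree. In degrees below d the identity component vanishes by \<open>odd_c0\<close>, in the
  others it is given by the symbol.\<close>

lemma a_elt_eq: assumes j: "j \<le> d" shows "a_elt d \<zeta> a j = kap (an j)"
  unfolding a_elt_def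
proof (rule Trunc_unique)
  show Z: "an j \<in> Zh" unfolding an_def by (intro Zh_cs AA_Zh)
  have odd: "tau (an j) = - an j" unfolding an_def by (simp add: tau_cs AA_HH tau_AA)
  show "Trunc d \<zeta> a (kap (an j)) = var Gx ^ (d - j) * var GY ^ j + var Gy ^ (d - j) * var GX ^ j"
  proof (rule poly_mapping_eqI)
    fix m
    obtain i1 j1 k1 l1 where m: "idx m False 1 = (i1, j1, k1, l1, False, 1)" using that unfolding idx_def by blast
    have "c0 (an j) (idx m False 1) = c0 (sg (d - j) 0 0 j) (idx m False 1)"
    proof (cases "pdeg (idx m False 1) \<ge> d")
      case True
      then show ?thesis unfolding an_def by (rule c0_sym[OF AA_M0_sym(2)[OF j]])
    next
      case False
      then have "c0 (an j) (idx m False 1) = 0" using odd_c0[OF Zh_HH[OF Z] odd, of i1 j1 k1 l1] m by auto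
      then show ?thesis using False j by (auto simp: sg_def c0_simps c0_mu)
    qed
    also have "\<dots> = (if idx m False 1 = (d - j, 0, 0, j, False, 1) then 1 else 0) + (if idx m False 1 = (0, d - j, j, 0, False, 1) then 1 else 0)"
      by (simp add: sg_def c0_simps c0_mu)
    also have "\<dots> = lk (var Gx ^ (d - j) * var GY ^ j + var Gy ^ (d - j) * var GX ^ j) m"
    proof -
      have "(idx m False 1 = (d - j, 0, 0, j, False, 1)) = (m = Poly_Mapping.single Gx (d - j) + Poly_Mapping.single GY j)"
        using idx_eq[of m False 1 "d - j" 0 0 j False 1] by (simp add: mexp_def)
      moreover have "(idx m False 1 = (0, d - j, j, 0, False, 1)) = (m = Poly_Mapping.single Gy (d - j) + Poly_Mapping.single GX j)"
        using idx_eq[of m False 1 0 "d - j" j 0 False 1] by (simp add: mexp_def)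
      ultimately show ?thesis by (simp add: var_power mult_single lookup_add lookup_single when_def)
    qed
    finally show "lk (Trunc d \<zeta> a (kap (an j))) m = lk (var Gx ^ (d - j) * var GY ^ j + var Gy ^ (d - j) * var GX ^ j) m"
      using Trunc_kap[OF Zh_HH[OF Z]] by simp
  qed
qed

end

context cherednik
begin

section \<open>A filtered quotient of the standard module modulo hbar\<close>

section \<open>The filtration of the standard module\<close>

text \<open>Modulo \<open>\<hbar>\<close> the standard module has a quotient with basis \<open>x\<^sup>m e\<^sub>+, y\<^sup>m e\<^sub>-\<close>, because \<open>y e\<^sub>+\<close> and
  \<open>x e\<^sub>-\<close> are singular vectors: \<open>\<Sum> z\<^sup>2 = 0\<close> over the \<open>d\<close>-th roots of unity. The quotient is filtered by
  the degree \<open>m\<close>.\<close>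

definition blk :: "(nat \<Rightarrow> bool) \<Rightarrow> nat \<times> nat \<times> bool \<Rightarrow> bool" where
  "blk P = (\<lambda>(i, j, v). if v then i = 0 \<and> P j else j = 0 \<and> P i)"

text \<open>Vectors whose image in the quotient with basis x^m e+, y^m e- has no component of degree
  m with \<open>P m\<close>. Thus \<open>Ko\<close> is the kernel of the projection to the quotient
  and \<open>Kn n\<close> the preimage of the part of degree at least n.\<close>

definition KK :: "(nat \<Rightarrow> bool) \<Rightarrow> ((nat \<times> nat \<times> bool) \<Rightarrow>\<^sub>0 complex poly) set" where
  "KK P = {p. \<forall>b. blk P b \<longrightarrow> coeff (lk p b) 0 = 0}"

abbreviation "Ko \<equiv> KK (\<lambda>m. True)"
abbreviation "Kn n \<equiv> KK (\<lambda>m. m < n)"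
abbreviation "ep \<equiv> (basis (0, 0, False) :: (nat \<times> nat \<times> bool) \<Rightarrow>\<^sub>0 complex poly)"
abbreviation "em \<equiv> (basis (0, 0, True) :: (nat \<times> nat \<times> bool) \<Rightarrow>\<^sub>0 complex poly)"

lemma KK_simps: "0 \<in> KK P" "p \<in> KK P \<Longrightarrow> q \<in> KK P \<Longrightarrow> p + q \<in> KK P" "p \<in> KK P \<Longrightarrow> q \<in> KK P \<Longrightarrow> p - q \<in> KK P"
  "p \<in> KK P \<Longrightarrow> pscale c p \<in> KK P" and KK_coeff0: "coeff c 0 = 0 \<Longrightarrow> pscale c q \<in> KK P"
  and KK_uminus: "p \<in> KK P \<Longrightarrow> - p \<in> KK P"
  unfolding KK_def mem_Collect_eq by (simp_all add: lookup_add lookup_minus coeff_0_mult)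

lemma KK_sum: "(\<And>i. i \<in> I \<Longrightarrow> f i \<in> KK P) \<Longrightarrow> sum f I \<in> KK P"
  by (induction I rule: infinite_finite_induct) (auto intro: KK_simps)

lemma KK_basis: "basis b \<in> KK P \<longleftrightarrow> \<not> blk P b"
  by (auto simp: KK_def lookup_single when_def simp del: split_paired_All)

lemma KK_single: "\<not> blk P b \<Longrightarrow> Poly_Mapping.single b c \<in> KK P"
  by (auto simp: KK_def lookup_single when_def simp del: split_paired_All)

lemma KK_app: assumes "p \<in> KK P" "\<And>b. \<not> blk P b \<Longrightarrow> app A (basis b) \<in> KK Q" shows "app A p \<in> KK Q"
  unfolding app_expand[of A p]
proof (rule KK_sum)
  fix b assume "b \<in> Poly_Mapping.keys p"
  show "pscale (lk p b) (app A (basis b)) \<in> KK Q"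
  proof (cases "coeff (lk p b) 0 = 0")
    case False
    then have "\<not> blk P b" using assms(1) unfolding KK_def mem_Collect_eq by blast
    then show ?thesis by (intro KK_simps(4) assms(2))
  qed (rule KK_coeff0)
qed

lemma Kn_mono: "p \<in> Kn n \<Longrightarrow> m \<le> n \<Longrightarrow> p \<in> Kn m"
  by (force simp: KK_def blk_def)

lemma Ko_Kn: "p \<in> Ko \<Longrightarrow> p \<in> Kn m"
  by (force simp: KK_def blk_def)

lemma Dl_So: "app (Dl.So z) (basis (i, j, v)) = Poly_Mapping.single (j, i, \<not> v) [:z ^ j / z ^ i * (if v then 1 / z else z):]"
  by (simp add: Dl.So_basis Dl.emb_def mult.commute)

lemma Dl_SS: "app (Dl.SS f) ep = Poly_Mapping.single (0, 0, True) [:\<Sum>z\<in>U. f z * z:]"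
  "app (Dl.SS f) em = Poly_Mapping.single (0, 0, False) [:\<Sum>z\<in>U. f z / z:]"
proof -
  have s: "(\<Sum>z\<in>U. Poly_Mapping.single b [:g z:]) = Poly_Mapping.single b [:\<Sum>z\<in>U. g z:]" for g and b :: "nat \<times> nat \<times> bool"
  proof -
    have "(\<Sum>z\<in>V. Poly_Mapping.single b [:g z:]) = Poly_Mapping.single b [:\<Sum>z\<in>V. g z:]" for V
      by (induction V rule: infinite_finite_induct) (simp_all flip: single_add)
    then show ?thesis .
  qed
  show "app (Dl.SS f) ep = Poly_Mapping.single (0, 0, True) [:\<Sum>z\<in>U. f z * z:]"
    "app (Dl.SS f) em = Poly_Mapping.single (0, 0, False) [:\<Sum>z\<in>U. f z / z:]"
    by (simp_all add: Dl.SS_def Dl_So s mult.commute)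
qed

lemma sum_U_12: "(\<Sum>z\<in>U. z) = 0" "(\<Sum>z\<in>U. z * z) = 0" "(\<Sum>z\<in>U. 1 / z) = 0" "(\<Sum>z\<in>U. 1 / (z * z)) = 0"
  using sum_U_power[of 1] sum_U_power[of 2] sum_U_div[OF U_1, of "\<lambda>z. z"] sum_U_div[OF U_1, of "\<lambda>z. z * z"] d5
  by (simp_all add: power2_eq_square)

lemma Dl_C: "app Dl.Cx (basis (0, 0, v)) = Poly_Mapping.single (0, 0, v) [:0, 1:]" "app Dl.Cy ep = 0" "app Dl.Dx em = 0"
  using sum_U_12 by (cases v; simp add: Dl.Cx_def Dl.Cy_def Dl.Dx_def Dl_SS)+

lemma Dl_XY_0: "app Dl.Xo (basis (0, 0, v)) = 0" "app Dl.Yo (basis (0, 0, v)) = 0"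
  by (simp_all add: Dl.Xo_def Dl.Yo_def Dl.dunkl_0)

lemma Kn_x: "p \<in> Kn n \<Longrightarrow> app (Dl.xo ^ m) p \<in> Kn (n + m)" and Kn_y: "p \<in> Kn n \<Longrightarrow> app (Dl.yo ^ m) p \<in> Kn (n + m)"
proof -
  have x: "q \<in> Kn k \<Longrightarrow> app Dl.xo q \<in> Kn (Suc k)" for q k
    by (erule KK_app) (auto simp: KK_basis blk_def split: if_splits)
  have y: "q \<in> Kn k \<Longrightarrow> app Dl.yo q \<in> Kn (Suc k)" for q k
    by (erule KK_app) (auto simp: KK_basis blk_def split: if_splits)
  show "p \<in> Kn n \<Longrightarrow> app (Dl.xo ^ m) p \<in> Kn (n + m)" by (induction m) (simp_all add: x)
  show "p \<in> Kn n \<Longrightarrow> app (Dl.yo ^ m) p \<in> Kn (n + m)" by (induction m) (simp_all add: y)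
qed

lemma KK_S: "p \<in> KK P \<Longrightarrow> app (Dl.So z) p \<in> KK P"
  by (erule KK_app) (auto simp: Dl_So blk_def intro!: KK_single split: if_splits)

lemma KK_SS: "p \<in> KK P \<Longrightarrow> app (Dl.SS f) p \<in> KK P"
  by (simp add: Dl.SS_def KK_S KK_simps KK_sum)

lemma Ko_xy: "p \<in> Ko \<Longrightarrow> app Dl.xo p \<in> Ko" "p \<in> Ko \<Longrightarrow> app Dl.yo p \<in> Ko"
  by (erule KK_app, auto simp: KK_basis blk_def split: if_splits)+

lemma KK_C: "p \<in> KK P \<Longrightarrow> app Dl.Cx p \<in> KK P" "p \<in> KK P \<Longrightarrow> app Dl.Cy p \<in> KK P" "p \<in> KK P \<Longrightarrow> app Dl.Dx p \<in> KK P"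
  by (simp_all add: Dl.Cx_def Dl.Cy_def Dl.Dx_def KK_simps KK_SS)

lemma app_Dl: "app Dl.Xo (app Dl.xo p) = app Dl.xo (app Dl.Xo p) - app Dl.Cx p"
  "app Dl.Yo (app Dl.xo p) = app Dl.xo (app Dl.Yo p) - app Dl.Dx p"
  "app Dl.Xo (app Dl.yo p) = app Dl.yo (app Dl.Xo p) - app Dl.Cy p"
  "app Dl.Yo (app Dl.yo p) = app Dl.yo (app Dl.Yo p) - app Dl.Cx p"
  using arg_cong[OF Dl.Xo_xo, of "\<lambda>A. app A p"] arg_cong[OF Dl.Yo_xo, of "\<lambda>A. app A p"]
    arg_cong[OF Dl.Xo_yo, of "\<lambda>A. app A p"] arg_cong[OF Dl.Yo_yo, of "\<lambda>A. app A p"] by simp_all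

text \<open>X and Y annihilate y e+ and x e- modulo hbar because the sums of z, z^2 and their
  inverses over the roots of unity vanish; \<open>Ko\<close> is spanned modulo hbar by what these
  vectors generate under x and y, and moving X, Y past x, y stays inside.\<close>

lemma Ko_XY_basis: assumes "\<not> blk (\<lambda>m. True) (i, j, v)"
  shows "app Dl.Xo (basis (i, j, v)) \<in> Ko \<and> app Dl.Yo (basis (i, j, v)) \<in> Ko"
proof -
  let ?st = "\<lambda>p. p \<in> Ko \<and> app Dl.Xo p \<in> Ko \<and> app Dl.Yo p \<in> Ko"
  have x: "?st p \<Longrightarrow> ?st (app Dl.xo p)" for p
    by (simp add: app_Dl KK_simps(3) Ko_xy KK_C)
  have y: "?st p \<Longrightarrow> ?st (app Dl.yo p)" for p
    by (simp add: app_Dl KK_simps(3) Ko_xy KK_C)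
  have b1: "?st (basis (0, Suc 0, False))"
  proof -
    have "app Dl.Xo (app Dl.yo ep) = 0" unfolding app_Dl Dl_XY_0 Dl_C by simp
    moreover have "app Dl.Yo (app Dl.yo ep) = - Poly_Mapping.single (0, 0, False) [:0, 1:]" unfolding app_Dl Dl_XY_0 Dl_C by simp
    moreover have "Poly_Mapping.single (0, 0, False) [:0, 1:] \<in> Ko" using KK_coeff0[of "[:0, 1:]" ep] by simp
    ultimately show ?thesis by (simp add: KK_basis blk_def KK_simps(1) KK_uminus)
  qed
  have b2: "?st (basis (Suc 0, 0, True))"
  proof -
    have "app Dl.Yo (app Dl.xo em) = 0" unfolding app_Dl Dl_XY_0 Dl_C by simp
    moreover have "app Dl.Xo (app Dl.xo em) = - Poly_Mapping.single (0, 0, True) [:0, 1:]" unfolding app_Dl Dl_XY_0 Dl_C by simp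
    moreover have "Poly_Mapping.single (0, 0, True) [:0, 1:] \<in> Ko" using KK_coeff0[of "[:0, 1:]" em] by simp
    ultimately show ?thesis by (simp add: KK_basis blk_def KK_simps(1) KK_uminus)
  qed
  have xs: "?st (basis (0, j, v)) \<Longrightarrow> ?st (basis (i, j, v))" for i j v
  proof (induction i)
    case (Suc i)
    then show ?case using x[of "basis (i, j, v)"] by simp
  qed
  have ys: "?st (basis (i, 0, v)) \<Longrightarrow> ?st (basis (i, j, v))" for i j v
  proof (induction j)
    case (Suc j)
    then show ?case using y[of "basis (i, j, v)"] by simp
  qed
  have y1: "?st (basis (0, Suc j, False))" for j
  proof (induction j)
    case 0
    then show ?case using b1 by simp
  next
    case (Suc j)
    then show ?case using y[of "basis (0, Suc j, False)"] by simp
  qed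
  have x1: "?st (basis (Suc i, 0, True))" for i
  proof (induction i)
    case 0
    then show ?case using b2 by simp
  next
    case (Suc i)
    then show ?case using x[of "basis (Suc i, 0, True)"] by simp
  qed
  show ?thesis
  proof (cases v)
    case True
    then obtain i' where "i = Suc i'" using assms True by (cases i) (auto simp: blk_def)
    then show ?thesis using ys[OF x1[of i'], of j] True by simp
  next
    case False
    then obtain j' where "j = Suc j'" using assms False by (cases j) (auto simp: blk_def)
    then show ?thesis using xs[OF y1[of j'], of i] False by simp
  qed
qed

lemma Ko_XY: "p \<in> Ko \<Longrightarrow> app Dl.Xo p \<in> Ko" "p \<in> Ko \<Longrightarrow> app Dl.Yo p \<in> Ko"
proof -
  have b: "app Dl.Xo (basis b) \<in> Ko \<and> app Dl.Yo (basis b) \<in> Ko" if "\<not> blk (\<lambda>m. True) b" for b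
    using that Ko_XY_basis[of "fst b" "fst (snd b)" "snd (snd b)"] by simp
  show "p \<in> Ko \<Longrightarrow> app Dl.Xo p \<in> Ko" "p \<in> Ko \<Longrightarrow> app Dl.Yo p \<in> Ko"
    using b KK_app by blast+
qed

lemma rho_Ko: "A \<in> HH \<Longrightarrow> p \<in> Ko \<Longrightarrow> app (rho A) p \<in> Ko"
  by (induction arbitrary: p rule: HH_induct)
    (simp_all add: rho_add rho_mult rho_osc1 rho_letters rho_S KK_simps Ko_xy Ko_XY KK_S)

lemma rho_comm: assumes "r \<in> Zh" "B \<in> HH"
  shows "app (rho r) (app (rho B) p) = app (rho B) (app (rho r) p) + pscale [:0, 1:] (app (rho (pb r B)) p)"
proof -
  have "r * B = B * r + hb (pb r B)" using pb(2)[OF assms] by (simp add: diff_eq_eq add.commute)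
  then have "rho r * rho B = rho B * rho r + hb (rho (pb r B))"
    using Zh_HH[OF assms(1)] assms(2) pb(1)[OF assms]
    by (simp add: rho_mult[symmetric] rho_add[symmetric] rho_hb[symmetric] HH_mult HH_hb)
  from arg_cong[OF this, of "\<lambda>A. app A p"] show ?thesis by simp
qed

lemma basis_axis: "basis (m, 0, False) = app (rho (x ^ m)) ep" "basis (0, m, True) = app (rho (y ^ m)) em"
proof -
  have "app (Dl.xo ^ m) ep = basis (m, 0, False)" by (induction m) simp_all
  then show "basis (m, 0, False) = app (rho (x ^ m)) ep" by (simp add: rho_power HH_letters rho_letters)
  have "app (Dl.yo ^ m) em = basis (0, m, True)" by (induction m) simp_all
  then show "basis (0, m, True) = app (rho (y ^ m)) em" by (simp add: rho_power HH_letters rho_letters)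
qed

lemma hb_KK: "pscale [:0, 1:] p \<in> KK P"
  by (rule KK_coeff0) simp

text \<open>Modulo hbar, r commutes with x^m, y^m and s_0, so its action on the quotient is
  determined by its value on e+: the shift of the filtration there is the shift everywhere.\<close>

lemma Kn_act: assumes r: "r \<in> Zh" and N: "app (rho r) ep \<in> Kn N" and p: "p \<in> Kn n"
  shows "app (rho r) p \<in> Kn (n + N)"
proof (rule KK_app[OF p])
  have em: "em = app (rho (S 1)) ep" by (simp add: rho_S Dl_So pCons_one)
  have N': "app (rho r) em \<in> Kn N"
    unfolding em rho_comm[OF r HH_S[OF U_1]] unfolding rho_S[OF U_1]
    by (intro KK_simps(2) KK_S N hb_KK)
  fix b :: "nat \<times> nat \<times> bool" assume b: "\<not> blk (\<lambda>m. m < n) b"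
  obtain i j v where bi: "b = (i, j, v)" by (cases b) auto
  show "app (rho r) (basis b) \<in> Kn (n + N)"
  proof (cases "blk (\<lambda>m. True) b")
    case False
    then show ?thesis using Ko_Kn[OF rho_Ko[OF Zh_HH[OF r], of "basis b"]] by (simp add: KK_basis)
  next
    case True
    show ?thesis
    proof (cases v)
      case v: True
      have b': "b = (0, j, True)" "n \<le> j" using True b v by (auto simp: bi blk_def)
      have "app (rho (y ^ j)) (app (rho r) em) \<in> Kn (N + j)"
        using Kn_y[OF N', of j] by (simp add: rho_power HH_letters rho_letters)
      then have "app (rho (y ^ j)) (app (rho r) em) \<in> Kn (n + N)" by (rule Kn_mono) (use b' in simp)
      moreover have "basis b = app (rho (y ^ j)) em" by (simp only: b'(1) basis_axis(2)[of j])
      ultimately show ?thesis using rho_comm[OF r HH_power[OF HH_letters(2)], of j em]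
        by (simp only:) (intro KK_simps(2) hb_KK)
    next
      case v: False
      have b': "b = (i, 0, False)" "n \<le> i" using True b v by (auto simp: bi blk_def)
      have "app (rho (x ^ i)) (app (rho r) ep) \<in> Kn (N + i)"
        using Kn_x[OF N, of i] by (simp add: rho_power HH_letters rho_letters)
      then have "app (rho (x ^ i)) (app (rho r) ep) \<in> Kn (n + N)" by (rule Kn_mono) (use b' in simp)
      moreover have "basis b = app (rho (x ^ i)) ep" by (simp only: b'(1) basis_axis(1)[of i])
      ultimately show ?thesis using rho_comm[OF r HH_power[OF HH_letters(1)], of i ep]
        by (simp only:) (intro KK_simps(2) hb_KK)
    qed
  qed
qed

lemma Kn_0: "p \<in> Kn 0" by (auto simp: KK_def blk_def)

lemma odd_coeff:
  assumes A: "A \<in> HH" "tau A = - A" and nz: "lk (app (rho A) ep) (i, j, v) \<noteq> 0"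
  shows "tt ^ i / tt ^ j * (if v then tt else 1 / tt) = - (1 / tt)"
proof -
  let ?p = "app (rho A) ep"
  define w :: "nat \<times> nat \<times> bool \<Rightarrow> complex" where "w = (\<lambda>(i, j, v). tt ^ i / tt ^ j * (if v then tt else 1 / tt))"
  have To: "app Dt.To (basis b) = Poly_Mapping.single b [:w b:]" for b
    by (cases b) (simp add: Dt.To_basis w_def Dl.emb_def mult.commute)
  have "app Dt.To ?p = lin (\<lambda>b. Poly_Mapping.single b [:w b:]) ?p"
    by (rule app_eq_lin) (simp add: To flip: app_basis)
  then have 1: "lk (app Dt.To ?p) b = lk ?p b * [:w b:]" for b
    using lookup_lin_inj(1)[of "\<lambda>b. Poly_Mapping.single b [:w b:]" "\<lambda>b. b" "\<lambda>b. [:w b:]" ?p b] by simp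
  have "app Dt.To ?p = app (rho (- A)) (app Dt.To ep)"
    using arg_cong[OF tau(3)[OF A(1)], of "\<lambda>A. app A ep"] unfolding A(2) by simp
  also have "app Dt.To ep = pscale [:1 / tt:] ep" by (simp add: To w_def)
  also have "app (rho (- A)) (pscale [:1 / tt:] ep) = pscale (- [:1 / tt:]) ?p"
    unfolding app_simps(5) rho_uminus[OF A(1)] app_ops(5) pscale_minus_left by (simp only: pscale_simps)
  finally have 2: "lk (app Dt.To ?p) (i, j, v) = - [:1 / tt:] * lk ?p (i, j, v)" by (simp only: lookup_pscale)
  have "lk ?p (i, j, v) * [:w (i, j, v):] = lk ?p (i, j, v) * [:- (1 / tt):]"
    unfolding 1[symmetric] 2 by (simp add: mult.commute)
  then show ?thesis using nz unfolding mult_cancel_left by (simp add: w_def)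
qed

text \<open>e+ is an eigenvector of the twist with eigenvalue 1/t, so an odd element sends it to
  eigenvalue -1/t. On x^i e+ this means t^i = -1, on y^j e- it means t^(j-2) = -1; both force the
  degree to be at least d.\<close>

lemma odd_Kn: assumes A: "A \<in> HH" "tau A = - A" shows "app (rho A) ep \<in> Kn d"
  unfolding KK_def mem_Collect_eq
proof (intro allI impI, rule ccontr)
  fix b assume b: "blk (\<lambda>m. m < d) b" and nz: "coeff (lk (app (rho A) ep) b) 0 \<noteq> 0"
  have nz': "lk (app (rho A) ep) b \<noteq> 0" using nz by auto
  obtain i j v where bi: "b = (i, j, v)" by (cases b) auto
  have e: "tt ^ i / tt ^ j * (if v then tt else 1 / tt) = - (1 / tt)" using odd_coeff[OF A] nz' bi by simp
  have d2: "tt ^ (2 * d) = 1" using tt(2) by (simp add: power_mult power2_eq_square mult.commute power_even_eq)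
  show False
  proof (cases v)
    case False
    then have "j = 0" "i < d" using b by (simp_all add: bi blk_def)
    moreover have "tt ^ i = -1" using e False \<open>j = 0\<close> by (simp add: field_simps)
    ultimately show False using tt_power_eq[of i] by auto
  next
    case True
    then have ij: "i = 0" "j < d" using b by (simp_all add: bi blk_def)
    then have "tt ^ j = - (tt * tt)" using e True by (simp add: field_simps)
    moreover have "tt ^ (2 * d) = tt ^ (2 * d - 2) * (tt * tt)"
    proof -
      have "2 * d = (2 * d - 2) + 2" using d5 by simp
      then have "tt ^ (2 * d) = tt ^ ((2 * d - 2) + 2)" by (rule arg_cong)
      then show ?thesis by (simp only: power_add power2_eq_square)
    qed
    \<comment> \<open>The exponent j - 2 is raised by the period 2d of t to stay in the natural
      numbers; an odd multiple of d of this size is at least 3d, as j < d excludes nothing smaller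
      but d itself, which is less than 2d - 2.\<close>
    ultimately have "tt ^ (j + (2 * d - 2)) = -1" using d2 by (simp add: power_add mult_ac)
    then obtain k where k: "j + (2 * d - 2) = d * (2 * k + 1)" using tt_power_eq by blast
    show False
    proof (cases k)
      case 0
      then show False using k d5 by simp
    next
      case (Suc k')
      then have "j + 2 * d - 2 = 3 * d + 2 * (d * k')" using k d5 by (simp add: algebra_simps)
      then show False using ij d5 by linarith
    qed
  qed
qed

lemma rho_eu_0: "app (rho eu) (basis (0, 0, v)) = 0"
proof -
  have "rho s1 = Dl.SS (\<lambda>z. 1)"
    by (simp add: s1_def P.SS_def Dl.SS_def rho_sum HH_S rho_S)
  then have "rho eu = Dl.xo * Dl.Xo + Dl.yo * Dl.Yo + cs a (Dl.SS (\<lambda>z. 1))"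
    by (simp add: eu_def rho_add rho_mult rho_cs rho_letters HH_add HH_mult HH_letters HH_cs s1_HH)
  then show ?thesis by (cases v) (simp_all add: Dl_XY_0 Dl_SS sum_U_12)
qed

lemma rho_eu: "app (rho eu) (basis (i, j, v)) = Poly_Mapping.single (i, j, v) [:0, - (of_nat (i + j)):]"
proof -
  have pbx: "pb eu x = - x" "pb eu y = - y"
    using eu_comm(1,2) unfolding cm_def by (simp_all add: pb_eqI)
  have x: "app (rho eu) (app Dl.xo p) = app Dl.xo (app (rho eu) p) - pscale [:0, 1:] (app Dl.xo p)" for p
    using rho_comm[OF sl2_Zh(3) HH_letters(1), of p] by (simp add: pbx rho_uminus HH_letters rho_letters)
  have y: "app (rho eu) (app Dl.yo p) = app Dl.yo (app (rho eu) p) - pscale [:0, 1:] (app Dl.yo p)" for p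
    using rho_comm[OF sl2_Zh(3) HH_letters(2), of p] by (simp add: pbx rho_uminus HH_letters rho_letters)
  have s: "app Dl.xo (Poly_Mapping.single (i, j, v) c) = Poly_Mapping.single (Suc i, j, v) c"
    "app Dl.yo (Poly_Mapping.single (i, j, v) c) = Poly_Mapping.single (i, Suc j, v) c" for i j v c
    by (simp_all only: app_single) (simp_all flip: app_basis)
  have c: "- of_nat j - 1 = - 1 - (of_nat j :: complex)" "- of_nat i - of_nat j - 1 = - 1 - of_nat i - (of_nat j :: complex)" for i j
    by simp_all
  have j: "app (rho eu) (basis (0, j, v)) = Poly_Mapping.single (0, j, v) [:0, - of_nat j:]"
  proof (induction j)
    case (Suc j)
    then show ?case using y[of "basis (0, j, v)"] by (simp add: s c flip: single_diff)
  qed (simp add: rho_eu_0)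
  show ?thesis
  proof (induction i)
    case (Suc i)
    then show ?case using x[of "basis (i, j, v)"] by (simp add: s c flip: single_diff)
  qed (simp add: j)
qed

text \<open>eu annihilates e+ and acts on vectors of degree m by -m hbar, so an element of weight n
  can reach only the degree -n.\<close>

lemma eu_degree:
  assumes A: "A \<in> HH" "pb eu A = cs n A" and nz: "lk (app (rho A) ep) (i, j, v) \<noteq> 0"
  shows "n = - of_nat (i + j)"
proof -
  let ?p = "app (rho A) ep"
  have "app (rho eu) ?p = lin (\<lambda>b. Poly_Mapping.single b (case b of (i, j, v) \<Rightarrow> [:0, - (of_nat (i + j)):])) ?p"
    by (rule app_eq_lin) (auto simp: rho_eu simp flip: app_basis)
  then have 1: "lk (app (rho eu) ?p) (i, j, v) = lk ?p (i, j, v) * [:0, - (of_nat (i + j)):]"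
    using lookup_lin_inj(1)[of "\<lambda>b. Poly_Mapping.single b (case b of (i, j, v) \<Rightarrow> [:0, - (of_nat (i + j)):])" "\<lambda>b. b"
        "\<lambda>b. case b of (i, j, v) \<Rightarrow> [:0, - (of_nat (i + j)):]" ?p "(i, j, v)"] by simp
  have "app (rho eu) ?p = pscale [:0, n:] ?p"
    using rho_comm[OF sl2_Zh(3) A(1), of ep] by (simp add: A rho_cs rho_eu_0)
  then have "lk ?p (i, j, v) * [:0, - (of_nat (i + j)):] = lk ?p (i, j, v) * [:0, n:]"
    using 1 by (simp add: mult.commute)
  then show ?thesis using nz unfolding mult_cancel_left by simp
qed

text \<open>The two middle weight vectors of \<open>\<langle>a\<^sub>0, \<dots>, a\<^sub>d\<rangle>\<close> for odd \<open>d\<close> annihilate \<open>e\<^sub>+\<close>: they would map it to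
  vectors of degree \<open>1\<close> and \<open>-1\<close>, which have the wrong weight under the twist.\<close>

lemma AA_middle: assumes i: "d = 2 * i + 1" shows "app (rho (AA i)) ep = 0" "app (rho (AA (Suc i))) ep = 0"
proof -
  have pbe: "pb eu (AA j) = cs (2 * of_nat j - of_nat d) (AA j)" for j
    by (rule pb_eqI) (use eu_AA in \<open>simp add: cm_def\<close>)
  have dd: "of_nat d = 2 * of_nat i + (1 :: complex)" by (subst i) simp
  show "app (rho (AA (Suc i))) ep = 0"
  proof (rule poly_mapping_eqI, rule ccontr)
    fix b assume nz: "lk (app (rho (AA (Suc i))) ep) b \<noteq> lk 0 b"
    obtain k l v where b: "b = (k, l, v)" by (cases b) auto
    have e: "2 * of_nat (Suc i) - of_nat d = - (of_nat (k + l) :: complex)"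
      using eu_degree[OF AA_HH pbe, of "Suc i" k l v] nz b by simp
    have "of_nat (1 + k + l) = 1 - (2 * of_nat (Suc i) - of_nat d :: complex)" unfolding e by simp
    also have "\<dots> = 0" by (simp add: dd)
    finally have "of_nat (1 + k + l) = (0 :: complex)" .
    then show False unfolding of_nat_eq_0_iff by simp
  qed
  show "app (rho (AA i)) ep = 0"
  proof (rule poly_mapping_eqI, rule ccontr)
    fix b assume nz: "lk (app (rho (AA i)) ep) b \<noteq> lk 0 b"
    obtain k l v where b: "b = (k, l, v)" by (cases b) auto
    have e0: "2 * of_nat i - of_nat d = - (of_nat (k + l) :: complex)"
      using eu_degree[OF AA_HH pbe, of i k l v] nz b by simp
    have "of_nat (k + l) = - (2 * of_nat i - of_nat d :: complex)" unfolding e0 by simp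
    also have "\<dots> = of_nat 1" by (simp add: dd)
    finally have "of_nat (k + l) = (of_nat 1 :: complex)" .
    then have kl: "k + l = 1" unfolding of_nat_eq_iff .
    have e: "tt ^ k / tt ^ l * (if v then tt else 1 / tt) = - (1 / tt)"
      using odd_coeff[OF AA_HH tau_AA, of i k l v] nz b by simp
    have n1: "tt \<noteq> -1" using tt_power_eq[of 1] d5 by auto
    have n3: "tt ^ 3 \<noteq> -1"
    proof
      assume "tt ^ 3 = -1"
      then obtain k where "3 = d * (2 * k + 1)" using tt_power_eq by blast
      then have "d dvd 3" by (rule dvdI)
      then have "d \<le> 3" by (rule dvd_imp_le) simp
      then show False using d5 by simp
    qed
    \<comment> \<open>The twist has eigenvalues 1, t^2, 1/t^2 and 1 on x e+, x e-, y e+ and y e-.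
      Equality with -1/t would mean t = -1 or t^3 = -1.\<close>
    have "k = 1 \<and> l = 0 \<or> k = 0 \<and> l = 1" using kl by arith
    then show False
    proof
      assume "k = 1 \<and> l = 0"
      then show False using e n1 n3 by (cases v) (simp_all add: field_simps power3_eq_cube)
    next
      assume "k = 0 \<and> l = 1"
      moreover have "- tt \<noteq> 1" using n1 minus_minus[of tt] by metis
      ultimately show False using e n1 by (cases v) (simp_all add: field_simps)
    qed
  qed
qed

end

context cherednik
begin

section \<open>Bounds from the standard module, and brackets of the triple with m_0\<close>

section \<open>The ideal \<open>m\<^sub>0\<close> and its square\<close>

inductive_set M2 :: "(nat \<times> nat \<times> pbw) op set" where
  p: "A \<in> M0 \<Longrightarrow> B \<in> M0 \<Longrightarrow> A * B \<in> M2"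
| h: "B \<in> HH \<Longrightarrow> hb B \<in> M2"
| add: "A \<in> M2 \<Longrightarrow> B \<in> M2 \<Longrightarrow> A + B \<in> M2"

lemma M2_M0: "A \<in> M2 \<Longrightarrow> A \<in> M0"
  by (induction rule: M2.induct) (auto intro: M0.mult M0_Zh M0.h M0.add)

lemma M2_Zh: "A \<in> M2 \<Longrightarrow> A \<in> Zh"
  by (rule M0_Zh[OF M2_M0])

lemma M2_mult: "A \<in> M2 \<Longrightarrow> B \<in> Zh \<Longrightarrow> B * A \<in> M2"
proof (induction rule: M2.induct)
  case (p A C)
  then have "B * A * C \<in> M2" by (intro M2.p M0.mult)
  then show ?case by (simp only: mult.assoc)
next
  case (h C)
  then have "hb (B * C) \<in> M2" by (simp add: M2.h HH_mult Zh_HH)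
  then show ?case by simp
qed (simp add: distrib_left M2.add)

lemma M2_cs: "A \<in> M2 \<Longrightarrow> cs c A \<in> M2"
  using M2_mult[of A "cs c 1"] by (simp add: Zh_cs Zh_1)

lemma M2_uminus: "A \<in> M2 \<Longrightarrow> - A \<in> M2" using M2_cs[of A "-1"] by simp
lemma M2_diff: "A \<in> M2 \<Longrightarrow> B \<in> M2 \<Longrightarrow> A - B \<in> M2" using M2.add[of A "- B"] M2_uminus[of B] by simp
lemma M2_0: "0 \<in> M2" using M2.h[OF HH_0] by simp
lemma M2_sum: "(\<And>i. i \<in> I \<Longrightarrow> f i \<in> M2) \<Longrightarrow> sum f I \<in> M2"
  by (induction I rule: infinite_finite_induct) (auto intro: M2_0 M2.add)
lemma M2_trans: "A - B \<in> M2 \<Longrightarrow> B - C \<in> M2 \<Longrightarrow> A - C \<in> M2" using M2.add[of "A - B" "B - C"] by simp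

text \<open>In the quotient q, Q and eu annihilate e+, and the odd elements \<open>AA j\<close> move
  it to degree at least d; \<open>Kn_act\<close> takes care of multiples. It follows that m_0
  contains no nonzero constant and that m_0^2 moves e+ to degree at least 2d.\<close>

lemma M0_Kn: "A \<in> M0 \<Longrightarrow> app (rho A) ep \<in> Kn d"
proof (induction rule: M0.induct)
  case q
  show ?case by (simp add: qq_def rho_mult HH_letters rho_letters KK_basis blk_def)
next
  case Q
  show ?case by (simp add: QQ_def rho_mult HH_letters rho_letters Dl_XY_0 KK_simps(1))
next
  case e
  show ?case by (simp add: rho_eu_0 KK_simps(1))
next
  case (A j)
  show ?case by (rule odd_Kn[OF AA_HH tau_AA])
next
  case (h B)
  then show ?case by (simp add: rho_hb hb_KK)
next
  case (add A B)
  then show ?case by (simp add: rho_add Zh_HH M0_Zh KK_simps(2))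
next
  case (mult A B)
  then show ?case using Kn_act[OF mult(2) Kn_0 mult(3)] by (simp add: rho_mult Zh_HH M0_Zh)
qed

lemma M2_Kn: "A \<in> M2 \<Longrightarrow> app (rho A) ep \<in> Kn (2 * d)"
proof (induction rule: M2.induct)
  case (p A B)
  show ?case using Kn_act[OF M0_Zh[OF p(1)] M0_Kn[OF p(1)] M0_Kn[OF p(2)]] p
    by (simp add: rho_mult Zh_HH M0_Zh mult_2)
next
  case (h B)
  then show ?case by (simp add: rho_hb hb_KK)
next
  case (add A B)
  then show ?case by (simp add: rho_add Zh_HH M2_Zh KK_simps(2))
qed

lemma const_M0: assumes "cs c 1 \<in> M0" shows "c = 0"
proof -
  have "Poly_Mapping.single (0, 0, False) [:c:] \<in> Kn d"
    using M0_Kn[OF assms] by (simp add: rho_cs HH_1 rho_1)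
  moreover have "blk (\<lambda>m. m < d) (0, 0, False)" using d_pos by (simp add: blk_def)
  ultimately have "coeff (lk (Poly_Mapping.single (0 :: nat, 0 :: nat, False) [:c:]) (0, 0, False)) 0 = 0"
    unfolding KK_def mem_Collect_eq by blast
  then show ?thesis by simp
qed

text \<open>\<open>AA 0\<close> sends e+ to x^d e+ + y^d e+, whose first summand is nonzero in
  degree d of the quotient, below the bound 2d for \<open>M2\<close>.\<close>

lemma AA_0_M2: assumes "cs c (AA 0) \<in> M2" shows "c = 0"
proof -
  have y: "app (Dl.yo ^ m) ep = basis (0, m, False)" for m by (induction m) simp_all
  have x: "app (Dl.xo ^ m) ep = basis (m, 0, False)" for m by (induction m) simp_all
  have "rho (AA 0) = Dl.xo ^ d + Dl.yo ^ d"
    by (simp add: AA_def wd_0 rho_add HH_power HH_letters rho_power rho_letters)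
  then have e: "app (rho (cs c (AA 0))) ep = Poly_Mapping.single (d, 0, False) [:c:] + Poly_Mapping.single (0, d, False) [:c:]"
    by (simp add: rho_cs AA_HH x y)
  have "blk (\<lambda>m. m < 2 * d) (d, 0, False)" using d_pos by (simp add: blk_def)
  then have "coeff (lk (app (rho (cs c (AA 0))) ep) (d, 0, False)) 0 = 0"
    using M2_Kn[OF assms] unfolding KK_def mem_Collect_eq by blast
  then show ?thesis unfolding e using d_pos by (simp add: lookup_add lookup_single)
qed

lemma AA_gt: "j > d \<Longrightarrow> AA j = 0"
  by (simp add: AA_def wd_gt)

lemma AA_M0: "AA j \<in> M0"
  by (cases "j \<le> d") (auto intro: M0.A simp: AA_gt M0_0)

lemma pb_0_right: "pb A 0 = 0" and pb_0_left: "pb 0 A = 0"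
  by (rule pb_eqI, simp)+

lemma pb_diff_right: "A \<in> Zh \<Longrightarrow> B \<in> HH \<Longrightarrow> C \<in> HH \<Longrightarrow> pb A (B - C) = pb A B - pb A C"
  using pb_add_right[of A B "- C"] pb_cs_right[of A C "-1"] by (simp add: HH_uminus)

lemma pb_sum_right: "A \<in> Zh \<Longrightarrow> (\<And>i. i \<in> I \<Longrightarrow> f i \<in> HH) \<Longrightarrow> pb A (sum f I) = (\<Sum>i\<in>I. pb A (f i))"
  by (induction I rule: infinite_finite_induct) (simp_all add: pb_0_right pb_add_right HH_sum)

lemma pb_sl2': "pb qq eu = cs 2 qq" "pb QQ eu = cs (-2) QQ" "pb QQ qq = hb 1 - eu"
  using pb_anti[OF sl2_Zh(3) sl2_HH(1)] pb_anti[OF sl2_Zh(3) sl2_HH(2)] pb_anti[OF sl2_Zh(1) sl2_HH(2)]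
  by (simp_all add: pb_sl2)

lemma pb_M0I:
  assumes g: "g \<in> Zh" and A: "A \<in> M0"
    and gen: "pb g qq \<in> M0" "pb g QQ \<in> M0" "pb g eu \<in> M0" "\<And>j. j \<le> d \<Longrightarrow> pb g (AA j) \<in> M0"
  shows "pb g A \<in> M0"
  using A
proof (induction rule: M0.induct)
  case (h B)
  show ?case unfolding pb_hb_right pb(2)[OF g h] by (rule M0.h[OF pb(1)[OF g h]])
next
  case (add A B)
  then show ?case by (simp add: pb_add_right g Zh_HH M0_Zh M0.add)
next
  case (mult A B)
  then show ?case using M0.add[OF M0.mult[OF mult(1) Zh_pb[OF g mult(2)]] M0.mult[OF mult(3,2)]]
    by (simp add: pb_mult_right g Zh_HH M0_Zh)
qed (use gen in auto)

lemma sl2_pb_M0: assumes "g \<in> {qq, QQ, eu}" "A \<in> M0" shows "pb g A \<in> M0"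
proof -
  have q: "pb qq (AA j) \<in> M0" for j
    by (cases j) (simp_all add: pb_AA M0_0 M0_cs AA_M0)
  have h: "hb 1 \<in> M0" by (rule M0.h[OF HH_1])
  have "pb qq A \<in> M0" by (rule pb_M0I[OF sl2_Zh(1) assms(2)])
    (simp_all add: pb_sl2 pb_sl2' pb_self q M0_0 M0_cs M0_diff h M0.e M0.q)
  moreover have "pb QQ A \<in> M0" by (rule pb_M0I[OF sl2_Zh(2) assms(2)])
    (simp_all only: pb_sl2 pb_sl2' pb_self pb_AA M0_0 M0_cs M0_diff h M0.e M0.Q AA_M0)
  moreover have "pb eu A \<in> M0" by (rule pb_M0I[OF sl2_Zh(3) assms(2)])
    (simp_all only: pb_sl2 pb_sl2' pb_self pb_AA M0_0 M0_cs M0_diff h M0.q M0.Q AA_M0)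
  ultimately show ?thesis using assms(1) by blast
qed

section \<open>Evaluation at the origin; m_0 is a Poisson ideal\<close>

section \<open>The constant term\<close>

text \<open>Evaluation at the origin: the constant exists by \<open>Zh_CM\<close> and is unique by
  \<open>const_M0\<close>.\<close>

definition ev :: "(nat \<times> nat \<times> pbw) op \<Rightarrow> complex" where "ev z = (SOME c. z - cs c 1 \<in> M0)"

lemma ev_eqI: assumes "z - cs c 1 \<in> M0" shows "ev z = c"
  unfolding ev_def
proof (rule some_equality[where P = "\<lambda>c. z - cs c 1 \<in> M0", OF assms])
  fix c' assume "z - cs c' 1 \<in> M0"
  then have "(z - cs c 1) - (z - cs c' 1) \<in> M0" using assms by (rule M0_diff[rotated])
  then have "cs (c' - c) 1 \<in> M0" by (simp add: cs_diff_left)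
  then show "c' = c" using const_M0[of "c' - c"] by simp
qed

lemma ev: "z \<in> Zh \<Longrightarrow> z - cs (ev z) 1 \<in> M0"
  using Zh_CM[of z] ev_eqI by blast

lemma ev_M0: "z \<in> M0 \<Longrightarrow> ev z = 0"
  by (rule ev_eqI) simp

lemma ev_0: "z \<in> Zh \<Longrightarrow> ev z = 0 \<Longrightarrow> z \<in> M0"
  using ev[of z] by simp

lemma ev_add: assumes "z \<in> Zh" "w \<in> Zh" shows "ev (z + w) = ev z + ev w"
proof (rule ev_eqI)
  have "z + w - cs (ev z + ev w) 1 = (z - cs (ev z) 1) + (w - cs (ev w) 1)" by (simp add: cs_add_left)
  then show "z + w - cs (ev z + ev w) 1 \<in> M0" using M0.add[OF ev[OF assms(1)] ev[OF assms(2)]] by (simp only:)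
qed

lemma ev_cs: assumes "z \<in> Zh" shows "ev (cs c z) = c * ev z"
  using M0_cs[OF ev[OF assms], of c] by (intro ev_eqI) simp

lemma ev_pb: assumes g: "g \<in> {qq, QQ, eu}" and z: "z \<in> Zh" shows "ev (pb g z) = 0"
proof -
  have gZ: "g \<in> Zh" using g sl2_Zh by blast
  have "pb g (z - cs (ev z) 1) = pb g z"
    using z gZ by (simp add: pb_diff_right Zh_HH HH_cs HH_1 pb_cs_right pb_1)
  then show ?thesis using sl2_pb_M0[OF g ev[OF z]] by (simp add: ev_M0)
qed

definition E :: "nat \<Rightarrow> nat \<Rightarrow> (nat \<times> nat \<times> pbw) op" where "E i j = pb (AA i) (AA j)"

lemma E_Zh: "E i j \<in> Zh"
  unfolding E_def by (intro Zh_pb AA_Zh)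

lemma pb_E: assumes "g \<in> Zh" shows "pb g (E i j) = pb (pb g (AA i)) (AA j) + pb (AA i) (pb g (AA j))"
  unfolding E_def by (rule pb_jacobi[OF assms AA_Zh AA_HH])

lemma pb_eu_E: "pb eu (E i j) = cs (2 * (of_nat i + of_nat j - of_nat d)) (E i j)"
proof -
  have "pb eu (E i j) = cs (2 * of_nat i - of_nat d) (E i j) + cs (2 * of_nat j - of_nat d) (E i j)"
    unfolding pb_E[OF sl2_Zh(3)] pb_AA by (simp add: pb_cs_left pb_cs_right AA_Zh AA_HH E_def)
  also have "\<dots> = cs ((2 * of_nat i - of_nat d) + (2 * of_nat j - of_nat d)) (E i j)" by (simp only: cs_add_left)
  also have "(2 * of_nat i - of_nat d) + (2 * of_nat j - of_nat d) = 2 * (of_nat i + of_nat j - of_nat d :: complex)" by simp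
  finally show ?thesis .
qed

lemma pb_qq_E: "pb qq (E (Suc i) (Suc j)) = cs (of_nat d - of_nat i) (E i (Suc j)) + cs (of_nat d - of_nat j) (E (Suc i) j)"
  "pb qq (E 0 (Suc j)) = cs (of_nat d - of_nat j) (E 0 j)"
  unfolding pb_E[OF sl2_Zh(1)] pb_AA by (simp_all add: pb_cs_left pb_cs_right AA_Zh AA_HH E_def pb_0_left)

lemma pb_QQ_E: "pb QQ (E i j) = cs (- (of_nat i + 1)) (E (Suc i) j) + cs (- (of_nat j + 1)) (E i (Suc j))"
  unfolding pb_E[OF sl2_Zh(2)] pb_AA by (simp only: pb_cs_left pb_cs_right AA_Zh AA_HH E_def)

text \<open>Both elements annihilate e+, hence so does their commutator and, after division by hbar,
  their bracket. But the component along e+ of the result is the value of the bracket at the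
  origin.\<close>

lemma ev_E_middle: assumes "d = 2 * i + 1" shows "ev (E i (Suc i)) = 0"
proof -
  let ?c = "ev (E i (Suc i))"
  have EH: "E i (Suc i) \<in> HH" by (rule Zh_HH[OF E_Zh])
  have "rho (hb (E i (Suc i))) = rho (AA i) * rho (AA (Suc i)) - rho (AA (Suc i)) * rho (AA i)"
    unfolding E_def pb(2)[OF AA_Zh AA_HH, symmetric] by (simp add: rho_diff rho_mult HH_mult AA_HH)
  then have "app (hb (rho (E i (Suc i)))) ep = 0"
    unfolding rho_hb[OF EH] by (simp only: app_ops AA_middle[OF assms] app_simps diff_0_right)
  then have 0: "app (rho (E i (Suc i))) ep = 0"
    unfolding app_hb by (intro poly_mapping_eqI) (metis lookup_pscale lookup_zero mult_eq_0_iff pCons_eq_0_iff zero_neq_one)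
  have "app (rho (E i (Suc i) - cs ?c 1)) ep = - Poly_Mapping.single (0, 0, False) [:?c:]"
    using EH by (simp add: rho_diff HH_cs HH_1 rho_cs rho_1 0)
  then have "- Poly_Mapping.single (0, 0, False) [:?c:] \<in> Kn d" using M0_Kn[OF ev[OF E_Zh[of i "Suc i"]]] by simp
  moreover have "blk (\<lambda>m. m < d) (0, 0, False)" using d_pos by (simp add: blk_def)
  ultimately have "coeff (lk (- Poly_Mapping.single (0 :: nat, 0 :: nat, False) [:?c:]) (0, 0, False)) 0 = 0"
    unfolding KK_def mem_Collect_eq by blast
  then show ?thesis by simp
qed

text \<open>The constant terms of the brackets form an invariant pairing on an irreducible \<open>sl\<^sub>2\<close>-module, which
  vanishes as soon as it vanishes in the middle weight.\<close>

lemma ev_E: assumes "i \<le> d" "j \<le> d" shows "ev (E i j) = 0"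
proof (cases "i + j = d")
  case False
  have "2 * (of_nat i + of_nat j - of_nat d) * ev (E i j) = 0"
    using ev_pb[of eu "E i j"] by (simp add: E_Zh pb_eu_E ev_cs)
  moreover have "of_nat i + of_nat j \<noteq> (of_nat d :: complex)"
    using False by (simp only: of_nat_add[symmetric] of_nat_eq_iff not_False_eq_True)
  ultimately show ?thesis unfolding mult_eq_0_iff right_minus_eq by simp
next
  case True
  define f where "f i = ev (E i (d - i))" for i
  \<comment> \<open>For i + j + 1 = d the bracket of q with \<open>E (Suc i) (Suc j)\<close> has
    value 0 at the origin. Its two terms are \<open>f i\<close> and \<open>f (Suc i)\<close> with
    nonzero coefficients, so these vanish together.\<close>
  have step: "f i = 0 \<longleftrightarrow> f (Suc i) = 0" if i: "i < d" for i
  proof -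
    obtain j where j: "d = Suc (i + j)" using i unfolding less_iff_Suc_add by blast
    have "ev (pb qq (E (Suc i) (Suc j))) = 0" by (rule ev_pb) (simp_all add: E_Zh)
    then have "(of_nat d - of_nat i) * ev (E i (Suc j)) + (of_nat d - of_nat j) * ev (E (Suc i) j) = 0"
      by (simp add: pb_qq_E ev_add ev_cs E_Zh Zh_cs)
    moreover have "d - i = Suc j" "d - Suc i = j" using j by simp_all
    moreover have "of_nat d - of_nat i = (of_nat (Suc j) :: complex)" "of_nat d - of_nat j = (of_nat (Suc i) :: complex)"
      by (simp_all add: j)
    ultimately have e: "of_nat (Suc j) * f i + of_nat (Suc i) * f (Suc i) = 0" by (simp only: f_def)
    show ?thesis
    proof
      assume "f i = 0"
      then show "f (Suc i) = 0" using e by (simp del: of_nat_Suc)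
    next
      assume "f (Suc i) = 0"
      then show "f i = 0" using e by (simp del: of_nat_Suc)
    qed
  qed
  have all: "f i = 0 \<longleftrightarrow> f 0 = 0" if "i \<le> d" for i
    using that by (induction i) (use step in auto)
  have "\<exists>m\<le>d. f m = 0"
  proof (cases "even d")
    case True
    then obtain m where m: "d = 2 * m" by blast
    then have dm: "d - m = m" by simp
    have "f m = 0" unfolding f_def dm E_def pb_self by (rule ev_M0[OF M0_0])
    then show ?thesis using m by (intro exI[of _ m]) simp
  next
    case False
    then obtain m where m: "d = 2 * m + 1" by (rule oddE)
    then have "d - m = Suc m" by simp
    then have "f m = 0" using ev_E_middle[OF m] by (simp only: f_def)
    then show ?thesis using m by (intro exI[of _ m]) simp
  qed
  then obtain m where m: "m \<le> d" "f m = 0" by blast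
  have "f i = 0" using all[OF m(1)] m(2) all[OF assms(1)] by simp
  moreover have "d - i = j" using True by simp
  ultimately show ?thesis by (simp add: f_def)
qed

lemma E_M0: "i \<le> d \<Longrightarrow> j \<le> d \<Longrightarrow> E i j \<in> M0"
  by (rule ev_0[OF E_Zh ev_E])

text \<open>By the Leibniz rule it suffices to treat generators. Brackets with q, Q, eu are
  explicit, and those of two \<open>AA\<close> lie in m_0 by \<open>ev_E\<close>.\<close>

lemma pb_M0: assumes A: "A \<in> M0" and B: "B \<in> M0" shows "pb A B \<in> M0"
proof -
  have anti: "pb A g \<in> M0" if "g \<in> Zh" "pb g A \<in> M0" "A \<in> M0" for g A
    using pb_anti[OF that(1) Zh_HH[OF M0_Zh[OF that(3)]]] that(2) by (simp add: M0_uminus)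
  have a: "pb (AA j) A \<in> M0" if j: "j \<le> d" for j
  proof (rule pb_M0I[OF AA_Zh A])
    show "pb (AA j) qq \<in> M0" "pb (AA j) QQ \<in> M0" "pb (AA j) eu \<in> M0"
      by (rule anti[OF sl2_Zh(1) sl2_pb_M0[OF _ AA_M0] AA_M0] anti[OF sl2_Zh(2) sl2_pb_M0[OF _ AA_M0] AA_M0]
          anti[OF sl2_Zh(3) sl2_pb_M0[OF _ AA_M0] AA_M0], simp)+
    show "pb (AA j) (AA i) \<in> M0" if "i \<le> d" for i using E_M0[OF j that] by (simp only: E_def)
  qed
  show ?thesis
  proof (rule pb_M0I[OF M0_Zh[OF A] B])
    show "pb A qq \<in> M0" "pb A QQ \<in> M0" "pb A eu \<in> M0"
      by (rule anti[OF sl2_Zh(1) sl2_pb_M0[OF _ A] A] anti[OF sl2_Zh(2) sl2_pb_M0[OF _ A] A]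
          anti[OF sl2_Zh(3) sl2_pb_M0[OF _ A] A], simp)+
    show "pb A (AA j) \<in> M0" if "j \<le> d" for j by (rule anti[OF AA_Zh a[OF that] A])
  qed
qed

lemma pb_M2: assumes A: "A \<in> M0" and B: "B \<in> M2" shows "pb A B \<in> M2"
  using B
proof (induction rule: M2.induct)
  case (p B C)
  then show ?case using M2.add[OF M2.p[OF pb_M0[OF A p(1)] p(2)] M2.p[OF p(1) pb_M0[OF A p(2)]]]
    by (simp add: pb_mult_right Zh_HH M0_Zh A)
next
  case (h B)
  show ?case unfolding pb_hb_right pb(2)[OF M0_Zh[OF A] h] by (rule M2.h[OF pb(1)[OF M0_Zh[OF A] h]])
next
  case (add B C)
  then show ?case by (simp add: pb_add_right A Zh_HH M0_Zh M2_Zh M2.add)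
qed

lemma pb_M2_left: assumes A: "A \<in> M2" and B: "B \<in> M0" shows "pb A B \<in> M2"
  using pb_anti[OF M0_Zh[OF B] Zh_HH[OF M2_Zh[OF A]]] M2_uminus[OF pb_M2[OF B A]] by simp

lemma pb_M2_cong: assumes "A \<in> M0" "B - C \<in> M2" "B \<in> HH" "C \<in> HH" shows "pb A B - pb A C \<in> M2"
  using pb_M2[OF assms(1,2)] assms by (simp add: pb_diff_right M0_Zh)

section \<open>A basis of m_0/m_0^2\<close>

section \<open>Linear independence modulo \<open>m\<^sub>0\<^sup>2\<close>\<close>

lemma tau_M0: "A \<in> M0 \<Longrightarrow> tau A \<in> M0"
proof (induction rule: M0.induct)
  case (A j)
  then show ?case by (simp add: tau_AA M0_uminus M0.A)
next
  case (mult A B)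
  then show ?case by (simp add: tau_mult Zh_HH M0_Zh M0.mult tau_Zh)
qed (simp_all add: tau_sl2 M0.intros tau_hb tau tau_add Zh_HH M0_Zh)

lemma tau_M2: "A \<in> M2 \<Longrightarrow> tau A \<in> M2"
proof (induction rule: M2.induct)
  case (p A B)
  then show ?case by (simp add: tau_mult Zh_HH M0_Zh M2.p tau_M0)
qed (simp_all add: M2.intros tau_hb tau tau_add Zh_HH M2_Zh)

lemma tau_pb: assumes "A \<in> Zh" "B \<in> HH" shows "tau (pb A B) = pb (tau A) (tau B)"
proof (rule pb_eqI[symmetric])
  have "tau A * tau B - tau B * tau A = tau (A * B - B * A)"
    using assms by (simp add: tau_diff tau_mult HH_mult Zh_HH)
  then show "tau A * tau B - tau B * tau A = hb (tau (pb A B))"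
    using pb[OF assms] by (simp add: tau_hb)
qed

definition L2 :: "complex \<Rightarrow> complex \<Rightarrow> complex \<Rightarrow> (nat \<times> nat \<times> pbw) op" where
  "L2 u v w = cs u qq + cs v QQ + cs w eu"

definition LV :: "(nat \<Rightarrow> complex) \<Rightarrow> (nat \<times> nat \<times> pbw) op" where
  "LV c = (\<Sum>j\<le>d. cs (c j) (AA j))"

lemma L2_M0: "L2 u v w \<in> M0" and LV_M0: "LV c \<in> M0"
  unfolding L2_def LV_def by (intro M0.add M0_sum M0_cs M0.q M0.Q M0.e AA_M0)+

lemma L2_Zh: "L2 u v w \<in> Zh" and LV_Zh: "LV c \<in> Zh"
  by (rule M0_Zh, rule L2_M0 LV_M0)+

lemma L2_HH: "L2 u v w \<in> HH" and LV_HH: "LV c \<in> HH"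
  by (rule Zh_HH, rule L2_Zh LV_Zh)+

lemma L2_add: "L2 u v w + L2 u' v' w' = L2 (u + u') (v + v') (w + w')"
  and L2_cs: "cs k (L2 u v w) = L2 (k * u) (k * v) (k * w)"
  and L2_0: "L2 0 0 0 = 0"
  by (simp_all add: L2_def cs_add_left)

lemma LV_add: "LV c + LV c' = LV (\<lambda>j. c j + c' j)"
  and LV_cs: "cs k (LV c) = LV (\<lambda>j. k * c j)"
  and LV_0: "LV (\<lambda>j. 0) = 0"
  by (simp_all add: LV_def cs_sum cs_add_left sum.distrib)

lemma LV_uminus: "- LV c = LV (\<lambda>j. - c j)" and L2_uminus: "- L2 u v w = L2 (- u) (- v) (- w)"
  using LV_cs[of "-1" c] L2_cs[of "-1" u v w] by simp_all

lemma LV_diff: "LV c - LV c' = LV (\<lambda>j. c j - c' j)"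
  and L2_diff: "L2 u v w - L2 u' v' w' = L2 (u - u') (v - v') (w - w')"
  using LV_add[of c "\<lambda>j. - c' j"] L2_add[of u v w "- u'" "- v'" "- w'"] by (simp_all flip: LV_uminus L2_uminus)

lemma LV_cong: "(\<And>j. j \<le> d \<Longrightarrow> c j = c' j) \<Longrightarrow> LV c = LV c'"
  unfolding LV_def by (intro sum.cong) auto

lemma LV_unit: "j \<le> d \<Longrightarrow> LV (\<lambda>i. if i = j then k else 0) = cs k (AA j)"
proof -
  assume j: "j \<le> d"
  have "LV (\<lambda>i. if i = j then k else 0) = (\<Sum>i\<le>d. if i = j then cs k (AA i) else 0)"
    unfolding LV_def by (intro sum.cong) auto
  then show ?thesis using j by simp
qed

lemma tau_LV: "tau (LV c) = - LV c"
proof -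
  have "tau (sum f I) = (\<Sum>i\<in>I. tau (f i))" if "\<And>i. i \<in> I \<Longrightarrow> f i \<in> HH" for f and I :: "nat set"
    using that by (induction I rule: infinite_finite_induct) (simp_all add: tau_add HH_sum tau_cs[OF HH_0, of 0, simplified])
  then show ?thesis by (simp add: LV_def HH_cs AA_HH tau_cs tau_AA sum_negf)
qed

lemma tau_L2: "tau (L2 u v w) = L2 u v w"
  by (simp add: L2_def tau_add HH_add HH_cs sl2_HH tau_cs tau_sl2)

lemma pb_LV: "g \<in> Zh \<Longrightarrow> pb g (LV c) = (\<Sum>j\<le>d. cs (c j) (pb g (AA j)))"
  unfolding LV_def by (simp add: pb_sum_right HH_cs AA_HH pb_cs_right)

lemma pb_qq_LV: "pb qq (LV c) = LV (\<lambda>j. (of_nat d - of_nat j) * c (Suc j))"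
proof -
  have "pb qq (LV c) = (\<Sum>j<Suc d. cs (c j) (pb qq (AA j)))"
    by (simp only: pb_LV[OF sl2_Zh(1)] lessThan_Suc_atMost)
  also have "\<dots> = (\<Sum>j<d. cs ((of_nat d - of_nat j) * c (Suc j)) (AA j))"
    by (simp add: sum.lessThan_Suc_shift pb_AA mult.commute del: sum.lessThan_Suc)
  also have "\<dots> = (\<Sum>j<Suc d. cs ((of_nat d - of_nat j) * c (Suc j)) (AA j))" by simp
  finally show ?thesis by (simp only: LV_def lessThan_Suc_atMost)
qed

lemma pb_QQ_LV: "pb QQ (LV c) = LV (\<lambda>j. - of_nat j * c (j - 1))"
proof -
  have "pb QQ (LV c) = (\<Sum>j<Suc d. cs (c j) (pb QQ (AA j)))"
    by (simp only: pb_LV[OF sl2_Zh(2)] lessThan_Suc_atMost)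
  also have "\<dots> = (\<Sum>j<d. cs (- of_nat (Suc j) * c j) (AA (Suc j)))"
    by (simp add: pb_AA AA_gt mult.commute add.commute)
  also have "\<dots> = (\<Sum>j<Suc d. cs (- of_nat j * c (j - 1)) (AA j))"
    by (simp add: sum.lessThan_Suc_shift del: sum.lessThan_Suc of_nat_Suc)
  finally show ?thesis by (simp only: LV_def lessThan_Suc_atMost)
qed

lemma pb_eu_LV: "pb eu (LV c) = LV (\<lambda>j. (2 * of_nat j - of_nat d) * c j)"
  by (simp only: pb_LV[OF sl2_Zh(3)]) (simp add: LV_def pb_AA mult.commute)

lemma pb_L2: "A \<in> HH \<Longrightarrow> pb (L2 u v w) A = cs u (pb qq A) + cs v (pb QQ A) + cs w (pb eu A)"
  unfolding L2_def by (simp add: pb_add_left pb_cs_left Zh_add Zh_cs sl2_Zh)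

lemma pb_L2_LV: "pb (L2 u v w) (LV c) =
    LV (\<lambda>j. u * ((of_nat d - of_nat j) * c (Suc j)) + v * (- of_nat j * c (j - 1)) + w * ((2 * of_nat j - of_nat d) * c j))"
  unfolding pb_L2[OF LV_HH] pb_qq_LV pb_QQ_LV pb_eu_LV LV_cs LV_add ..

lemma pb_L2_L2: "pb (L2 u v w) (L2 u' v' w') - L2 (2 * (u * w' - w * u')) (2 * (w * v' - v * w')) (u * v' - v * u') \<in> M2"
proof -
  have r: "pb g (L2 u' v' w') = cs u' (pb g qq) + cs v' (pb g QQ) + cs w' (pb g eu)" if "g \<in> Zh" for g
    unfolding L2_def using that by (simp add: pb_add_right pb_cs_right HH_add HH_cs sl2_HH)
  have "pb (L2 u v w) (L2 u' v' w') - L2 (2 * (u * w' - w * u')) (2 * (w * v' - v * w')) (u * v' - v * u')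
      = hb (cs (v * u' - u * v') 1)"
    unfolding pb_L2[OF L2_HH] r[OF sl2_Zh(1)] r[OF sl2_Zh(2)] r[OF sl2_Zh(3)]
    by (simp add: pb_sl2 pb_sl2' pb_self L2_def cs_diff_left cs_add_left algebra_simps)
  then show ?thesis using M2.h[OF HH_cs[OF HH_1]] by (simp only:)
qed

lemma of_nat_rel: "of_nat m = (of_nat n :: complex) \<longleftrightarrow> m = n" by simp

text \<open>The bracket with q lowers indices with nonzero factors and preserves \<open>M2\<close>.
  It reduces a relation to one among fewer elements and finally to a multiple of
  \<open>AA 0\<close>, which is excluded by \<open>AA_0_M2\<close>.\<close>

lemma LV_indep: assumes "LV c \<in> M2" "j \<le> d" shows "c j = 0"
proof -
  have main: "\<forall>j\<le>d. c j = 0" if "LV c \<in> M2" "\<forall>j. n < j \<and> j \<le> d \<longrightarrow> c j = 0" for n c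
    using that
  proof (induction n arbitrary: c)
    case 0
    have "LV c = LV (\<lambda>i. if i = 0 then c 0 else 0)" by (rule LV_cong) (use 0 in auto)
    then have "c 0 = 0" using 0 AA_0_M2[of "c 0"] by (simp add: LV_unit)
    then show ?case using 0 by (metis gr0I)
  next
    case (Suc n)
    define c' where "c' j = (of_nat d - of_nat j) * c (Suc j)" for j
    have "LV c' \<in> M2" using pb_M2[OF M0.q Suc.prems(1)] unfolding pb_qq_LV c'_def .
    moreover have "\<forall>j. n < j \<and> j \<le> d \<longrightarrow> c' j = 0"
    proof (intro allI impI)
      fix j assume "n < j \<and> j \<le> d"
      then show "c' j = 0" using Suc.prems(2) by (cases "j = d") (auto simp: c'_def)
    qed
    ultimately have c': "\<forall>j\<le>d. c' j = 0" by (rule Suc.IH)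
    have s: "c (Suc j) = 0" if j: "j < d" for j
    proof -
      have "(of_nat d - of_nat j :: complex) \<noteq> 0" using j by simp
      moreover have "c' j = 0" using c' j by simp
      ultimately show ?thesis unfolding c'_def mult_eq_0_iff by blast
    qed
    have p: "c j = 0" if "0 < j" "j \<le> d" for j using s[of "j - 1"] that by simp
    have "LV c = LV (\<lambda>i. if i = 0 then c 0 else 0)" by (rule LV_cong) (use p in auto)
    then have "c 0 = 0" using Suc.prems AA_0_M2[of "c 0"] by (simp add: LV_unit)
    then show ?case using p by (metis gr0I)
  qed
  have "\<forall>j\<le>d. c j = 0" by (rule main[OF assms(1), of d]) auto
  then show ?thesis using assms(2) by simp
qed

text \<open>The two summands are the parts with eigenvalues 1 and -1 under \<open>tau\<close>, which
  preserves \<open>M2\<close>.\<close>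

lemma L2_LV_separate: assumes "L2 u v w + LV c \<in> M2" shows "L2 u v w \<in> M2" "LV c \<in> M2"
proof -
  have "L2 u v w - LV c \<in> M2" using tau_M2[OF assms] by (simp add: tau_add L2_HH LV_HH tau_LV tau_L2)
  from M2_cs[OF M2.add[OF assms this], of "1 / 2"] M2_cs[OF M2_diff[OF assms this], of "1 / 2"]
  show "L2 u v w \<in> M2" "LV c \<in> M2" by (simp_all flip: cs_add_left add: diff_diff_eq2)
qed

text \<open>sl_2 acts faithfully on the span of the \<open>AA j\<close>: the bracket with
  \<open>AA 1\<close> has coefficients proportional to u, w and v at \<open>AA 0\<close>,
  \<open>AA 1\<close> and \<open>AA 2\<close>, with factors that are nonzero as d is neither 0 nor
  2.\<close>

lemma L2_indep: assumes "L2 u v w \<in> M2" shows "u = 0" "v = 0" "w = 0"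
proof -
  let ?c = "\<lambda>i. if i = Suc 0 then 1 else 0 :: complex"
  have "pb (L2 u v w) (LV ?c) \<in> M2" by (rule pb_M2_left[OF assms LV_M0])
  from LV_indep[OF this[unfolded pb_L2_LV], of 0] LV_indep[OF this[unfolded pb_L2_LV], of 1] LV_indep[OF this[unfolded pb_L2_LV], of 2]
  have "u * of_nat d = 0" "w * (2 - of_nat d) = 0" "v * 2 = 0" using d5 by simp_all
  moreover have "of_nat d \<noteq> (2 :: complex)" using d5 of_nat_rel[of d 2] by auto
  ultimately show "u = 0" "v = 0" "w = 0" using d5 by auto
qed

lemma M0_span: assumes "A \<in> M0" shows "\<exists>u v w c. A - (L2 u v w + LV c) \<in> M2"
  using assms
proof (induction rule: M0.induct)
  case q
  show ?case by (rule exI[of _ 1], rule exI[of _ 0], rule exI[of _ 0], rule exI[of _ "\<lambda>_. 0"]) (simp add: L2_def LV_0 M2_0)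
next
  case Q
  show ?case by (rule exI[of _ 0], rule exI[of _ 1], rule exI[of _ 0], rule exI[of _ "\<lambda>_. 0"]) (simp add: L2_def LV_0 M2_0)
next
  case e
  show ?case by (rule exI[of _ 0], rule exI[of _ 0], rule exI[of _ 1], rule exI[of _ "\<lambda>_. 0"]) (simp add: L2_def LV_0 M2_0)
next
  case (A j)
  then show ?case by (intro exI[of _ 0] exI[of _ "\<lambda>i. if i = j then 1 else 0"]) (simp add: L2_0 LV_unit M2_0)
next
  case (h B)
  then show ?case by (intro exI[of _ 0] exI[of _ "\<lambda>i. 0"]) (simp add: L2_0 LV_0 M2.h)
next
  case (add A B)
  then obtain u v w c u' v' w' c' where "A - (L2 u v w + LV c) \<in> M2" "B - (L2 u' v' w' + LV c') \<in> M2" by blast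
  then have "(A - (L2 u v w + LV c)) + (B - (L2 u' v' w' + LV c')) \<in> M2" by (rule M2.add)
  also have "(A - (L2 u v w + LV c)) + (B - (L2 u' v' w' + LV c')) = A + B - ((L2 u v w + L2 u' v' w') + (LV c + LV c'))"
    by simp
  finally show ?case unfolding L2_add LV_add by blast
next
  case (mult A B)
  then obtain u v w c where A: "A - (L2 u v w + LV c) \<in> M2" by blast
  \<comment> \<open>B is split into its value at the origin and an element of \<open>M0\<close>; the
    latter times A lies in \<open>M2\<close>, so B acts on the quotient as a scalar.\<close>
  have "(B - cs (ev B) 1) * A + cs (ev B) (A - (L2 u v w + LV c)) \<in> M2"
    by (intro M2.add M2.p ev mult M2_cs A)
  also have "(B - cs (ev B) 1) * A + cs (ev B) (A - (L2 u v w + LV c)) = B * A - (cs (ev B) (L2 u v w) + cs (ev B) (LV c))"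
    by (simp add: algebra_simps)
  finally show ?case unfolding L2_cs LV_cs by blast
qed

section \<open>Commutativity of the span of the a_j modulo m_0^2\<close>

section \<open>The brackets of the \<open>a\<^sub>j\<close>\<close>

text \<open>The bracket of two odd elements is even under \<open>tau\<close>, so it lies in the span
  of q, Q, eu modulo \<open>M2\<close>. It has weight 2(i+j-d) for eu, while q, Q, eu have weights
  -2, 2, 0; the three equations express this.\<close>

lemma E_L2:
  assumes "i \<le> d" "j \<le> d"
  shows "\<exists>u v w. E i j - L2 u v w \<in> M2 \<and> (2 * (of_nat i + of_nat j - of_nat d) + 2) * u = 0 \<and>
    (2 * (of_nat i + of_nat j - of_nat d) - 2) * v = 0 \<and> 2 * (of_nat i + of_nat j - of_nat d) * w = 0"
proof -
  let ?n = "2 * (of_nat i + of_nat j - of_nat d) :: complex"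
  obtain u v w c where s: "E i j - (L2 u v w + LV c) \<in> M2" using M0_span[OF E_M0[OF assms]] by blast
  have tE: "tau (E i j) = E i j"
  proof -
    have "pb (- AA i) (- AA j) = pb (cs (-1) (AA i)) (cs (-1) (AA j))" by simp
    also have "\<dots> = pb (AA i) (AA j)"
      by (simp only: pb_cs_left[OF AA_Zh HH_cs[OF AA_HH]] pb_cs_right[OF AA_Zh AA_HH] cs_simps) simp
    finally show ?thesis unfolding E_def tau_pb[OF AA_Zh AA_HH] tau_AA .
  qed
  have t: "E i j - (L2 u v w - LV c) \<in> M2"
    using tau_M2[OF s] by (simp add: tau_diff tau_add Zh_HH E_Zh L2_HH LV_HH HH_add tE tau_L2 tau_LV)
  \<comment> \<open>Averaging the expansion with its image under \<open>tau\<close> removes the odd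
    part.\<close>
  have "cs (1 / 2) ((E i j - (L2 u v w + LV c)) + (E i j - (L2 u v w - LV c))) \<in> M2"
    by (intro M2_cs M2.add s t)
  also have "cs (1 / 2) ((E i j - (L2 u v w + LV c)) + (E i j - (L2 u v w - LV c))) = E i j - L2 u v w"
  proof -
    have "(E i j - (L2 u v w + LV c)) + (E i j - (L2 u v w - LV c)) = cs 2 (E i j - L2 u v w)"
      unfolding cs_two by simp
    then show ?thesis by simp
  qed
  finally have EL: "E i j - L2 u v w \<in> M2" .
  have 1: "cs ?n (E i j) - pb eu (L2 u v w) \<in> M2"
    using pb_M2_cong[OF M0.e EL Zh_HH[OF E_Zh] L2_HH] unfolding pb_eu_E .
  have e: "pb eu (L2 u v w) = L2 (- 2 * u) (2 * v) 0"
    unfolding L2_def by (simp add: pb_add_right pb_cs_right sl2_Zh HH_add HH_cs sl2_HH pb_sl2 pb_self mult.commute)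
  have "cs ?n (E i j) - L2 (- 2 * u) (2 * v) 0 - cs ?n (E i j - L2 u v w) \<in> M2"
    using M2_diff[OF 1 M2_cs[OF EL, of ?n]] unfolding e .
  also have "cs ?n (E i j) - L2 (- 2 * u) (2 * v) 0 - cs ?n (E i j - L2 u v w) = cs ?n (L2 u v w) - L2 (- 2 * u) (2 * v) 0"
    by simp
  finally have "L2 (?n * u - (- 2 * u)) (?n * v - 2 * v) (?n * w - 0) \<in> M2" unfolding L2_cs L2_diff .
  from L2_indep[OF this] have "(?n + 2) * u = 0" "(?n - 2) * v = 0" "?n * w = 0"
    by (simp_all add: algebra_simps)
  then show ?thesis using EL by blast
qed

text \<open>Modulo \<open>M2\<close>, weights leave \<open>E 0 d\<close> = w eu,
  \<open>E 1 d\<close> = v1 Q and \<open>E 0 1\<close> = 0. The bracket of the first with Q gives v1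
  = 2 w, as \<open>AA (Suc d)\<close> vanishes; the Jacobi identity for \<open>AA 0\<close>,
  \<open>AA 1\<close>, \<open>AA d\<close> gives v1 = (d - 2) w. Hence (d - 4) w = 0, and d being
  different from 4 yields w = 0.\<close>

lemma E_0_d: "E 0 d \<in> M2" "E 1 d \<in> M2"
proof -
  have ne: "of_nat d \<noteq> (2 :: complex)" "of_nat d \<noteq> (4 :: complex)" "of_nat d \<noteq> (0 :: complex)" "of_nat d \<noteq> (1 :: complex)"
    using d5 of_nat_rel[of d 2] of_nat_rel[of d 4] by auto
  obtain u v w where "E 0 d - L2 u v w \<in> M2" "(2 * (of_nat 0 + of_nat d - of_nat d) + 2) * u = 0"
    "(2 * (of_nat 0 + of_nat d - of_nat d) - 2) * v = 0"
    using E_L2[of 0 d] by blast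
  then have 0: "E 0 d - L2 0 0 w \<in> M2" by simp
  obtain u1 v1 w1 where "E 1 d - L2 u1 v1 w1 \<in> M2" "(2 * (of_nat 1 + of_nat d - of_nat d) + 2) * u1 = 0"
    "2 * (of_nat 1 + of_nat d - of_nat d) * w1 = 0"
    using E_L2[of 1 d] d5 by auto
  then have 1: "E 1 d - L2 0 v1 0 \<in> M2" by simp
  obtain u2 v2 w2 where "E 0 1 - L2 u2 v2 w2 \<in> M2" "(2 * (of_nat 0 + of_nat 1 - of_nat d) + 2) * u2 = 0"
    "(2 * (of_nat 0 + of_nat 1 - of_nat d) - 2) * v2 = 0" "2 * (of_nat 0 + of_nat 1 - of_nat d) * w2 = 0"
    using E_L2[of 0 1] d5 by auto
  then have 2: "E 0 1 \<in> M2" using ne by (simp add: L2_0 algebra_simps)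
  have "pb QQ (E 0 d) - pb QQ (L2 0 0 w) \<in> M2"
    by (rule pb_M2_cong[OF M0.Q 0 Zh_HH[OF E_Zh] L2_HH])
  moreover have "pb QQ (E 0 d) = - E 1 d"
    unfolding pb_QQ_E by (simp add: E_def AA_gt pb_0_right)
  moreover have "pb QQ (L2 0 0 w) = L2 0 (- 2 * w) 0"
    by (simp add: L2_def pb_cs_right sl2_Zh sl2_HH pb_sl2' mult.commute)
  ultimately have "- E 1 d - L2 0 (- 2 * w) 0 \<in> M2" by simp
  from M2.add[OF this 1] have "- L2 0 (- 2 * w) 0 - L2 0 v1 0 \<in> M2" by (simp only: diff_add_eq add_diff_eq) simp
  moreover have "- L2 0 (- 2 * w) 0 - L2 0 v1 0 = L2 0 (2 * w - v1) 0"
    unfolding L2_uminus L2_diff by simp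
  ultimately have "L2 0 (2 * w - v1) 0 \<in> M2" by (simp only:)
  from L2_indep(2)[OF this] have v1: "v1 = 2 * w" by simp
  have "pb (AA 0) (E 1 d) = pb (E 0 1) (AA d) + pb (AA 1) (E 0 d)"
    unfolding E_def by (rule pb_jacobi[OF AA_Zh AA_Zh AA_HH])
  moreover have "pb (AA 0) (E 1 d) - pb (AA 0) (L2 0 v1 0) \<in> M2"
    by (rule pb_M2_cong[OF AA_M0 1 Zh_HH[OF E_Zh] L2_HH])
  moreover have "pb (AA 1) (E 0 d) - pb (AA 1) (L2 0 0 w) \<in> M2"
    by (rule pb_M2_cong[OF AA_M0 0 Zh_HH[OF E_Zh] L2_HH])
  moreover have "pb (E 0 1) (AA d) \<in> M2" by (rule pb_M2_left[OF 2 AA_M0])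
  ultimately have m: "pb (AA 0) (L2 0 v1 0) - pb (AA 1) (L2 0 0 w) \<in> M2"
  proof -
    assume j: "pb (AA 0) (E 1 d) = pb (E 0 1) (AA d) + pb (AA 1) (E 0 d)"
      and a: "pb (AA 0) (E 1 d) - pb (AA 0) (L2 0 v1 0) \<in> M2"
      and b: "pb (AA 1) (E 0 d) - pb (AA 1) (L2 0 0 w) \<in> M2" and c: "pb (E 0 1) (AA d) \<in> M2"
    have "pb (AA 0) (L2 0 v1 0) - pb (AA 1) (L2 0 0 w) =
        pb (E 0 1) (AA d) + (pb (AA 1) (E 0 d) - pb (AA 1) (L2 0 0 w)) - (pb (AA 0) (E 1 d) - pb (AA 0) (L2 0 v1 0))"
      unfolding j by simp
    then show ?thesis using M2_diff[OF M2.add[OF c b] a] by (simp only:)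
  qed
  have "pb (AA 0) (L2 0 v1 0) = cs v1 (AA 1)"
    using pb_anti[OF sl2_Zh(2) AA_HH, of 0] by (simp add: L2_def pb_cs_right AA_Zh sl2_HH pb_AA)
  moreover have "pb (AA 1) (L2 0 0 w) = cs (w * (of_nat d - 2)) (AA 1)"
    using pb_anti[OF sl2_Zh(3) AA_HH, of 1] by (simp add: L2_def pb_cs_right AA_Zh sl2_HH pb_AA flip: cs_uminus_left)
  ultimately have "cs (v1 - w * (of_nat d - 2)) (AA 1) \<in> M2" using m unfolding cs_diff_left by (simp only:)
  then have "LV (\<lambda>i. if i = 1 then v1 - w * (of_nat d - 2) else 0) \<in> M2" using LV_unit[of 1] d5 by simp
  from LV_indep[OF this, of 1] have "w * (4 - of_nat d) = 0" using d5 v1 by (simp add: algebra_simps)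
  then have w: "w = 0" using ne by simp
  show "E 0 d \<in> M2" "E 1 d \<in> M2" using 0 1 by (simp_all add: w v1 L2_0)
qed

text \<open>The bracket modulo \<open>M2\<close> is equivariant. Starting from \<open>E 0 d\<close>,
  brackets with Q reach every \<open>E i d\<close>, since \<open>AA (Suc d)\<close> = 0; brackets
  with q then lower the second index.\<close>

lemma E_M2: assumes "i \<le> d" "j \<le> d" shows "E i j \<in> M2"
proof -
  have d': "E i d \<in> M2" if "i \<le> d" for i
    using that
  proof (induction i)
    case (Suc i)
    have "pb QQ (E i d) \<in> M2" using Suc by (intro pb_M2 M0.Q) simp
    then have "cs (- (of_nat i + 1)) (E (Suc i) d) \<in> M2"
      unfolding pb_QQ_E by (simp add: E_def AA_gt pb_0_right)
    then have "cs (1 / (- (of_nat i + 1))) (cs (- (of_nat i + 1)) (E (Suc i) d)) \<in> M2" by (rule M2_cs)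
    moreover have "(of_nat i + 1 :: complex) \<noteq> 0" using of_nat_neq_0[of i] by (simp add: add.commute)
    ultimately show ?case by (simp add: add_eq_0_iff)
  qed (rule E_0_d)
  have "\<forall>i\<le>d. E i (d - k) \<in> M2" if "k \<le> d" for k
    using that
  proof (induction k)
    case 0
    then show ?case using d' by simp
  next
    case (Suc k)
    define j where "j = d - Suc k"
    have j: "d - k = Suc j" "j < d" using Suc.prems by (simp_all add: j_def)
    have IH: "E i (Suc j) \<in> M2" if "i \<le> d" for i using Suc that j by simp
    have nz: "(of_nat d - of_nat j :: complex) \<noteq> 0" using j by simp
    have a: "cs (of_nat d - of_nat j) (E i j) \<in> M2" if i: "i \<le> d" for i
    proof (cases i)
      case 0
      then show ?thesis using pb_M2[OF M0.q IH[OF i]] by (simp add: pb_qq_E)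
    next
      case (Suc i')
      have "pb qq (E i (Suc j)) - cs (of_nat d - of_nat i') (E i' (Suc j)) \<in> M2"
        using Suc i by (intro M2_diff pb_M2 M0.q M2_cs IH) simp_all
      then show ?thesis by (simp add: Suc pb_qq_E)
    qed
    have "E i j \<in> M2" if "i \<le> d" for i
      using M2_cs[OF a[OF that], of "1 / (of_nat d - of_nat j)"] nz by simp
    then show ?case by (simp add: j_def)
  qed
  from this[of "d - j"] assms show ?thesis by simp
qed

lemma pb_LV_LV: "pb (LV c) (LV c') \<in> M2"
proof -
  have "pb (LV c) (AA j) \<in> M2" if j: "j \<le> d" for j
  proof -
    have "pb (AA j) (LV c) \<in> M2"
      unfolding pb_LV[OF AA_Zh] by (intro M2_sum M2_cs) (use E_M2[OF j] in \<open>simp add: E_def\<close>)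
    then show ?thesis using pb_anti[OF AA_Zh LV_HH, of c j] by (simp add: M2_uminus)
  qed
  then show ?thesis unfolding pb_LV[OF LV_Zh] by (intro M2_sum M2_cs) simp
qed

end

section \<open>Transport to m_0/m_0^2: a subalgebra and a commutative ideal\<close>

section \<open>The quotient of \<open>m\<^sub>0\<close> by its square\<close>

context cherednik
begin

abbreviation "Zc \<equiv> Z_c d \<zeta> a"
abbreviation "Lw \<equiv> Lie0 d \<zeta> a"

lemma Zc_ops: "mult Zc = mult Hc" "add Zc = add Hc" "one Zc = one Hc" "zero Zc = zero Hc"
  by (simp_all add: Z_c_def Let_def)

lemma kap_one: "kap 1 = \<one>\<^bsub>Hc\<^esub>"
proof -
  have c: "kap 1 \<in> carrier Hc" by (rule kap.f_closed[OF HH_1])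
  obtain B where B: "B \<in> HH" "\<one>\<^bsub>Hc\<^esub> = kap B" using kap.one_closed unfolding kap.carrier_f by blast
  have "kap 1 \<otimes>\<^bsub>Hc\<^esub> kap B = kap B" using kap.f_mult[OF HH_1 B(1)] by simp
  moreover have "kap 1 \<otimes>\<^bsub>Hc\<^esub> kap B = kap 1" using kap.r_one[OF c] B(2) by simp
  ultimately show ?thesis using B(2) by simp
qed

lemma ring_Zc: "ring Zc"
proof (rule ringI)
  show "abelian_group Zc"
  proof (rule abelian_groupI)
    fix z assume "z \<in> carrier Zc"
    then obtain A where A: "A \<in> Zh" "z = kap A" by (auto simp: Z_c_carrier)
    have "kap (- A) \<oplus>\<^bsub>Hc\<^esub> kap A = \<zero>\<^bsub>Hc\<^esub>"
      using kap.f_add[OF HH_uminus[OF Zh_HH[OF A(1)]] Zh_HH[OF A(1)]] by (simp add: kap.f_0)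
    then show "\<exists>y\<in>carrier Zc. y \<oplus>\<^bsub>Zc\<^esub> z = \<zero>\<^bsub>Zc\<^esub>"
      using A Zh_uminus[OF A(1)] by (auto simp: Zc_ops Z_c_carrier)
  next
    have "kap 0 \<in> carrier Zc" by (simp add: Z_c_carrier Zh_0)
    then show "\<zero>\<^bsub>Zc\<^esub> \<in> carrier Zc" by (simp add: Zc_ops kap.f_0)
  next
    fix z w assume "z \<in> carrier Zc" "w \<in> carrier Zc"
    then obtain A B where "A \<in> Zh" "z = kap A" "B \<in> Zh" "w = kap B" by (auto simp: Z_c_carrier)
    then show "z \<oplus>\<^bsub>Zc\<^esub> w \<in> carrier Zc"
      by (simp add: Zc_ops Z_c_carrier Zh_HH Zh_add flip: kap.f_add)
  next
    fix z w assume "z \<in> carrier Zc" "w \<in> carrier Zc"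
    then have "z \<in> carrier Hc" "w \<in> carrier Hc" by (auto simp: Z_c_carrier kap.f_closed Zh_HH)
    then show "z \<oplus>\<^bsub>Zc\<^esub> w = w \<oplus>\<^bsub>Zc\<^esub> z" unfolding Zc_ops by (rule kap.a_comm)
  qed (auto simp: Zc_ops Z_c_carrier kap.f_closed Zh_HH kap.a_assoc)
  show "Group.monoid Zc"
  proof (rule monoidI)
    fix z w assume "z \<in> carrier Zc" "w \<in> carrier Zc"
    then obtain A B where "A \<in> Zh" "z = kap A" "B \<in> Zh" "w = kap B" by (auto simp: Z_c_carrier)
    then show "z \<otimes>\<^bsub>Zc\<^esub> w \<in> carrier Zc"
      by (simp add: Zc_ops Z_c_carrier Zh_HH Zh_mult flip: kap.f_mult)
  next
    show "\<one>\<^bsub>Zc\<^esub> \<in> carrier Zc" using Zh_1 by (auto simp: Zc_ops Z_c_carrier kap_one[symmetric])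
  qed (auto simp: Zc_ops Z_c_carrier kap.f_closed Zh_HH kap.m_assoc)
qed (auto simp: Zc_ops Z_c_carrier kap.f_closed Zh_HH kap.l_distr kap.r_distr)

end

sublocale cherednik \<subseteq> Zk: ring_image Zc Zh kap
  by (intro ring_image.intro ring_image_axioms.intro ring_Zc)
    (simp_all add: Zh_1 Zh_add Zh_uminus Zh_mult Z_c_carrier Zc_ops kap.f_add kap.f_mult Zh_HH)

context cherednik
begin

lemma gens_kap: "q_elt d \<zeta> a = kap qq" "Q_elt d \<zeta> a = kap QQ"
  by (simp_all add: q_elt_eq Q_elt_eq qq_def QQ_def)

lemma an_M0: "an j \<in> M0"
  unfolding an_def by (intro M0_cs AA_M0)

lemma kap_hb: "B \<in> HH \<Longrightarrow> kap (hb B) = \<zero>\<^bsub>Zc\<^esub>"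
  using kap_eq[of "hb B" 0] by (auto simp: Zc_ops kap.f_0[symmetric] HH_hb HH_0)

text \<open>The generators a_j and \<open>AA j\<close> differ by invertible binomial coefficients,
  and the multiples of hbar in \<open>M0\<close> become zero in the centre of H_c.\<close>

lemma m0_eq: "m0 d \<zeta> a = kap ` M0"
proof -
  let ?G = "{q_elt d \<zeta> a, Q_elt d \<zeta> a, eu_elt d \<zeta> a} \<union> a_elt d \<zeta> a ` {0..d}"
  have G: "?G = {kap qq, kap QQ, kap eu} \<union> (\<lambda>j. kap (an j)) ` {0..d}"
    unfolding gens_kap eu_elt_eq using a_elt_eq by (intro arg_cong2[of _ _ _ _ "(\<union>)"] image_cong) auto
  have GZ: "?G \<subseteq> carrier Zc"
    unfolding G Z_c_carrier using sl2_Zh M0_Zh[OF an_M0] by auto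
  have id: "ideal (kap ` M0) Zc"
    by (rule Zk.ideal_image) (auto intro: M0_Zh M0_0 M0.add M0.mult M0_multr)
  interpret I: ideal "genideal Zc ?G" Zc by (rule Zk.genideal_ideal[OF GZ])
  have gen: "g \<in> genideal Zc ?G" if "g \<in> ?G" for g using Zk.genideal_self[OF GZ] that by blast
  have "kap A \<in> genideal Zc ?G" if "A \<in> M0" for A
    using that
  proof (induction rule: M0.induct)
    case q show ?case by (rule gen) (unfold G, simp)
  next
    case Q show ?case by (rule gen) (unfold G, simp)
  next
    case e show ?case by (rule gen) (unfold G, simp)
  next
    case (A j)
    have "kap (an j) \<in> genideal Zc ?G" by (rule gen, unfold G) (use A in simp)
    then have "kap (cs (of_nat (d choose j)) 1) \<otimes>\<^bsub>Zc\<^esub> kap (an j) \<in> genideal Zc ?G"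
      by (rule I.I_l_closed) (simp add: Z_c_carrier Zh_cs Zh_1)
    moreover have "cs (of_nat (d choose j)) 1 * an j = AA j"
      using A by (simp add: an_def)
    ultimately show ?case using Zk.f_mult[of "cs (of_nat (d choose j)) 1" "an j"]
      by (simp add: Zh_cs Zh_1 M0_Zh[OF an_M0])
  next
    case (h B)
    show ?case unfolding kap_hb[OF h] by (rule I.zero_closed)
  next
    case (add A B)
    show ?case unfolding Zk.f_add[OF M0_Zh[OF add(1)] M0_Zh[OF add(2)]] by (rule I.a_closed[OF add(3,4)])
  next
    case (mult A B)
    show ?case unfolding Zk.f_mult[OF mult(2) M0_Zh[OF mult(1)]] by (rule I.I_l_closed[OF mult(3) Zk.f_closed[OF mult(2)]])
  qed
  then have 1: "kap ` M0 \<subseteq> genideal Zc ?G" by (rule image_subsetI)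
  have 2: "genideal Zc ?G \<subseteq> kap ` M0"
    by (rule Zk.genideal_minimal[OF id], unfold G) (use an_M0 M0.q M0.Q M0.e in blast)
  show ?thesis unfolding m0_def by (rule equalityI[OF 2 1])
qed

lemma m0_sq_eq: "m0_sq d \<zeta> a = kap ` M2"
proof -
  have i1: "kap A \<in> ideal_prod Zc (kap ` M0) (kap ` M0)" if "A \<in> M2" for A
    using that
  proof (induction rule: M2.induct)
    case (p A B)
    then show ?case using ideal_prod.prod[of "kap A" "kap ` M0" "kap B" "kap ` M0" Zc] by (simp add: Zk.f_mult M0_Zh)
  next
    case (h B)
    have "kap 0 \<otimes>\<^bsub>Zc\<^esub> kap 0 \<in> ideal_prod Zc (kap ` M0) (kap ` M0)"
      by (intro ideal_prod.prod imageI M0_0)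
    then show ?case using h by (simp add: kap_hb Zk.f_0)
  next
    case (add A B)
    then show ?case using ideal_prod.sum[of "kap A" Zc "kap ` M0" "kap ` M0" "kap B"] by (simp add: Zk.f_add M2_Zh)
  qed
  have i2: "z \<in> kap ` M2" if "z \<in> ideal_prod Zc (kap ` M0) (kap ` M0)" for z
    using that
  proof (induction rule: ideal_prod.induct)
    case (prod i j)
    then obtain A B where "A \<in> M0" "i = kap A" "B \<in> M0" "j = kap B" by blast
    then have "i \<otimes>\<^bsub>Zc\<^esub> j = kap (A * B)" "A * B \<in> M2" by (simp_all add: Zk.f_mult M0_Zh M2.p)
    then show ?case by blast
  next
    case (sum s1 s2)
    then obtain A B where "A \<in> M2" "s1 = kap A" "B \<in> M2" "s2 = kap B" by blast
    then have "s1 \<oplus>\<^bsub>Zc\<^esub> s2 = kap (A + B)" "A + B \<in> M2" by (simp_all add: Zk.f_add M2_Zh M2.add)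
    then show ?case by blast
  qed
  show ?thesis unfolding m0_sq_def m0_eq
    by (intro equalityI subsetI image_subsetI) (erule i2, erule i1)
qed

definition Lam :: "(nat \<times> nat \<times> pbw) op \<Rightarrow> hc set" where
  "Lam A = m0_sq d \<zeta> a +>\<^bsub>Zc\<^esub> kap A"

text \<open>The operations of \<open>Lie0\<close> are unions over representatives; this describes
  all representatives of a class on the level of operators.\<close>

lemma Lam: assumes A: "A \<in> Zh" shows "Lam A = kap ` {B \<in> Zh. B - A \<in> M2}"
proof -
  have "Lam A = (\<lambda>C. kap (C + A)) ` M2"
    unfolding Lam_def m0_sq_eq a_r_coset_def' using A by (auto simp: Zk.f_add M2_Zh)
  also have "\<dots> = kap ` {B \<in> Zh. B - A \<in> M2}"
  proof (intro equalityI subsetI)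
    fix z assume "z \<in> (\<lambda>C. kap (C + A)) ` M2"
    then obtain C where "C \<in> M2" "z = kap (C + A)" by blast
    then show "z \<in> kap ` {B \<in> Zh. B - A \<in> M2}" using A by (intro image_eqI[of _ _ "C + A"]) (simp_all add: Zh_add M2_Zh)
  next
    fix z assume "z \<in> kap ` {B \<in> Zh. B - A \<in> M2}"
    then obtain B where "B - A \<in> M2" "z = kap B" by blast
    then show "z \<in> (\<lambda>C. kap (C + A)) ` M2" by (intro image_eqI[of _ _ "B - A"]) simp_all
  qed
  finally show ?thesis .
qed

lemma Lam_eq: assumes A: "A \<in> Zh" and B: "B \<in> Zh" shows "Lam A = Lam B \<longleftrightarrow> A - B \<in> M2"
proof
  assume e: "Lam A = Lam B"
  have "kap A \<in> Lam A" unfolding Lam[OF A] using A M2_0 by auto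
  then obtain B' where B': "B' \<in> Zh" "B' - B \<in> M2" "kap A = kap B'" unfolding e Lam[OF B] by blast
  obtain C where "C \<in> HH" "A - B' = hb C" using kap_eq[OF Zh_HH[OF A] Zh_HH[OF B'(1)]] B'(3) by blast
  then have "A - B' \<in> M2" by (simp add: M2.h)
  then show "A - B \<in> M2" using B'(2) by (rule M2_trans)
next
  assume AB: "A - B \<in> M2"
  then have BA: "B - A \<in> M2" using M2_uminus[OF AB] by simp
  have "C - A \<in> M2 \<longleftrightarrow> C - B \<in> M2" for C using M2_trans[OF _ AB, of C] M2_trans[OF _ BA, of C] by blast
  then show "Lam A = Lam B" unfolding Lam[OF A] Lam[OF B] by simp
qed

lemma Lw_carrier: "carrier Lw = Lam ` M0"
  by (simp add: Lie0_def Let_def m0_eq Lam_def image_image)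

lemma Lw_zero: "\<zero>\<^bsub>Lw\<^esub> = Lam 0"
proof -
  have "kap ` M2 = kap ` {B \<in> Zh. B \<in> M2}" using M2_Zh by (intro arg_cong[of _ _ "image kap"]) auto
  then show ?thesis by (simp add: Lie0_def Let_def m0_sq_eq Lam[OF Zh_0])
qed

lemma Lw_add: assumes A: "A \<in> Zh" and B: "B \<in> Zh" shows "Lam A \<oplus>\<^bsub>Lw\<^esub> Lam B = Lam (A + B)"
proof -
  have "Lam A \<oplus>\<^bsub>Lw\<^esub> Lam B = (\<Union>z\<in>Lam A. \<Union>w\<in>Lam B. {z \<oplus>\<^bsub>Zc\<^esub> w})"
    by (simp add: Lie0_def Let_def set_add_def set_mult_def)
  also have "\<dots> = Lam (A + B)"
  proof (intro equalityI subsetI)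
    fix s assume "s \<in> (\<Union>z\<in>Lam A. \<Union>w\<in>Lam B. {z \<oplus>\<^bsub>Zc\<^esub> w})"
    then obtain A' B' where AB: "A' \<in> Zh" "A' - A \<in> M2" "B' \<in> Zh" "B' - B \<in> M2" and s: "s = kap A' \<oplus>\<^bsub>Zc\<^esub> kap B'"
      unfolding Lam[OF A] Lam[OF B] by blast
    have "(A' - A) + (B' - B) \<in> M2" using AB by (intro M2.add)
    then have "A' + B' - (A + B) \<in> M2" by (simp add: algebra_simps)
    moreover have "s = kap (A' + B')" unfolding s using AB by (simp add: Zk.f_add)
    ultimately show "s \<in> Lam (A + B)" unfolding Lam[OF Zh_add[OF A B]] using Zh_add[OF AB(1,3)] by blast
  next
    fix s assume "s \<in> Lam (A + B)"
    then obtain C where C: "C \<in> Zh" "C - (A + B) \<in> M2" "s = kap C" unfolding Lam[OF Zh_add[OF A B]] by blast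
    have "kap (C - B) \<in> Lam A" unfolding Lam[OF A] using C B by (intro imageI) (simp add: Zh_diff algebra_simps)
    moreover have "kap B \<in> Lam B" unfolding Lam[OF B] using B M2_0 by auto
    moreover have "s = kap (C - B) \<oplus>\<^bsub>Zc\<^esub> kap B" using Zk.f_add[OF Zh_diff[OF C(1) B] B] C(3) by simp
    ultimately show "s \<in> (\<Union>z\<in>Lam A. \<Union>w\<in>Lam B. {z \<oplus>\<^bsub>Zc\<^esub> w})" by blast
  qed
  finally show ?thesis .
qed

lemma Lam_self: "A \<in> Zh \<Longrightarrow> kap A \<in> Lam A"
  unfolding Lam using M2_0 by auto

lemma Lw_smult: assumes A: "A \<in> Zh" shows "c \<odot>\<^bsub>Lw\<^esub> Lam A = Lam (cs c A)"
proof -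
  have "c \<odot>\<^bsub>Lw\<^esub> Lam A = (\<Union>z\<in>Lam A. m0_sq d \<zeta> a +>\<^bsub>Zc\<^esub> (kap (cs c 1) \<otimes>\<^bsub>Zc\<^esub> z))"
    by (simp add: Lie0_def Let_def kap_scalar)
  also have "\<dots> = (\<Union>z\<in>Lam A. Lam (cs c A))"
  proof (intro SUP_cong refl)
    fix z assume "z \<in> Lam A"
    then obtain A' where A': "A' \<in> Zh" "A' - A \<in> M2" "z = kap A'" unfolding Lam[OF A] by blast
    have "kap (cs c 1) \<otimes>\<^bsub>Zc\<^esub> z = kap (cs c A')"
      using Zk.f_mult[OF Zh_cs[OF Zh_1] A'(1), of c] A'(3) by simp
    moreover have "Lam (cs c A') = Lam (cs c A)"
      using Lam_eq[OF Zh_cs[OF A'(1)] Zh_cs[OF A]] M2_cs[OF A'(2), of c] by simp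
    ultimately show "m0_sq d \<zeta> a +>\<^bsub>Zc\<^esub> (kap (cs c 1) \<otimes>\<^bsub>Zc\<^esub> z) = Lam (cs c A)" by (simp add: Lam_def)
  qed
  also have "\<dots> = Lam (cs c A)" using Lam_self[OF A] by blast
  finally show ?thesis .
qed

text \<open>All members of the union coincide, because brackets of m_0 with m_0^2 stay in
  m_0^2.\<close>

lemma Lw_bracket: assumes A: "A \<in> M0" and B: "B \<in> M0" shows "bracket Lw (Lam A) (Lam B) = Lam (pb A B)"
proof -
  have AZ: "A \<in> Zh" and BZ: "B \<in> Zh" using A B M0_Zh by auto
  have "bracket Lw (Lam A) (Lam B) = (\<Union>z\<in>Lam A. \<Union>w\<in>Lam B. m0_sq d \<zeta> a +>\<^bsub>Zc\<^esub> poisson d \<zeta> a z w)"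
    by (simp add: Lie0_def Let_def)
  also have "\<dots> = (\<Union>z\<in>Lam A. \<Union>w\<in>Lam B. Lam (pb A B))"
  proof (intro SUP_cong refl)
    fix z w assume "z \<in> Lam A" "w \<in> Lam B"
    then obtain A' B' where A': "A' \<in> Zh" "A' - A \<in> M2" "z = kap A'" and B': "B' \<in> Zh" "B' - B \<in> M2" "w = kap B'"
      unfolding Lam[OF AZ] Lam[OF BZ] by blast
    have B0: "B' \<in> M0" using M0.add[OF M2_M0[OF B'(2)] B] by simp
    have "pb (A' - A) B' = pb A' B' - pb A B'"
      using pb_add_left[OF A'(1) Zh_uminus[OF AZ] Zh_HH[OF B'(1)]] pb_cs_left[OF AZ Zh_HH[OF B'(1)], of "-1"] by simp
    then have 1: "pb A' B' - pb A B' \<in> M2" using pb_M2_left[OF A'(2) B0] by simp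
    have 2: "pb A B' - pb A B \<in> M2" by (rule pb_M2_cong[OF A B'(2) Zh_HH[OF B'(1)] Zh_HH[OF BZ]])
    have "Lam (pb A' B') = Lam (pb A B)"
      unfolding Lam_eq[OF Zh_pb[OF A'(1) B'(1)] Zh_pb[OF AZ BZ]] by (rule M2_trans[OF 1 2])
    then show "m0_sq d \<zeta> a +>\<^bsub>Zc\<^esub> poisson d \<zeta> a z w = Lam (pb A B)"
      unfolding A'(3) B'(3) poisson_eq[OF A'(1) B'(1)] Lam_def .
  qed
  also have "\<dots> = Lam (pb A B)" using Lam_self[OF AZ] Lam_self[OF BZ] by blast
  finally show ?thesis .
qed

lemma pb_jacobi_cyclic: assumes "A \<in> Zh" "B \<in> Zh" "C \<in> Zh"
  shows "pb A (pb B C) + pb B (pb C A) + pb C (pb A B) = 0"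
proof -
  note H = assms[THEN Zh_HH]
  have "pb C A = cs (-1) (pb A C)" using pb_anti[OF assms(1) H(3)] by simp
  then have "pb B (pb C A) = - pb B (pb A C)" using pb_cs_right[OF assms(2) pb(1)[OF assms(1) H(3)], of "-1"] by simp
  moreover have "pb C (pb A B) = - pb (pb A B) C"
    using pb_anti[OF Zh_pb[OF assms(1,2)] H(3)] .
  ultimately show ?thesis using pb_jacobi[OF assms(1,2) H(3)] by simp
qed

lemmas Lw_simps = Lw_carrier Lw_zero Lw_add Lw_smult Lw_bracket M0_Zh

lemma vectorspace_Lw: "vectorspace class_ring Lw"
proof (intro vectorspace.intro moduleI)
  show f: "field (class_ring :: complex ring)" by (rule class_field)
  show "cring (class_ring :: complex ring)" by (rule domain.axioms(1)[OF field.axioms(1)[OF f]])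
  show "abelian_group Lw"
  proof (rule abelian_groupI)
    fix v assume "v \<in> carrier Lw"
    then obtain A where A: "A \<in> M0" "v = Lam A" by (auto simp: Lw_carrier)
    then show "\<exists>w\<in>carrier Lw. w \<oplus>\<^bsub>Lw\<^esub> v = \<zero>\<^bsub>Lw\<^esub>"
      by (intro bexI[of _ "Lam (- A)"]) (auto simp: Lw_simps M0_uminus)
  qed (auto simp: Lw_simps M0.add M0_0 Zh_add ac_simps)
qed (auto simp: Lw_simps M0.add M0_cs Zh_add Zh_cs cs_add_left)

lemma lie_algebra_Lw: "lie_algebra class_ring Lw"
proof (intro lie_algebra.intro lie_algebra_axioms.intro vectorspace_Lw)
  fix u v w assume "u \<in> carrier Lw" "v \<in> carrier Lw" "w \<in> carrier Lw"
  then obtain A B C where "A \<in> M0" "u = Lam A" "B \<in> M0" "v = Lam B" "C \<in> M0" "w = Lam C" by (auto simp: Lw_carrier)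
  then show "bracket Lw u (bracket Lw v w) \<oplus>\<^bsub>Lw\<^esub> bracket Lw v (bracket Lw w u) \<oplus>\<^bsub>Lw\<^esub> bracket Lw w (bracket Lw u v) = \<zero>\<^bsub>Lw\<^esub>"
    by (simp add: Lw_simps pb_M0 Zh_pb Zh_add pb_jacobi_cyclic)
qed (auto simp: Lw_simps M0.add M0_cs pb_M0 Zh_pb pb_add_left pb_add_right pb_cs_left pb_cs_right pb_self Zh_HH)

lemma subspace_LwI:
  assumes J: "J \<subseteq> M0" "0 \<in> J" "\<And>A B. A \<in> J \<Longrightarrow> B \<in> J \<Longrightarrow> A + B \<in> J" "\<And>c A. A \<in> J \<Longrightarrow> cs c A \<in> J"
  shows "subspace class_ring (Lam ` J) Lw"
proof (intro subspace.intro vectorspace_Lw submodule.intro)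
  show "module class_ring Lw" using vectorspace_Lw by (simp add: vectorspace_def)
  show "Lam ` J \<subseteq> carrier Lw" using J(1) by (auto simp: Lw_carrier)
  show "\<zero>\<^bsub>Lw\<^esub> \<in> Lam ` J" using J(2) by (simp add: Lw_zero)
  fix v w assume "v \<in> Lam ` J" "w \<in> Lam ` J"
  then obtain A B where AB: "A \<in> J" "B \<in> J" and e: "v = Lam A" "w = Lam B" by blast
  have Z: "A \<in> Zh" "B \<in> Zh" using AB J(1) M0_Zh by blast+
  show "v \<oplus>\<^bsub>Lw\<^esub> w \<in> Lam ` J" unfolding e Lw_add[OF Z] by (rule imageI[OF J(3)[OF AB]])
next
  fix c :: complex and v assume "v \<in> Lam ` J"
  then obtain A where A: "A \<in> J" and e: "v = Lam A" by blast
  have Z: "A \<in> Zh" using A J(1) M0_Zh by blast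
  show "c \<odot>\<^bsub>Lw\<^esub> v \<in> Lam ` J" unfolding e Lw_smult[OF Z] by (rule imageI[OF J(4)[OF A]])
qed

definition "JG = {A. \<exists>u v w. A = L2 u v w}"
definition "JS = {A. \<exists>c. A = LV c}"
abbreviation "gg \<equiv> Lam ` JG"
abbreviation "SS \<equiv> Lam ` JS"

lemma JG_JS: "JG \<subseteq> M0" "JS \<subseteq> M0" "L2 u v w \<in> JG" "LV c \<in> JS"
  by (auto simp: JG_def JS_def L2_M0 LV_M0)

lemma subspace_gg: "subspace class_ring gg Lw"
proof (rule subspace_LwI[OF JG_JS(1)])
  show "0 \<in> JG" unfolding L2_0[symmetric] by (rule JG_JS(3))
next
  fix A B assume "A \<in> JG" "B \<in> JG"
  then obtain u v w u' v' w' where e: "A = L2 u v w" "B = L2 u' v' w'" unfolding JG_def mem_Collect_eq by blast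
  show "A + B \<in> JG" unfolding e L2_add by (rule JG_JS(3))
next
  fix c A assume "A \<in> JG"
  then obtain u v w where e: "A = L2 u v w" unfolding JG_def mem_Collect_eq by blast
  show "cs c A \<in> JG" unfolding e L2_cs by (rule JG_JS(3))
qed

lemma subspace_SS: "subspace class_ring SS Lw"
proof (rule subspace_LwI[OF JG_JS(2)])
  show "0 \<in> JS" unfolding LV_0[symmetric] by (rule JG_JS)
qed (auto simp: JS_def LV_add LV_cs)

lemma lie_subalgebra_gg: "lie_subalgebra class_ring Lw gg"
  unfolding lie_subalgebra_def
proof (intro conjI subspace_gg ballI)
  fix v w assume "v \<in> gg" "w \<in> gg"
  then obtain u v' w' u1 v1 w1 where e: "v = Lam (L2 u v' w')" "w = Lam (L2 u1 v1 w1)"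
    unfolding JG_def by blast
  have "bracket Lw v w = Lam (L2 (2 * (u * w1 - w' * u1)) (2 * (w' * v1 - v' * w1)) (u * v1 - v' * u1))"
    unfolding e Lw_bracket[OF L2_M0 L2_M0] Lam_eq[OF Zh_pb[OF L2_Zh L2_Zh] L2_Zh] by (rule pb_L2_L2)
  then show "bracket Lw v w \<in> gg" using JG_JS(3) by blast
qed

text \<open>Modulo \<open>M2\<close> an element of m_0 is a combination of q, Q, eu plus one of the
  \<open>AA j\<close>. The first part acts within the span of the \<open>AA j\<close>, the second
  one acts by zero.\<close>

lemma lie_ideal_SS: "lie_ideal class_ring Lw SS"
  unfolding lie_ideal_def
proof (intro conjI subspace_SS ballI)
  fix v s assume "v \<in> carrier Lw" "s \<in> SS"
  then obtain A c where A: "A \<in> M0" and e: "v = Lam A" "s = Lam (LV c)" by (auto simp: Lw_carrier JS_def)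
  obtain u1 v1 w1 c1 where s: "A - (L2 u1 v1 w1 + LV c1) \<in> M2" using M0_span[OF A] by blast
  have "pb A (LV c) - pb (L2 u1 v1 w1) (LV c) = pb (A - (L2 u1 v1 w1 + LV c1)) (LV c) + pb (LV c1) (LV c)"
  proof -
    have "pb A (LV c) = pb ((A - (L2 u1 v1 w1 + LV c1)) + (L2 u1 v1 w1 + LV c1)) (LV c)" by simp
    also have "\<dots> = pb (A - (L2 u1 v1 w1 + LV c1)) (LV c) + (pb (L2 u1 v1 w1) (LV c) + pb (LV c1) (LV c))"
      by (simp only: pb_add_left[OF M2_Zh[OF s] Zh_add[OF L2_Zh LV_Zh] LV_HH] pb_add_left[OF L2_Zh LV_Zh LV_HH])
    finally show ?thesis by simp
  qed
  also have "\<dots> \<in> M2" by (intro M2.add pb_M2_left[OF s LV_M0] pb_LV_LV)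
  finally have "Lam (pb A (LV c)) = Lam (pb (L2 u1 v1 w1) (LV c))"
    unfolding Lam_eq[OF Zh_pb[OF M0_Zh[OF A] LV_Zh] Zh_pb[OF L2_Zh LV_Zh]] .
  then show "bracket Lw v s \<in> SS" unfolding e Lw_bracket[OF A LV_M0] pb_L2_LV using JG_JS(4) by blast
qed

lemma lie_commutative_SS: "lie_commutative (Lw\<lparr>carrier := SS\<rparr>)"
  unfolding lie_commutative_def
proof (intro ballI)
  fix s t assume "s \<in> carrier (Lw\<lparr>carrier := SS\<rparr>)" "t \<in> carrier (Lw\<lparr>carrier := SS\<rparr>)"
  then obtain c c' where e: "s = Lam (LV c)" "t = Lam (LV c')" by (auto simp: JS_def)
  have "bracket Lw s t = Lam 0"
    unfolding e Lw_bracket[OF LV_M0 LV_M0] Lam_eq[OF Zh_pb[OF LV_Zh LV_Zh] Zh_0] by (simp add: pb_LV_LV)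
  then show "bracket (Lw\<lparr>carrier := SS\<rparr>) s t = \<zero>\<^bsub>Lw\<lparr>carrier := SS\<rparr>\<^esub>" by (simp add: Lw_zero)
qed

lemma direct_sum: "internal_direct_sum class_ring Lw gg SS"
  unfolding internal_direct_sum_def
proof (intro conjI subspace_gg subspace_SS)
  interpret V: vectorspace class_ring Lw by (rule vectorspace_Lw)
  show "module.submodule_sum Lw gg SS = carrier Lw"
  proof (intro equalityI subsetI)
    fix v assume "v \<in> module.submodule_sum Lw gg SS"
    then obtain A B where AB: "A \<in> JG" "B \<in> JS" and e: "v = Lam A \<oplus>\<^bsub>Lw\<^esub> Lam B" by (auto simp: V.submodule_sum_def)
    have m: "A \<in> M0" "B \<in> M0" using AB JG_JS(1,2) by blast+
    show "v \<in> carrier Lw" unfolding e Lw_add[OF m[THEN M0_Zh]] Lw_carrier by (rule imageI[OF M0.add[OF m]])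
  next
    fix v assume "v \<in> carrier Lw"
    then obtain A where A: "A \<in> M0" "v = Lam A" by (auto simp: Lw_carrier)
    obtain u1 v1 w1 c1 where s: "A - (L2 u1 v1 w1 + LV c1) \<in> M2" using M0_span[OF A(1)] by blast
    have "v = Lam (L2 u1 v1 w1 + LV c1)" unfolding A(2) Lam_eq[OF M0_Zh[OF A(1)] Zh_add[OF L2_Zh LV_Zh]] by (rule s)
    then have "v = Lam (L2 u1 v1 w1) \<oplus>\<^bsub>Lw\<^esub> Lam (LV c1)" by (simp only: Lw_add[OF L2_Zh LV_Zh])
    then show "v \<in> module.submodule_sum Lw gg SS" using JG_JS(3,4) unfolding V.submodule_sum_def by blast
  qed
  show "gg \<inter> SS = {\<zero>\<^bsub>Lw\<^esub>}"
  proof (intro equalityI subsetI)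
    fix v assume "v \<in> gg \<inter> SS"
    then obtain A B where AB: "A \<in> JG" "v = Lam A" "B \<in> JS" "v = Lam B" by blast
    obtain u v' w where A: "A = L2 u v' w" using AB(1) unfolding JG_def mem_Collect_eq by blast
    obtain c where B: "B = LV c" using AB(3) unfolding JS_def mem_Collect_eq by blast
    have e: "v = Lam (L2 u v' w)" "Lam (L2 u v' w) = Lam (LV c)" using AB(2,4) unfolding A B by simp_all
    have "L2 u v' w - LV c \<in> M2" using e(2) Lam_eq[OF L2_Zh LV_Zh] by blast
    then have "L2 u v' w + LV (\<lambda>j. - c j) \<in> M2" unfolding LV_uminus[symmetric] by simp
    then have "L2 u v' w \<in> M2" by (rule L2_LV_separate(1))
    then show "v \<in> {\<zero>\<^bsub>Lw\<^esub>}" unfolding e(1) Lw_zero using Lam_eq[OF L2_Zh Zh_0] by simp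
  next
    fix v assume "v \<in> {\<zero>\<^bsub>Lw\<^esub>}"
    then have "v = Lam (L2 0 0 0)" "v = Lam (LV (\<lambda>j. 0))" by (simp_all add: Lw_zero L2_0 LV_0)
    then show "v \<in> gg \<inter> SS" using JG_JS(3,4) by blast
  qed
qed

lemma LV_eq: "Lam (LV c) = Lam (LV c') \<longleftrightarrow> (\<forall>j\<le>d. c j = c' j)"
proof
  assume "Lam (LV c) = Lam (LV c')"
  then have "LV (\<lambda>j. c j - c' j) \<in> M2" unfolding Lam_eq[OF LV_Zh LV_Zh] LV_diff .
  from LV_indep[OF this] show "\<forall>j\<le>d. c j = c' j" by simp
next
  assume "\<forall>j\<le>d. c j = c' j"
  then show "Lam (LV c) = Lam (LV c')" using LV_cong[of c c'] by simp
qed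

lemma L2_eq: "Lam (L2 u v w) = Lam (L2 u' v' w') \<longleftrightarrow> u = u' \<and> v = v' \<and> w = w'"
proof
  assume "Lam (L2 u v w) = Lam (L2 u' v' w')"
  then have "L2 (u - u') (v - v') (w - w') \<in> M2" unfolding Lam_eq[OF L2_Zh L2_Zh] L2_diff .
  from L2_indep[OF this] show "u = u' \<and> v = v' \<and> w = w'" by simp
qed simp

abbreviation "LS \<equiv> Lw\<lparr>carrier := SS\<rparr>"

lemma vectorspace_LS: "vectorspace class_ring LS"
  by (rule vectorspace.subspace_is_vs[OF vectorspace_Lw subspace_SS])

lemma dim_SS: "vectorspace.fin_dim class_ring LS" "vectorspace.dim class_ring LS = d + 1"
proof -
  define T where "T v = Lam (LV (\<lambda>j. v $ j))" for v :: "complex vec"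
  interpret V: vec_space "TYPE(complex)" "d + 1" .
  have T: "T \<in> LinearCombinations.module_hom class_ring (module_vec TYPE(complex) (d + 1)) LS"
    unfolding LinearCombinations.module_hom_def mem_Collect_eq
  proof (intro conjI allI impI)
    show "T \<in> carrier (module_vec TYPE(complex) (d + 1)) \<rightarrow> carrier LS" using JG_JS(4) by (auto simp: T_def)
    fix v w :: "complex vec"
    assume "v \<in> carrier (module_vec TYPE(complex) (d + 1)) \<and> w \<in> carrier (module_vec TYPE(complex) (d + 1))"
    then have "LV (\<lambda>j. (v + w) $ j) = LV (\<lambda>j. v $ j) + LV (\<lambda>j. w $ j)"
      unfolding LV_add by (intro LV_cong) (auto simp: module_vec_simps)
    then show "T (v \<oplus>\<^bsub>module_vec TYPE(complex) (d + 1)\<^esub> w) = T v \<oplus>\<^bsub>LS\<^esub> T w"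
      by (simp add: T_def module_vec_simps Lw_add LV_Zh)
  next
    fix c :: complex and v :: "complex vec"
    assume "c \<in> carrier class_ring \<and> v \<in> carrier (module_vec TYPE(complex) (d + 1))"
    then have "LV (\<lambda>j. (c \<cdot>\<^sub>v v) $ j) = cs c (LV (\<lambda>j. v $ j))"
      unfolding LV_cs by (intro LV_cong) (auto simp: module_vec_simps)
    then show "T (c \<odot>\<^bsub>module_vec TYPE(complex) (d + 1)\<^esub> v) = c \<odot>\<^bsub>LS\<^esub> T v"
      by (simp add: T_def module_vec_simps Lw_smult LV_Zh)
  qed
  interpret W: vectorspace class_ring LS by (rule vectorspace_LS)
  interpret T: linear_map class_ring "module_vec TYPE(complex) (d + 1)" LS T
    by unfold_locales (rule T)
  have inj: "inj_on T (carrier (module_vec TYPE(complex) (d + 1)))"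
    by (rule inj_onI) (auto simp: T_def LV_eq module_vec_simps intro!: eq_vecI)
  have surj: "T ` carrier (module_vec TYPE(complex) (d + 1)) = carrier LS"
  proof (intro equalityI subsetI)
    fix s assume "s \<in> carrier LS"
    then obtain c where c: "s = Lam (LV c)" by (auto simp: JS_def)
    have "s = T (vec (d + 1) c)" unfolding c T_def by (rule arg_cong[of _ _ Lam], rule LV_cong) simp
    then show "s \<in> T ` carrier (module_vec TYPE(complex) (d + 1))" by (auto simp: module_vec_simps)
  qed (use T.T_im in auto)
  show "vectorspace.fin_dim class_ring LS" by (rule T.rank_nullity_main(2)[OF V.fin_dim surj])
  show "vectorspace.dim class_ring LS = d + 1" using T.dim_eq[OF V.fin_dim inj surj] V.dim_is_n by simp
qed

end

section \<open>Isomorphisms with sl_2 and with the binary forms of degree d\<close>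

section \<open>The isomorphisms with \<open>sl\<^sub>2\<close> and \<open>Sym\<^sup>d\<close>\<close>

lemma m2_eqI: fixes A B :: "'a mat"
  assumes "dim_row A = 2" "dim_col A = 2" "dim_row B = 2" "dim_col B = 2"
    "A $$ (0,0) = B $$ (0,0)" "A $$ (0,1) = B $$ (0,1)" "A $$ (1,0) = B $$ (1,0)" "A $$ (1,1) = B $$ (1,1)"
  shows "A = B"
proof (rule eq_matI)
  fix i j assume "i < dim_row B" "j < dim_col B"
  then have "(i = 0 \<or> i = 1) \<and> (j = 0 \<or> j = 1)" using assms(3,4) by auto
  then show "A $$ (i, j) = B $$ (i, j)" using assms(5-8) by auto
qed (use assms in auto)

lemma m2_mult: fixes A B :: "'a :: semiring_0 mat"
  assumes "dim_row A = 2" "dim_col A = 2" "dim_row B = 2" "dim_col B = 2" "i < 2" "j < 2"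
  shows "(A * B) $$ (i, j) = A $$ (i,0) * B $$ (0,j) + A $$ (i,1) * B $$ (1,j)"
proof -
  have s: "{0..<2} = {0, 1 :: nat}" by auto
  have "(A * B) $$ (i, j) = (\<Sum>k\<in>{0..<2}. A $$ (i, k) * B $$ (k, j))"
    using assms by (simp add: scalar_prod_def)
  also have "\<dots> = A $$ (i,0) * B $$ (0,j) + A $$ (i,1) * B $$ (1,j)"
    unfolding s by (subst sum.insert) simp_all
  finally show ?thesis .
qed

lemma sl2_carrier: "A \<in> carrier sl2 \<longleftrightarrow> dim_row A = 2 \<and> dim_col A = 2 \<and> A $$ (1,1) = - A $$ (0,0)"
proof -
  have c: "carrier sl2 = {A \<in> carrier_mat 2 2. A $$ (0,0) + A $$ (1,1) = 0}"
    unfolding sl2_def by (rule partial_object.select_convs)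
  show ?thesis unfolding c carrier_mat_def mem_Collect_eq add_eq_0_iff by (simp only: conj_assoc)
qed

lemma sl2_ops: "A \<oplus>\<^bsub>sl2\<^esub> B = A + B" "c \<odot>\<^bsub>sl2\<^esub> A = c \<cdot>\<^sub>m A" "\<zero>\<^bsub>sl2\<^esub> = 0\<^sub>m 2 2" "bracket sl2 A B = A * B - B * A"
  by (simp_all only: sl2_def ring.select_convs module.select_convs lie_alg.select_convs)

lemma lie_algebra_sl2: "lie_algebra class_ring sl2"
proof (intro lie_algebra.intro lie_algebra_axioms.intro vectorspace.intro moduleI)
  show f: "field (class_ring :: complex ring)" by (rule class_field)
  show "cring (class_ring :: complex ring)" by (rule domain.axioms(1)[OF field.axioms(1)[OF f]])
  show "abelian_group sl2"
  proof (rule abelian_groupI)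
    fix A assume "A \<in> carrier sl2"
    then show "\<exists>B\<in>carrier sl2. B \<oplus>\<^bsub>sl2\<^esub> A = \<zero>\<^bsub>sl2\<^esub>"
      by (intro bexI[of _ "- A"] m2_eqI) (simp_all add: sl2_carrier sl2_ops)
  qed (auto simp: sl2_carrier sl2_ops intro!: m2_eqI)
qed (auto simp: sl2_carrier sl2_ops m2_mult algebra_simps simp del: index_mult_mat(1) intro!: m2_eqI)

definition SYM :: "nat \<Rightarrow> (nat \<Rightarrow> complex) \<Rightarrow> complex poly poly" where
  "SYM d c = (\<Sum>j\<le>d. monom (monom (c j) j) (d - j))"

lemma coeff_SYM: "coeff (coeff (SYM d c) k) i = (if i + k = d then c i else 0)"
proof -
  have "coeff (coeff (SYM d c) k) i = (\<Sum>j\<le>d. if j = i then (if i + k = d then c i else 0) else 0)"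
    unfolding SYM_def coeff_sum by (intro sum.cong refl) (auto split: if_splits)
  then show ?thesis by auto
qed

lemma poly_poly_eqI: "(\<And>k i. coeff (coeff p k) i = coeff (coeff q k) i) \<Longrightarrow> p = q"
  by (intro poly_eqI) auto

lemma coeff_linear_mult:
  "coeff (coeff ([:[:0, a:], [:b:]:] * r) k) i =
    (if i = 0 then 0 else a * coeff (coeff r k) (i - 1)) + (if k = 0 then 0 else b * coeff (coeff r (k - 1)) i)"
  by (cases i; cases k) simp_all

lemma coeff_sym_action:
  "coeff (coeff (sym_action A p) k) i =
    A $$ (0,0) * (of_nat i * coeff (coeff p k) i) +
    (if k = 0 then 0 else A $$ (1,0) * (of_nat (Suc i) * coeff (coeff p (k - 1)) (Suc i))) +
    ((if i = 0 then 0 else A $$ (0,1) * (of_nat (Suc k) * coeff (coeff p (Suc k)) (i - 1))) +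
    A $$ (1,1) * (of_nat k * coeff (coeff p k) i))"
proof -
  have l: "[:[:c:]:] * [:[:0, 1:]:] + [:[:c':]:] * [:0, 1:] = [:[:0, c:], [:c':]:]" for c c' :: complex by simp
  have of_nat: "coeff (of_nat n * q) m = of_nat n * coeff q m" for n m and q :: "complex poly"
    by (simp add: of_nat_poly)
  show ?thesis unfolding sym_action_def Let_def l coeff_add coeff_linear_mult
    by (cases i; cases k) (simp_all add: coeff_map_poly coeff_pderiv of_nat del: of_nat_Suc)
qed

context cherednik
begin

text \<open>The matrix units E_12 and E_21 go to Q and -q, and diag(1,-1) goes to eu. The sign is
  due to {q,Q} = eu, as opposed to [E_12,E_21] = diag(1,-1).\<close>

definition phi :: "complex mat \<Rightarrow> hc set" where
  "phi A = Lam (L2 (- A $$ (1,0)) (A $$ (0,1)) (A $$ (0,0)))"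

lemma L2_gg: "Lam (L2 u v w) \<in> gg"
  using JG_JS(3) by blast

lemma phi_surj: "\<exists>A\<in>carrier sl2. phi A = Lam (L2 u v w)"
proof (rule bexI)
  let ?A = "mat 2 2 (\<lambda>(i, j). if i = 0 then (if j = 0 then w else v) else (if j = 0 then - u else - w))"
  show "phi ?A = Lam (L2 u v w)" by (simp add: phi_def)
  show "?A \<in> carrier sl2" by (simp add: sl2_carrier)
qed

lemma phi_add: "A \<in> carrier sl2 \<Longrightarrow> B \<in> carrier sl2 \<Longrightarrow> phi (A \<oplus>\<^bsub>sl2\<^esub> B) = phi A \<oplus>\<^bsub>Lw\<^esub> phi B"
  by (simp add: sl2_carrier sl2_ops phi_def Lw_add L2_Zh L2_add)

lemma phi_smult: "A \<in> carrier sl2 \<Longrightarrow> phi (c \<odot>\<^bsub>sl2\<^esub> A) = c \<odot>\<^bsub>Lw\<^esub> phi A"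
  by (simp add: sl2_carrier sl2_ops phi_def Lw_smult L2_Zh L2_cs)

lemma phi_bracket:
  assumes "A \<in> carrier sl2" "B \<in> carrier sl2"
  shows "phi (bracket sl2 A B) = bracket Lw (phi A) (phi B)"
proof -
  have "bracket Lw (phi A) (phi B) = Lam (L2 (2 * (- A $$ (1,0) * B $$ (0,0) - A $$ (0,0) * - B $$ (1,0)))
      (2 * (A $$ (0,0) * B $$ (0,1) - A $$ (0,1) * B $$ (0,0))) (- A $$ (1,0) * B $$ (0,1) - A $$ (0,1) * - B $$ (1,0)))"
    unfolding phi_def Lw_bracket[OF L2_M0 L2_M0] Lam_eq[OF Zh_pb[OF L2_Zh L2_Zh] L2_Zh] by (rule pb_L2_L2)
  also have "\<dots> = phi (bracket sl2 A B)"
    unfolding phi_def L2_eq using assms by (simp add: sl2_carrier sl2_ops m2_mult algebra_simps del: index_mult_mat(1))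
  finally show ?thesis ..
qed

lemma phi_iso: "phi \<in> lie_isos class_ring sl2 (Lw\<lparr>carrier := gg\<rparr>)"
  unfolding lie_isos_def mem_Collect_eq LinearCombinations.module_hom_def
proof (intro conjI allI ballI impI)
  show "phi \<in> carrier sl2 \<rightarrow> carrier (Lw\<lparr>carrier := gg\<rparr>)" by (simp add: phi_def L2_gg)
  show "bij_betw phi (carrier sl2) (carrier (Lw\<lparr>carrier := gg\<rparr>))"
    unfolding bij_betw_def
  proof
    show "inj_on phi (carrier sl2)"
    proof (rule inj_onI)
      fix A B assume "A \<in> carrier sl2" "B \<in> carrier sl2" "phi A = phi B"
      then show "A = B" unfolding phi_def L2_eq by (intro m2_eqI) (simp_all add: sl2_carrier)
    qed
    have "phi ` carrier sl2 = gg"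
    proof (intro equalityI subsetI)
      fix v assume "v \<in> gg"
      then obtain u v' w where "v = Lam (L2 u v' w)" unfolding JG_def by blast
      then show "v \<in> phi ` carrier sl2" using phi_surj[of u v' w] by (metis imageI)
    qed (auto simp only: phi_def L2_gg)
    then show "phi ` carrier sl2 = carrier (Lw\<lparr>carrier := gg\<rparr>)" by simp
  qed
qed (simp_all add: phi_add phi_smult phi_bracket)

definition act2 :: "complex mat \<Rightarrow> (nat \<Rightarrow> complex) \<Rightarrow> nat \<Rightarrow> complex" where
  "act2 A c j = - A $$ (1,0) * ((of_nat d - of_nat j) * c (Suc j)) + A $$ (0,1) * (- of_nat j * c (j - 1)) +
     A $$ (0,0) * ((2 * of_nat j - of_nat d) * c j)"

lemma bracket_phi: "bracket Lw (phi A) (Lam (LV c)) = Lam (LV (act2 A c))"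
  unfolding phi_def Lw_bracket[OF L2_M0 LV_M0] pb_L2_LV act2_def ..

lemma LV_SS: "Lam (LV c) \<in> SS"
  using JG_JS(4) by blast

lemma SS_E: "s \<in> SS \<Longrightarrow> (\<And>c. s = Lam (LV c) \<Longrightarrow> Q) \<Longrightarrow> Q"
  unfolding JS_def by blast

lemma phi_carrier: "phi A \<in> carrier Lw"
  unfolding phi_def Lw_carrier by (rule imageI[OF L2_M0])

lemma LV_carrier: "Lam (LV c) \<in> carrier Lw"
  unfolding Lw_carrier by (rule imageI[OF LV_M0])

lemma SS_carrier: "s \<in> SS \<Longrightarrow> s \<in> carrier Lw"
  by (erule SS_E) (simp only: LV_carrier)

lemma LS_ops: "add LS = add Lw" "zero LS = zero Lw"
  by simp_all

lemma representation: "lie_representation class_ring sl2 LS (\<lambda>A s. bracket Lw (phi A) s)"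
proof (intro lie_representation.intro lie_algebra_sl2 vectorspace_LS lie_representation_axioms.intro)
  interpret L: lie_algebra class_ring Lw by (rule lie_algebra_Lw)
  interpret W: vectorspace class_ring LS by (rule vectorspace_LS)
  show "(\<lambda>s. bracket Lw (phi A) s) \<in> LinearCombinations.module_hom class_ring LS LS" for A
    unfolding LinearCombinations.module_hom_def mem_Collect_eq
  proof (intro conjI allI impI funcsetI)
    fix s assume "s \<in> carrier LS"
    then have "s \<in> SS" by simp
    then obtain c where "s = Lam (LV c)" by (rule SS_E)
    then show "bracket Lw (phi A) s \<in> carrier LS" by (simp add: bracket_phi LV_SS)
  next
    fix s t assume "s \<in> carrier LS \<and> t \<in> carrier LS"
    then have "s \<in> SS" "t \<in> SS" by simp_all
    then have "s \<in> carrier Lw" "t \<in> carrier Lw" by (simp_all add: SS_carrier)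
    then show "bracket Lw (phi A) (s \<oplus>\<^bsub>LS\<^esub> t) = bracket Lw (phi A) s \<oplus>\<^bsub>LS\<^esub> bracket Lw (phi A) t"
      using L.bracket_add_right[OF phi_carrier] by simp
  next
    fix k :: complex and s assume "k \<in> carrier class_ring \<and> s \<in> carrier LS"
    then have "s \<in> SS" by simp
    then have "s \<in> carrier Lw" by (rule SS_carrier)
    then show "bracket Lw (phi A) (k \<odot>\<^bsub>LS\<^esub> s) = k \<odot>\<^bsub>LS\<^esub> bracket Lw (phi A) s"
      using L.bracket_smult_right[OF _ phi_carrier] by simp
  qed
  fix A B s assume AB: "A \<in> carrier sl2" "B \<in> carrier sl2" and s: "s \<in> carrier LS"
  have "s \<in> SS" using s by simp
  then obtain c where c: "s = Lam (LV c)" by (rule SS_E)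
  show "bracket Lw (phi (A \<oplus>\<^bsub>sl2\<^esub> B)) s = bracket Lw (phi A) s \<oplus>\<^bsub>LS\<^esub> bracket Lw (phi B) s"
    unfolding phi_add[OF AB] c using L.bracket_add_left[OF phi_carrier phi_carrier LV_carrier] by simp
  let ?P = "L2 (- A $$ (1,0)) (A $$ (0,1)) (A $$ (0,0))" and ?Q = "L2 (- B $$ (1,0)) (B $$ (0,1)) (B $$ (0,0))"
  have 1: "bracket Lw (phi (bracket sl2 A B)) s = Lam (pb (pb ?P ?Q) (LV c))"
    unfolding phi_bracket[OF AB] c
    unfolding phi_def Lw_bracket[OF L2_M0 L2_M0] Lw_bracket[OF pb_M0[OF L2_M0 L2_M0] LV_M0] by (rule refl)
  have 2: "bracket Lw (phi A) (bracket Lw (phi B) s) = Lam (pb ?P (pb ?Q (LV c)))"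
    "bracket Lw (phi B) (bracket Lw (phi A) s) = Lam (pb ?Q (pb ?P (LV c)))"
    unfolding c phi_def Lw_bracket[OF L2_M0 LV_M0] Lw_bracket[OF L2_M0 pb_M0[OF L2_M0 LV_M0]] by (rule refl)+
  have "\<exists>e. pb ?Q (pb ?P (LV c)) = LV e" unfolding pb_L2_LV by (rule exI, rule refl)
  then obtain e where e: "pb ?Q (pb ?P (LV c)) = LV e" ..
  \<comment> \<open>The difference of module elements involves the abstract inverse in
    \<open>LS\<close>; it is identified with the class of \<open>- LV e\<close> once this class is
    known to lie in the submodule.\<close>
  have "Lam (- LV e) \<oplus>\<^bsub>LS\<^esub> Lam (LV e) = \<zero>\<^bsub>LS\<^esub>"
    using Lw_add[OF Zh_uminus[OF LV_Zh] LV_Zh, of e e] by (simp add: Lw_zero)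
  moreover have "Lam (LV e) \<in> carrier LS" using LV_SS by simp
  moreover have "Lam (- LV e) \<in> carrier LS" using LV_SS unfolding LV_uminus by simp
  ultimately have m: "\<ominus>\<^bsub>LS\<^esub> Lam (LV e) = Lam (- LV e)" by (rule W.M.minus_equality)
  have Z: "pb ?P (pb ?Q (LV c)) \<in> Zh" by (rule Zh_pb[OF L2_Zh Zh_pb[OF L2_Zh LV_Zh]])
  have "Lam (pb ?P (pb ?Q (LV c))) \<ominus>\<^bsub>LS\<^esub> Lam (LV e) = Lam (pb ?P (pb ?Q (LV c)) - LV e)"
    unfolding a_minus_def m LS_ops Lw_add[OF Z Zh_uminus[OF LV_Zh]] by (simp only: diff_conv_add_uminus)
  moreover have "pb ?P (pb ?Q (LV c)) - LV e = pb (pb ?P ?Q) (LV c)"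
  proof -
    have j: "pb ?P (pb ?Q (LV c)) = pb (pb ?P ?Q) (LV c) + pb ?Q (pb ?P (LV c))"
      by (rule pb_jacobi[OF L2_Zh L2_Zh LV_HH])
    show ?thesis unfolding j e by (rule add_diff_cancel_right')
  qed
  ultimately show "bracket Lw (phi (bracket sl2 A B)) s =
      bracket Lw (phi A) (bracket Lw (phi B) s) \<ominus>\<^bsub>LS\<^esub> bracket Lw (phi B) (bracket Lw (phi A) s)"
    unfolding 1 2 e by (simp only:)
next
  interpret L: lie_algebra class_ring Lw by (rule lie_algebra_Lw)
  fix k :: complex and A s assume k: "k \<in> carrier class_ring" and A: "A \<in> carrier sl2" and s: "s \<in> carrier LS"
  have "s \<in> SS" using s by simp
  then obtain c where c: "s = Lam (LV c)" by (rule SS_E)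
  show "bracket Lw (phi (k \<odot>\<^bsub>sl2\<^esub> A)) s = k \<odot>\<^bsub>LS\<^esub> bracket Lw (phi A) s"
    unfolding phi_smult[OF A] c using L.bracket_smult_left[OF k phi_carrier LV_carrier] by simp
qed

text \<open>Irreducibility in coordinates: brackets with q bring a nonzero vector down to a nonzero
  multiple of \<open>AA 0\<close>, and brackets with Q recover all \<open>AA j\<close> from
  it.\<close>

lemma LV_generates:
  assumes J: "\<And>A B. A \<in> J \<Longrightarrow> B \<in> J \<Longrightarrow> A + B \<in> J" "\<And>k A. A \<in> J \<Longrightarrow> cs k A \<in> J"
    and q: "\<And>A. A \<in> J \<Longrightarrow> pb qq A \<in> J" and Q: "\<And>A. A \<in> J \<Longrightarrow> pb QQ A \<in> J"
    and c: "LV c \<in> J" "j \<le> d" "c j \<noteq> 0"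
  shows "LV c' \<in> J"
proof -
  have base: "AA 0 \<in> J" if c: "LV c \<in> J" "c 0 \<noteq> 0" "\<And>j. 0 < j \<Longrightarrow> j \<le> d \<Longrightarrow> c j = 0" for c
  proof -
    have "LV c = LV (\<lambda>i. if i = 0 then c 0 else 0)" by (rule LV_cong) (use c(3) in auto)
    then have "LV c = cs (c 0) (AA 0)" by (simp add: LV_unit)
    then show ?thesis using J(2)[OF c(1), of "1 / c 0"] c(2) by simp
  qed
  have "AA 0 \<in> J" if "LV c \<in> J" "\<And>j. n < j \<Longrightarrow> j \<le> d \<Longrightarrow> c j = 0" "\<exists>j\<le>d. c j \<noteq> 0" for n c
    using that
  proof (induction n arbitrary: c)
    case 0
    then obtain j where "j \<le> d" "c j \<noteq> 0" by blast
    then have "c 0 \<noteq> 0" using 0(2)[of j] by (cases j) auto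
    then show ?case using base[OF 0(1) _ 0(2)] by blast
  next
    case (Suc n)
    show ?case
    proof (cases "\<exists>j<d. c (Suc j) \<noteq> 0")
      case True
      then obtain j where j: "j < d" "c (Suc j) \<noteq> 0" by blast
      let ?c = "\<lambda>j. (of_nat d - of_nat j) * c (Suc j)"
      show ?thesis
      proof (rule Suc.IH[of ?c])
        show "LV ?c \<in> J" using q[OF Suc.prems(1)] unfolding pb_qq_LV .
        show "?c i = 0" if "n < i" "i \<le> d" for i
          using Suc.prems(2)[of "Suc i"] that by (cases "i = d") auto
        have "(of_nat d - of_nat j :: complex) \<noteq> 0" using j by simp
        then show "\<exists>j\<le>d. ?c j \<noteq> 0" using j by (intro exI[of _ j]) simp
      qed
    next
      case False
      have z: "c j = 0" if "0 < j" "j \<le> d" for j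
        using False that by (cases j) auto
      obtain j where "j \<le> d" "c j \<noteq> 0" using Suc.prems(3) by blast
      then have "c 0 \<noteq> 0" using z[of j] by (cases j) auto
      then show ?thesis using base[OF Suc.prems(1) _ z] by blast
    qed
  qed
  from this[of c d] have A0: "AA 0 \<in> J" using c by auto
  have A: "AA j \<in> J" for j
  proof (induction j)
    case (Suc j)
    define k :: complex where "k = - (of_nat j + 1)"
    have k: "k = - of_nat (Suc j)" by (simp add: k_def)
    have nz: "k \<noteq> 0" unfolding k neg_equal_0_iff_equal by (rule of_nat_neq_0)
    have "cs k (AA (Suc j)) \<in> J" using Q[OF Suc] unfolding pb_AA k_def .
    from J(2)[OF this, of "1 / k"] show ?case using nz by simp
  qed (rule A0)
  have "(\<Sum>j\<in>I. cs (c' j) (AA j)) \<in> J" for I :: "nat set"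
    using J(2)[OF A0, of 0] by (induction I rule: infinite_finite_induct) (simp_all add: J A)
  then show ?thesis unfolding LV_def .
qed

lemma irreducible: "lie_irreducible class_ring sl2 LS (\<lambda>A s. bracket Lw (phi A) s)"
  unfolding lie_irreducible_def
proof (intro conjI representation allI impI)
  have "Lam (LV (\<lambda>j. 1)) \<noteq> Lam (LV (\<lambda>j. 0))" unfolding LV_eq by auto
  then have "Lam (LV (\<lambda>j. 1)) \<noteq> \<zero>\<^bsub>LS\<^esub>" by (simp add: Lw_zero LV_0)
  moreover have "Lam (LV (\<lambda>j. 1)) \<in> carrier LS" by (simp add: LV_SS)
  ultimately show "carrier LS \<noteq> {\<zero>\<^bsub>LS\<^esub>}" by blast
  fix V assume "subspace class_ring V LS \<and> (\<forall>x\<in>carrier sl2. \<forall>u\<in>V. bracket Lw (phi x) u \<in> V)"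
  then have V: "subspace class_ring V LS" and st: "\<And>x u. x \<in> carrier sl2 \<Longrightarrow> u \<in> V \<Longrightarrow> bracket Lw (phi x) u \<in> V" by auto
  have sub: "submodule class_ring V LS" using V by (rule subspace.submod)
  have VS: "V \<subseteq> SS" using submodule.subset[OF sub] by simp
  have Vz: "\<zero>\<^bsub>LS\<^esub> \<in> V" by (rule submodule.zero_closed[OF sub])
  have Va: "s \<oplus>\<^bsub>Lw\<^esub> t \<in> V" if "s \<in> V" "t \<in> V" for s t
    using submodule.m_closed[OF sub that] by simp
  have Vs: "k \<odot>\<^bsub>Lw\<^esub> t \<in> V" if "t \<in> V" for k t
    using submodule.smult_closed[OF sub _ that, of k] by simp
  show "V = {\<zero>\<^bsub>LS\<^esub>} \<or> V = carrier LS"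
  proof (cases "V = {\<zero>\<^bsub>LS\<^esub>}")
    case False
    then obtain s where s: "s \<in> V" "s \<noteq> \<zero>\<^bsub>LS\<^esub>" using Vz by blast
    obtain c where c: "s = Lam (LV c)" using SS_E[OF subsetD[OF VS s(1)]] by blast
    have "\<exists>j\<le>d. c j \<noteq> 0"
    proof (rule ccontr)
      assume "\<not> ?thesis"
      then have "Lam (LV c) = Lam (LV (\<lambda>j. 0))" unfolding LV_eq by blast
      then show False using s(2) by (simp add: c LV_0 Lw_zero)
    qed
    then obtain j where j: "j \<le> d" "c j \<noteq> 0" by blast
    \<comment> \<open>The submodule is pulled back to combinations of the \<open>AA j\<close>;
      stability under sl_2 becomes stability under brackets with every
      \<open>L2 u v w\<close>.\<close>
    define J where "J = {A. \<exists>c. A = LV c \<and> Lam A \<in> V}"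
    have JI: "LV c \<in> J" if "Lam (LV c) \<in> V" for c
      unfolding J_def using that by blast
    have sl: "pb (L2 u v w) A \<in> J" if "A \<in> J" for A u v w
    proof -
      obtain c where cA: "A = LV c" "Lam A \<in> V" using \<open>A \<in> J\<close> by (auto simp: J_def)
      obtain x where x: "x \<in> carrier sl2" "phi x = Lam (L2 u v w)" using phi_surj by blast
      have "Lam (pb (L2 u v w) A) \<in> V"
        using st[OF x(1) cA(2)] unfolding x(2) cA(1) Lw_bracket[OF L2_M0 LV_M0] .
      then show ?thesis unfolding cA(1) pb_L2_LV by (rule JI)
    qed
    have "LV c' \<in> J" for c'
    proof (rule LV_generates[of J c j])
      fix A B assume "A \<in> J" "B \<in> J"
      then obtain c1 c2 where AB: "A = LV c1" "Lam A \<in> V" "B = LV c2" "Lam B \<in> V" by (auto simp: J_def)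
      have "Lam (A + B) \<in> V" using Va[OF AB(2,4)] unfolding AB(1,3) Lw_add[OF LV_Zh LV_Zh] .
      then show "A + B \<in> J" unfolding AB(1,3) LV_add by (rule JI)
    next
      fix k A assume "A \<in> J"
      then obtain c1 where A: "A = LV c1" "Lam A \<in> V" by (auto simp: J_def)
      have "Lam (cs k A) \<in> V" using Vs[OF A(2), of k] unfolding A(1) Lw_smult[OF LV_Zh] .
      then show "cs k A \<in> J" unfolding A(1) LV_cs by (rule JI)
    next
      fix A assume A: "A \<in> J"
      show "pb qq A \<in> J" using sl[OF A, of 1 0 0] by (simp add: L2_def)
      show "pb QQ A \<in> J" using sl[OF A, of 0 1 0] by (simp add: L2_def)
    next
      show "LV c \<in> J" using s(1) unfolding c by (rule JI)
    qed (fact j)+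
    then have "Lam (LV c') \<in> V" for c' unfolding J_def by blast
    then have "SS \<subseteq> V" by (intro subsetI, elim SS_E) simp
    then have "V = SS" using VS by (intro equalityI)
    then show ?thesis by simp
  qed simp
qed

text \<open>The isomorphism sends \<open>AA j\<close> to (-1)^j (d choose j) u^j v^(d-j). Q
  multiplies by -(j+1) on passing from \<open>AA j\<close> to \<open>AA (Suc j)\<close>, whereas u
  d/dv multiplies u^j v^(d-j) by d-j; \<open>bin_Suc\<close> reconciles the two.\<close>

definition bin :: "nat \<Rightarrow> complex" where "bin j = (-1) ^ j * of_nat (d choose j)"

lemma bin_nz: "j \<le> d \<Longrightarrow> bin j \<noteq> 0"
  by (simp add: bin_def)

lemma bin_Suc: assumes "Suc i + k = d" shows "of_nat (Suc i) * bin (Suc i) = - (of_nat (Suc k) * bin i)"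
proof -
  have c: "d - i = Suc k" using assms by simp
  have a: "Suc i * (d choose Suc i) = d * ((d - 1) choose i)" by (rule binomial_absorption)
  have b: "(d - i) * (d choose i) = d * ((d - 1) choose i)" by (rule binomial_absorb_comp)
  have "Suc i * (d choose Suc i) = Suc k * (d choose i)" by (rule trans[OF a b[unfolded c, symmetric]])
  then have "(of_nat (Suc i * (d choose Suc i)) :: complex) = of_nat (Suc k * (d choose i))" by (rule arg_cong)
  then have e: "of_nat (Suc i) * of_nat (d choose Suc i) = (of_nat (Suc k) * of_nat (d choose i) :: complex)"
    by (simp only: of_nat_mult)
  have "of_nat (Suc i) * bin (Suc i) = - ((-1) ^ i * (of_nat (Suc i) * of_nat (d choose Suc i)))"
    by (simp add: bin_def del: of_nat_Suc)
  also have "\<dots> = - (of_nat (Suc k) * bin i)" unfolding e by (simp add: bin_def del: of_nat_Suc)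
  finally show ?thesis .
qed

text \<open>The class determines the coefficients only up to index d; \<open>SYM d\<close> ignores
  all others, so \<open>psi\<close> is well defined.\<close>

definition co :: "hc set \<Rightarrow> nat \<Rightarrow> complex" where "co s = (SOME c. s = Lam (LV c))"
definition psi :: "hc set \<Rightarrow> complex poly poly" where "psi s = SYM d (\<lambda>j. co s j * bin j)"

lemma psi_LV: "psi (Lam (LV c)) = SYM d (\<lambda>j. c j * bin j)"
proof -
  have "Lam (LV c) = Lam (LV (co (Lam (LV c))))" unfolding co_def by (rule someI[of _ c]) simp
  then show ?thesis unfolding psi_def SYM_def LV_eq by (intro sum.cong refl) simp
qed

lemma act2_sym:
  assumes A: "A \<in> carrier sl2"
  shows "SYM d (\<lambda>j. act2 A c j * bin j) = sym_action A (SYM d (\<lambda>j. c j * bin j))"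
proof (rule poly_poly_eqI)
  fix k i
  show "coeff (coeff (SYM d (\<lambda>j. act2 A c j * bin j)) k) i = coeff (coeff (sym_action A (SYM d (\<lambda>j. c j * bin j))) k) i"
  proof (cases "i + k = d")
    case False
    then show ?thesis unfolding coeff_sym_action coeff_SYM by (cases i; cases k) auto
  next
    case True
    have dk: "of_nat d - of_nat i = (of_nat k :: complex)" "2 * of_nat i - of_nat d = (of_nat i - of_nat k :: complex)"
      using True by (auto simp flip: True)
    have A11: "A $$ (1,1) = - A $$ (0,0)" using A by (simp add: sl2_carrier)
    \<comment> \<open>The recursion of \<open>bin\<close> upwards, and in the next fact downwards.
      For k = 0 and i = 0 the left sides vanish, so the meaningless coefficients
      \<open>c (Suc d)\<close> and \<open>c (0 - 1)\<close> drop out.\<close>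
    have K: "of_nat k * bin i = (if k = 0 then 0 else - (of_nat (Suc i) * bin (Suc i)))"
    proof (cases k)
      case (Suc k')
      then show ?thesis using bin_Suc[of i k'] True by simp
    qed simp
    have I: "of_nat i * bin i = (if i = 0 then 0 else - (of_nat (Suc k) * bin (i - 1)))"
    proof (cases i)
      case (Suc i')
      then show ?thesis using bin_Suc[of i' k] True by simp
    qed simp
    have "coeff (coeff (SYM d (\<lambda>j. act2 A c j * bin j)) k) i = act2 A c i * bin i" using True by (simp add: coeff_SYM)
    also have "\<dots> = - A $$ (1,0) * c (Suc i) * (of_nat k * bin i) - A $$ (0,1) * c (i - 1) * (of_nat i * bin i)
        + A $$ (0,0) * (of_nat i - of_nat k) * c i * bin i"
      unfolding act2_def dk by (simp add: algebra_simps)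
    also have "\<dots> = coeff (coeff (sym_action A (SYM d (\<lambda>j. c j * bin j))) k) i"
      unfolding K I coeff_sym_action coeff_SYM A11 using True
      by (cases i; cases k) (simp_all add: algebra_simps)
    finally show ?thesis .
  qed
qed

lemma psi_iso: "psi \<in> lie_module_isos class_ring sl2 LS (\<lambda>A s. bracket Lw (phi A) s) (sym_power d) sym_action"
  unfolding lie_module_isos_def mem_Collect_eq LinearCombinations.module_hom_def
proof (intro conjI allI ballI impI funcsetI)
  fix s assume "s \<in> carrier LS"
  then have "s \<in> SS" by simp
  then obtain c where c: "s = Lam (LV c)" by (rule SS_E)
  show "psi s \<in> carrier (sym_power d)" unfolding c psi_LV by (simp add: sym_power_def coeff_SYM)
next
  fix s t assume "s \<in> carrier LS \<and> t \<in> carrier LS"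
  then have "s \<in> SS" "t \<in> SS" by simp_all
  then obtain c c' where c: "s = Lam (LV c)" "t = Lam (LV c')" by (elim SS_E)
  have "psi (s \<oplus>\<^bsub>Lw\<^esub> t) = psi s + psi t"
    unfolding c Lw_add[OF LV_Zh LV_Zh] LV_add psi_LV by (rule poly_poly_eqI) (simp add: coeff_SYM distrib_right)
  then show "psi (s \<oplus>\<^bsub>LS\<^esub> t) = psi s \<oplus>\<^bsub>sym_power d\<^esub> psi t" by (simp add: sym_power_def)
next
  fix k :: complex and s assume "k \<in> carrier class_ring \<and> s \<in> carrier LS"
  then have "s \<in> SS" by simp
  then obtain c where c: "s = Lam (LV c)" by (rule SS_E)
  have "psi (k \<odot>\<^bsub>Lw\<^esub> s) = Polynomial.smult [:k:] (psi s)"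
    unfolding c Lw_smult[OF LV_Zh] LV_cs psi_LV by (rule poly_poly_eqI) (simp add: coeff_SYM)
  then show "psi (k \<odot>\<^bsub>LS\<^esub> s) = k \<odot>\<^bsub>sym_power d\<^esub> psi s" by (simp add: sym_power_def)
next
  show "bij_betw psi (carrier LS) (carrier (sym_power d))"
    unfolding bij_betw_def
  proof
    show "inj_on psi (carrier LS)"
    proof (rule inj_onI)
      fix s t assume st: "s \<in> carrier LS" "t \<in> carrier LS" and e: "psi s = psi t"
      have "s \<in> SS" "t \<in> SS" using st by simp_all
      then obtain c c' where c: "s = Lam (LV c)" "t = Lam (LV c')" by (elim SS_E)
      have "c j = c' j" if j: "j \<le> d" for j
        using arg_cong[OF e[unfolded c psi_LV], of "\<lambda>p. coeff (coeff p (d - j)) j"] j bin_nz[OF j]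
        by (simp add: coeff_SYM)
      then show "s = t" unfolding c LV_eq by blast
    qed
    show "psi ` carrier LS = carrier (sym_power d)"
    proof (intro equalityI subsetI)
      fix p assume "p \<in> psi ` carrier LS"
      then obtain s where s: "s \<in> SS" "p = psi s" by auto
      obtain c where c: "s = Lam (LV c)" using s(1) by (rule SS_E)
      show "p \<in> carrier (sym_power d)" unfolding s(2) c psi_LV by (simp add: sym_power_def coeff_SYM)
    next
      fix p assume p: "p \<in> carrier (sym_power d)"
      define c where "c j = coeff (coeff p (d - j)) j / bin j" for j
      have "psi (Lam (LV c)) = p"
        unfolding psi_LV
      proof (rule poly_poly_eqI)
        fix k i
        show "coeff (coeff (SYM d (\<lambda>j. c j * bin j)) k) i = coeff (coeff p k) i"
        proof (cases "i + k = d")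
          case True
          then have "d - i = k" "i \<le> d" by simp_all
          then show ?thesis using True bin_nz[of i] by (simp add: coeff_SYM c_def)
        next
          case False
          then show ?thesis using p by (auto simp: coeff_SYM sym_power_def)
        qed
      qed
      moreover have "Lam (LV c) \<in> carrier LS" by (simp add: LV_SS)
      ultimately show "p \<in> psi ` carrier LS" by (metis imageI)
    qed
  qed
next
  fix A s assume A: "A \<in> carrier sl2" and "s \<in> carrier LS"
  then have "s \<in> SS" by simp
  then obtain c where c: "s = Lam (LV c)" by (rule SS_E)
  show "psi (bracket Lw (phi A) s) = sym_action A (psi s)"
    unfolding c bracket_phi psi_LV by (rule act2_sym[OF A])
qed

end

theorem proposition2p12:
  fixes d :: nat and \<zeta> a :: complex
  assumes "primitive_root_of_unity d \<zeta>" and "a \<noteq> 0" and "d \<ge> 5"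
  shows "lie_algebra class_ring (Lie0 d \<zeta> a) \<and>
    (\<exists>\<gg> S \<phi>.
      lie_subalgebra class_ring (Lie0 d \<zeta> a) \<gg> \<and>
      \<phi> \<in> lie_isos class_ring sl2 ((Lie0 d \<zeta> a)\<lparr>carrier := \<gg>\<rparr>) \<and>
      lie_ideal class_ring (Lie0 d \<zeta> a) S \<and>
      lie_commutative ((Lie0 d \<zeta> a)\<lparr>carrier := S\<rparr>) \<and>
      internal_direct_sum class_ring (Lie0 d \<zeta> a) \<gg> S \<and>
      vectorspace.fin_dim class_ring ((Lie0 d \<zeta> a)\<lparr>carrier := S\<rparr>) \<and>
      vectorspace.dim class_ring ((Lie0 d \<zeta> a)\<lparr>carrier := S\<rparr>) = d + 1 \<and>
      lie_irreducible class_ring sl2 ((Lie0 d \<zeta> a)\<lparr>carrier := S\<rparr>)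
        (\<lambda>A s. bracket (Lie0 d \<zeta> a) (\<phi> A) s) \<and>
      lie_module_isos class_ring sl2
        ((Lie0 d \<zeta> a)\<lparr>carrier := S\<rparr>) (\<lambda>A s. bracket (Lie0 d \<zeta> a) (\<phi> A) s)
        (sym_power d) sym_action \<noteq> {})"
proof -
  interpret cherednik d \<zeta> a using assms by unfold_locales
  show ?thesis
    using lie_algebra_Lw lie_subalgebra_gg phi_iso lie_ideal_SS lie_commutative_SS direct_sum dim_SS irreducible psi_iso
    by blast
qed

end
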